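(* Let $(k_i)_{i\in I}$ be a family of fields, $(A_i)_{i\in I}$ a family of Hopf algebras with $A_i$ over $k_i$, and $\mathcal U$ a non-principal ultrafilter on $I$. The representing Hopf algebra (over $k=\prod_{\mathcal U}k_i$) of the restricted ultraproduct $\prod_R\mathrm{Comod}_{A_i}$ of the categories $\mathrm{Comod}_{A_i}$ is isomorphic to the restricted ultraproduct $A_R$ of the Hopf algebras $A_i$.
   Context: Algebras are commutative with identity where they are function algebras of groups (so the Hopf algebras $A_i$ are commutative). $\mathrm{Comod}_A$ is the category of finite dimensional right $A$-comodules. **Restricted ultraproduct of the categories.** Objects of $\prod_R\mathrm{Comod}_{A_i}$ are classes $[X_i]$ of tuples of objects $X_i\in\mathrm{Comod}_{A_i}$, modulo equality for almost every $i$ (i.e. on a set in $\mathcal U$), such that $\dim X_i$ is bounded for almost every $i$; $\mathrm{Hom}([X_i],[Y_i])$ is the set of classes $[\phi_i]$ with $\phi_i\in\mathrm{Hom}(X_i,Y_i)$ for almost every $i$; all structure (composition, addition, tensor product, associativity, commutativity and unit constraints) is componentwise. It is a neutral tannakian category over $k=\prod_{\mathcal U}k_i$ with fibre functor $\omega([X_i])=\prod_{\mathcal U}X_i$, $\omega([\phi_i])=[\phi_i]$. By tannakian duality, it is tensorially equivalent, via $\omega$, to $\mathrm{Comod}_{A_\infty}$ for a Hopf algebra $A_\infty$ over $k$ (unique up to isomorphism); $A_\infty$ is its representing Hopf algebra. **Rank.** Let $A$ be a Hopf algebra over a field $k$. For $X\in\mathrm{Comod}_A$, let $\langle X\rangle$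 be the full subcategory of objects isomorphic to a subobject of a quotient of some $X^n$, and let $L_X\subseteq\mathrm{End}_k(X)$ be the algebra of linear maps $\lambda_X$ that extend to a family $(\lambda_Y)_{Y\in\langle X\rangle}$ of linear maps $\lambda_Y:Y\to Y$ commuting with all comodule morphisms in $\langle X\rangle$ (the family is then determined by $\lambda_X$). If $X\in\langle Y\rangle$ the transition map $T_{X,Y}:L_Y\to L_X$ sends $\lambda_Y$ to $\lambda_X$; these form an inverse system with limit $\varprojlim L_X$ and projections $T_Y:\varprojlim L_X\to L_Y$. For an algebra $L$, $L^\circ$ denotes its finite dual: the linear functionals $L\to k$ killing a (two-sided) ideal of finite codimension; the rank of $\alpha\in L^\circ$ is the least $m$ such that $\alpha$ kills an ideal of codimension $m$. One has $A=\varinjlim L_X^\circ$ (direct limit along the duals of the $T_{X,Y}$), where for a comodule $(Y,\rho)$, $v\in Y$, $f\in Y^*$, the class of $\lambda\mapsto f(\lambda(v))$ in $L_Y^\circ$ corresponds to $(f\otimes1)\rho(v)\in A$. There is an injective map $\phi:A\to(\varprojlim L_X)^\circ$ sending the class of $\alpha:L_Y\to k$ to $\varprojlim L_X\xrightarrow{T_Y}L_Y\xrightarrow{\alpha}k$. The rank of $a\in A$ is the rank of $\phi(a)$. **Restricted ultraproduct of Hopf algebras.** $A_R\subseteq\prod_{\mathcal U}A_i$ is the set of $[a_i]$ such that $\mathrm{rank}(a_i)$ is bounded for almost every $i$. The natural injection $\Phi:\prod_{\mathcal U}A_i\otimes\prod_{\mathcal U}A_i\to\prod_{\mathcal U}(A_i\otimes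 A_i)$, $[a_i]\otimes[b_i]\mapsto[a_i\otimes b_i]$, allows one to define $\Delta:A_R\to A_R\otimes A_R$ as $\Phi^{-1}\circ[\Delta_i]$ (apply $[\Delta_i]$ first; it maps $A_R$ into $\Phi(A_R\otimes A_R)$), and the counit is $[\varepsilon_i]$ restricted to $A_R$; the multiplication is the componentwise one inherited from $\prod_{\mathcal U}A_i$. *)

theory Defs
  imports "Jordan_Normal_Form.Missing_VectorSpace" "HOL-Algebra.Ideal"
begin

section \<open>Linear algebra over a field given as a record\<close>

text \<open>Linear maps are taken to be \<open>undefined\<close> outside the source, so that
  two of them are equal as soon as they agree on the source.\<close>

definition lin_maps ::
  "('k, 'r) ring_scheme \<Rightarrow> ('k, 'v, 'm) module_scheme \<Rightarrow> ('k, 'w, 'n) module_scheme \<Rightarrow> ('v \<Rightarrow> 'w) set"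
  where "lin_maps K V W = module_hom K V W \<inter> extensional (carrier V)"

definition lin_isos ::
  "('k, 'r) ring_scheme \<Rightarrow> ('k, 'v, 'm) module_scheme \<Rightarrow> ('k, 'w, 'n) module_scheme \<Rightarrow> ('v \<Rightarrow> 'w) set"
  where "lin_isos K V W = {f \<in> lin_maps K V W. bij_betw f (carrier V) (carrier W)}"

definition scalar_space :: "('k, 'r) ring_scheme \<Rightarrow> ('k, 'k) module"
  where "scalar_space K =
    \<lparr>carrier = carrier K, mult = mult K, one = one K, zero = zero K, add = add K, smult = mult K\<rparr>"

text \<open>The fields \<open>mult\<close> and \<open>one\<close> of a module record play no role for a
  plain vector space; they are left unspecified in the constructions below.\<close>

definition quot_space :: "('k, 'v, 'm) module_scheme \<Rightarrow> 'v set \<Rightarrow> ('k, 'v set) module"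
  where "quot_space V N =
    \<lparr>carrier = a_rcosets\<^bsub>V\<^esub> N, mult = undefined, one = undefined, zero = N,
     add = set_add V, smult = (\<lambda>c C. \<Union>x\<in>C. N +>\<^bsub>V\<^esub> (c \<odot>\<^bsub>V\<^esub> x))\<rparr>"

definition power_space :: "('k, 'v, 'm) module_scheme \<Rightarrow> nat \<Rightarrow> ('k, nat \<Rightarrow> 'v) module"
  where "power_space V n =
    \<lparr>carrier = {..<n} \<rightarrow>\<^sub>E carrier V, mult = undefined, one = undefined,
     zero = (\<lambda>j\<in>{..<n}. \<zero>\<^bsub>V\<^esub>),
     add = (\<lambda>x y. \<lambda>j\<in>{..<n}. x j \<oplus>\<^bsub>V\<^esub> y j),
     smult = (\<lambda>c x. \<lambda>j\<in>{..<n}. c \<odot>\<^bsub>V\<^esub> x j)\<rparr>"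

definition power_inj :: "('k, 'v, 'm) module_scheme \<Rightarrow> nat \<Rightarrow> nat \<Rightarrow> 'v \<Rightarrow> nat \<Rightarrow> 'v"
  where "power_inj V n j v = (\<lambda>l\<in>{..<n}. if l = j then v else \<zero>\<^bsub>V\<^esub>)"


subsection \<open>Tensor products\<close>

text \<open>The tensor product is the free vector space on \<open>carrier V \<times> carrier W\<close>
  modulo the bilinearity relations.\<close>

definition free_space :: "('k, 'r) ring_scheme \<Rightarrow> 's set \<Rightarrow> ('k, 's \<Rightarrow> 'k) module"
  where "free_space K S =
    (ring.func_space K S)
      \<lparr>carrier := {F \<in> S \<rightarrow>\<^sub>E carrier K. finite {s \<in> S. F s \<noteq> \<zero>\<^bsub>K\<^esub>}}\<rparr>"

definition free_gen :: "('k, 'r) ring_scheme \<Rightarrow> 's set \<Rightarrow> 's \<Rightarrow> 's \<Rightarrow> 'k"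
  where "free_gen K S s = (\<lambda>t\<in>S. if t = s then \<one>\<^bsub>K\<^esub> else \<zero>\<^bsub>K\<^esub>)"

definition tensor_rels ::
  "('k, 'r) ring_scheme \<Rightarrow> ('k, 'v, 'm) module_scheme \<Rightarrow> ('k, 'w, 'n) module_scheme \<Rightarrow> ('v \<times> 'w \<Rightarrow> 'k) set"
  where "tensor_rels K V W =
    (let S = carrier V \<times> carrier W; F = free_space K S; e = (\<lambda>v w. free_gen K S (v, w)) in
      module.span K F
       ({e (v \<oplus>\<^bsub>V\<^esub> v') w \<ominus>\<^bsub>F\<^esub> (e v w \<oplus>\<^bsub>F\<^esub> e v' w) | v v' w.
            v \<in> carrier V \<and> v' \<in> carrier V \<and> w \<in> carrier W}
        \<union> {e v (w \<oplus>\<^bsub>W\<^esub> w') \<ominus>\<^bsub>F\<^esub> (e v w \<oplus>\<^bsub>F\<^esub> e v w') | v w w'.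
            v \<in> carrier V \<and> w \<in> carrier W \<and> w' \<in> carrier W}
        \<union> {e (c \<odot>\<^bsub>V\<^esub> v) w \<ominus>\<^bsub>F\<^esub> (c \<odot>\<^bsub>F\<^esub> e v w) | c v w.
            c \<in> carrier K \<and> v \<in> carrier V \<and> w \<in> carrier W}
        \<union> {e v (c \<odot>\<^bsub>W\<^esub> w) \<ominus>\<^bsub>F\<^esub> (c \<odot>\<^bsub>F\<^esub> e v w) | c v w.
            c \<in> carrier K \<and> v \<in> carrier V \<and> w \<in> carrier W}))"

definition tensor_space ::
  "('k, 'r) ring_scheme \<Rightarrow> ('k, 'v, 'm) module_scheme \<Rightarrow> ('k, 'w, 'n) module_scheme
    \<Rightarrow> ('k, ('v \<times> 'w \<Rightarrow> 'k) set) module"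
  where "tensor_space K V W =
    quot_space (free_space K (carrier V \<times> carrier W)) (tensor_rels K V W)"

definition pure_tensor ::
  "('k, 'r) ring_scheme \<Rightarrow> ('k, 'v, 'm) module_scheme \<Rightarrow> ('k, 'w, 'n) module_scheme
    \<Rightarrow> 'v \<Rightarrow> 'w \<Rightarrow> ('v \<times> 'w \<Rightarrow> 'k) set"
  where "pure_tensor K V W v w =
    a_r_coset (free_space K (carrier V \<times> carrier W)) (tensor_rels K V W)
      (free_gen K (carrier V \<times> carrier W) (v, w))"

text \<open>The linear map induced by a bilinear map.\<close>

definition tensor_lift ::
  "('k, 'r) ring_scheme \<Rightarrow> ('k, 'v, 'm) module_scheme \<Rightarrow> ('k, 'w, 'n) module_scheme
    \<Rightarrow> ('k, 'p, 'q) module_scheme \<Rightarrow> ('v \<Rightarrow> 'w \<Rightarrow> 'p) \<Rightarrow> ('v \<times> 'w \<Rightarrow> 'k) set \<Rightarrow> 'p"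
  where "tensor_lift K V W P \<beta> =
    (THE f. f \<in> lin_maps K (tensor_space K V W) P
      \<and> (\<forall>v\<in>carrier V. \<forall>w\<in>carrier W. f (pure_tensor K V W v w) = \<beta> v w))"

definition tensor_map ::
  "('k, 'r) ring_scheme \<Rightarrow> ('k, 'v, 'm) module_scheme \<Rightarrow> ('k, 'w, 'n) module_scheme
    \<Rightarrow> ('k, 'v', 'm') module_scheme \<Rightarrow> ('k, 'w', 'n') module_scheme
    \<Rightarrow> ('v \<Rightarrow> 'v') \<Rightarrow> ('w \<Rightarrow> 'w') \<Rightarrow> ('v \<times> 'w \<Rightarrow> 'k) set \<Rightarrow> ('v' \<times> 'w' \<Rightarrow> 'k) set"
  where "tensor_map K V W V' W' f g =
    tensor_lift K V W (tensor_space K V' W') (\<lambda>v w. pure_tensor K V' W' (f v) (g w))"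

text \<open>The associativity isomorphism from \<open>(V \<otimes> W) \<otimes> P\<close> to \<open>V \<otimes> (W \<otimes> P)\<close>.\<close>

definition tensor_assoc ::
  "('k, 'r) ring_scheme \<Rightarrow> ('k, 'v, 'm) module_scheme \<Rightarrow> ('k, 'w, 'n) module_scheme
    \<Rightarrow> ('k, 'p, 'q) module_scheme
    \<Rightarrow> (('v \<times> 'w \<Rightarrow> 'k) set \<times> 'p \<Rightarrow> 'k) set \<Rightarrow> ('v \<times> ('w \<times> 'p \<Rightarrow> 'k) set \<Rightarrow> 'k) set"
  where "tensor_assoc K V W P =
    (let WP = tensor_space K W P; T = tensor_space K V WP in
      tensor_lift K (tensor_space K V W) P T
        (\<lambda>t p. tensor_lift K V W T (\<lambda>v w. pure_tensor K V WP v (pure_tensor K W P w p)) t))"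

definition tensor_algebra ::
  "('k, 'r) ring_scheme \<Rightarrow> ('k, 'a, 'm) module_scheme \<Rightarrow> ('k, 'b, 'n) module_scheme
    \<Rightarrow> ('k, ('a \<times> 'b \<Rightarrow> 'k) set) module"
  where "tensor_algebra K A B =
    (let T = tensor_space K A B in
      T\<lparr>mult := (\<lambda>x y. tensor_lift K A B T
            (\<lambda>a b. tensor_lift K A B T
              (\<lambda>a' b'. pure_tensor K A B (a \<otimes>\<^bsub>A\<^esub> a') (b \<otimes>\<^bsub>B\<^esub> b')) y) x),
        one := pure_tensor K A B \<one>\<^bsub>A\<^esub> \<one>\<^bsub>B\<^esub>\<rparr>)"


section \<open>Commutative Hopf algebras\<close>

record ('k, 'a) hopf = "('k, 'a) module" +
  comult :: "'a \<Rightarrow> ('a \<times> 'a \<Rightarrow> 'k) set"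
  counit :: "'a \<Rightarrow> 'k"

text \<open>The antipode of a bialgebra is unique if it exists, so it is not made part of the record.
  Commutativity of the multiplication is part of the locale \<^locale>\<open>algebra\<close>.\<close>

locale hopf_algebra = K?: field K + A?: algebra K A
  for K :: "('k, 'r) ring_scheme" and A :: "('k, 'a, 'm) hopf_scheme" +
  assumes comult_linear: "comult A \<in> module_hom K A (tensor_space K A A)"
    and comult_hom: "comult A \<in> ring_hom A (tensor_algebra K A A)"
    and counit_linear: "counit A \<in> module_hom K A (scalar_space K)"
    and counit_hom: "counit A \<in> ring_hom A K"
    and coassoc: "a \<in> carrier A \<Longrightarrow>
      tensor_assoc K A A A (tensor_map K A A (tensor_space K A A) A (comult A) (\<lambda>x. x) (comult A a))
        = tensor_map K A A A (tensor_space K A A) (\<lambda>x. x) (comult A) (comult A a)"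
    and counit_left: "a \<in> carrier A \<Longrightarrow>
      tensor_lift K A A A (\<lambda>b c. counit A b \<odot>\<^bsub>A\<^esub> c) (comult A a) = a"
    and counit_right: "a \<in> carrier A \<Longrightarrow>
      tensor_lift K A A A (\<lambda>b c. counit A c \<odot>\<^bsub>A\<^esub> b) (comult A a) = a"
    and antipode: "\<exists>S\<in>module_hom K A A. \<forall>a\<in>carrier A.
      tensor_lift K A A A (\<lambda>b c. S b \<otimes>\<^bsub>A\<^esub> c) (comult A a) = counit A a \<odot>\<^bsub>A\<^esub> \<one>\<^bsub>A\<^esub>
      \<and> tensor_lift K A A A (\<lambda>b c. b \<otimes>\<^bsub>A\<^esub> S c) (comult A a) = counit A a \<odot>\<^bsub>A\<^esub> \<one>\<^bsub>A\<^esub>"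

definition hopf_isomorphic ::
  "('k, 'r) ring_scheme \<Rightarrow> ('k, 'a, 'm) hopf_scheme \<Rightarrow> ('k, 'b, 'n) hopf_scheme \<Rightarrow> bool"
  where "hopf_isomorphic K A B \<longleftrightarrow>
    (\<exists>h. h \<in> ring_hom A B \<and> h \<in> module_hom K A B \<and> bij_betw h (carrier A) (carrier B)
      \<and> (\<forall>a\<in>carrier A. comult B (h a) = tensor_map K A A B B h h (comult A a))
      \<and> (\<forall>a\<in>carrier A. counit B (h a) = counit A a))"


section \<open>Tensor categories\<close>

text \<open>Linear categories with a tensor product and its constraints. Morphisms need not determine
  their source and target, hence the object arguments: \<open>Cmp C X g f\<close> is the composite
  of \<open>f : X \<rightarrow> Y\<close> and \<open>g : Y \<rightarrow> Z\<close>; \<open>TensHom C X X' Y Y' f g\<close> is \<open>f \<otimes> g\<close>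
  for \<open>f : X \<rightarrow> X'\<close> and \<open>g : Y \<rightarrow> Y'\<close>. The constraints are
  \<open>Assoc : (X \<otimes> Y) \<otimes> Z \<rightarrow> X \<otimes> (Y \<otimes> Z)\<close>, \<open>Braid : X \<otimes> Y \<rightarrow> Y \<otimes> X\<close>,
  \<open>LUnit : 1 \<otimes> X \<rightarrow> X\<close> and \<open>RUnit : X \<otimes> 1 \<rightarrow> X\<close>.\<close>

record ('o, 'h, 'k) tensor_category =
  Obj :: "'o set"
  Hom :: "'o \<Rightarrow> 'o \<Rightarrow> 'h set"
  Ident :: "'o \<Rightarrow> 'h"
  Cmp :: "'o \<Rightarrow> 'h \<Rightarrow> 'h \<Rightarrow> 'h"
  HAdd :: "'o \<Rightarrow> 'o \<Rightarrow> 'h \<Rightarrow> 'h \<Rightarrow> 'h"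
  HScale :: "'o \<Rightarrow> 'o \<Rightarrow> 'k \<Rightarrow> 'h \<Rightarrow> 'h"
  Tens :: "'o \<Rightarrow> 'o \<Rightarrow> 'o"
  TensHom :: "'o \<Rightarrow> 'o \<Rightarrow> 'o \<Rightarrow> 'o \<Rightarrow> 'h \<Rightarrow> 'h \<Rightarrow> 'h"
  UnitObj :: "'o"
  Assoc :: "'o \<Rightarrow> 'o \<Rightarrow> 'o \<Rightarrow> 'h"
  Braid :: "'o \<Rightarrow> 'o \<Rightarrow> 'h"
  LUnit :: "'o \<Rightarrow> 'h"
  RUnit :: "'o \<Rightarrow> 'h"

definition cat_iso :: "('o, 'h, 'k) tensor_category \<Rightarrow> 'o \<Rightarrow> 'o \<Rightarrow> 'h \<Rightarrow> bool"
  where "cat_iso C X Y f \<longleftrightarrow>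
    f \<in> Hom C X Y \<and> (\<exists>g\<in>Hom C Y X. Cmp C X g f = Ident C X \<and> Cmp C Y f g = Ident C Y)"

text \<open>A linear tensor functor has an object part \<open>F\<close>, a morphism part \<open>Fm\<close>, natural isomorphisms
  \<open>c X Y : F X \<otimes> F Y \<rightarrow> F (X \<otimes> Y)\<close> and an isomorphism \<open>u : 1 \<rightarrow> F 1\<close>.\<close>

locale tensor_functor =
  fixes K :: "('k, 'r) ring_scheme"
    and C :: "('o, 'h, 'k) tensor_category"
    and D :: "('p, 'g, 'k) tensor_category"
    and F :: "'o \<Rightarrow> 'p"
    and Fm :: "'o \<Rightarrow> 'o \<Rightarrow> 'h \<Rightarrow> 'g"
    and c :: "'o \<Rightarrow> 'o \<Rightarrow> 'g"
    and u :: 'g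
  assumes F_obj: "X \<in> Obj C \<Longrightarrow> F X \<in> Obj D"
    and F_hom: "\<lbrakk>X \<in> Obj C; Y \<in> Obj C; f \<in> Hom C X Y\<rbrakk> \<Longrightarrow> Fm X Y f \<in> Hom D (F X) (F Y)"
    and F_ident: "X \<in> Obj C \<Longrightarrow> Fm X X (Ident C X) = Ident D (F X)"
    and F_cmp: "\<lbrakk>X \<in> Obj C; Y \<in> Obj C; Z \<in> Obj C; f \<in> Hom C X Y; g \<in> Hom C Y Z\<rbrakk> \<Longrightarrow>
      Fm X Z (Cmp C X g f) = Cmp D (F X) (Fm Y Z g) (Fm X Y f)"
    and F_add: "\<lbrakk>X \<in> Obj C; Y \<in> Obj C; f \<in> Hom C X Y; g \<in> Hom C X Y\<rbrakk> \<Longrightarrow>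
      Fm X Y (HAdd C X Y f g) = HAdd D (F X) (F Y) (Fm X Y f) (Fm X Y g)"
    and F_scale: "\<lbrakk>X \<in> Obj C; Y \<in> Obj C; r \<in> carrier K; f \<in> Hom C X Y\<rbrakk> \<Longrightarrow>
      Fm X Y (HScale C X Y r f) = HScale D (F X) (F Y) r (Fm X Y f)"
    and c_iso: "\<lbrakk>X \<in> Obj C; Y \<in> Obj C\<rbrakk> \<Longrightarrow>
      cat_iso D (Tens D (F X) (F Y)) (F (Tens C X Y)) (c X Y)"
    and c_natural: "\<lbrakk>X \<in> Obj C; X' \<in> Obj C; Y \<in> Obj C; Y' \<in> Obj C;
        f \<in> Hom C X X'; g \<in> Hom C Y Y'\<rbrakk> \<Longrightarrow>
      Cmp D (Tens D (F X) (F Y)) (Fm (Tens C X Y) (Tens C X' Y') (TensHom C X X' Y Y' f g)) (c X Y)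
      = Cmp D (Tens D (F X) (F Y)) (c X' Y')
          (TensHom D (F X) (F X') (F Y) (F Y') (Fm X X' f) (Fm Y Y' g))"
    and u_iso: "cat_iso D (UnitObj D) (F (UnitObj C)) u"
    and c_assoc: "\<lbrakk>X \<in> Obj C; Y \<in> Obj C; Z \<in> Obj C\<rbrakk> \<Longrightarrow>
      (let S = Tens D (Tens D (F X) (F Y)) (F Z) in
        Cmp D S (Fm (Tens C (Tens C X Y) Z) (Tens C X (Tens C Y Z)) (Assoc C X Y Z))
          (Cmp D S (c (Tens C X Y) Z)
            (TensHom D (Tens D (F X) (F Y)) (F (Tens C X Y)) (F Z) (F Z) (c X Y) (Ident D (F Z))))
        = Cmp D S (c X (Tens C Y Z))
            (Cmp D S
              (TensHom D (F X) (F X) (Tens D (F Y) (F Z)) (F (Tens C Y Z)) (Ident D (F X)) (c Y Z))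
              (Assoc D (F X) (F Y) (F Z))))"
    and c_braid: "\<lbrakk>X \<in> Obj C; Y \<in> Obj C\<rbrakk> \<Longrightarrow>
      Cmp D (Tens D (F X) (F Y)) (Fm (Tens C X Y) (Tens C Y X) (Braid C X Y)) (c X Y)
      = Cmp D (Tens D (F X) (F Y)) (c Y X) (Braid D (F X) (F Y))"
    and c_lunit: "X \<in> Obj C \<Longrightarrow>
      (let S = Tens D (UnitObj D) (F X) in
        Cmp D S (Fm (Tens C (UnitObj C) X) X (LUnit C X))
          (Cmp D S (c (UnitObj C) X)
            (TensHom D (UnitObj D) (F (UnitObj C)) (F X) (F X) u (Ident D (F X))))
        = LUnit D (F X))"
    and c_runit: "X \<in> Obj C \<Longrightarrow>
      (let S = Tens D (F X) (UnitObj D) in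
        Cmp D S (Fm (Tens C X (UnitObj C)) X (RUnit C X))
          (Cmp D S (c X (UnitObj C))
            (TensHom D (F X) (F X) (UnitObj D) (F (UnitObj C)) (Ident D (F X)) u))
        = RUnit D (F X))"

locale tensor_equivalence = tensor_functor +
  assumes fully_faithful: "\<lbrakk>X \<in> Obj C; Y \<in> Obj C\<rbrakk> \<Longrightarrow>
      bij_betw (Fm X Y) (Hom C X Y) (Hom D (F X) (F Y))"
    and ess_surj: "Z \<in> Obj D \<Longrightarrow> \<exists>X\<in>Obj C. \<exists>f. cat_iso D (F X) Z f"


section \<open>The category of finite dimensional comodules\<close>

record ('k, 'a, 'v) comodule = "('k, 'v) module" +
  coact :: "'v \<Rightarrow> ('v \<times> 'a \<Rightarrow> 'k) set"

locale right_comodule = vectorspace K V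
  for K :: "('k, 'r) ring_scheme" and A :: "('k, 'a, 'm) hopf_scheme"
    and V :: "('k, 'a, 'v) comodule" +
  assumes coact_linear: "coact V \<in> module_hom K V (tensor_space K V A)"
    and coact_coassoc: "v \<in> carrier V \<Longrightarrow>
      tensor_assoc K V A A (tensor_map K V A (tensor_space K V A) A (coact V) (\<lambda>x. x) (coact V v))
        = tensor_map K V A V (tensor_space K A A) (\<lambda>x. x) (comult A) (coact V v)"
    and coact_counit: "v \<in> carrier V \<Longrightarrow>
      tensor_lift K V A V (\<lambda>w a. counit A a \<odot>\<^bsub>V\<^esub> w) (coact V v) = v"

definition with_coact ::
  "('k, 'v) module \<Rightarrow> ('v \<Rightarrow> ('v \<times> 'a \<Rightarrow> 'k) set) \<Rightarrow> ('k, 'a, 'v) comodule"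
  where "with_coact V \<rho> =
    \<lparr>carrier = carrier V, mult = mult V, one = one V, zero = zero V, add = add V,
     smult = smult V, coact = \<rho>\<rparr>"

definition comod_hom ::
  "('k, 'r) ring_scheme \<Rightarrow> ('k, 'a, 'm) hopf_scheme \<Rightarrow> ('k, 'a, 'v) comodule
    \<Rightarrow> ('k, 'a, 'w) comodule \<Rightarrow> ('v \<Rightarrow> 'w) set"
  where "comod_hom K A V W =
    {f \<in> lin_maps K V W. \<forall>v\<in>carrier V.
       coact W (f v) = tensor_map K V A W A f (\<lambda>a. a) (coact V v)}"

text \<open>The coaction \<open>x \<otimes> y \<mapsto> \<Sum> x' \<otimes> y' \<otimes> a b\<close> on a tensor product, where
  \<open>x \<mapsto> \<Sum> x' \<otimes> a\<close> and \<open>y \<mapsto> \<Sum> y' \<otimes> b\<close>.\<close>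

definition tensor_coact ::
  "('k, 'r) ring_scheme \<Rightarrow> ('k, 'a, 'm) hopf_scheme \<Rightarrow> ('k, 'a, 'v) comodule
    \<Rightarrow> ('k, 'a, 'w) comodule
    \<Rightarrow> ('v \<times> 'w \<Rightarrow> 'k) set \<Rightarrow> (('v \<times> 'w \<Rightarrow> 'k) set \<times> 'a \<Rightarrow> 'k) set"
  where "tensor_coact K A X Y =
    (let XY = tensor_space K X Y; T = tensor_space K XY A in
      tensor_lift K X Y T (\<lambda>x y.
        tensor_lift K X A T (\<lambda>x' a.
          tensor_lift K Y A T (\<lambda>y' b.
            pure_tensor K XY A (pure_tensor K X Y x' y') (a \<otimes>\<^bsub>A\<^esub> b)) (coact Y y)) (coact X x)))"

text \<open>The objects of the category of comodules are the finite dimensional comodules whose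
  underlying set is a subset of a fixed type \<open>'v\<close>. For this category to have tensor products the
  honest tensor product, whose elements live in another type, is moved back to \<open>'v\<close>
  along a chosen isomorphism; such an isomorphism exists as soon as there are vector spaces
  of every finite dimension on subsets of \<open>'v\<close>.\<close>

definition copy ::
  "('k, 'r) ring_scheme \<Rightarrow> ('k, 's) module \<Rightarrow> ('k, 'v) module \<times> ('s \<Rightarrow> 'v)"
  where "copy K M = (SOME p. vectorspace K (fst p) \<and> snd p \<in> lin_isos K M (fst p))"

definition copy_space :: "('k, 'r) ring_scheme \<Rightarrow> ('k, 's) module \<Rightarrow> ('k, 'v) module"
  where "copy_space K M = fst (copy K M)"

definition copy_map :: "('k, 'r) ring_scheme \<Rightarrow> ('k, 's) module \<Rightarrow> 's \<Rightarrow> 'v"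
  where "copy_map K M = snd (copy K M)"

definition uncopy_map :: "('k, 'r) ring_scheme \<Rightarrow> ('k, 's) module \<Rightarrow> 'v \<Rightarrow> 's"
  where "uncopy_map K M = inv_into (carrier M) (copy_map K M)"

definition copy_comodule ::
  "('k, 'r) ring_scheme \<Rightarrow> ('k, 'a, 'm) hopf_scheme \<Rightarrow> ('k, 's) module
    \<Rightarrow> ('s \<Rightarrow> ('s \<times> 'a \<Rightarrow> 'k) set) \<Rightarrow> ('k, 'a, 'v) comodule"
  where "copy_comodule K A M \<rho> =
    with_coact (copy_space K M)
      (\<lambda>x. tensor_map K M A (copy_space K M) A (copy_map K M) (\<lambda>a. a) (\<rho> (uncopy_map K M x)))"

text \<open>The chosen tensor product on subsets of \<open>'v\<close>: the underlying space,
  the universal bilinear map, and the linear map induced by a bilinear map.\<close>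

definition vtensor ::
  "('k, 'r) ring_scheme \<Rightarrow> ('k, 'v, 'm) module_scheme \<Rightarrow> ('k, 'v, 'n) module_scheme \<Rightarrow> ('k, 'v) module"
  where "vtensor K X Y = copy_space K (tensor_space K X Y)"

definition vpure ::
  "('k, 'r) ring_scheme \<Rightarrow> ('k, 'v, 'm) module_scheme \<Rightarrow> ('k, 'v, 'n) module_scheme \<Rightarrow> 'v \<Rightarrow> 'v \<Rightarrow> 'v"
  where "vpure K X Y x y = copy_map K (tensor_space K X Y) (pure_tensor K X Y x y)"

definition vlift ::
  "('k, 'r) ring_scheme \<Rightarrow> ('k, 'v, 'm) module_scheme \<Rightarrow> ('k, 'v, 'n) module_scheme
    \<Rightarrow> ('k, 'p, 'q) module_scheme \<Rightarrow> ('v \<Rightarrow> 'v \<Rightarrow> 'p) \<Rightarrow> 'v \<Rightarrow> 'p"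
  where "vlift K X Y P \<beta> =
    (\<lambda>z\<in>carrier (vtensor K X Y).
       tensor_lift K X Y P \<beta> (uncopy_map K (tensor_space K X Y) z))"

definition comod_tensor ::
  "('k, 'r) ring_scheme \<Rightarrow> ('k, 'a, 'm) hopf_scheme \<Rightarrow> ('k, 'a, 'v) comodule
    \<Rightarrow> ('k, 'a, 'v) comodule \<Rightarrow> ('k, 'a, 'v) comodule"
  where "comod_tensor K A X Y = copy_comodule K A (tensor_space K X Y) (tensor_coact K A X Y)"

definition comod_unit ::
  "('k, 'r) ring_scheme \<Rightarrow> ('k, 'a, 'm) hopf_scheme \<Rightarrow> ('k, 'a, 'v) comodule"
  where "comod_unit K A =
    copy_comodule K A (scalar_space K) (\<lambda>r. pure_tensor K (scalar_space K) A r \<one>\<^bsub>A\<^esub>)"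

definition Comod ::
  "('k, 'r) ring_scheme \<Rightarrow> ('k, 'a, 'm) hopf_scheme
    \<Rightarrow> (('k, 'a, 'v) comodule, 'v \<Rightarrow> 'v, 'k) tensor_category"
  where "Comod K A =
    \<lparr>Obj = {X. right_comodule K A X \<and> vectorspace.fin_dim K X},
     Hom = comod_hom K A,
     Ident = (\<lambda>X. \<lambda>x\<in>carrier X. x),
     Cmp = (\<lambda>X g f. compose (carrier X) g f),
     HAdd = (\<lambda>X Y f g. \<lambda>x\<in>carrier X. f x \<oplus>\<^bsub>Y\<^esub> g x),
     HScale = (\<lambda>X Y r f. \<lambda>x\<in>carrier X. r \<odot>\<^bsub>Y\<^esub> f x),
     Tens = comod_tensor K A,
     TensHom = (\<lambda>X X' Y Y' f g.
       vlift K X Y (vtensor K X' Y') (\<lambda>x y. vpure K X' Y' (f x) (g y))),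
     UnitObj = comod_unit K A,
     Assoc = (\<lambda>X Y Z.
       vlift K (vtensor K X Y) Z (vtensor K X (vtensor K Y Z))
         (\<lambda>t z. vlift K X Y (vtensor K X (vtensor K Y Z))
           (\<lambda>x y. vpure K X (vtensor K Y Z) x (vpure K Y Z y z)) t)),
     Braid = (\<lambda>X Y. vlift K X Y (vtensor K Y X) (\<lambda>x y. vpure K Y X y x)),
     LUnit = (\<lambda>X. vlift K (copy_space K (scalar_space K)) X X
       (\<lambda>r x. uncopy_map K (scalar_space K) r \<odot>\<^bsub>X\<^esub> x)),
     RUnit = (\<lambda>X. vlift K X (copy_space K (scalar_space K)) X
       (\<lambda>x r. uncopy_map K (scalar_space K) r \<odot>\<^bsub>X\<^esub> x))\<rparr>"

text \<open>\<open>B\<close> represents a linear tensor category \<open>C\<close> with fibre functor \<open>(\<omega>, \<omega>m, c, u)\<close> if the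
  spaces \<open>\<omega> X\<close> carry coactions of \<open>B\<close> through which \<open>\<omega>\<close> becomes a tensor
  equivalence from \<open>C\<close> to the category of \<open>B\<close>-comodules.\<close>

definition represents ::
  "('k, 'r) ring_scheme \<Rightarrow> ('o, 'h, 'k) tensor_category \<Rightarrow> ('o \<Rightarrow> ('k, 'v) module)
    \<Rightarrow> ('o \<Rightarrow> 'o \<Rightarrow> 'h \<Rightarrow> 'v \<Rightarrow> 'v) \<Rightarrow> ('o \<Rightarrow> 'o \<Rightarrow> 'v \<Rightarrow> 'v) \<Rightarrow> ('v \<Rightarrow> 'v)
    \<Rightarrow> ('k, 'b, 'm) hopf_scheme \<Rightarrow> bool"
  where "represents K C \<omega> \<omega>m c u B \<longleftrightarrow>
    hopf_algebra K B
    \<and> (\<exists>\<rho>. tensor_equivalence K C (Comod K B) (\<lambda>X. with_coact (\<omega> X) (\<rho> X)) \<omega>m c u)"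


section \<open>The rank of an element of a Hopf algebra\<close>

definition power_comodule ::
  "('k, 'r) ring_scheme \<Rightarrow> ('k, 'a, 'm) hopf_scheme \<Rightarrow> ('k, 'a, 'v) comodule \<Rightarrow> nat
    \<Rightarrow> ('k, 'a, nat \<Rightarrow> 'v) comodule"
  where "power_comodule K A X n =
    with_coact (power_space X n)
      (\<lambda>x. finsum (tensor_space K (power_space X n) A)
        (\<lambda>j. tensor_map K X A (power_space X n) A (power_inj X n j) (\<lambda>a. a) (coact X (x j)))
        {..<n})"

definition generated ::
  "('k, 'r) ring_scheme \<Rightarrow> ('k, 'a, 'm) hopf_scheme \<Rightarrow> ('k, 'a, 'v) comodule
    \<Rightarrow> ('k, 'a, 'v) comodule set"
  where "generated K A X =
    {Y \<in> Obj (Comod K A). \<exists>n. \<exists>Q :: ('k, 'a, 'v) comodule \<in> Obj (Comod K A).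
       (\<exists>p\<in>comod_hom K A (power_comodule K A X n) Q.
          p ` carrier (power_comodule K A X n) = carrier Q)
       \<and> (\<exists>j\<in>comod_hom K A Y Q. inj_on j (carrier Y))}"

definition natural_family ::
  "('k, 'r) ring_scheme \<Rightarrow> ('k, 'a, 'm) hopf_scheme \<Rightarrow> ('k, 'a, 'v) comodule
    \<Rightarrow> (('k, 'a, 'v) comodule \<Rightarrow> 'v \<Rightarrow> 'v) \<Rightarrow> bool"
  where "natural_family K A X \<Lambda> \<longleftrightarrow>
    (\<forall>Y\<in>generated K A X. \<Lambda> Y \<in> lin_maps K Y Y)
    \<and> (\<forall>Y\<in>generated K A X. \<forall>Z\<in>generated K A X. \<forall>f\<in>comod_hom K A Y Z. \<forall>y\<in>carrier Y.
          f (\<Lambda> Y y) = \<Lambda> Z (f y))"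

definition L_alg ::
  "('k, 'r) ring_scheme \<Rightarrow> ('k, 'a, 'm) hopf_scheme \<Rightarrow> ('k, 'a, 'v) comodule \<Rightarrow> ('v \<Rightarrow> 'v) set"
  where "L_alg K A X = {\<Lambda> X | \<Lambda>. natural_family K A X \<Lambda>}"

text \<open>The transition map from \<open>L_alg K A Y\<close> to \<open>L_alg K A X\<close>, for \<open>X\<close> in \<open>generated K A Y\<close>.\<close>

definition L_trans ::
  "('k, 'r) ring_scheme \<Rightarrow> ('k, 'a, 'm) hopf_scheme \<Rightarrow> ('k, 'a, 'v) comodule
    \<Rightarrow> ('k, 'a, 'v) comodule \<Rightarrow> ('v \<Rightarrow> 'v) \<Rightarrow> ('v \<Rightarrow> 'v)"
  where "L_trans K A X Y l = (THE l'. \<exists>\<Lambda>. natural_family K A Y \<Lambda> \<and> \<Lambda> Y = l \<and> \<Lambda> X = l')"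

definition L_lim ::
  "('k, 'r) ring_scheme \<Rightarrow> ('k, 'a, 'm) hopf_scheme
    \<Rightarrow> ('k, ('k, 'a, 'v) comodule \<Rightarrow> 'v \<Rightarrow> 'v) module"
  where "L_lim K A =
    (let Ob = Obj (Comod K A) in
     \<lparr>carrier = {\<Lambda> \<in> (\<Pi>\<^sub>E X\<in>Ob. L_alg K A X).
        \<forall>Y\<in>Ob. \<forall>X\<in>generated K A Y. L_trans K A X Y (\<Lambda> Y) = \<Lambda> X},
      mult = (\<lambda>\<Lambda> M. \<lambda>X\<in>Ob. compose (carrier X) (\<Lambda> X) (M X)),
      one = (\<lambda>X\<in>Ob. \<lambda>x\<in>carrier X. x),
      zero = (\<lambda>X\<in>Ob. \<lambda>x\<in>carrier X. \<zero>\<^bsub>X\<^esub>),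
      add = (\<lambda>\<Lambda> M. \<lambda>X\<in>Ob. \<lambda>x\<in>carrier X. \<Lambda> X x \<oplus>\<^bsub>X\<^esub> M X x),
      smult = (\<lambda>r \<Lambda>. \<lambda>X\<in>Ob. \<lambda>x\<in>carrier X. r \<odot>\<^bsub>X\<^esub> \<Lambda> X x)\<rparr>)"

text \<open>The least codimension of a two-sided ideal of \<open>L\<close> killed by \<open>\<alpha>\<close>.\<close>

definition functional_rank ::
  "('k, 'r) ring_scheme \<Rightarrow> ('k, 'l, 'm) module_scheme \<Rightarrow> ('l \<Rightarrow> 'k) \<Rightarrow> nat"
  where "functional_rank K L \<alpha> =
    (LEAST m. \<exists>J. ideal J L \<and> subspace K J L
       \<and> vectorspace.fin_dim K (quot_space L J) \<and> vectorspace.dim K (quot_space L J) = m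
       \<and> (\<forall>x\<in>J. \<alpha> x = \<zero>\<^bsub>K\<^esub>))"

text \<open>The matrix coefficient \<open>(f \<otimes> 1) (\<rho> v)\<close>.\<close>

definition coefficient ::
  "('k, 'r) ring_scheme \<Rightarrow> ('k, 'a, 'm) hopf_scheme \<Rightarrow> ('k, 'a, 'v) comodule
    \<Rightarrow> ('v \<Rightarrow> 'k) \<Rightarrow> 'v \<Rightarrow> 'a"
  where "coefficient K A Y f v = tensor_lift K Y A A (\<lambda>y a. f y \<odot>\<^bsub>A\<^esub> a) (coact Y v)"

text \<open>Every element of \<open>A\<close> is a matrix coefficient of a finite dimensional comodule \<open>Y\<close>; it
  corresponds to the class of the functional sending \<open>l\<close> in \<open>L_alg K A Y\<close> to \<open>f (l v)\<close>, which
  is then composed with the projection sending \<open>\<Lambda>\<close> to \<open>\<Lambda> Y\<close>. The result does not depend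
  on how the element is written as a coefficient.\<close>

definition dual_embedding ::
  "('k, 'r) ring_scheme \<Rightarrow> ('k, 'a, 'm) hopf_scheme \<Rightarrow> 'a
    \<Rightarrow> (('k, 'a, 'v) comodule \<Rightarrow> 'v \<Rightarrow> 'v) \<Rightarrow> 'k"
  where "dual_embedding K A a =
    (THE \<alpha>. \<exists>Y\<in>Obj (Comod K A). \<exists>v\<in>carrier Y. \<exists>f\<in>lin_maps K Y (scalar_space K).
       coefficient K A Y f v = a \<and> \<alpha> = (\<lambda>\<Lambda>\<in>carrier (L_lim K A). f (\<Lambda> Y v)))"

definition hopf_rank ::
  "'v itself \<Rightarrow> ('k, 'r) ring_scheme \<Rightarrow> ('k, 'a, 'm) hopf_scheme \<Rightarrow> 'a \<Rightarrow> nat"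
  where "hopf_rank TV K A a =
    functional_rank K (L_lim K A :: ('k, ('k, 'a, 'v) comodule \<Rightarrow> 'v \<Rightarrow> 'v) module)
      (dual_embedding K A a)"


section \<open>Ultraproducts\<close>

definition nonprincipal_ultrafilter :: "'i filter \<Rightarrow> bool"
  where "nonprincipal_ultrafilter U \<longleftrightarrow>
    U \<noteq> bot \<and> (\<forall>P. eventually P U \<or> eventually (\<lambda>i. \<not> P i) U)
    \<and> (\<forall>i. \<not> eventually (\<lambda>j. j = i) U)"

text \<open>An element of an ultraproduct is the set of all families almost everywhere equal to a given
  one; operations are applied to chosen representatives.\<close>

definition ucls :: "'i filter \<Rightarrow> ('i \<Rightarrow> 'a) \<Rightarrow> ('i \<Rightarrow> 'a) set"
  where "ucls U f = {g. eventually (\<lambda>i. g i = f i) U}"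

definition urep :: "('i \<Rightarrow> 'a) set \<Rightarrow> 'i \<Rightarrow> 'a"
  where "urep x = (SOME f. f \<in> x)"

definition umap1 :: "'i filter \<Rightarrow> ('i \<Rightarrow> 'a \<Rightarrow> 'b) \<Rightarrow> ('i \<Rightarrow> 'a) set \<Rightarrow> ('i \<Rightarrow> 'b) set"
  where "umap1 U op x = ucls U (\<lambda>i. op i (urep x i))"

definition umap2 ::
  "'i filter \<Rightarrow> ('i \<Rightarrow> 'a \<Rightarrow> 'b \<Rightarrow> 'c) \<Rightarrow> ('i \<Rightarrow> 'a) set \<Rightarrow> ('i \<Rightarrow> 'b) set \<Rightarrow> ('i \<Rightarrow> 'c) set"
  where "umap2 U op x y = ucls U (\<lambda>i. op i (urep x i) (urep y i))"

definition uprod_set :: "'i filter \<Rightarrow> ('i \<Rightarrow> 'a set) \<Rightarrow> ('i \<Rightarrow> 'a) set set"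
  where "uprod_set U S = {ucls U f | f. eventually (\<lambda>i. f i \<in> S i) U}"

definition uprod_ring :: "'i filter \<Rightarrow> ('i \<Rightarrow> ('k, 'r) ring_scheme) \<Rightarrow> ('i \<Rightarrow> 'k) set ring"
  where "uprod_ring U R =
    \<lparr>carrier = uprod_set U (\<lambda>i. carrier (R i)),
     mult = umap2 U (\<lambda>i. mult (R i)), one = ucls U (\<lambda>i. one (R i)),
     zero = ucls U (\<lambda>i. zero (R i)), add = umap2 U (\<lambda>i. add (R i))\<rparr>"

definition uprod_module ::
  "'i filter \<Rightarrow> ('i \<Rightarrow> ('k, 'v, 'm) module_scheme) \<Rightarrow> (('i \<Rightarrow> 'k) set, ('i \<Rightarrow> 'v) set) module"
  where "uprod_module U M =
    \<lparr>carrier = uprod_set U (\<lambda>i. carrier (M i)),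
     mult = umap2 U (\<lambda>i. mult (M i)), one = ucls U (\<lambda>i. one (M i)),
     zero = ucls U (\<lambda>i. zero (M i)), add = umap2 U (\<lambda>i. add (M i)),
     smult = umap2 U (\<lambda>i. smult (M i))\<rparr>"


subsection \<open>The restricted ultraproduct of Hopf algebras\<close>

definition restr_carrier ::
  "'v itself \<Rightarrow> 'i filter \<Rightarrow> ('i \<Rightarrow> ('k, 'r) ring_scheme) \<Rightarrow> ('i \<Rightarrow> ('k, 'a, 'm) hopf_scheme)
    \<Rightarrow> ('i \<Rightarrow> 'a) set set"
  where "restr_carrier TV U K A =
    {ucls U a | a. eventually (\<lambda>i. a i \<in> carrier (A i)) U
       \<and> (\<exists>m. eventually (\<lambda>i. hopf_rank TV (K i) (A i) (a i) \<le> m) U)}"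

text \<open>The map \<open>[a] \<otimes> [b] \<mapsto> [a \<otimes> b]\<close> on \<open>R \<otimes> R\<close>, for a subspace \<open>R\<close> of the ultraproduct
  of the \<open>A i\<close>.\<close>

definition uprod_tensor ::
  "'i filter \<Rightarrow> ('i \<Rightarrow> ('k, 'r) ring_scheme) \<Rightarrow> ('i \<Rightarrow> ('k, 'a, 'm) module_scheme)
    \<Rightarrow> (('i \<Rightarrow> 'k) set, ('i \<Rightarrow> 'a) set, 'n) module_scheme
    \<Rightarrow> (('i \<Rightarrow> 'a) set \<times> ('i \<Rightarrow> 'a) set \<Rightarrow> ('i \<Rightarrow> 'k) set) set
    \<Rightarrow> ('i \<Rightarrow> ('a \<times> 'a \<Rightarrow> 'k) set) set"
  where "uprod_tensor U K A R =
    tensor_lift (uprod_ring U K) R R (uprod_module U (\<lambda>i. tensor_space (K i) (A i) (A i)))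
      (umap2 U (\<lambda>i. pure_tensor (K i) (A i) (A i)))"

definition restr_uprod_hopf ::
  "'v itself \<Rightarrow> 'i filter \<Rightarrow> ('i \<Rightarrow> ('k, 'r) ring_scheme) \<Rightarrow> ('i \<Rightarrow> ('k, 'a, 'm) hopf_scheme)
    \<Rightarrow> (('i \<Rightarrow> 'k) set, ('i \<Rightarrow> 'a) set) hopf"
  where "restr_uprod_hopf TV U K A =
    (let k = uprod_ring U K; P = uprod_module U A; R = P\<lparr>carrier := restr_carrier TV U K A\<rparr> in
     \<lparr>carrier = carrier R, mult = mult R, one = one R, zero = zero R, add = add R, smult = smult R,
      comult = (\<lambda>x. inv_into (carrier (tensor_space k R R)) (uprod_tensor U K A R)
                 (umap1 U (\<lambda>i. comult (A i)) x)),
      counit = umap1 U (\<lambda>i. counit (A i))\<rparr>)"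


subsection \<open>The restricted ultraproduct of tensor categories\<close>

text \<open>The argument \<open>d\<close> is the dimension function on the objects of the factors.\<close>

definition restr_uprod_cat ::
  "'i filter \<Rightarrow> ('i \<Rightarrow> ('o, 'h, 'k) tensor_category) \<Rightarrow> ('i \<Rightarrow> 'o \<Rightarrow> nat)
    \<Rightarrow> (('i \<Rightarrow> 'o) set, ('i \<Rightarrow> 'h) set, ('i \<Rightarrow> 'k) set) tensor_category"
  where "restr_uprod_cat U C d =
    \<lparr>Obj = {ucls U X | X. eventually (\<lambda>i. X i \<in> Obj (C i)) U
              \<and> (\<exists>n. eventually (\<lambda>i. d i (X i) \<le> n) U)},
     Hom = (\<lambda>X Y. uprod_set U (\<lambda>i. Hom (C i) (urep X i) (urep Y i))),
     Ident = umap1 U (\<lambda>i. Ident (C i)),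
     Cmp = (\<lambda>X g f. ucls U (\<lambda>i. Cmp (C i) (urep X i) (urep g i) (urep f i))),
     HAdd = (\<lambda>X Y f g. ucls U (\<lambda>i. HAdd (C i) (urep X i) (urep Y i) (urep f i) (urep g i))),
     HScale = (\<lambda>X Y r f. ucls U (\<lambda>i. HScale (C i) (urep X i) (urep Y i) (urep r i) (urep f i))),
     Tens = umap2 U (\<lambda>i. Tens (C i)),
     TensHom = (\<lambda>X X' Y Y' f g.
       ucls U (\<lambda>i. TensHom (C i) (urep X i) (urep X' i) (urep Y i) (urep Y' i) (urep f i) (urep g i))),
     UnitObj = ucls U (\<lambda>i. UnitObj (C i)),
     Assoc = (\<lambda>X Y Z. ucls U (\<lambda>i. Assoc (C i) (urep X i) (urep Y i) (urep Z i))),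
     Braid = umap2 U (\<lambda>i. Braid (C i)),
     LUnit = umap1 U (\<lambda>i. LUnit (C i)),
     RUnit = umap1 U (\<lambda>i. RUnit (C i))\<rparr>"

definition restr_uprod_Comod ::
  "'i filter \<Rightarrow> ('i \<Rightarrow> ('k, 'r) ring_scheme) \<Rightarrow> ('i \<Rightarrow> ('k, 'a, 'm) hopf_scheme)
    \<Rightarrow> (('i \<Rightarrow> ('k, 'a, 'v) comodule) set, ('i \<Rightarrow> 'v \<Rightarrow> 'v) set, ('i \<Rightarrow> 'k) set) tensor_category"
  where "restr_uprod_Comod U K A =
    restr_uprod_cat U (\<lambda>i. Comod (K i) (A i)) (\<lambda>i X. vectorspace.dim (K i) X)"

text \<open>The fibre functor on objects and morphisms, and its tensor structure
  \<open>[x] \<otimes> [y] \<mapsto> [x \<otimes> y]\<close>.\<close>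

definition fibre_obj ::
  "'i filter \<Rightarrow> ('i \<Rightarrow> ('k, 'a, 'v) comodule) set \<Rightarrow> (('i \<Rightarrow> 'k) set, ('i \<Rightarrow> 'v) set) module"
  where "fibre_obj U X = uprod_module U (urep X)"

definition fibre_hom ::
  "'i filter \<Rightarrow> ('i \<Rightarrow> ('k, 'a, 'v) comodule) set \<Rightarrow> ('i \<Rightarrow> ('k, 'a, 'v) comodule) set
    \<Rightarrow> ('i \<Rightarrow> 'v \<Rightarrow> 'v) set \<Rightarrow> ('i \<Rightarrow> 'v) set \<Rightarrow> ('i \<Rightarrow> 'v) set"
  where "fibre_hom U X Y f = (\<lambda>x\<in>carrier (fibre_obj U X). umap2 U (\<lambda>i g z. g z) f x)"

definition fibre_tensor ::
  "'i filter \<Rightarrow> ('i \<Rightarrow> ('k, 'r) ring_scheme) \<Rightarrow> ('i \<Rightarrow> ('k, 'a, 'm) hopf_scheme)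
    \<Rightarrow> ('i \<Rightarrow> ('k, 'a, 'v) comodule) set \<Rightarrow> ('i \<Rightarrow> ('k, 'a, 'v) comodule) set
    \<Rightarrow> ('i \<Rightarrow> 'v) set \<Rightarrow> ('i \<Rightarrow> 'v) set"
  where "fibre_tensor U K A X Y =
    vlift (uprod_ring U K) (fibre_obj U X) (fibre_obj U Y)
      (fibre_obj U (Tens (restr_uprod_Comod U K A) X Y))
      (umap2 U (\<lambda>i. vpure (K i) (urep X i) (urep Y i)))"

definition fibre_unit ::
  "'i filter \<Rightarrow> ('i \<Rightarrow> ('k, 'r) ring_scheme) \<Rightarrow> ('i \<Rightarrow> 'v) set \<Rightarrow> ('i \<Rightarrow> 'v) set"
  where "fibre_unit U K =
    (let k = uprod_ring U K in
      (\<lambda>z\<in>carrier (copy_space k (scalar_space k)).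
        umap1 U (\<lambda>i. copy_map (K i) (scalar_space (K i))) (uncopy_map k (scalar_space k) z)))"

definition represents_restr_uprod ::
  "'v itself \<Rightarrow> 'i filter \<Rightarrow> ('i \<Rightarrow> ('k, 'r) ring_scheme) \<Rightarrow> ('i \<Rightarrow> ('k, 'a, 'm) hopf_scheme)
    \<Rightarrow> (('i \<Rightarrow> 'k) set, 'b, 'n) hopf_scheme \<Rightarrow> bool"
  where "represents_restr_uprod TV U K A B \<longleftrightarrow>
    represents (uprod_ring U K)
      (restr_uprod_Comod U K A ::
        (('i \<Rightarrow> ('k, 'a, 'v) comodule) set, ('i \<Rightarrow> 'v \<Rightarrow> 'v) set, ('i \<Rightarrow> 'k) set) tensor_category)
      (fibre_obj U) (fibre_hom U) (fibre_tensor U K A) (fibre_unit U K) B"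

end

theory Submission
  imports Defs
begin

text \<open>
  An element of a Hopf algebra has bounded rank iff it is a matrix coefficient of a comodule of
  bounded dimension, so the restricted ultraproduct consists of the classes of coefficients of
  comodules of bounded dimension. By Los's theorem and injectivity of the comparison map from the tensor
  product of ultraproducts to the ultraproduct of tensor products, it is a Hopf algebra, and every
  object of the restricted ultraproduct category becomes a comodule over it. Multiplicative matrices
  of bounded size pass to and from ultraproducts, which makes the fibre functor an
  equivalence. Any other representing Hopf algebra is identified with it by matching matrix
  coefficients; this is well defined because two coefficients can be compared inside a direct sum,
  where they agree iff they agree on the image of the comodule in the regular comodule.
\<close>

text \<open>What makes the rank usable across infinitely many fields is a two-sided estimate that
  depends neither on the field nor on the Hopf algebra. A coefficient of an
  \<open>n\<close>-dimensional comodule has rank at most n^2, because the kernel of the action on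
  that comodule is cut out by n^2 matrix entries. Conversely, an element whose comultiplication
  needs \<open>r\<close> terms has rank at least \<open>r\<close> and is a coefficient of an
  \<open>r\<close>-dimensional comodule. An ultrafilter turns bounded dimension into constant
  dimension, and a comodule of fixed dimension \<open>n\<close> is n^2 elements of the Hopf algebra
  subject to finitely many equations. The antipode respects the bounds because transposing the image
  of a multiplicative matrix under it gives a multiplicative matrix again. The formal obstacle is
  that comodules have carriers in one fixed type, so that tensor products are copied along arbitrary
  isomorphisms; coherence of the fibre functor is therefore treated as a system of identities
  between linear maps, checked on pure tensors.\<close>

abbreviation (input) add_in ("_ +[_] _" [65, 0, 66] 65) where "x +[V] y \<equiv> x \<oplus>\<^bsub>V\<^esub> y"
abbreviation (input) minus_in ("_ -[_] _" [65, 0, 66] 65) where "x -[V] y \<equiv> x \<ominus>\<^bsub>V\<^esub> y"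
abbreviation (input) neg_in ("-[_] _" [0, 81] 80) where "-[V] x \<equiv> \<ominus>\<^bsub>V\<^esub> x"
abbreviation (input) smult_in ("_ *[_] _" [70, 0, 71] 70) where "c *[V] x \<equiv> c \<odot>\<^bsub>V\<^esub> x"
abbreviation (input) mult_in ("_ **[_] _" [70, 0, 71] 70) where "x **[A] y \<equiv> x \<otimes>\<^bsub>A\<^esub> y"
abbreviation (input) zero_in ("0[_]") where "0[V] \<equiv> \<zero>\<^bsub>V\<^esub>"
abbreviation (input) one_in ("1[_]") where "1[A] \<equiv> \<one>\<^bsub>A\<^esub>"
abbreviation (input) in_carrier (infix ".:" 50) where "x .: V \<equiv> x \<in> carrier V"
abbreviation (input) "vsp \<equiv> vectorspace"
abbreviation (input) "vdim \<equiv> vectorspace.dim"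
abbreviation (input) "Lin \<equiv> module_hom"
abbreviation (input) "ten \<equiv> tensor_space"
abbreviation (input) "pt \<equiv> pure_tensor"
abbreviation (input) "tmap \<equiv> tensor_map"
abbreviation (input) "tlift \<equiv> tensor_lift"
abbreviation (input) "ssp \<equiv> scalar_space"
abbreviation (input) "coef \<equiv> coefficient"
abbreviation (input) "chom \<equiv> comod_hom"
abbreviation (input) "rcom \<equiv> right_comodule"
abbreviation (input) "OB K A \<equiv> Obj (Comod K A)"
abbreviation (input) "vten \<equiv> vtensor"
abbreviation (input) "wco \<equiv> with_coact"
abbreviation (input) "Fs \<equiv> finsum"
abbreviation (input) "Car \<equiv> carrier"

abbreviation (input) "frsp \<equiv> free_space"

section \<open>Elementary calculus in vector spaces over a fixed field\<close>

locale scalars = K?: field K for K :: "('k, 'r) ring_scheme"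
begin

lemma vs_iff_module: "vsp K V \<longleftrightarrow> module K V"
 using field_axioms by (auto simp: vectorspace_def)

text \<open>Facts of the locale \<open>vectorspace\<close> are restated with \<open>vsp K V\<close>
  as a premise: one formula usually mentions several spaces, and the same rules are later
  instantiated at every \<open>K i\<close> and at the ultraproduct field.\<close>

lemma
 assumes V: "vsp K V"
 shows vs_zero_closed [simp]: "0[V] .: V"
  and vs_add_closed [simp]: "[|x .: V; y .: V|] ==> x +[V] y .: V"
  and vs_neg_closed [simp]: "x .: V ==> -[V] x .: V"
  and vs_minus_closed [simp]: "[|x .: V; y .: V|] ==> x -[V] y .: V"
  and vs_sm_closed [simp]: "[|c .: K; x .: V|] ==> c *[V] x .: V"
  and vs_add_assoc: "[|x .: V; y .: V; z .: V|]
   ==> (x +[V] y) +[V] z = x +[V] (y +[V] z)"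
  and vs_add_comm: "[|x .: V; y .: V|] ==> x +[V] y = y +[V] x"
  and vs_add_lcomm: "[|x .: V; y .: V; z .: V|]
   ==> x +[V] (y +[V] z) = y +[V] (x +[V] z)"
  and vs_l_zero [simp]: "x .: V ==> 0[V] +[V] x = x"
  and vs_r_zero [simp]: "x .: V ==> x +[V] 0[V] = x"
  and vs_l_neg [simp]: "x .: V ==> -[V] x +[V] x = 0[V]"
  and vs_r_neg [simp]: "x .: V ==> x +[V] -[V] x = 0[V]"
  and vs_neg_neg [simp]: "x .: V ==> -[V] (-[V] x) = x"
  and vs_minus_self [simp]: "x .: V ==> x -[V] x = 0[V]"
  and vs_minus_eq_zero: "[|x .: V; y .: V|] ==> x -[V] y = 0[V] \<longleftrightarrow> x = y"
  and vs_minus_add [simp]: "[|x .: V; y .: V|] ==> (x -[V] y) +[V] y = x"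
  and vs_neg_smult: "x .: V ==> -[V] x = (-[K] 1[K]) *[V] x"
  and vs_sm_neg: "[|c .: K; x .: V|] ==> (-[K] c) *[V] x = -[V] (c *[V] x)"
  and vs_sm_one [simp]: "x .: V ==> 1[K] *[V] x = x"
  and vs_sm_l_zero [simp]: "x .: V ==> 0[K] *[V] x = 0[V]"
  and vs_sm_r_zero [simp]: "c .: K ==> c *[V] 0[V] = 0[V]"
  and vs_sm_smult: "[|c .: K; d .: K; x .: V|]
   ==> c *[V] (d *[V] x) = (c **[K] d) *[V] x"
  and vs_sm_l_distr: "[|c .: K; d .: K; x .: V|]
   ==> (c +[K] d) *[V] x = c *[V] x +[V] d *[V] x"
  and vs_sm_r_distr: "[|c .: K; x .: V; y .: V|]
   ==> c *[V] (x +[V] y) = c *[V] x +[V] c *[V] y"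
  and vs_add_cancel: "[|x .: V; y .: V; z .: V|]
   ==> x +[V] z = y +[V] z \<longleftrightarrow> x = y"
proof -
 interpret V: vectorspace K V by fact
 show "0[V] .: V" by simp
 show "[|x .: V; y .: V|] ==> x +[V] y .: V" by simp
 show "x .: V ==> -[V] x .: V" by simp
 show "[|x .: V; y .: V|] ==> x -[V] y .: V" by simp
 show "[|c .: K; x .: V|] ==> c *[V] x .: V" by simp
 show "[|x .: V; y .: V; z .: V|] ==> (x +[V] y) +[V] z = x +[V] (y +[V] z)"
  by (rule V.M.add.m_assoc)
 show "[|x .: V; y .: V|] ==> x +[V] y = y +[V] x" by (rule V.M.add.m_comm)
 show "[|x .: V; y .: V; z .: V|]
   ==> x +[V] (y +[V] z) = y +[V] (x +[V] z)" by (rule V.M.add.m_lcomm)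
 show "x .: V ==> 0[V] +[V] x = x" by simp
 show "x .: V ==> x +[V] 0[V] = x" by simp
 show "x .: V ==> -[V] x +[V] x = 0[V]" by (rule V.M.l_neg)
 show "x .: V ==> x +[V] -[V] x = 0[V]" by (rule V.M.r_neg)
 show "x .: V ==> -[V] (-[V] x) = x" by (rule V.M.minus_minus)
 show "x .: V ==> x -[V] x = 0[V]" by (simp add: a_minus_def V.M.r_neg)
 show "[|x .: V; y .: V|] ==> x -[V] y = 0[V] \<longleftrightarrow> x = y" by (rule V.M.minus_other_side)
 show "[|x .: V; y .: V|] ==> (x -[V] y) +[V] y = x"
  by (simp add: a_minus_def V.M.add.m_assoc V.M.l_neg)
 show "x .: V ==> -[V] x = (-[K] 1[K]) *[V] x" by (simp add: V.smult_minus_1)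
 show "[|c .: K; x .: V|] ==> (-[K] c) *[V] x = -[V] (c *[V] x)" by (rule V.smult_l_minus)
 show "x .: V ==> 1[K] *[V] x = x" by simp
 show "x .: V ==> 0[K] *[V] x = 0[V]" by simp
 show "c .: K ==> c *[V] 0[V] = 0[V]" by simp
 show "[|c .: K; d .: K; x .: V|]
   ==> c *[V] (d *[V] x) = (c **[K] d) *[V] x" by (simp add: V.smult_assoc1)
 show "[|c .: K; d .: K; x .: V|]
   ==> (c +[K] d) *[V] x = c *[V] x +[V] d *[V] x" by (rule V.smult_l_distr)
 show "[|c .: K; x .: V; y .: V|]
   ==> c *[V] (x +[V] y) = c *[V] x +[V] c *[V] y" by (rule V.smult_r_distr)
 show "[|x .: V; y .: V; z .: V|] ==> x +[V] z = y +[V] z \<longleftrightarrow> x = y"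
  by simp
qed

lemma
 assumes V: "vsp K V"
 shows vsum_closed [simp]: "(!!i. i:I ==> f i .: V) ==> Fs V f I .: V"
  and vsum_empty [simp]: "Fs V f {} = 0[V]"
  and vsum_insert: "[|finite I; j ~: I; f j .: V; !!i. i:I ==> f i .: V|]
   ==> Fs V f (insert j I) = f j +[V] Fs V f I"
  and vsum_cong: "[|I = J; !!i. i:J ==> g i .: V; !!i. i:J ==> f i = g i|]
   ==> Fs V f I = Fs V g J"
  and vsum_zero: "(!!i. i:I ==> f i = 0[V]) ==> Fs V f I = 0[V]"
  and vsum_add: "[|!!i. i:I ==> f i .: V; !!i. i:I ==> g i .: V|]
   ==> Fs V (%i. f i +[V] g i) I = Fs V f I +[V] Fs V g I"
  and vsum_smult: "[|c .: K; !!i. i:I ==> f i .: V|]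
   ==> Fs V (%i. c *[V] f i) I = c *[V] Fs V f I"
  and vsum_smult_l: "[|x .: V; !!i. i:I ==> d i .: K|]
   ==> Fs V (%i. d i *[V] x) I = Fs K d I *[V] x"
  and vsum_Un: "[|finite I; finite J; I Int J = {}; !!i. i:I Un J ==> f i .: V|]
   ==> Fs V f (I Un J) = Fs V f I +[V] Fs V f J"
proof -
 interpret V: vectorspace K V by fact
 show "(!!i. i:I ==> f i .: V) ==> Fs V f I .: V" by (rule V.M.finsum_closed) auto
 show "Fs V f {} = 0[V]" by simp
 show "[|finite I; j ~: I; f j .: V; !!i. i:I ==> f i .: V|]
   ==> Fs V f (insert j I) = f j +[V] Fs V f I" by (rule V.M.finsum_insert) auto
 show "[|I = J; !!i. i:J ==> g i .: V; !!i. i:J ==> f i = g i|]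
   ==> Fs V f I = Fs V g J" by (rule V.M.finsum_cong') auto
 show "(!!i. i:I ==> f i = 0[V]) ==> Fs V f I = 0[V]" by (rule V.M.add.finprod_one_eqI)
 show "[|!!i. i:I ==> f i .: V; !!i. i:I ==> g i .: V|]
   ==> Fs V (%i. f i +[V] g i) I = Fs V f I +[V] Fs V g I"
  by (rule V.M.finsum_addf) auto
 show "[|c .: K; !!i. i:I ==> f i .: V|]
   ==> Fs V (%i. c *[V] f i) I = c *[V] Fs V f I"
  by (rule V.finsum_smult [symmetric]) auto
 show "[|x .: V; !!i. i:I ==> d i .: K|]
   ==> Fs V (%i. d i *[V] x) I = Fs K d I *[V] x"
  by (rule V.finsum_smult_r [symmetric]) auto
 show "[|finite I; finite J; I Int J = {}; !!i. i:I Un J ==> f i .: V|]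
   ==> Fs V f (I Un J) = Fs V f I +[V] Fs V f J"
  by (rule V.M.finsum_Un_disjoint) auto
qed

lemma vsum_reindex:
 assumes "vsp K V" "inj_on h I" "!!i. i:I ==> f (h i) .: V"
 shows "Fs V f (h ` I) = Fs V (%i. f (h i)) I"
proof -
 interpret V: vectorspace K V by fact
 show ?thesis using assms by (intro V.M.finsum_reindex) auto
qed

lemma vsum_infinite:
 assumes "vsp K V" "infinite I"
 shows "Fs V f I = 0[V]"
proof -
 interpret V: vectorspace K V by fact
 show ?thesis using assms(2) by (rule V.M.finsum_infinite)
qed

lemma vsum_remove:
 assumes "vsp K V" "finite I" "j:I" "!!i. i:I ==> f i .: V"
 shows "Fs V f I = f j +[V] Fs V f (I - {j})"
 using vsum_insert[of V "I - {j}" j f] assms by (simp add: insert_absorb)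

lemma vsum_single:
 assumes V: "vsp K V" and "finite I" "j:I" "f j .: V"
  and "!!i. i:I ==> i ~= j ==> f i = 0[V]"
 shows "Fs V f I = f j"
proof -
 have "Fs V f I = f j +[V] Fs V f (I - {j})"
  by (rule vsum_remove) (use assms in "auto, metis vs_zero_closed")
 also have "Fs V f (I - {j}) = 0[V]" by (rule vsum_zero) (use assms in auto)
 finally show ?thesis using assms by simp
qed

lemma vsum_delta:
 assumes V: "vsp K V" and "finite I" "j:I" "!!i. i:I ==> f i .: V"
 shows "Fs V (%i. (if i = j then 1[K] else 0[K]) *[V] f i) I = f j"
  and "Fs V (%i. (if j = i then 1[K] else 0[K]) *[V] f i) I = f j"
 using vsum_single[OF assms(1-3), of "%i. (if i = j then 1[K] else 0[K]) *[V] f i"]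
  vsum_single[OF assms(1-3), of "%i. (if j = i then 1[K] else 0[K]) *[V] f i"] assms by auto

lemma vsum_swap:
 assumes V: "vsp K V" and "finite I" "finite J"
  and "!!i j. i:I ==> j:J ==> f i j .: V"
 shows "Fs V (%i. Fs V (%j. f i j) J) I = Fs V (%j. Fs V (%i. f i j) I) J"
 using assms(2,4)
proof (induction I)
 case empty
 then show ?case using V by (simp add: vsum_zero)
next
 case (insert i I)
 have "Fs V (%i. Fs V (f i) J) (insert i I)
   = Fs V (f i) J +[V] Fs V (%j. Fs V (%i. f i j) I) J"
  using insert V by (subst vsum_insert) auto
 also have "... = Fs V (%j. f i j +[V] Fs V (%i. f i j) I) J"
  using insert V by (subst vsum_add) auto
 also have "... = Fs V (%j. Fs V (%i. f i j) (insert i I)) J"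
  using insert V by (intro vsum_cong) (auto intro!: vsum_closed vsum_insert[symmetric])
 finally show ?case .
qed

lemma vsum_Times:
 assumes V: "vsp K V" and "finite I" "finite J"
  and "!!i j. i:I ==> j:J ==> f (i, j) .: V"
 shows "Fs V f (I \<times> J) = Fs V (%i. Fs V (%j. f (i, j)) J) I"
 using assms(2,4)
proof (induction I)
 case empty
 then show ?case using V by simp
next
 case (insert i I)
 have "insert i I \<times> J = Pair i ` J Un I \<times> J" by auto
 then have "Fs V f (insert i I \<times> J) = Fs V f (Pair i ` J) +[V] Fs V f (I \<times> J)"
  using insert V `finite J` by (simp only:) (subst vsum_Un; auto)
 also have "Fs V f (Pair i ` J) = Fs V (%j. f (i, j)) J"
  using insert V by (subst vsum_reindex) (auto simp: inj_on_def)
 finally show ?case using insert V `finite J` by (simp add: vsum_insert)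
qed

lemma vs_ssp: "vsp K (ssp K)"
 unfolding vs_iff_module scalar_space_def
 by (rule module_criteria)
  (auto simp: is_cring a_ac m_assoc l_distr r_distr intro!: bexI[of _ "-[K] _"] r_neg)

lemma scalar_space_simps [simp]:
 "Car (ssp K) = Car K" "zero (ssp K) = 0[K]"
 "add (ssp K) = add K" "smult (ssp K) = mult K"
 "mult (ssp K) = mult K" "one (ssp K) = one K"
 "Fs (ssp K) = Fs K"
 by (auto simp: scalar_space_def finsum_def finprod_def fun_eq_iff)

declare vs_ssp [simp]

subsection \<open>Linear maps\<close>

lemma homI:
 assumes "!!x. x .: V ==> T x .: W"
  and "!!x y. [|x .: V; y .: V|] ==> T (x +[V] y) = T x +[W] T y"
  and "!!c x. [|c .: K; x .: V|] ==> T (c *[V] x) = c *[W] T x"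
 shows "T:Lin K V W"
 using assms by (auto simp: module_hom_def)

lemma hom_cl: "T:Lin K V W ==> x .: V ==> T x .: W"
 and hom_add: "T:Lin K V W ==> x .: V ==> y .: V ==> T (x +[V] y) = T x +[W] T y"
 and hom_smult: "T:Lin K V W ==> c .: K ==> x .: V ==> T (c *[V] x) = c *[W] T x"
 by (auto simp: module_hom_def)

lemma hom_zero:
 assumes "vsp K V" "vsp K W" "T:Lin K V W"
 shows "T 0[V] = 0[W]"
proof -
 have "T (0[K] *[V] 0[V]) = 0[K] *[W] T 0[V]" using assms by (intro hom_smult) auto
 then show ?thesis using assms hom_cl[OF assms(3), of "0[V]"] by simp
qed

lemma hom_neg:
 assumes "vsp K V" "vsp K W" "T:Lin K V W" "x .: V"
 shows "T (-[V] x) = -[W] T x"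
 using assms hom_smult[OF assms(3), of "-[K] 1[K]" x] hom_cl[OF assms(3,4)]
 by (simp add: vs_neg_smult)

lemma hom_minus:
 assumes "vsp K V" "vsp K W" "T:Lin K V W" "x .: V" "y .: V"
 shows "T (x -[V] y) = T x -[W] T y"
 using assms by (simp add: a_minus_def hom_add[OF assms(3)] hom_neg)

lemma hom_sum:
 assumes V: "vsp K V" and W: "vsp K W" and T: "T:Lin K V W"
  and f: "!!i. i:I ==> f i .: V"
 shows "T (Fs V f I) = Fs W (%i. T (f i)) I"
 using f
proof (induction I rule: infinite_finite_induct)
 case (infinite I)
 then show ?case using V W T by (simp add: vsum_infinite hom_zero)
next
 case empty
 then show ?case using V W T by (simp add: hom_zero)
next
 case (insert i I)
 then show ?case using V W by (simp add: vsum_insert hom_add[OF T] hom_cl[OF T])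
qed

lemma hom_comp:
 "T:Lin K V W ==> S:Lin K W P ==> (%x. S (T x)):Lin K V P"
 by (rule homI) (simp_all add: hom_cl hom_add hom_smult)

lemma hom_id: "(%x. x):Lin K V V"
 by (auto simp: module_hom_def)

lemma hom_zero_map: "vsp K W ==> (%x. 0[W]):Lin K V W"
 by (auto simp: module_hom_def)

lemma hom_cong:
 assumes "vsp K V" "!!x. x .: V ==> T x = S x"
 shows "T:Lin K V W \<longleftrightarrow> S:Lin K V W"
 using assms by (auto simp: module_hom_def Pi_def)

lemma hom_restrict:
 "vsp K V ==> T:Lin K V W ==> restrict T (Car V):Lin K V W"
 by (auto simp: module_hom_def)

lemma hom_add_map:
 assumes W: "vsp K W" and T: "T:Lin K V W" and S: "S:Lin K V W"
 shows "(%x. T x +[W] S x):Lin K V W"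
 using W by (intro homI)
  (auto simp: hom_add[OF T] hom_add[OF S] hom_smult[OF T] hom_smult[OF S] hom_cl[OF T] hom_cl[OF S]
   vs_sm_r_distr vs_add_assoc vs_add_comm vs_add_lcomm)

lemma hom_smult_map:
 assumes W: "vsp K W" and T: "T:Lin K V W" and "c .: K"
 shows "(%x. c *[W] T x):Lin K V W"
 using assms by (intro homI)
  (auto simp: hom_add[OF T] hom_smult[OF T] hom_cl[OF T]
   vs_sm_r_distr vs_sm_smult m_comm)

lemma hom_smult_l:
 assumes W: "vsp K W" and T: "T:Lin K V (ssp K)" and "w .: W"
 shows "(%x. T x *[W] w):Lin K V W"
 using assms hom_cl[OF T] hom_add[OF T] hom_smult[OF T]
 by (intro homI) (auto simp: vs_sm_l_distr vs_sm_smult)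

lemma hom_sum_map:
 assumes V: "vsp K V" and W: "vsp K W" and "finite I"
  and T: "!!i. i:I ==> T i:Lin K V W"
 shows "(%x. Fs W (%i. T i x) I):Lin K V W"
 using assms(3,4)
proof (induction I)
 case empty
 then show ?case using W by (simp add: hom_zero_map)
next
 case (insert i I)
 have "(%x. T i x +[W] Fs W (%i. T i x) I):Lin K V W"
  using insert W by (intro hom_add_map) auto
 moreover have "x .: V ==> Fs W (%i. T i x) (insert i I) = T i x +[W] Fs W (%i. T i x) I" for x
  using insert W by (subst vsum_insert) (auto intro: hom_cl)
 ultimately show ?case using hom_cong[OF V] by (metis (no_types, lifting))
qed

lemma hom_inv:
 assumes V: "vsp K V" and T: "T:Lin K V W"
  and bij: "bij_betw T (Car V) (Car W)"
 shows "inv_into (Car V) T:Lin K W V"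
proof -
 let ?S = "inv_into (Car V) T"
 have cl: "?S y .: V" and TS: "T (?S y) = y" if "y .: W" for y
  using that bij by (auto simp: bij_betw_def inv_into_into f_inv_into_f)
 have ST: "?S (T x) = x" if "x .: V" for x using that bij by (simp add: bij_betw_inv_into_left)
 show ?thesis
 proof (rule homI)
  fix x y assume "x .: W" "y .: W"
  then show "?S (x +[W] y) = ?S x +[V] ?S y"
   using ST[of "?S x +[V] ?S y"] V by (simp add: hom_add[OF T] cl TS)
 next
  fix c x assume "c .: K" "x .: W"
  then show "?S (c *[W] x) = c *[V] ?S x"
   using ST[of "c *[V] ?S x"] V by (simp add: hom_smult[OF T] cl TS)
 qed (use cl in auto)
qed

lemma hom_inj_iff:
 assumes V: "vsp K V" and W: "vsp K W" and T: "T:Lin K V W"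
 shows "inj_on T (Car V) \<longleftrightarrow> (ALL x:Car V. T x = 0[W] --> x = 0[V])"
proof safe
 fix x assume "inj_on T (Car V)" "x .: V" "T x = 0[W]"
 then show "x = 0[V]" using hom_zero[OF V W T] V by (metis inj_onD vs_zero_closed)
next
 assume *: "ALL x:Car V. T x = 0[W] --> x = 0[V]"
 show "inj_on T (Car V)"
 proof (rule inj_onI)
  fix x y assume "x .: V" "y .: V" "T x = T y"
  then have "T (x -[V] y) = 0[W]" using hom_minus[OF V W T] W hom_cl[OF T] by simp
  then show "x = y" using * V `x \<in> carrier V` `y \<in> carrier V` by (metis vs_minus_closed vs_minus_eq_zero)
 qed
qed

lemma lm_hom: "T:lin_maps K V W ==> T:Lin K V W"
 by (simp add: lin_maps_def)

lemma lm_restrict: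
 "vsp K V ==> T:Lin K V W ==> restrict T (Car V):lin_maps K V W"
 by (simp add: lin_maps_def hom_restrict)

lemma lm_eqI:
 "T:lin_maps K V W ==> S:lin_maps K V W' ==> (!!x. x .: V ==> T x = S x) ==> T = S"
 by (auto simp: lin_maps_def intro: extensionalityI)

text \<open>The axioms are equations, apart from inverses, which are images of inverses. They
  therefore pass along every surjection compatible with the operations; this covers quotients as
  well as records sharing their operations.\<close>

lemma vs_transport:
 assumes V: "vsp K V"
  and surj: "Car Q = pj ` Car V" and z: "0[Q] = pj 0[V]"
  and add: "!!x y. [|x .: V; y .: V|] ==> pj x +[Q] pj y = pj (x +[V] y)"
  and smult: "!!c x. [|c .: K; x .: V|] ==> c *[Q] pj x = pj (c *[V] x)"
 shows "vsp K Q"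
 unfolding vs_iff_module
proof (rule module_criteria)
 show "ALL v w. v .: Q & w .: Q --> v +[Q] w = w +[Q] v"
  by (auto simp: surj add) (metis vs_add_comm[OF V])
 show "ALL v:Car Q. EX neg_v:Car Q. v +[Q] neg_v = 0[Q]"
 proof
  fix v assume "v .: Q"
  then obtain x where x: "x .: V" "v = pj x" using surj by auto
  then have "v +[Q] pj (-[V] x) = 0[Q]" using V z by (simp add: add)
  then show "EX neg_v:Car Q. v +[Q] neg_v = 0[Q]" using surj x V by auto
 qed
qed (use V in "auto simp: is_cring surj z add smult vs_add_assoc vs_sm_smult vs_sm_l_distr vs_sm_r_distr")

lemma subspace_I:
 assumes "vsp K V" "N <= Car V" "0[V] : N"
  "!!x y. x:N ==> y:N ==> x +[V] y:N" "!!c x. c .: K ==> x:N ==> c *[V] x:N"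
 shows "subspace K N V"
 using assms by (auto simp: subspace_def submodule_def vs_iff_module)

lemma subD:
 assumes "subspace K N V"
 shows "vsp K V" "N <= Car V" "0[V] : N"
  "!!x y. x:N ==> y:N ==> x +[V] y:N" "!!c x. c .: K ==> x:N ==> c *[V] x:N"
  "!!x. x:N ==> -[V] x:N" "!!x y. x:N ==> y:N ==> x -[V] y:N"
proof -
 show V: "vsp K V" and N: "N <= Car V" and "0[V] : N"
  and add: "!!x y. x:N ==> y:N ==> x +[V] y:N"
  and sm: "!!c x. c .: K ==> x:N ==> c *[V] x:N"
  using assms by (auto simp: subspace_def submodule_def)
 show neg: "x:N ==> -[V] x:N" for x
  using sm[of "-[K] 1[K]" x] N V by (auto simp: vs_neg_smult)
 show "x:N ==> y:N ==> x -[V] y:N" for x y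
  by (simp add: a_minus_def add neg)
qed

lemma kernel_subspace:
 assumes V: "vsp K V" and W: "vsp K W" and T: "T:Lin K V W"
 shows "subspace K {x:Car V. T x = 0[W]} V"
 using V W by (intro subspace_I) (auto simp: hom_zero[OF V W T] hom_add[OF T] hom_smult[OF T])

lemma subspace_vs: "subspace K N V ==> vsp K (V\<lparr>carrier := N\<rparr>)"
 using vectorspace.subspace_is_vs subD(1) by blast

subsection \<open>Quotients\<close>

lemma coset_image: "a_r_coset V N x = (%h. h +[V] x) ` N"
 by (auto simp: a_r_coset_def r_coset_def)

lemma coset_eq_iff:
 assumes N: "subspace K N V" and x: "x .: V" and y: "y .: V"
 shows "a_r_coset V N x = a_r_coset V N y \<longleftrightarrow> x -[V] y:N"
proof
 note V = subD(1)[OF N]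
 have NV: "n:N ==> n .: V" for n using subD(2)[OF N] by auto
 {
  assume "a_r_coset V N x = a_r_coset V N y"
  moreover have "x:a_r_coset V N x" unfolding coset_image
   using subD(3)[OF N] x V by (auto intro!: rev_image_eqI)
  ultimately obtain h where h: "h:N" "x = h +[V] y" by (auto simp: coset_image)
  then have "x -[V] y = h" using V NV y by (simp add: a_minus_def vs_add_assoc)
  then show "x -[V] y:N" using h by simp
 }
 have sub: "a_r_coset V N x <= a_r_coset V N y"
  if "x -[V] y:N" "x .: V" "y .: V" for x y
 proof
  fix z assume "z:a_r_coset V N x"
  then obtain h where h: "h:N" "z = h +[V] x" by (auto simp: coset_image)
  then have "z = (h +[V] (x -[V] y)) +[V] y" using V NV that by (simp add: vs_add_assoc)
  then show "z:a_r_coset V N y" unfolding coset_image using h that subD(4)[OF N] by blast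
 qed
 assume a: "x -[V] y:N"
 then have "-[V] (x -[V] y):N" by (rule subD(6)[OF N])
 moreover have "-[V] (x -[V] y) = y -[V] x"
 proof -
  interpret V: vectorspace K V by fact
  show ?thesis using x y by (simp add: a_minus_def V.M.minus_add V.M.add.m_comm)
 qed
 ultimately show "a_r_coset V N x = a_r_coset V N y" using sub[OF a x y] sub[of y x] x y by auto
qed

lemma quot_carrier: "Car (quot_space V N) = a_r_coset V N ` Car V"
 by (auto simp: quot_space_def A_RCOSETS_def RCOSETS_def a_r_coset_def)

lemma quot_add:
 assumes N: "subspace K N V" and x: "x .: V" and y: "y .: V"
 shows "a_r_coset V N x +[quot_space V N] a_r_coset V N y = a_r_coset V N (x +[V] y)"
proof -
 note V = subD(1)[OF N]
 have NV: "n:N ==> n .: V" for n using subD(2)[OF N] by auto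
 show ?thesis
 proof (rule Set.set_eqI)
  fix z
  have "z:a_r_coset V N x +[quot_space V N] a_r_coset V N y
   \<longleftrightarrow> (EX h:N. EX h':N. z = (h +[V] x) +[V] (h' +[V] y))"
   by (auto simp: quot_space_def set_add_def set_mult_def coset_image)
  also have "... \<longleftrightarrow> (EX h:N. EX h':N. z = (h +[V] h') +[V] (x +[V] y))"
   using V NV x y by (intro bex_cong refl) (simp add: vs_add_assoc vs_add_lcomm)
  also have "... \<longleftrightarrow> (EX h:N. z = h +[V] (x +[V] y))"
   using subD(3,4)[OF N] V NV by (metis vs_r_zero)
  finally show "z:a_r_coset V N x +[quot_space V N] a_r_coset V N y
   \<longleftrightarrow> z:a_r_coset V N (x +[V] y)" by (auto simp: coset_image)
 qed
qed

text \<open>The scalar multiple in \<open>quot_space\<close> is a union over all members of the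
  coset. All terms of that union are the same coset, and it is nonempty because a coset contains its
  representative.\<close>

lemma quot_smult:
 assumes N: "subspace K N V" and c: "c .: K" and x: "x .: V"
 shows "c *[quot_space V N] a_r_coset V N x = a_r_coset V N (c *[V] x)"
proof -
 note V = subD(1)[OF N]
 have NV: "n:N ==> n .: V" for n using subD(2)[OF N] by auto
 have "a_r_coset V N (c *[V] z) = a_r_coset V N (c *[V] x)" if z: "z:a_r_coset V N x" for z
 proof -
  obtain h where h: "h:N" "z = h +[V] x" using z by (auto simp: coset_image)
  have "c *[V] z -[V] c *[V] x = c *[V] h"
   using V NV h x c by (simp add: vs_sm_r_distr a_minus_def vs_add_assoc)
  then show ?thesis using h c x V NV subD(5)[OF N] by (subst coset_eq_iff[OF N]) auto
 qed
 moreover have "x:a_r_coset V N x" unfolding coset_image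
  using subD(3)[OF N] x V by (auto intro!: rev_image_eqI)
 ultimately have "(UN z:a_r_coset V N x. a_r_coset V N (c *[V] z)) = a_r_coset V N (c *[V] x)" by blast
 then show ?thesis by (simp add: quot_space_def)
qed

lemma quot_zero:
 assumes N: "subspace K N V"
 shows "0[quot_space V N] = a_r_coset V N 0[V]"
proof -
 have "(%h. h +[V] 0[V]) ` N = (%h. h) ` N"
  using subD(1,2)[OF N] by (intro image_cong) auto
 then show ?thesis by (simp add: quot_space_def coset_image)
qed

lemma quot_vs: "subspace K N V ==> vsp K (quot_space V N)"
 by (rule vs_transport[of V _ "a_r_coset V N"])
  (auto simp: subD(1) quot_carrier quot_add quot_smult quot_zero)

lemma quot_proj_hom: "subspace K N V ==> a_r_coset V N:Lin K V (quot_space V N)"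
 by (intro homI) (auto simp: quot_carrier quot_add quot_smult)

lemma quot_lift:
 assumes N: "subspace K N V" and P: "vsp K P" and T: "T:Lin K V P"
  and ker: "!!x. x:N ==> T x = 0[P]"
 shows "EX S:Lin K (quot_space V N) P. ALL x:Car V. S (a_r_coset V N x) = T x"
proof -
 note V = subD(1)[OF N]
 have wd: "T x = T y" if "a_r_coset V N x = a_r_coset V N y" "x .: V" "y .: V" for x y
 proof -
  have "T (x -[V] y) = 0[P]" using that coset_eq_iff[OF N] ker by auto
  then have "T x -[P] T y = 0[P]" using that by (simp add: hom_minus[OF V P T])
  then show ?thesis using that P hom_cl[OF T] by (simp add: vs_minus_eq_zero)
 qed
 define S where "S C = T (SOME x. x .: V & a_r_coset V N x = C)" for C
 have S: "S (a_r_coset V N x) = T x" if "x .: V" for x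
  unfolding S_def
 proof (rule someI2[of _ x])
  show "T y = T x" if "y .: V & a_r_coset V N y = a_r_coset V N x" for y
   using wd[of y x] that `x \<in> carrier V` by blast
 qed (use that in simp)
 have "S:Lin K (quot_space V N) P"
  by (rule homI) (use V in "auto simp: quot_carrier S hom_cl[OF T] quot_add[OF N] quot_smult[OF N]
   hom_add[OF T] hom_smult[OF T]")
 then show ?thesis using S by blast
qed

subsection \<open>Tensor products\<close>

definition bilin where
 "bilin V W P bt \<longleftrightarrow> (ALL v:Car V. bt v:Lin K W P)
  & (ALL w:Car W. (%v. bt v w):Lin K V P)"

lemma bilinD:
 assumes "bilin V W P bt"
 shows "v .: V ==> bt v:Lin K W P" "w .: W ==> (%v. bt v w):Lin K V P"
  "[|v .: V; w .: W|] ==> bt v w .: P"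
  "[|v .: V; v' .: V; w .: W|] ==> bt (v +[V] v') w = bt v w +[P] bt v' w"
  "[|v .: V; w .: W; w' .: W|] ==> bt v (w +[W] w') = bt v w +[P] bt v w'"
  "[|c .: K; v .: V; w .: W|] ==> bt (c *[V] v) w = c *[P] bt v w"
  "[|c .: K; v .: V; w .: W|] ==> bt v (c *[W] w) = c *[P] bt v w"
 using assms unfolding bilin_def module_hom_def by auto

lemma bilinI:
 assumes "!!v w. [|v .: V; w .: W|] ==> bt v w .: P"
  "!!v v' w. [|v .: V; v' .: V; w .: W|] ==> bt (v +[V] v') w = bt v w +[P] bt v' w"
  "!!v w w'. [|v .: V; w .: W; w' .: W|] ==> bt v (w +[W] w') = bt v w +[P] bt v w'"
  "!!c v w. [|c .: K; v .: V; w .: W|] ==> bt (c *[V] v) w = c *[P] bt v w"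
  "!!c v w. [|c .: K; v .: V; w .: W|] ==> bt v (c *[W] w) = c *[P] bt v w"
 shows "bilin V W P bt"
 using assms unfolding bilin_def by (auto intro!: homI)

lemma bilin_homI:
 "[|!!v. v .: V ==> bt v:Lin K W P; !!w. w .: W ==> (%v. bt v w):Lin K V P|]
  ==> bilin V W P bt"
 by (simp add: bilin_def)

lemma bilin_comp:
 "bilin V W P bt ==> T:Lin K P Q ==> bilin V W Q (%v w. T (bt v w))"
 by (auto simp: bilin_def intro: hom_comp)

lemma bilin_comp2:
 "bilin V W P bt ==> S:Lin K V' V ==> T:Lin K W' W
  ==> bilin V' W' P (%v w. bt (S v) (T w))"
 by (intro bilinI)
  (auto simp: bilinD(3-7) hom_cl hom_add[of S] hom_add[of T] hom_smult[of S] hom_smult[of T])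

lemma frsp_simps:
 "Car (frsp K S) = {F:S \<rightarrow>\<^sub>E Car K. finite {s:S. F s ~= 0[K]}}"
 "zero (frsp K S) = (\<lambda>s\<in>S. 0[K])"
 "add (frsp K S) = (%F G. \<lambda>s\<in>S. F s +[K] G s)"
 "smult (frsp K S) = (%c F. \<lambda>s\<in>S. c **[K] F s)"
 by (auto simp: free_space_def func_space_def)

lemma frsp_vs: "vsp K (frsp K S)"
proof -
 have "vsp K (func_space S)"
  using func_space_is_module vs_iff_module by blast
 then have "subspace K {F:S \<rightarrow>\<^sub>E Car K. finite {s:S. F s ~= 0[K]}} (func_space S)"
 proof (rule subspace_I)
  fix x y assume xy: "x : {F:S \<rightarrow>\<^sub>E Car K. finite {s:S. F s ~= 0[K]}}"
   "y : {F:S \<rightarrow>\<^sub>E Car K. finite {s:S. F s ~= 0[K]}}"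
  have "{s:S. x s +[K] y s ~= 0[K]} <= {s:S. x s ~= 0[K]} Un {s:S. y s ~= 0[K]}" by auto
  then have "finite {s:S. x s +[K] y s ~= 0[K]}"
   using xy by (auto intro: finite_subset)
  then show "x +[func_space S] y : {F:S \<rightarrow>\<^sub>E Car K. finite {s:S. F s ~= 0[K]}}"
   using xy by (auto simp: func_space_def cong: conj_cong)
 next
  fix c x assume c: "c .: K" and x: "x : {F:S \<rightarrow>\<^sub>E Car K. finite {s:S. F s ~= 0[K]}}"
  have "{s:S. c **[K] x s ~= 0[K]} <= {s:S. x s ~= 0[K]}" using c by auto
  then have "finite {s:S. c **[K] x s ~= 0[K]}"
   using x by (auto intro: finite_subset)
  then show "c *[func_space S] x : {F:S \<rightarrow>\<^sub>E Car K. finite {s:S. F s ~= 0[K]}}"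
   using x c by (auto simp: func_space_def cong: conj_cong)
 qed (auto simp: func_space_def cong: conj_cong)
 then show ?thesis unfolding free_space_def by (rule subspace_vs)
qed

lemma free_gen_closed: "s:S ==> free_gen K S s .: frsp K S"
proof -
 assume "s:S"
 have "{t:S. free_gen K S s t ~= 0[K]} <= {s}" by (auto simp: free_gen_def)
 then have "finite {t:S. free_gen K S s t ~= 0[K]}" using finite_subset by blast
 then show ?thesis by (auto simp: frsp_simps free_gen_def)
qed

text \<open>Induction on the size of the support: erasing one point of the support subtracts a
  multiple of one generator.\<close>

lemma free_induct [consumes 1, case_names zero gen]:
 assumes F: "F .: frsp K S"
  and z: "P 0[frsp K S]"
  and g: "!!F s c. [|F .: frsp K S; s:S; c .: K; P F|]
   ==> P (c *[frsp K S] free_gen K S s +[frsp K S] F)"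
 shows "P F"
 using F
proof (induction "card {s:S. F s ~= 0[K]}" arbitrary: F rule: less_induct)
 case less
 have fin: "finite {s:S. F s ~= 0[K]}" and FS: "F:S \<rightarrow>\<^sub>E Car K"
  using less.prems by (auto simp: frsp_simps)
 show ?case
 proof (cases "{s:S. F s ~= 0[K]} = {}")
  case True
  then have "F = 0[frsp K S]" using FS by (auto simp: frsp_simps PiE_def extensional_def)
  then show ?thesis using z by simp
 next
  case False
  then obtain s where s: "s:S" "F s ~= 0[K]" by auto
  define G where "G = F(s := 0[K])"
  have eq: "{t:S. G t ~= 0[K]} = {t:S. F t ~= 0[K]} - {s}" by (auto simp: G_def)
  have Gc: "G .: frsp K S"
   using fin FS s eq by (auto simp: frsp_simps G_def PiE_def extensional_def)
  have "P G"
   by (rule less.hyps[OF _ Gc]) (unfold eq, rule card_Diff1_less[OF fin], use s in simp)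
  moreover have "F = F s *[frsp K S] free_gen K S s +[frsp K S] G"
  proof
   fix t show "F t = (F s *[frsp K S] free_gen K S s +[frsp K S] G) t"
    using FS s by (cases "t:S") (auto simp: frsp_simps free_gen_def G_def PiE_def extensional_def Pi_def)
  qed
  ultimately show ?thesis using g[OF Gc s(1), of "F s"] FS s by auto
 qed
qed

lemma free_lift:
 assumes P: "vsp K P" and bt: "!!s. s:S ==> bt s .: P"
 shows "EX L:Lin K (frsp K S) P. ALL s:S. L (free_gen K S s) = bt s"
proof -
 define L where "L F = Fs P (%s. F s *[P] bt s) {s:S. F s ~= 0[K]}" for F
 \<comment> \<open>The support varies with \<open>F\<close>. Summing over any finite set containing
   it gives the same value, so two functions can be summed over a common set.\<close>
 have ext: "L F = Fs P (%s. F s *[P] bt s) T"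
  if "finite T" "T <= S" "{s:S. F s ~= 0[K]} <= T" "F:S \<rightarrow> Car K" for F T
 proof -
  have "Fs P (%s. F s *[P] bt s) T
   = Fs P (%s. F s *[P] bt s) ({s:S. F s ~= 0[K]} Un (T - {s:S. F s ~= 0[K]}))"
   using that by (simp add: Un_absorb1)
  also have "... = L F +[P] Fs P (%s. F s *[P] bt s) (T - {s:S. F s ~= 0[K]})"
   unfolding L_def using that P bt by (intro vsum_Un) (auto simp: Pi_def intro: finite_subset)
  also have "Fs P (%s. F s *[P] bt s) (T - {s:S. F s ~= 0[K]}) = 0[P]"
   using that P bt by (intro vsum_zero) auto
  finally show ?thesis
   using P bt that vsum_closed[OF P, of "{s:S. F s ~= 0[K]}" "%s. F s *[P] bt s"]
   by (simp add: L_def Pi_def)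
 qed
 have hom: "L:Lin K (frsp K S) P"
 proof (rule homI)
  fix F assume "F .: frsp K S"
  then show "L F .: P" unfolding L_def using P bt
   by (intro vsum_closed) (auto simp: frsp_simps PiE_def Pi_def)
 next
  fix F G assume F: "F .: frsp K S" and G: "G .: frsp K S"
  let ?T = "{s:S. F s ~= 0[K]} Un {s:S. G s ~= 0[K]}"
  have fin: "finite ?T" and F': "F:S \<rightarrow> Car K" and G': "G:S \<rightarrow> Car K"
   using F G by (auto simp: frsp_simps)
  have "L (F +[frsp K S] G) = Fs P (%s. (F +[frsp K S] G) s *[P] bt s) ?T"
   by (rule ext[OF fin]) (use F' G' in "auto simp: frsp_simps")
  also have "... = Fs P (%s. F s *[P] bt s +[P] G s *[P] bt s) ?T"
   using P bt F' G' by (intro vsum_cong) (auto simp: frsp_simps vs_sm_l_distr Pi_def)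
  also have "... = Fs P (%s. F s *[P] bt s) ?T +[P] Fs P (%s. G s *[P] bt s) ?T"
   using P bt F' G' by (intro vsum_add) (auto simp: Pi_def)
  also have "... = L F +[P] L G" using ext[OF fin _ _ F'] ext[OF fin _ _ G'] by auto
  finally show "L (F +[frsp K S] G) = L F +[P] L G" .
 next
  fix c F assume c: "c .: K" and F: "F .: frsp K S"
  let ?T = "{s:S. F s ~= 0[K]}"
  have fin: "finite ?T" and F': "F:S \<rightarrow> Car K"
   using F by (auto simp: frsp_simps)
  have "L (c *[frsp K S] F) = Fs P (%s. (c *[frsp K S] F) s *[P] bt s) ?T"
   by (rule ext[OF fin]) (use F' c in "auto simp: frsp_simps")
  also have "... = Fs P (%s. c *[P] (F s *[P] bt s)) ?T"
   using P bt F' c by (intro vsum_cong) (auto simp: frsp_simps vs_sm_smult Pi_def)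
  also have "... = c *[P] L F" unfolding L_def
   using P bt F' c by (intro vsum_smult) (auto simp: Pi_def)
  finally show "L (c *[frsp K S] F) = c *[P] L F" .
 qed
 have "L (free_gen K S s) = bt s" if "s:S" for s
 proof -
  have "L (free_gen K S s) = Fs P (%t. free_gen K S s t *[P] bt t) {s}"
   by (rule ext) (use that in "auto simp: free_gen_def")
  also have "... = free_gen K S s s *[P] bt s"
   by (rule vsum_single) (use that P bt in "auto simp: free_gen_def")
  also have "... = bt s" using that P bt by (simp add: free_gen_def)
  finally show ?thesis .
 qed
 then show ?thesis using hom by blast
qed

text \<open>The generators whose span is \<open>tensor_rels\<close>, split off so that closure and
  membership can be settled before the span is taken.\<close>

definition ten_gens where
 "ten_gens V W =
  (let S = Car V \<times> Car W; F = frsp K S; e = (%v w. free_gen K S (v, w)) in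
   ({e (v +[V] v') w -[F] (e v w +[F] e v' w) | v v' w.
      v .: V & v' .: V & w .: W}
    Un {e v (w +[W] w') -[F] (e v w +[F] e v w') | v w w'.
      v .: V & w .: W & w' .: W}
    Un {e (c *[V] v) w -[F] (c *[F] e v w) | c v w.
      c .: K & v .: V & w .: W}
    Un {e v (c *[W] w) -[F] (c *[F] e v w) | c v w.
      c .: K & v .: V & w .: W}))"

lemma ten_rels_span:
 "tensor_rels K V W = module.span K (frsp K (Car V \<times> Car W)) (ten_gens V W)"
 unfolding tensor_rels_def ten_gens_def Let_def by simp

lemma ten_gensI:
 fixes V W
 defines "S == Car V \<times> Car W"
 shows "[|v .: V; v' .: V; w .: W|] ==>
   free_gen K S (v +[V] v', w) -[frsp K S] (free_gen K S (v, w) +[frsp K S] free_gen K S (v', w))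
    : ten_gens V W"
  and "[|v .: V; w .: W; w' .: W|] ==>
   free_gen K S (v, w +[W] w') -[frsp K S] (free_gen K S (v, w) +[frsp K S] free_gen K S (v, w'))
    : ten_gens V W"
  and "[|c .: K; v .: V; w .: W|] ==>
   free_gen K S (c *[V] v, w) -[frsp K S] (c *[frsp K S] free_gen K S (v, w)):ten_gens V W"
  and "[|c .: K; v .: V; w .: W|] ==>
   free_gen K S (v, c *[W] w) -[frsp K S] (c *[frsp K S] free_gen K S (v, w)):ten_gens V W"
 unfolding ten_gens_def Let_def S_def
  apply (rule UnI1, rule UnI1, rule UnI1, rule CollectI, intro exI conjI, rule refl, assumption+)
  apply (rule UnI1, rule UnI1, rule UnI2, rule CollectI, intro exI conjI, rule refl, assumption+)
 apply (rule UnI1, rule UnI2, rule CollectI, intro exI conjI, rule refl, assumption+)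
 apply (rule UnI2, rule CollectI, intro exI conjI, rule refl, assumption+)
 done

lemma ten_gens_closed:
 assumes "vsp K V" "vsp K W"
 shows "ten_gens V W <= Car (frsp K (Car V \<times> Car W))"
 unfolding ten_gens_def Let_def using assms frsp_vs
 by (auto intro!: free_gen_closed vs_minus_closed vs_add_closed vs_sm_closed)

lemma ten_rels_subspace:
 assumes "vsp K V" "vsp K W"
 shows "subspace K (tensor_rels K V W) (frsp K (Car V \<times> Car W))"
 unfolding ten_rels_span
 by (rule vectorspace.span_is_subspace[OF frsp_vs ten_gens_closed[OF assms]])

lemma ten_rels_gens:
 assumes "vsp K V" "vsp K W"
 shows "ten_gens V W <= tensor_rels K V W"
 unfolding ten_rels_span
 using module.in_own_span[OF _ ten_gens_closed[OF assms]] frsp_vs vs_iff_module by blast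

lemma ten_vs [simp]:
 assumes "vsp K V" "vsp K W"
 shows "vsp K (ten K V W)"
 unfolding tensor_space_def by (rule quot_vs[OF ten_rels_subspace[OF assms]])

lemma pure_closed [simp]:
 assumes "v .: V" "w .: W"
 shows "pt K V W v w .: ten K V W"
 unfolding tensor_space_def pure_tensor_def quot_carrier using assms by (auto intro: free_gen_closed)

lemma pure_bilin:
 assumes V: "vsp K V" and W: "vsp K W"
 shows "bilin V W (ten K V W) (pt K V W)"
proof -
 let ?S = "Car V \<times> Car W"
 note N = ten_rels_subspace[OF V W] and G = ten_rels_gens[OF V W]
 note gc = free_gen_closed[of _ ?S]
 show ?thesis
 proof (rule bilinI)
  fix v v' w assume *: "v .: V" "v' .: V" "w .: W"
  from ten_gensI(1)[OF this] have "free_gen K ?S (v +[V] v', w) -[frsp K ?S] (free_gen K ?S (v, w) +[frsp K ?S] free_gen K ?S (v', w))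
   : tensor_rels K V W" by (rule subsetD[OF G])
  then show "pt K V W (v +[V] v') w
   = pt K V W v w +[ten K V W] pt K V W v' w"
   unfolding tensor_space_def pure_tensor_def
   using * V W frsp_vs
   by (subst quot_add[OF N], simp add: gc, simp add: gc, intro iffD2[OF coset_eq_iff[OF N]]) (auto intro!: vs_add_closed vs_sm_closed gc)
 next
  fix v w w' assume *: "v .: V" "w .: W" "w' .: W"
  from ten_gensI(2)[OF this] have "free_gen K ?S (v, w +[W] w') -[frsp K ?S] (free_gen K ?S (v, w) +[frsp K ?S] free_gen K ?S (v, w'))
   : tensor_rels K V W" by (rule subsetD[OF G])
  then show "pt K V W v (w +[W] w')
   = pt K V W v w +[ten K V W] pt K V W v w'"
   unfolding tensor_space_def pure_tensor_def
   using * V W frsp_vs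
   by (subst quot_add[OF N], simp add: gc, simp add: gc, intro iffD2[OF coset_eq_iff[OF N]]) (auto intro!: vs_add_closed vs_sm_closed gc)
 next
  fix c v w assume *: "c .: K" "v .: V" "w .: W"
  from ten_gensI(3)[OF this] have "free_gen K ?S (c *[V] v, w) -[frsp K ?S] (c *[frsp K ?S] free_gen K ?S (v, w))
   : tensor_rels K V W" by (rule subsetD[OF G])
  then show "pt K V W (c *[V] v) w = c *[ten K V W] pt K V W v w"
   unfolding tensor_space_def pure_tensor_def
   using * V W frsp_vs
   by (subst quot_smult[OF N], simp, simp add: gc, intro iffD2[OF coset_eq_iff[OF N]]) (auto intro!: vs_add_closed vs_sm_closed gc)
  from ten_gensI(4)[OF *] have "free_gen K ?S (v, c *[W] w) -[frsp K ?S] (c *[frsp K ?S] free_gen K ?S (v, w))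
   : tensor_rels K V W" by (rule subsetD[OF G])
  then show "pt K V W v (c *[W] w) = c *[ten K V W] pt K V W v w"
   unfolding tensor_space_def pure_tensor_def
   using * V W frsp_vs
   by (subst quot_smult[OF N], simp, simp add: gc, intro iffD2[OF coset_eq_iff[OF N]]) (auto intro!: vs_add_closed vs_sm_closed gc)
 qed simp
qed

text \<open>No cases for zero and for scalar multiples are required, because both are absorbed into
  the first factor of a pure tensor.\<close>

lemma ten_induct [consumes 3, case_names pure add]:
 assumes V: "vsp K V" and W: "vsp K W" and t: "t .: ten K V W"
  and pure: "!!v w. [|v .: V; w .: W|] ==> P (pt K V W v w)"
  and add: "!!s t. [|s .: ten K V W; t .: ten K V W; P s; P t|]
   ==> P (s +[ten K V W] t)"
 shows "P t"
proof -
 let ?S = "Car V \<times> Car W"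
 let ?T = "ten K V W"
 let ?N = "tensor_rels K V W"
 note N = ten_rels_subspace[OF V W] and F = frsp_vs[of ?S]
 obtain x where x: "x .: (frsp K ?S)" "t = a_r_coset (frsp K ?S) ?N x"
  using t by (auto simp: tensor_space_def quot_carrier)
 have "P (a_r_coset (frsp K ?S) ?N x)" using x(1)
 proof (induction rule: free_induct)
  case zero
  have "a_r_coset (frsp K ?S) ?N 0[frsp K ?S] = pt K V W (0[K] *[V] 0[V]) 0[W]"
   using V W quot_zero[OF N] by (subst bilinD(6)[OF pure_bilin[OF V W]]) (auto simp: tensor_space_def[symmetric])
  then show ?case using pure V W by simp
 next
  case (gen x s c)
  obtain v w where s: "s = (v, w)" "v .: V" "w .: W" using gen by auto
  have "a_r_coset (frsp K ?S) ?N (c *[frsp K ?S] free_gen K ?S s +[frsp K ?S] x)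
   = c *[?T] pt K V W v w +[?T] a_r_coset (frsp K ?S) ?N x"
   unfolding tensor_space_def pure_tensor_def using gen s F
   by (subst quot_smult[OF N]) (auto simp: free_gen_closed quot_add[OF N])
  also have "c *[?T] pt K V W v w = pt K V W (c *[V] v) w"
   using gen s V W by (simp add: bilinD[OF pure_bilin[OF V W]])
  finally show ?case
   using add[OF pure_closed[of "c *[V] v" V w W] _ pure[of "c *[V] v" w] gen.IH] gen s V
   by (simp add: tensor_space_def quot_carrier)
 qed
 then show ?thesis using x by simp
qed

lemma ten_hom_eqI:
 assumes V: "vsp K V" and W: "vsp K W"
  and S: "S:Lin K (ten K V W) P" and T: "T:Lin K (ten K V W) P"
  and eq: "!!v w. [|v .: V; w .: W|] ==> S (pt K V W v w) = T (pt K V W v w)"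
  and t: "t .: ten K V W"
 shows "S t = T t"
 using V W t by (induction rule: ten_induct) (auto simp: eq hom_add[OF S] hom_add[OF T])

text \<open>Existence comes from the free space. Uniqueness as functions relies on
  \<open>lin_maps\<close> being extensional, and it is what gives the definite description in
  \<open>tensor_lift\<close> a meaning.\<close>

lemma tlift_ex1:
 assumes V: "vsp K V" and W: "vsp K W" and P: "vsp K P"
  and bt: "bilin V W P bt"
 shows "EX! f. f:lin_maps K (ten K V W) P
   & (ALL v:Car V. ALL w:Car W. f (pt K V W v w) = bt v w)"
proof -
 let ?S = "Car V \<times> Car W"
 let ?F = "frsp K ?S"
 note N = ten_rels_subspace[OF V W] and F = frsp_vs[of ?S]
 note gc = free_gen_closed[of _ ?S]
 obtain L where L: "L:Lin K ?F P" "!!s. s:?S ==> L (free_gen K ?S s) = (case s of (v, w) => bt v w)"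
  using free_lift[OF P, of ?S "%(v, w). bt v w"] bilinD(3)[OF bt] by auto
 have gens: "ten_gens V W <= {x:Car ?F. L x = 0[P]}"
 proof
  fix x assume x: "x:ten_gens V W"
  have *: "L (a -[?F] b) = 0[P]" if "a .: ?F" "b .: ?F" "L a = L b" for a b
   using that P by (simp add: hom_minus[OF F P L(1)] hom_cl[OF L(1)])
  have "L x = 0[P]" using x unfolding ten_gens_def Let_def
   using V W F by (auto intro!: * simp: gc L(2) hom_add[OF L(1)] hom_smult[OF L(1)] bilinD[OF bt])
  then show "x : {x:Car ?F. L x = 0[P]}" using x ten_gens_closed[OF V W] by auto
 qed
 have "tensor_rels K V W <= {x:Car ?F. L x = 0[P]}"
  unfolding ten_rels_span
  by (rule module.span_is_subset[OF _ gens])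
   (use kernel_subspace[OF F P L(1)] F in "auto simp: subspace_def vs_iff_module")
 then obtain T where T: "T:Lin K (quot_space ?F (tensor_rels K V W)) P"
  "!!x. x .: ?F ==> T (a_r_coset ?F (tensor_rels K V W) x) = L x"
  using quot_lift[OF N P L(1)] by blast
 let ?f = "restrict T (Car (ten K V W))"
 have f: "?f:lin_maps K (ten K V W) P" "v .: V ==> w .: W ==> ?f (pt K V W v w) = bt v w" for v w
  using T V W by (auto intro!: lm_restrict simp: tensor_space_def[symmetric])
   (simp add: pure_tensor_def T(2) L(2) gc)
 show ?thesis
 proof (rule ex1I[of _ ?f])
  fix g assume g: "g:lin_maps K (ten K V W) P
   & (ALL v:Car V. ALL w:Car W. g (pt K V W v w) = bt v w)"
  show "g = ?f"
   by (rule lm_eqI[of g "ten K V W" P ?f P], use g f in simp, use g f in simp)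
    (rule ten_hom_eqI[OF V W, of _ P], use g f in "auto intro: lm_hom simp del: restrict_apply")
 qed (use f in auto)
qed

lemma tensor_lift:
 assumes "vsp K V" "vsp K W" "vsp K P" "bilin V W P bt"
 shows tlift_lin: "tlift K V W P bt:lin_maps K (ten K V W) P"
  and tlift_pure: "[|v .: V; w .: W|]
   ==> tlift K V W P bt (pt K V W v w) = bt v w"
  and tlift_hom: "tlift K V W P bt:Lin K (ten K V W) P"
proof -
 note * = theI'[OF tlift_ex1[OF assms], folded tensor_lift_def]
 show "tlift K V W P bt:lin_maps K (ten K V W) P" using * by blast
 show "[|v .: V; w .: W|]
   ==> tlift K V W P bt (pt K V W v w) = bt v w" using * by blast
 show "tlift K V W P bt:Lin K (ten K V W) P"
  using * by (blast intro: lm_hom)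
qed

lemma tlift_unique:
 assumes "vsp K V" "vsp K W" "vsp K P" "bilin V W P bt"
  and T: "T:Lin K (ten K V W) P"
  and "!!v w. [|v .: V; w .: W|] ==> T (pt K V W v w) = bt v w"
  and "t .: ten K V W"
 shows "tlift K V W P bt t = T t"
 by (rule ten_hom_eqI[OF assms(1,2) tlift_hom[OF assms(1-4)] T])
  (use assms in "auto simp: tlift_pure")

end

section \<open>Functoriality and associativity of tensor products\<close>

context scalars
begin

lemma tlift_cong:
 assumes "!!v w. v .: V ==> w .: W ==> bt v w = bt' v w"
 shows "tlift K V W P bt = tlift K V W P bt'"
proof -
 have "(ALL v:Car V. ALL w:Car W. f (pt K V W v w) = bt v w)
  \<longleftrightarrow> (ALL v:Car V. ALL w:Car W. f (pt K V W v w) = bt' v w)" for f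
  using assms by auto
 then show ?thesis unfolding tensor_lift_def by simp
qed

lemma pure_hom:
 assumes "vsp K V" "vsp K W"
 shows "v .: V ==> pt K V W v:Lin K W (ten K V W)"
  "w .: W ==> (%v. pt K V W v w):Lin K V (ten K V W)"
 using pure_bilin[OF assms] by (auto simp: bilin_def)

lemma tensor_map:
 assumes V: "vsp K V" and W: "vsp K W" and V': "vsp K V'" and W': "vsp K W'"
  and f: "f:Lin K V V'" and g: "g:Lin K W W'"
 shows tmap_lin: "tmap K V W V' W' f g:lin_maps K (ten K V W) (ten K V' W')"
  and tmap_hom: "tmap K V W V' W' f g:Lin K (ten K V W) (ten K V' W')"
  and tmap_pure: "[|v .: V; w .: W|]
   ==> tmap K V W V' W' f g (pt K V W v w) = pt K V' W' (f v) (g w)"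
proof -
 note b = bilin_comp2[OF pure_bilin[OF V' W'] f g]
 note vs = V W ten_vs[OF V' W'] b
 show "tmap K V W V' W' f g:lin_maps K (ten K V W) (ten K V' W')"
  unfolding tensor_map_def by (rule tlift_lin[OF vs])
 show "tmap K V W V' W' f g:Lin K (ten K V W) (ten K V' W')"
  unfolding tensor_map_def by (rule tlift_hom[OF vs])
 show "[|v .: V; w .: W|]
   ==> tmap K V W V' W' f g (pt K V W v w) = pt K V' W' (f v) (g w)"
  unfolding tensor_map_def by (rule tlift_pure[OF vs])
qed

lemma tmap_cong:
 assumes "!!v. v .: V ==> f v = f' v" "!!w. w .: W ==> g w = g' w"
 shows "tmap K V W V' W' f g = tmap K V W V' W' f' g'"
 unfolding tensor_map_def using assms by (intro tlift_cong) simp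

text \<open>Currying for trilinear maps: since lifts are unique, a bilinear map depending linearly
  on a parameter has a lift depending linearly on it. Associators and products on tensor products
  are obtained by such iterated lifts.\<close>

lemma bilin_lift_left:
 assumes V: "vsp K V" and W: "vsp K W" and P: "vsp K P" and T: "vsp K T"
  and b: "!!p. p .: P ==> bilin V W T (ga p)"
  and h: "!!v w. v .: V ==> w .: W ==> (%p. ga p v w):Lin K P T"
 shows "bilin (ten K V W) P T (%t p. tlift K V W T (ga p) t)"
proof (rule bilin_homI)
 fix t assume t: "t .: ten K V W"
 show "(%p. tlift K V W T (ga p) t):Lin K P T"
 proof (rule homI)
  show "tlift K V W T (ga p) t .: T" if "p .: P" for p
   by (rule hom_cl[OF tlift_hom[OF V W T b[OF that]] t])
 next
  fix p q assume pq: "p .: P" "q .: P"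
  show "tlift K V W T (ga (p +[P] q)) t = tlift K V W T (ga p) t +[T] tlift K V W T (ga q) t"
   by (rule tlift_unique[OF V W T b _ _ t])
    (use pq P in "auto intro!: hom_add_map T tlift_hom[OF V W T b]
      simp: tlift_pure[OF V W T b] hom_add[OF h]")
 next
  fix c p assume pq: "c .: K" "p .: P"
  show "tlift K V W T (ga (c *[P] p)) t = c *[T] tlift K V W T (ga p) t"
   by (rule tlift_unique[OF V W T b _ _ t])
    (use pq P in "auto intro!: hom_smult_map T tlift_hom[OF V W T b]
      simp: tlift_pure[OF V W T b] hom_smult[OF h]")
 qed
qed (rule tlift_hom[OF V W T b])

lemma bilin_flip: "bilin V W P bt ==> bilin W V P (%w v. bt v w)"
 by (auto simp: bilin_def)

lemma bilin_lift_right: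
 assumes V: "vsp K V" and W: "vsp K W" and P: "vsp K P" and T: "vsp K T"
  and b: "!!p. p .: P ==> bilin V W T (ga p)"
  and h: "!!v w. v .: V ==> w .: W ==> (%p. ga p v w):Lin K P T"
 shows "bilin P (ten K V W) T (%p t. tlift K V W T (ga p) t)"
 using bilin_flip[OF bilin_lift_left[OF assms]] .

text \<open>The last clause leaves the first argument an arbitrary tensor. This is the form met in
  coassociativity, where that argument is itself a value of a coaction.\<close>

lemma tensor_assoc:
 assumes V: "vsp K V" and W: "vsp K W" and P: "vsp K P"
 shows ten_assoc_hom: "tensor_assoc K V W P:Lin K (ten K (ten K V W) P)
   (ten K V (ten K W P))"
  and ten_assoc_pure: "[|v .: V; w .: W; p .: P|] ==>
   tensor_assoc K V W P (pt K (ten K V W) P (pt K V W v w) p)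
    = pt K V (ten K W P) v (pt K W P w p)"
  and ten_assoc_pure2: "[|t .: ten K V W; p .: P|] ==>
   tensor_assoc K V W P (pt K (ten K V W) P t p)
    = tmap K V W V (ten K W P) (%v. v) (%w. pt K W P w p) t"
proof -
 let ?WP = "ten K W P"
 let ?T = "ten K V ?WP"
 let ?g = "%p v w. pt K V ?WP v (pt K W P w p)"
 have WP: "vsp K ?WP" and T: "vsp K ?T" using V W P by simp_all
 have b: "bilin V W ?T (?g p)" if "p .: P" for p
  by (rule bilin_comp2[OF pure_bilin[OF V WP] hom_id pure_hom(2)[OF W P that]])
 have h: "(%p. ?g p v w):Lin K P ?T" if "v .: V" "w .: W" for v w
  by (rule hom_comp[OF pure_hom(1)[OF W P that(2)] pure_hom(1)[OF V WP that(1)]])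
 note bl = bilin_lift_left[OF V W P T b h]
 note vs = ten_vs[OF V W] P T bl
 show "tensor_assoc K V W P:Lin K (ten K (ten K V W) P) ?T"
  unfolding tensor_assoc_def Let_def by (rule tlift_hom[OF vs])
 show *: "tensor_assoc K V W P (pt K (ten K V W) P t p)
    = tmap K V W V (ten K W P) (%v. v) (%w. pt K W P w p) t"
  if "t .: ten K V W" "p .: P" for t p
  unfolding tensor_assoc_def Let_def tensor_map_def by (rule tlift_pure[OF vs that])
 show "tensor_assoc K V W P (pt K (ten K V W) P (pt K V W v w) p)
    = pt K V (ten K W P) v (pt K W P w p)"
  if "v .: V" "w .: W" "p .: P" for v w p
  using that V W WP by (simp add: * tmap_pure[OF V W V WP hom_id pure_hom(2)[OF W P]])
qed

text \<open>The construction reads only carrier, addition and scalar multiplication. Modules,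
  algebras and comodules sharing these data thus have literally the same tensor product, not merely
  isomorphic ones.\<close>

lemma ten_space_cong:
 assumes "Car V = Car V'" "add V = add V'" "smult V = smult V'"
  "Car W = Car W'" "add W = add W'" "smult W = smult W'"
 shows "ten K V W = ten K V' W'" "pt K V W = pt K V' W'"
proof -
 have r: "tensor_rels K V W = tensor_rels K V' W'"
  unfolding tensor_rels_def Let_def assms by simp
 show "ten K V W = ten K V' W'" unfolding tensor_space_def r assms ..
 show "pt K V W = pt K V' W'" unfolding pure_tensor_def r assms ..
qed

lemma module_hom_cong:
 assumes "Car V = Car V'" "add V = add V'" "smult V = smult V'"
  "Car W = Car W'" "add W = add W'" "smult W = smult W'"
 shows "Lin K V W = Lin K V' W'" "lin_maps K V W = lin_maps K V' W'"
 unfolding module_hom_def lin_maps_def assms by simp_all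

lemma tlift_space_cong:
 assumes "Car V = Car V'" "add V = add V'" "smult V = smult V'"
  "Car W = Car W'" "add W = add W'" "smult W = smult W'"
  "Car P = Car P'" "add P = add P'" "smult P = smult P'"
 shows "tlift K V W P bt = tlift K V' W' P' bt"
 unfolding tensor_lift_def ten_space_cong[OF assms(1-6)] assms(1,4)
  module_hom_cong(2)[OF refl refl refl assms(7-9)] ..

lemma tmap_space_cong:
 assumes "Car V = Car V'" "add V = add V'" "smult V = smult V'"
  "Car W = Car W'" "add W = add W'" "smult W = smult W'"
  "Car P = Car P'" "add P = add P'" "smult P = smult P'"
  "Car Q = Car Q'" "add Q = add Q'" "smult Q = smult Q'"
 shows "tmap K V W P Q f g = tmap K V' W' P' Q' f g"
 unfolding tensor_map_def ten_space_cong[OF assms(7-12)]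
 by (rule tlift_space_cong) (use assms in simp_all)

lemma vectorspace_cong:
 assumes "vsp K V" "Car V = Car V'" "add V = add V'" "smult V = smult V'" "zero V = zero V'"
 shows "vsp K V'"
 by (rule vs_transport[OF assms(1), of _ "%x. x"]) (use assms in auto)

lemma finsum_cong_space:
 assumes "Car V = Car V'" "add V = add V'" "zero V = zero V'"
 shows "Fs V = Fs V'"
 unfolding finsum_def finprod_def by (intro ext) (simp add: assms)

subsection \<open>Linear functionals and finite families\<close>

lemma subspace_span_one:
 assumes M: "subspace K M V" and x: "x .: V"
 shows "subspace K {m +[V] c *[V] x | m c. m:M & c .: K} V" (is "subspace K ?M V")
proof -
 note V = subD(1)[OF M]
 have MV: "m:M ==> m .: V" for m using subD(2)[OF M] by auto
 show ?thesis
 proof (rule subspace_I[OF V])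
  show "0[V] : ?M"
   using subD(3)[OF M] V x by (intro CollectI exI[of _ "0[V]"] exI[of _ "0[K]"]) auto
 next
  fix a b assume "a:?M" "b:?M"
  then obtain m c n d where *: "m:M" "c .: K" "a = m +[V] c *[V] x"
   "n:M" "d .: K" "b = n +[V] d *[V] x" by auto
  then have "a +[V] b = (m +[V] n) +[V] (c +[K] d) *[V] x"
   using V MV x by (simp add: vs_sm_l_distr vs_add_assoc vs_add_lcomm)
  then show "a +[V] b:?M" using * subD(4)[OF M] by blast
 next
  fix e a assume e: "e .: K" "a:?M"
  then obtain m c where *: "m:M" "c .: K" "a = m +[V] c *[V] x" by auto
  then have "e *[V] a = e *[V] m +[V] (e **[K] c) *[V] x"
   using V MV x e by (simp add: vs_sm_r_distr vs_sm_smult)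
  then show "e *[V] a:?M" using * e subD(5)[OF M] by blast
 qed (use V MV x in auto)
qed

text \<open>Zorn's lemma. Such a maximal \<open>M\<close> is a complement of the line through
  \<open>v\<close>, hence the kernel of a functional, in a space of arbitrary dimension.\<close>

lemma maximal_subspace_avoiding:
 assumes N: "subspace K N V" and v: "v ~: N"
 shows "EX M. subspace K M V & N <= M & v ~: M & (ALL M'. subspace K M' V --> M <= M' --> v ~: M' --> M' = M)"
proof -
 let ?A = "{M. subspace K M V & N <= M & v ~: M}"
 note V = subD(1)[OF N]
 have "EX M:?A. ALL X:?A. M <= X --> X = M"
 proof (rule subset_Zorn_nonempty)
  show "?A ~= {}" using N v by auto
  fix C assume C: "C ~= {}" "subset.chain ?A C"
  have sub: "subspace K M V" "N <= M" "v ~: M" if "M:C" for M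
   using C(2) that by (auto simp: subset_chain_def)
  have tot: "M <= M' | M' <= M" if "M:C" "M':C" for M M'
   using C(2) that by (auto simp: subset_chain_def)
  have "subspace K (\<Union>C) V"
  proof (rule subspace_I[OF V])
   show "\<Union>C <= Car V" by (meson Union_least sub(1) subD(2))
   show "0[V] : \<Union>C" by (metis C(1) UnionI all_not_in_conv sub(1) subD(3))
  next
   fix x y assume "x : \<Union>C" "y : \<Union>C"
   then obtain M M' where "M:C" "x:M" "M':C" "y:M'" by auto
   then obtain M'' where "M'':C" "x:M''" "y:M''" using tot by blast
   then show "x +[V] y : \<Union>C" by (meson UnionI sub(1) subD(4))
  next
   fix c x assume "c .: K" "x : \<Union>C"
   then show "c *[V] x : \<Union>C" by (meson UnionE UnionI sub(1) subD(5))
  qed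
  then show "\<Union>C:?A" using C(1) sub by blast
 qed
 then obtain M where "M:?A" "ALL X:?A. M <= X --> X = M" by blast
 then show ?thesis by (intro exI[of _ M]) auto
qed

lemma functional_separates:
 assumes N: "subspace K N V" and v: "v .: V" "v ~: N"
 shows "EX phi:Lin K V (ssp K). phi v = 1[K] & (ALL x:N. phi x = 0[K])"
proof -
 obtain M where M: "subspace K M V" "N <= M" "v ~: M"
  and max: "!!M'. subspace K M' V ==> M <= M' ==> v ~: M' ==> M' = M"
  using maximal_subspace_avoiding[OF N v(2)] by blast
 note V = subD(1)[OF M(1)]
 have MV: "m:M ==> m .: V" for m using subD(2)[OF M(1)] by auto
 have ex: "EX c m. c .: K & m:M & x = m +[V] c *[V] v" if x: "x .: V" for x
 proof (cases "x:M")
  case True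
  then show ?thesis using v V MV by (intro exI[of _ "0[K]"] exI[of _ x]) auto
 next
  case False
  let ?M = "{m +[V] c *[V] x | m c. m:M & c .: K}"
  have "M <= ?M"
  proof
   fix m assume "m:M"
   then show "m:?M" using V MV x by (intro CollectI exI[of _ m] exI[of _ "0[K]"]) auto
  qed
  moreover have "x:?M"
   using V x subD(3)[OF M(1)] by (intro CollectI exI[of _ "0[V]"] exI[of _ "1[K]"]) auto
  \<comment> \<open>By maximality the span of \<open>M\<close> and \<open>x\<close> must contain
    \<open>v\<close>; the coefficient of \<open>x\<close> is then nonzero and the relation can be
    solved for \<open>x\<close>.\<close>
  ultimately have "v:?M" using max[OF subspace_span_one[OF M(1) x]] False by blast
  then obtain m c where mc: "m:M" "c .: K" "v = m +[V] c *[V] x" by auto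
  have c0: "c ~= 0[K]" using mc M(3) V MV x by auto
  let ?d = "inv\<^bsub>K\<^esub> c"
  have d: "?d .: K" "?d **[K] c = 1[K]" using c0 mc field_Units by auto
  have "?d *[V] v = ?d *[V] m +[V] x"
   using mc d V MV x by (simp add: vs_sm_r_distr vs_sm_smult)
  then have "x = -[V] (?d *[V] m) +[V] ?d *[V] v"
   using d mc V MV x by (simp add: vs_add_assoc[symmetric])
  moreover have "-[V] (?d *[V] m):M" using subD(5,6)[OF M(1)] d mc by blast
  ultimately show ?thesis using d by blast
 qed
 have uniq: "c = d" if "c .: K" "d .: K" "m:M" "n:M"
  "m +[V] c *[V] v = n +[V] d *[V] v" for c d m n
 proof (rule ccontr)
  assume "c ~= d"
  let ?e = "c -[K] d"
  have e: "?e .: K" "?e ~= 0[K]" using that `c \<noteq> d` by auto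
  have "n = m +[V] (c *[V] v +[V] -[V] (d *[V] v))"
   using that V MV v by (metis (no_types, lifting) vs_add_assoc vs_neg_closed vs_r_neg vs_r_zero vs_sm_closed)
  also have "c *[V] v +[V] -[V] (d *[V] v) = ?e *[V] v"
   using that V v by (simp add: a_minus_def vs_sm_l_distr vs_sm_neg)
  finally have "?e *[V] v = n -[V] m"
   using that V MV v e by (simp add: a_minus_def vs_add_comm vs_add_assoc[symmetric])
  then have "?e *[V] v:M" using that subD(7)[OF M(1)] by simp
  then have "inv\<^bsub>K\<^esub> ?e *[V] (?e *[V] v):M" using subD(5)[OF M(1)] e by simp
  moreover have "inv\<^bsub>K\<^esub> ?e **[K] ?e = 1[K]" using e field_Units by auto
  ultimately show False using M(3) e V v by (simp add: vs_sm_smult)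
 qed
 define phi where "phi x = (THE c. c .: K & (EX m:M. x = m +[V] c *[V] v))" for x
 have phi: "phi (m +[V] c *[V] v) = c" if "m:M" "c .: K" for m c
  unfolding phi_def by (rule the_equality) (use that uniq in auto)
 have "phi:Lin K V (ssp K)"
 proof (rule homI)
  fix x assume "x .: V"
  then show "phi x .: ssp K" using ex[of x] phi by auto
 next
  fix x y assume "x .: V" "y .: V"
  then obtain c m d n where *: "c .: K" "m:M" "x = m +[V] c *[V] v"
   "d .: K" "n:M" "y = n +[V] d *[V] v" using ex[of x] ex[of y] by auto
  then have "x +[V] y = (m +[V] n) +[V] (c +[K] d) *[V] v"
   using V MV v by (simp add: vs_sm_l_distr vs_add_assoc vs_add_lcomm)
  then show "phi (x +[V] y) = phi x +[ssp K] phi y"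
   using * phi subD(4)[OF M(1)] by simp
 next
  fix e x assume e: "e .: K" "x .: V"
  then obtain c m where *: "c .: K" "m:M" "x = m +[V] c *[V] v" using ex[of x] by auto
  then have "e *[V] x = e *[V] m +[V] (e **[K] c) *[V] v"
   using V MV v e by (simp add: vs_sm_r_distr vs_sm_smult)
  then show "phi (e *[V] x) = e *[ssp K] phi x"
   using * e phi subD(5)[OF M(1)] by simp
 qed
 moreover have "phi v = 1[K]" using phi[of "0[V]" "1[K]"] subD(3)[OF M(1)] V v by simp
 moreover have "phi x = 0[K]" if "x:N" for x
  using phi[of x "0[K]"] that M(2) MV V v by (simp add: subset_iff)
 ultimately show ?thesis by blast
qed

text \<open>Indexed families are used instead of sets, since images under linear maps and classes in
  an ultraproduct keep the index set even where values might coincide.\<close>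

definition indep where
 "indep V I e \<longleftrightarrow> finite I & (ALL i:I. e i .: V)
  & (ALL c. (ALL i:I. c i .: K) --> Fs V (%i. c i *[V] e i) I = 0[V] --> (ALL i:I. c i = 0[K]))"

definition dual_fam where
 "dual_fam V I e phi \<longleftrightarrow> finite I & (ALL i:I. e i .: V)
  & (ALL i:I. phi i:Lin K V (ssp K))
  & (ALL i:I. ALL j:I. phi i (e j) = (if i = j then 1[K] else 0[K]))"

text \<open>A finite basis together with its coordinate functionals. Carrying the functionals turns
  expansion of a vector into an equation, which passes to ultraproducts componentwise.\<close>

definition dbasis where
 "dbasis V I e phi \<longleftrightarrow> dual_fam V I e phi & (ALL v:Car V. v = Fs V (%i. phi i v *[V] e i) I)"

lemma indepD:
 assumes "indep V I e"
 shows "finite I" "i:I ==> e i .: V"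
  "[|!!i. i:I ==> c i .: K; Fs V (%i. c i *[V] e i) I = 0[V]; i:I|] ==> c i = 0[K]"
 using assms unfolding indep_def by blast+

lemma dual_famD:
 assumes "dual_fam V I e phi"
 shows "finite I" "i:I ==> e i .: V" "i:I ==> phi i:Lin K V (ssp K)"
  "i:I ==> j:I ==> phi i (e j) = (if i = j then 1[K] else 0[K])"
  "i:I ==> v .: V ==> phi i v .: K"
 using assms unfolding dual_fam_def using hom_cl[of "phi i" V "ssp K" v] by auto

lemma dual_fam_coeff:
 assumes V: "vsp K V" and d: "dual_fam V I e phi" and i: "i:I"
  and c: "!!j. j:I ==> c j .: K"
 shows "phi i (Fs V (%j. c j *[V] e j) I) = c i"
proof -
 have "phi i (Fs V (%j. c j *[V] e j) I)
  = Fs (ssp K) (%j. phi i (c j *[V] e j)) I"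
  using d c V dual_famD(2)[OF d] by (intro hom_sum[OF V _ dual_famD(3)[OF d i]]) auto
 also have "... = Fs (ssp K) (%j. (if j = i then 1[K] else 0[K]) *[ssp K] c j) I"
  using dual_famD(2,4)[OF d] c i
  by (intro vsum_cong) (auto simp: hom_smult[OF dual_famD(3)[OF d i]])
 also have "... = c i" by (rule vsum_delta(1)) (use dual_famD(1)[OF d] i c in auto)
 finally show ?thesis .
qed

lemma dual_fam_indep:
 assumes V: "vsp K V" and d: "dual_fam V I e phi"
 shows "indep V I e"
 unfolding indep_def
proof (intro conjI allI impI ballI)
 fix c i assume c: "ALL i:I. c i .: K" "Fs V (%i. c i *[V] e i) I = 0[V]" "i:I"
 then have "phi i 0[V] = c i" using dual_fam_coeff[OF V d, of i c] by simp
 then show "c i = 0[K]" using hom_zero[OF V vs_ssp dual_famD(3)[OF d c(3)]] by simp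
qed (use dual_famD[OF d] in auto)

lemma span_subspace:
 assumes V: "vsp K V" and "finite I" and e: "!!i. i:I ==> e i .: V"
 shows "subspace K {Fs V (%i. c i *[V] e i) I | c. ALL i:I. c i .: K} V"
proof (rule subspace_I[OF V])
 show "{Fs V (%i. c i *[V] e i) I | c. ALL i:I. c i .: K} <= Car V"
  using V e by (auto intro!: vsum_closed)
 show "0[V] : {Fs V (%i. c i *[V] e i) I | c. ALL i:I. c i .: K}"
  using V e by (intro CollectI exI[of _ "%_. 0[K]"]) (auto intro!: vsum_zero[symmetric])
next
 fix x y assume "x : {Fs V (%i. c i *[V] e i) I | c. ALL i:I. c i .: K}"
  "y : {Fs V (%i. c i *[V] e i) I | c. ALL i:I. c i .: K}"
 then obtain c d where *: "ALL i:I. c i .: K" "x = Fs V (%i. c i *[V] e i) I"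
  "ALL i:I. d i .: K" "y = Fs V (%i. d i *[V] e i) I" by auto
 have "x +[V] y = Fs V (%i. c i *[V] e i +[V] d i *[V] e i) I"
  using * V e by (simp add: vsum_add)
 also have "... = Fs V (%i. (c i +[K] d i) *[V] e i) I"
  using * V e by (intro vsum_cong) (auto simp: vs_sm_l_distr)
 finally show "x +[V] y : {Fs V (%i. c i *[V] e i) I | c. ALL i:I. c i .: K}"
  using * by (intro CollectI exI[of _ "%i. c i +[K] d i"]) auto
next
 fix r x assume r: "r .: K" and "x : {Fs V (%i. c i *[V] e i) I | c. ALL i:I. c i .: K}"
 then obtain c where *: "ALL i:I. c i .: K" "x = Fs V (%i. c i *[V] e i) I" by auto
 have "r *[V] x = Fs V (%i. r *[V] (c i *[V] e i)) I"
  using * V e r by (simp add: vsum_smult)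
 also have "... = Fs V (%i. (r **[K] c i) *[V] e i) I"
  using * V e r by (intro vsum_cong) (auto simp: vs_sm_smult)
 finally show "r *[V] x : {Fs V (%i. c i *[V] e i) I | c. ALL i:I. c i .: K}"
  using * r by (intro CollectI exI[of _ "%i. r **[K] c i"]) auto
qed

lemma span_gen:
 assumes V: "vsp K V" and "finite I" and e: "!!i. i:I ==> e i .: V" and j: "j:I"
 shows "e j : {Fs V (%i. c i *[V] e i) I | c. ALL i:I. c i .: K}"
 using vsum_delta(1)[OF V `finite I` j e]
 by (intro CollectI exI[of _ "%i. if i = j then 1[K] else 0[K]"]) auto

text \<open>The functional belonging to \<open>i\<close> is one that separates \<open>e i\<close>
  from the span of the remaining vectors. The ambient space may be infinite-dimensional, as it is
  when elements of a Hopf algebra are compared.\<close>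

lemma indep_dual:
 assumes V: "vsp K V" and i: "indep V I e"
 shows "EX phi. dual_fam V I e phi"
proof -
 have "EX phi:Lin K V (ssp K). ALL j:I. phi (e j) = (if i = j then 1[K] else 0[K])"
  if iI: "i:I" for i
 proof -
  let ?I = "I - {i}"
  let ?N = "{Fs V (%j. c j *[V] e j) ?I | c. ALL j:?I. c j .: K}"
  have fin: "finite ?I" and e: "!!j. j:?I ==> e j .: V" using indepD(1,2)[OF i] by auto
  have "e i ~: ?N"
  proof
   assume "e i:?N"
   then obtain c where c: "ALL j:?I. c j .: K" "e i = Fs V (%j. c j *[V] e j) ?I" by auto
   let ?c = "c(i := -[K] 1[K])"
   have "Fs V (%j. ?c j *[V] e j) I = ?c i *[V] e i +[V] Fs V (%j. ?c j *[V] e j) ?I"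
    using indepD(1,2)[OF i] iI c V by (intro vsum_remove) auto
   also have "Fs V (%j. ?c j *[V] e j) ?I = e i"
    unfolding c(2) using c(1) e V by (intro vsum_cong) auto
   also have "?c i *[V] e i +[V] e i = 0[V]"
    using V indepD(2)[OF i iI] by (simp add: vs_neg_smult[symmetric])
   finally have "?c i = 0[K]"
    by (intro indepD(3)[OF i _ _ iI]) (use c in auto)
   then show False by simp
  qed
  then obtain phi where phi: "phi:Lin K V (ssp K)" "phi (e i) = 1[K]" "!!x. x:?N ==> phi x = 0[K]"
   using functional_separates[OF span_subspace[where e=e, OF V fin e] indepD(2)[OF i iI]] by blast
  have "phi (e j) = 0[K]" if "j:I" "j ~= i" for j
   by (rule phi(3)) (rule span_gen[where e=e, OF V fin e], use that in auto)
  then show ?thesis using phi by (intro bexI[of _ phi]) auto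
 qed
 then obtain phi where "ALL i:I. phi i:Lin K V (ssp K) & (ALL j:I. phi i (e j) = (if i = j then 1[K] else 0[K]))"
  by metis
 then have "dual_fam V I e phi" using i unfolding dual_fam_def indep_def by auto
 then show ?thesis by blast
qed

lemma dbD:
 assumes "dbasis V I e phi"
 shows "dual_fam V I e phi" "finite I" "i:I ==> e i .: V" "i:I ==> phi i:Lin K V (ssp K)"
  "i:I ==> j:I ==> phi i (e j) = (if i = j then 1[K] else 0[K])"
  "i:I ==> v .: V ==> phi i v .: K"
  "v .: V ==> Fs V (%i. phi i v *[V] e i) I = v"
 using assms dual_famD[of V I e phi] unfolding dbasis_def by auto

lemma dbasis_indep: "vsp K V ==> dbasis V I e phi ==> indep V I e"
 using dual_fam_indep dbD(1) by blast

lemma dbasisI: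
 assumes V: "vsp K V" and i: "indep V I e"
  and s: "!!v. v .: V ==> EX c. (ALL i:I. c i .: K) & v = Fs V (%i. c i *[V] e i) I"
 shows "EX phi. dbasis V I e phi"
proof -
 obtain phi where phi: "dual_fam V I e phi" using indep_dual[OF V i] by blast
 have "v = Fs V (%i. phi i v *[V] e i) I" if v: "v .: V" for v
 proof -
  obtain c where c: "ALL i:I. c i .: K" "v = Fs V (%i. c i *[V] e i) I" using s[OF v] by blast
  have "Fs V (%i. phi i v *[V] e i) I = Fs V (%i. c i *[V] e i) I"
   by (rule vsum_cong[OF V refl])
    (use c dual_fam_coeff[OF V phi] V dual_famD(2)[OF phi] in auto)
  then show ?thesis using c by simp
 qed
 then show ?thesis using phi unfolding dbasis_def by blast
qed

lemma dbasis_hom_ex: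
 assumes V: "vsp K V" and W: "vsp K W" and b: "dbasis V I e phi"
  and w: "!!i. i:I ==> w i .: W"
 shows "EX T:Lin K V W. ALL i:I. T (e i) = w i"
proof
 show "(%v. Fs W (%i. phi i v *[W] w i) I):Lin K V W"
  using dbD[OF b] w by (intro hom_sum_map V W hom_smult_l) auto
 show "ALL j:I. Fs W (%i. phi i (e j) *[W] w i) I = w j"
 proof
  fix j assume j: "j:I"
  have "Fs W (%i. phi i (e j) *[W] w i) I = Fs W (%i. (if i = j then 1[K] else 0[K]) *[W] w i) I"
   using dbD[OF b] j w W by (intro vsum_cong) auto
  then show "Fs W (%i. phi i (e j) *[W] w i) I = w j"
   using vsum_delta(1)[OF W dbD(2)[OF b] j w] by simp
 qed
qed

lemma dbasis_hom_eqI: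
 assumes V: "vsp K V" and W: "vsp K W" and b: "dbasis V I e phi"
  and S: "S:Lin K V W" and T: "T:Lin K V W"
  and eq: "!!i. i:I ==> S (e i) = T (e i)" and v: "v .: V"
 shows "S v = T v"
proof -
 have "R v = Fs W (%i. phi i v *[W] R (e i)) I" if R: "R:Lin K V W" for R
 proof -
  have "R (Fs V (%i. phi i v *[V] e i) I) = Fs W (%i. R (phi i v *[V] e i)) I"
   using dbD[OF b] v V by (intro hom_sum[OF V W R]) auto
  also have "... = Fs W (%i. phi i v *[W] R (e i)) I"
   using dbD[OF b] v W by (intro vsum_cong) (auto simp: hom_smult[OF R] hom_cl[OF R])
  finally show ?thesis using dbD(7)[OF b v] by simp
 qed
 then have "S v = Fs W (%i. phi i v *[W] S (e i)) I" "T v = Fs W (%i. phi i v *[W] T (e i)) I"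
  using S T by blast+
 moreover have "Fs W (%i. phi i v *[W] S (e i)) I = Fs W (%i. phi i v *[W] T (e i)) I"
  using dbD[OF b] v W eq by (intro vsum_cong) (auto simp: hom_cl[OF T])
 ultimately show ?thesis by simp
qed

lemma dbasis_reindex:
 assumes V: "vsp K V" and b: "dbasis V I e phi" and h: "bij_betw h J I"
 shows "dbasis V J (%j. e (h j)) (%j. phi (h j))"
proof -
 have fin: "finite J" using dbD(2)[OF b] h bij_betw_finite by blast
 have hJ: "j:J ==> h j:I" and inj: "inj_on h J" and im: "h ` J = I" for j using h by (auto simp: bij_betw_def)
 have "v = Fs V (%j. phi (h j) v *[V] e (h j)) J" if "v .: V" for v
  using vsum_reindex[OF V inj, of "%i. phi i v *[V] e i"] dbD[OF b] hJ V that by (auto simp: im)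
 then show ?thesis unfolding dbasis_def dual_fam_def
  using fin dbD[OF b] hJ inj by (auto simp: inj_on_def)
qed

lemma indep_inj: "vsp K V ==> indep V I e ==> inj_on e I"
proof (rule inj_onI)
 fix i j assume V: "vsp K V" and ie: "indep V I e" and ij: "i:I" "j:I" "e i = e j"
 obtain phi where "dual_fam V I e phi" using indep_dual[OF V ie] by blast
 then have "phi i (e i) = 1[K]" "phi i (e j) = (if i = j then 1[K] else 0[K])" using dual_famD(4) ij by fastforce+
 then show "i = j" using ij by (metis zero_not_one)
qed

lemma lincomb_image:
 assumes V: "vsp K V" and e: "!!i. i:I ==> e i .: V" and inj: "inj_on e I"
  and c: "!!x. x:e ` I ==> c x .: K"
 shows "module.lincomb V c (e ` I) = Fs V (%i. c (e i) *[V] e i) I"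
proof -
 interpret V: vectorspace K V by fact
 show ?thesis unfolding V.lincomb_def using assms by (subst vsum_reindex) auto
qed

lemma indep_lin_indpt:
 assumes V: "vsp K V" and i: "indep V I e"
 shows "~ module.lin_dep K V (e ` I)"
proof -
 interpret V: vectorspace K V by fact
 show ?thesis
 proof (rule V.finite_lin_indpt2)
  fix a assume a: "a:e ` I \<rightarrow> Car K" "V.lincomb a (e ` I) = 0[V]"
  then have "Fs V (%i. a (e i) *[V] e i) I = 0[V]"
   using lincomb_image[OF V, of I e a] indepD(2)[OF i] indep_inj[OF V i] by (auto simp: Pi_def)
  then show "ALL v:e ` I. a v = 0[K]" using indepD(3)[OF i, of "%i. a (e i)"] a by (auto simp: Pi_def)
 qed (use indepD[OF i] in auto)
qed

lemma dbasis_dim: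
 assumes V: "vsp K V" and b: "dbasis V I e phi"
 shows "vectorspace.fin_dim K V" "vdim K V = card I"
proof -
 interpret V: vectorspace K V by fact
 note ie = dbasis_indep[OF V b]
 have inj: "inj_on e I" by (rule indep_inj[OF V ie])
 have sub: "e ` I <= Car V" using dbD(3)[OF b] by auto
 have "v:V.span (e ` I)" if v: "v .: V" for v
 proof -
  let ?a = "%x. phi (the_inv_into I e x) v"
  have "V.lincomb ?a (e ` I) = Fs V (%i. ?a (e i) *[V] e i) I"
   using dbD(3,6)[OF b] v by (intro lincomb_image[OF V _ inj]) (auto simp: the_inv_into_f_f[OF inj])
  also have "... = Fs V (%i. phi i v *[V] e i) I"
   using dbD(3,6)[OF b] v V by (intro vsum_cong) (auto simp: the_inv_into_f_f[OF inj])
  finally have "V.lincomb ?a (e ` I) = v" using dbD(7)[OF b v] by simp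
  moreover have "?a:e ` I \<rightarrow> Car K" using dbD(6)[OF b] v by (auto simp: the_inv_into_f_f[OF inj])
  ultimately show ?thesis unfolding V.span_def using dbD(2)[OF b]
   by (intro CollectI exI[of _ ?a] exI[of _ "e ` I"]) auto
 qed
 then have gen: "V.span (e ` I) = Car V" using V.span_is_subset2[OF sub] by auto
 have bas: "V.basis (e ` I)" unfolding V.basis_def using gen sub indep_lin_indpt[OF V ie] by auto
 show "V.fin_dim" unfolding V.fin_dim_def using gen sub dbD(2)[OF b] by blast
 show "V.dim = card I" using V.dim_basis[OF _ bas] dbD(2)[OF b] card_image[OF inj] by simp
qed

lemma dbasis_ex:
 assumes V: "vsp K V" and fd: "vectorspace.fin_dim K V"
 shows "EX e phi. dbasis V {..<vdim K V} e phi"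
proof -
 interpret V: vectorspace K V by fact
 obtain B where B: "finite B" "V.basis B" using V.finite_basis_exists[OF fd] by blast
 have d: "V.dim = card B" by (rule V.dim_basis[OF B])
 have sub: "B <= Car V" and li: "~ V.lin_dep B" and gen: "V.span B = Car V"
  using B by (auto simp: V.basis_def)
 have "indep V B (%x. x)" unfolding indep_def
 proof (intro conjI allI impI ballI)
  fix c i assume c: "ALL i:B. c i .: K" "Fs V (%i. c i *[V] i) B = 0[V]" "i:B"
  show "c i = 0[K]"
  proof (rule ccontr)
   assume "c i ~= 0[K]"
   then have "V.lin_dep B" using V.lin_dep_crit[OF B(1), of B c i] c by (auto simp: V.lincomb_def)
   then show False using li by simp
  qed
 qed (use B sub in auto)
 then have "EX phi. dbasis V B (%x. x) phi"
 proof (rule dbasisI[OF V])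
  fix v assume "v .: V"
  then obtain a where "a:B \<rightarrow> Car K" "V.lincomb a B = v"
   using V.finite_in_span[OF B(1) sub] gen by auto
  then show "EX c. (ALL i:B. c i .: K) & v = Fs V (%i. c i *[V] i) B"
   by (intro exI[of _ a]) (auto simp: V.lincomb_def)
 qed
 then obtain phi where phi: "dbasis V B (%x. x) phi" ..
 obtain h where "bij_betw h {..<card B} B" using B(1) ex_bij_betw_nat_finite[of B] by (auto simp: atLeast0LessThan)
 from dbasis_reindex[OF V phi this] show ?thesis unfolding d by blast
qed

text \<open>Take an independent subfamily that is maximal under inclusion. If some
  \<open>g j\<close> lay outside its span, a functional separating it from the span would show that
  \<open>j\<close> can be added.\<close>

lemma maximal_indep_subfamily:
 assumes V: "vsp K V" and "finite J" and g: "!!j. j:J ==> g j .: V"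
 shows "EX I<=J. indep V I g &
  (ALL j:J. EX c. (ALL i:I. c i .: K) & g j = Fs V (%i. c i *[V] g i) I)"
proof -
 let ?S = "{I. I <= J & indep V I g}"
 have "finite ?S" using `finite J` by simp
 moreover have "{} : ?S" by (simp add: indep_def)
 ultimately obtain I where I: "I:?S" "ALL X:?S. I <= X --> I = X"
  using finite_has_maximal[of ?S] by (metis (no_types, lifting) empty_iff)
 then have IJ: "I <= J" and ind: "indep V I g" by auto
 have fin: "finite I" and gI: "!!i. i:I ==> g i .: V" using indepD[OF ind] by auto
 let ?N = "{Fs V (%i. c i *[V] g i) I | c. ALL i:I. c i .: K}"
 have "g j:?N" if j: "j:J" for j
 proof (rule ccontr)
  assume n: "g j ~: ?N"
  then have jI: "j ~: I" using span_gen[where e=g, OF V fin gI] by blast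
  obtain phi where phi: "phi:Lin K V (ssp K)" "phi (g j) = 1[K]" "!!x. x:?N ==> phi x = 0[K]"
   using functional_separates[OF span_subspace[where e=g, OF V fin gI] g[OF j] n] by blast
  have "indep V (insert j I) g" unfolding indep_def
  proof (intro conjI allI impI)
   fix c assume c: "ALL i:insert j I. c i .: K" and s: "Fs V (%i. c i *[V] g i) (insert j I) = 0[V]"
   have s': "c j *[V] g j +[V] Fs V (%i. c i *[V] g i) I = 0[V]"
    using s c V g[OF j] gI fin jI by (subst (asm) vsum_insert) auto
   have cl: "Fs V (%i. c i *[V] g i) I .: V" "Fs V (%i. c i *[V] g i) I:?N"
    using c gI V by (auto intro!: vsum_closed)
   have "phi (c j *[V] g j +[V] Fs V (%i. c i *[V] g i) I) = c j"
    using c cl V g[OF j] phi(2) phi(3)[OF cl(2)] by (simp add: hom_add[OF phi(1)] hom_smult[OF phi(1)])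
   then have cj: "c j = 0[K]" using s' hom_zero[OF V _ phi(1)] by simp
   then have "Fs V (%i. c i *[V] g i) I = 0[V]" using s' cl V g[OF j] by simp
   then show "ALL i:insert j I. c i = 0[K]" using indepD(3)[OF ind] c cj by auto
  qed (use fin gI g[OF j] in auto)
  then show False using I(2) IJ j jI by blast
 qed
 then have "ALL j:J. EX c. (ALL i:I. c i .: K) & g j = Fs V (%i. c i *[V] g i) I" by blast
 with IJ ind show ?thesis by (intro exI[of _ I] conjI)
qed

lemma spanning_dbasis:
 assumes V: "vsp K V" and "finite J" and g: "!!j. j:J ==> g j .: V"
  and s: "!!v. v .: V ==> EX c. (ALL j:J. c j .: K) & v = Fs V (%j. c j *[V] g j) J"
 shows "EX I<=J. EX phi. dbasis V I g phi"
proof -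
 have "EX I<=J. indep V I g &
   (ALL j:J. EX c. (ALL i:I. c i .: K) & g j = Fs V (%i. c i *[V] g i) I)"
  by (rule maximal_indep_subfamily[OF V `finite J`]) (rule g)
 then obtain I where I: "I <= J" "indep V I g"
  and r: "ALL j:J. EX c. (ALL i:I. c i .: K) & g j = Fs V (%i. c i *[V] g i) I"
  by (elim exE conjE) (rule that)
 let ?N = "{Fs V (%i. c i *[V] g i) I | c. ALL i:I. c i .: K}"
 have sub: "subspace K ?N V" by (rule span_subspace[OF V]) (use indepD[OF I(2)] in auto)
 have gN: "g j:?N" if "j:J" for j using bspec[OF r that] by blast
 have "v:?N" if v: "v .: V" for v
 proof -
  obtain c where c: "ALL j:J. c j .: K" "v = Fs V (%j. c j *[V] g j) J" using s[OF v] by blast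
  have "Fs V (%j. c j *[V] g j) J':?N" if "J' <= J" for J'
   using finite_subset[OF that `finite J`] that
  proof (induction J')
   case empty
   then show ?case using subD(3)[OF sub] V by simp
  next
   case (insert j J')
   then have "Fs V (%j. c j *[V] g j) (insert j J')
    = c j *[V] g j +[V] Fs V (%j. c j *[V] g j) J'"
    using V c g by (intro vsum_insert) auto
   moreover have "c j *[V] g j:?N" using subD(5)[OF sub _ gN, of "c j" j] insert c by blast
   ultimately show ?case using insert subD(4)[OF sub] by auto
  qed
  from this[of J] show ?thesis using c by simp
 qed
 then have "EX phi. dbasis V I g phi" by (intro dbasisI[OF V I(2)]) auto
 then show ?thesis using I by blast
qed

lemma iso_ex:
 assumes V: "vsp K V" and W: "vsp K W" and fV: "dbasis V I e phi" and fW: "dbasis W J f ps"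
  and eq: "card I = card J"
 shows "EX T. T:lin_isos K V W"
proof -
 obtain h where h: "bij_betw h I J" using eq dbD(2)[OF fV] dbD(2)[OF fW] by (metis finite_same_card_bij)
 note fW' = dbasis_reindex[OF W fW h]
 obtain T where T: "T:Lin K V W" "ALL i:I. T (e i) = f (h i)"
  using dbasis_hom_ex[OF V W fV, of "%i. f (h i)"] dbD(3)[OF fW'] by blast
 obtain S where S: "S:Lin K W V" "ALL i:I. S (f (h i)) = e i"
  using dbasis_hom_ex[OF W V fW', of e] dbD(3)[OF fV] by blast
 have ST: "S (T x) = x" if "x .: V" for x
  by (rule dbasis_hom_eqI[OF V V fV hom_comp[OF T(1) S(1)] hom_id _ that]) (use S T in auto)
 have TS: "T (S x) = x" if "x .: W" for x
  by (rule dbasis_hom_eqI[OF W W fW' hom_comp[OF S(1) T(1)] hom_id _ that]) (use S T in auto)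
 have "bij_betw (restrict T (Car V)) (Car V) (Car W)"
  by (rule bij_betw_byWitness[of _ S]) (use ST TS hom_cl[OF T(1)] hom_cl[OF S(1)] in auto)
 then show ?thesis using lm_restrict[OF V T(1)] by (auto simp: lin_isos_def)
qed

lemma iso_dbasis:
 assumes V: "vsp K V" and W: "vsp K W" and b: "dbasis V I e phi"
  and T: "T:Lin K V W" and bij: "bij_betw T (Car V) (Car W)"
 shows "dbasis W I (%i. T (e i)) (%i x. phi i (inv_into (Car V) T x))"
proof -
 let ?S = "inv_into (Car V) T"
 note S = hom_inv[OF V T bij]
 have ST: "?S (T x) = x" if "x .: V" for x using that bij by (simp add: bij_betw_inv_into_left)
 have TS: "T (?S y) = y" if "y .: W" for y using that bij by (simp add: bij_betw_inv_into_right)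
 have "y = Fs W (%i. phi i (?S y) *[W] T (e i)) I" if y: "y .: W" for y
 proof -
  have Sy: "?S y .: V" by (rule hom_cl[OF S y])
  have "T (Fs V (%i. phi i (?S y) *[V] e i) I) = Fs W (%i. T (phi i (?S y) *[V] e i)) I"
   using dbD[OF b] Sy V by (intro hom_sum[OF V W T]) auto
  also have "... = Fs W (%i. phi i (?S y) *[W] T (e i)) I"
   using dbD[OF b] Sy W by (intro vsum_cong) (auto simp: hom_smult[OF T] hom_cl[OF T])
  finally show ?thesis using dbD(7)[OF b Sy] TS[OF y] by simp
 qed
 moreover have "(%x. phi i (?S x)):Lin K W (ssp K)" if "i:I" for i
  using hom_comp[OF S dbD(4)[OF b that]] .
 ultimately show ?thesis unfolding dbasis_def dual_fam_def
  using dbD[OF b] by (auto simp: hom_cl[OF T] ST)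
qed

subsection \<open>Expansions in tensor products\<close>

text \<open>The map \<open>f \<otimes> 1\<close>. For a coaction it yields matrix coefficients, and
  for a dual family it yields the coefficients of a tensor.\<close>

definition slice where "slice V W f = tlift K V W W (%v w. f v *[W] w)"

lemma slice_bilin:
 assumes "vsp K V" "vsp K W" "f:Lin K V (ssp K)"
 shows "bilin V W W (%v w. f v *[W] w)"
 using assms hom_cl[OF assms(3)]
 by (intro bilin_homI) (auto intro!: hom_smult_map[OF assms(2) hom_id] hom_smult_l)

lemma slice_hom:
 assumes "vsp K V" "vsp K W" "f:Lin K V (ssp K)"
 shows "slice V W f:Lin K (ten K V W) W"
 unfolding slice_def by (rule tlift_hom) (use assms slice_bilin in auto)

lemma slice_pure:
 assumes "vsp K V" "vsp K W" "f:Lin K V (ssp K)" "v .: V" "w .: W"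
 shows "slice V W f (pt K V W v w) = f v *[W] w"
 unfolding slice_def by (rule tlift_pure) (use assms slice_bilin in auto)

definition tsum where "tsum V W I v w = Fs (ten K V W) (%i. pt K V W (v i) (w i)) I"

lemma tsum_closed [simp]:
 assumes "vsp K V" "vsp K W" "!!i. i:I ==> v i .: V" "!!i. i:I ==> w i .: W"
 shows "tsum V W I v w .: ten K V W"
 unfolding tsum_def using assms by (intro vsum_closed) auto

lemma hom_tsum:
 assumes V: "vsp K V" and W: "vsp K W" and P: "vsp K P"
  and T: "T:Lin K (ten K V W) P"
  and v: "!!i. i:I ==> v i .: V" and w: "!!i. i:I ==> w i .: W"
 shows "T (tsum V W I v w) = Fs P (%i. T (pt K V W (v i) (w i))) I"
 unfolding tsum_def by (rule hom_sum[OF _ P T]) (use V W v w in auto)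

lemma tlift_tsum:
 assumes V: "vsp K V" and W: "vsp K W" and P: "vsp K P" and b: "bilin V W P bt"
  and v: "!!i. i:I ==> v i .: V" and w: "!!i. i:I ==> w i .: W"
 shows "tlift K V W P bt (tsum V W I v w) = Fs P (%i. bt (v i) (w i)) I"
proof -
 have "tlift K V W P bt (tsum V W I v w) = Fs P (%i. tlift K V W P bt (pt K V W (v i) (w i))) I"
  by (rule hom_tsum[OF V W P tlift_hom[OF V W P b]]) (use v w in auto)
 also have "... = Fs P (%i. bt (v i) (w i)) I"
  by (rule vsum_cong) (use V W P v w in "auto simp: tlift_pure[OF V W P b] bilinD(3)[OF b]")
 finally show ?thesis .
qed

lemma slice_tsum:
 assumes V: "vsp K V" and W: "vsp K W" and d: "dual_fam V I e phi"
  and w: "!!i. i:I ==> w i .: W" and j: "j:I"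
 shows "slice V W (phi j) (tsum V W I e w) = w j"
proof -
 have "slice V W (phi j) (tsum V W I e w) = Fs W (%i. phi j (e i) *[W] w i) I"
  unfolding slice_def
  by (rule tlift_tsum[OF V W W slice_bilin[OF V W dual_famD(3)[OF d j]]]) (use w dual_famD(2)[OF d] in auto)
 also have "... = Fs W (%i. (if j = i then 1[K] else 0[K]) *[W] w i) I"
  using V W d j w dual_famD[OF d] by (intro vsum_cong) auto
 also have "... = w j" by (rule vsum_delta(2)) (use W w j dual_famD[OF d] in auto)
 finally show ?thesis .
qed

text \<open>Slicing with a dual family isolates each second factor, so tensors can be compared
  coefficientwise against any independent family, in a space of arbitrary dimension.\<close>

lemma tsum_eq_iff:
 assumes V: "vsp K V" and W: "vsp K W" and d: "indep V I e"
  and w: "!!i. i:I ==> w i .: W" and w': "!!i. i:I ==> w' i .: W"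
 shows "tsum V W I e w = tsum V W I e w' \<longleftrightarrow> (ALL i:I. w i = w' i)"
proof
 obtain phi where phi: "dual_fam V I e phi" using indep_dual[OF V d] by blast
 show "ALL i:I. w i = w' i" if "tsum V W I e w = tsum V W I e w'"
  using slice_tsum[OF V W phi, of w] slice_tsum[OF V W phi, of w'] w w' that by metis
 show "tsum V W I e w = tsum V W I e w'" if "ALL i:I. w i = w' i"
  unfolding tsum_def using that w' indepD(2)[OF d] V W by (intro vsum_cong) auto
qed

lemma tsum_eq_zero:
 assumes V: "vsp K V" and W: "vsp K W" and d: "indep V I e"
  and w: "!!i. i:I ==> w i .: W" and z: "tsum V W I e w = 0[ten K V W]" and i: "i:I"
 shows "w i = 0[W]"
proof -
 have "pt K V W (e i) 0[W] = 0[ten K V W]" if "i:I" for i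
  using hom_zero[OF W _ pure_hom(1)[OF V W indepD(2)[OF d that]]] V W by simp
 then have "tsum V W I e (%_. 0[W]) = 0[ten K V W]" unfolding tsum_def
  using V W by (intro vsum_zero) auto
 then show ?thesis using tsum_eq_iff[OF V W d, of w "%_. 0[W]"] z W i w by simp
qed

lemma dbasis_tsum:
 assumes V: "vsp K V" and W: "vsp K W" and b: "dbasis V I e phi"
  and t: "t .: ten K V W"
 shows "t = tsum V W I e (%i. slice V W (phi i) t)"
 using V W t
proof (induction rule: ten_induct)
 case (pure v w)
 have "tsum V W I e (%i. slice V W (phi i) (pt K V W v w))
  = Fs (ten K V W) (%i. pt K V W (phi i v *[V] e i) w) I"
  unfolding tsum_def using V W pure dbD[OF b]
  by (intro vsum_cong) (auto simp: slice_pure bilinD[OF pure_bilin[OF V W]])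
 also have "... = pt K V W (Fs V (%i. phi i v *[V] e i) I) w"
  using V W pure dbD[OF b] by (intro hom_sum[OF V _ pure_hom(2)[OF V W], symmetric]) auto
 finally show ?case using dbD(7)[OF b] pure by simp
next
 case (add s t)
 have cl: "slice V W (phi i) u .: W" if "i:I" "u .: ten K V W" for i u
  using hom_cl[OF slice_hom[OF V W dbD(4)[OF b]]] that by blast
 have "tsum V W I e (%i. slice V W (phi i) (s +[ten K V W] t))
  = Fs (ten K V W) (%i. pt K V W (e i) (slice V W (phi i) s)
   +[ten K V W] pt K V W (e i) (slice V W (phi i) t)) I"
  unfolding tsum_def using V W add dbD[OF b] cl
  by (intro vsum_cong) (auto simp: hom_add[OF slice_hom] bilinD[OF pure_bilin[OF V W]])
 also have "... = tsum V W I e (%i. slice V W (phi i) s) +[ten K V W] tsum V W I e (%i. slice V W (phi i) t)"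
  unfolding tsum_def using V W add dbD[OF b] cl by (intro vsum_add) auto
 finally show ?case using add by simp
qed

lemma ten_induct2 [consumes 3, case_names zero add]:
 assumes V: "vsp K V" and W: "vsp K W" and t: "t .: ten K V W"
  and zero: "P 0[ten K V W]"
  and add: "!!v w t. [|v .: V; w .: W; t .: ten K V W; P t|]
   ==> P (pt K V W v w +[ten K V W] t)"
 shows "P t"
proof -
 \<comment> \<open>Generalising over an added tensor \<open>s\<close> turns the case of a sum into
   two successive additions of pure tensors.\<close>
 have "ALL s:Car (ten K V W). P s --> P (t +[ten K V W] s)"
  using V W t
 proof (induction rule: ten_induct)
  case (add s t)
  then show ?case using V W by (simp add: vs_add_assoc)
 qed (use add in auto)
 then have "P (t +[ten K V W] 0[ten K V W])" using zero V W by simp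
 then show ?thesis using V W t by simp
qed

lemma tsum_insert:
 assumes "vsp K V" "vsp K W" "finite I" "j ~: I"
  "!!i. i:insert j I ==> v i .: V" "!!i. i:insert j I ==> w i .: W"
 shows "tsum V W (insert j I) v w = pt K V W (v j) (w j) +[ten K V W] tsum V W I v w"
 unfolding tsum_def by (rule vsum_insert) (use assms in auto)

lemma tsum_cong:
 assumes "vsp K V" "vsp K W" "I = J"
  "!!i. i:J ==> v' i .: V" "!!i. i:J ==> w' i .: W" "!!i. i:J ==> v i = v' i" "!!i. i:J ==> w i = w' i"
 shows "tsum V W I v w = tsum V W J v' w'"
 unfolding tsum_def by (rule vsum_cong) (use assms in auto)

lemma tsum_ex:
 assumes V: "vsp K V" and W: "vsp K W" and t: "t .: ten K V W"
 shows "EX (n::nat) v w. (ALL i<n. v i .: V) & (ALL i<n. w i .: W) & t = tsum V W {..<n} v w"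
 using V W t
proof (induction rule: ten_induct2)
 case zero
 show ?case by (rule exI[of _ 0]) (use V W in "simp add: tsum_def")
next
 case (add v w t)
 then obtain n v' w' where *: "ALL i<n. v' i .: V" "ALL i<n. w' i .: W" "t = tsum V W {..<n::nat} v' w'" by auto
 have "tsum V W {..<n} v' w' = tsum V W {..<n} (v'(n := v)) (w'(n := w))"
  by (rule tsum_cong) (use V W * in auto)
 moreover have "tsum V W (insert n {..<n}) (v'(n := v)) (w'(n := w))
  = pt K V W ((v'(n := v)) n) ((w'(n := w)) n) +[ten K V W] tsum V W {..<n} (v'(n := v)) (w'(n := w))"
  by (rule tsum_insert) (use V W * add in auto)
 ultimately have "pt K V W v w +[ten K V W] t = tsum V W {..<Suc n} (v'(n := v)) (w'(n := w))"
  using * by (simp add: lessThan_Suc)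
 moreover have "ALL i<Suc n. (v'(n := v)) i .: V" "ALL i<Suc n. (w'(n := w)) i .: W"
  using * add by (auto simp: less_Suc_eq)
 ultimately show ?case by blast
qed

text \<open>A linear relation in which \<open>k\<close> occurs expresses \<open>v k\<close> through
  the other vectors. Bilinearity moves the scalars to the second factors, and the term of
  \<open>k\<close> is absorbed by the others.\<close>

lemma tsum_reduce:
 assumes V: "vsp K V" and W: "vsp K W" and I: "finite I"
  and v: "!!i. i:I ==> v i .: V" and w: "!!i. i:I ==> w i .: W" and nd: "~ indep V I v"
 shows "EX k:I. EX w'. (ALL i:I-{k}. w' i .: W) & tsum V W I v w = tsum V W (I - {k}) v w'"
proof -
 let ?T = "ten K V W"
 note pb = bilinD[OF pure_bilin[OF V W]]
 obtain c k where c: "ALL i:I. c i .: K" "Fs V (%i. c i *[V] v i) I = 0[V]" "k:I" "c k ~= 0[K]"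
  using nd I v unfolding indep_def by blast
 let ?J = "I - {k}" and ?d = "%i. -[K] (inv\<^bsub>K\<^esub> (c k)) **[K] c i"
 have inv: "inv\<^bsub>K\<^esub> (c k) .: K" "inv\<^bsub>K\<^esub> (c k) **[K] c k = 1[K]" using c field_Units by auto
 have "Fs V (%i. ?d i *[V] v i) I = Fs V (%i. (-[K] (inv\<^bsub>K\<^esub> (c k))) *[V] (c i *[V] v i)) I"
  using c inv v V by (intro vsum_cong) (auto simp: vs_sm_smult)
 also have "... = 0[V]" using c inv v V by (subst vsum_smult) auto
 finally have z: "Fs V (%i. ?d i *[V] v i) I = 0[V]" .
 have "Fs V (%i. ?d i *[V] v i) I = ?d k *[V] v k +[V] Fs V (%i. ?d i *[V] v i) ?J"
  using c inv v V I by (intro vsum_remove) auto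
 also have "?d k = -[K] 1[K]" using inv c by (simp add: l_minus)
 finally have "-[V] v k +[V] Fs V (%i. ?d i *[V] v i) ?J = 0[V]" using z V v c by (simp add: vs_neg_smult)
 moreover have scl: "Fs V (%i. ?d i *[V] v i) ?J .: V" using c inv v V by (intro vsum_closed) auto
 ultimately have "v k +[V] (-[V] v k +[V] Fs V (%i. ?d i *[V] v i) ?J) = v k" using V v c by simp
 then have vk: "v k = Fs V (%i. ?d i *[V] v i) ?J"
  using V v c scl by (subst (asm) vs_add_assoc[symmetric]) auto
 let ?w = "%i. w i +[W] ?d i *[W] w k"
 have "tsum V W I v w = pt K V W (v k) (w k) +[?T] tsum V W ?J v w"
  unfolding tsum_def using c I v w V W by (intro vsum_remove) auto
 also have "pt K V W (v k) (w k) = Fs ?T (%i. pt K V W (?d i *[V] v i) (w k)) ?J"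
  unfolding vk using c inv v w V W by (intro hom_sum[OF V _ pure_hom(2)[OF V W]]) auto
 also have "... = Fs ?T (%i. pt K V W (v i) (?d i *[W] w k)) ?J"
  using c inv v w V W by (intro vsum_cong) (auto simp: pb(6,7))
 also have "... +[?T] tsum V W ?J v w
  = Fs ?T (%i. pt K V W (v i) (?d i *[W] w k) +[?T] pt K V W (v i) (w i)) ?J"
  unfolding tsum_def using c inv v w V W by (intro vsum_add[symmetric]) auto
 also have "... = tsum V W ?J v ?w"
  unfolding tsum_def using c inv v w V W by (intro vsum_cong) (auto simp: pb(5)[symmetric] vs_add_comm)
 finally have "tsum V W I v w = tsum V W ?J v ?w" .
 then show ?thesis using c inv w W by (intro bexI[of _ k] exI[of _ ?w]) auto
qed

text \<open>The symmetry of the tensor product, by which \<open>tsum_reduce\<close> also applies to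
  dependent second factors.\<close>

definition ten_flip where
 "ten_flip V W = tlift K V W (ten K W V) (%v w. pt K W V w v)"

lemma ten_flip_hom:
 assumes V: "vsp K V" and W: "vsp K W"
 shows "ten_flip V W:Lin K (ten K V W) (ten K W V)"
  and ten_flip_tsum: "[|!!i. i:I ==> v i .: V; !!i. i:I ==> w i .: W|]
   ==> ten_flip V W (tsum V W I v w) = tsum W V I w v"
 unfolding ten_flip_def tsum_def[of W V]
 using tlift_hom[OF V W ten_vs[OF W V] bilin_flip[OF pure_bilin[OF W V]]]
  tlift_tsum[OF V W ten_vs[OF W V] bilin_flip[OF pure_bilin[OF W V]]] by blast+

text \<open>In a representation with the least number of terms both families are independent, since
  a dependency on either side would save a term.\<close>

lemma tsum_indep_ex:
 assumes V: "vsp K V" and W: "vsp K W" and t: "t .: ten K V W"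
 shows "EX (I::nat set) v w. indep V I v & indep W I w & t = tsum V W I v w"
proof -
 define Q where "Q = (%(I::nat set, v, w). finite I & (ALL i:I. v i .: V) & (ALL i:I. w i .: W)
  & t = tsum V W I v w)"
 obtain n v0 w0 where "ALL i<n. v0 i .: V" "ALL i<n. w0 i .: W" "t = tsum V W {..<n::nat} v0 w0"
  using tsum_ex[OF V W t] by blast
 then have "Q ({..<n}, v0, w0)" by (simp add: Q_def)
 from ex_has_least_nat[of Q, OF this, of "%p. card (fst p)"]
 obtain p where p: "Q p" "ALL y. Q y --> card (fst p) <= card (fst y)" by blast
 obtain I v w where pe: "p = (I, v, w)" by (cases p)
 have Q: "Q (I, v, w)" and min: "!!J v' w'. Q (J, v', w') ==> card I <= card J"
  using p unfolding pe by fastforce+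
 then have *: "finite I" "!!i. i:I ==> v i .: V" "!!i. i:I ==> w i .: W" "t = tsum V W I v w"
  by (auto simp: Q_def)
 have "indep V I v"
 proof (rule ccontr)
  assume "~ indep V I v"
  then obtain k w' where k: "k:I" "ALL i:I-{k}. w' i .: W" "tsum V W I v w = tsum V W (I - {k}) v w'"
   using tsum_reduce[where v=v and w=w, OF V W *(1-3)] by blast
  then have "Q (I - {k}, v, w')" using * by (simp add: Q_def)
  then show False using min card_Diff1_less[OF *(1) k(1)] by fastforce
 qed
 moreover have "indep W I w"
 proof (rule ccontr)
  assume "~ indep W I w"
  then obtain k v' where k: "k:I" "ALL i:I-{k}. v' i .: V" "tsum W V I w v = tsum W V (I - {k}) w v'"
   using tsum_reduce[where v=w and w=v, OF W V *(1) *(3) *(2)] by blast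
  have "t = ten_flip W V (tsum W V I w v)"
   unfolding *(4) by (rule ten_flip_tsum[OF W V, symmetric]) (use * in auto)
  also have "... = tsum V W (I - {k}) v' w"
   unfolding k(3) by (rule ten_flip_tsum[OF W V]) (use * k in auto)
  finally have "Q (I - {k}, v', w)" using * k by (simp add: Q_def)
  then show False using min card_Diff1_less[OF *(1) k(1)] by fastforce
 qed
 ultimately show ?thesis using * by blast
qed

lemma ten_dbasis:
 assumes V: "vsp K V" and W: "vsp K W" and b: "dbasis V I e phi" and c: "dbasis W J f ps"
 shows "EX ch. dbasis (ten K V W) (I \<times> J) (%(i, j). pt K V W (e i) (f j)) ch"
proof
 let ?T = "ten K V W"
 let ?ch = "%(i, j) t. ps j (slice V W (phi i) t)"
 have T: "vsp K ?T" using V W by simp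
 have hom: "?ch (i, j):Lin K ?T (ssp K)" if "i:I" "j:J" for i j
  using hom_comp[OF slice_hom[OF V W dbD(4)[OF b that(1)]] dbD(4)[OF c that(2)]] by simp
 have exp: "t = Fs ?T (%ij. ?ch ij t *[?T] (case ij of (i, j) => pt K V W (e i) (f j))) (I \<times> J)"
  if t: "t .: ?T" for t
 proof -
  have sl: "slice V W (phi i) t .: W" if "i:I" for i
   by (rule hom_cl[OF slice_hom[OF V W dbD(4)[OF b that]] t])
  have cl: "ps j (slice V W (phi i) t) .: K" if "i:I" "j:J" for i j
   using dbD(6)[OF c that(2) sl[OF that(1)]] .
  have "pt K V W (e i) (slice V W (phi i) t)
   = Fs ?T (%j. ps j (slice V W (phi i) t) *[?T] pt K V W (e i) (f j)) J" if i: "i:I" for i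
  proof -
   have "pt K V W (e i) (Fs W (%j. ps j (slice V W (phi i) t) *[W] f j) J)
    = Fs ?T (%j. pt K V W (e i) (ps j (slice V W (phi i) t) *[W] f j)) J"
    using dbD(3)[OF b] dbD(3)[OF c] cl i W
    by (intro hom_sum[OF W T pure_hom(1)[OF V W]]) auto
   also have "... = Fs ?T (%j. ps j (slice V W (phi i) t) *[?T] pt K V W (e i) (f j)) J"
    using dbD(3)[OF b] dbD(3)[OF c] cl i T
    by (intro vsum_cong) (auto simp: bilinD(7)[OF pure_bilin[OF V W]])
   finally show ?thesis using dbD(7)[OF c sl[OF i]] by simp
  qed
  then have "t = Fs ?T (%i. Fs ?T (%j. ps j (slice V W (phi i) t) *[?T] pt K V W (e i) (f j)) J) I"
   using dbasis_tsum[OF V W b t] dbD(3)[OF b] dbD(3)[OF c] cl T sl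
   unfolding tsum_def by (subst (asm) (2) vsum_cong[OF T refl]) (auto intro!: vsum_closed)
  also have "... = Fs ?T (%ij. ?ch ij t *[?T] (case ij of (i, j) => pt K V W (e i) (f j))) (I \<times> J)"
   using dbD(2,3)[OF b] dbD(2,3)[OF c] cl T by (subst vsum_Times) auto
  finally show ?thesis .
 qed
 show "dbasis ?T (I \<times> J) (%(i, j). pt K V W (e i) (f j)) ?ch"
  unfolding dbasis_def dual_fam_def
 proof (intro conjI ballI)
  fix p q assume "p:I \<times> J" "q:I \<times> J"
  then obtain i j i' j' where p: "p = (i, j)" "i:I" "j:J" "q = (i', j')" "i':I" "j':J" by auto
  have cl: "(if i = i' then 1[K] else 0[K]) .: K" by simp
  show "?ch p (case q of (i, j) => pt K V W (e i) (f j)) = (if p = q then 1[K] else 0[K])"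
   using p dbD(3,4,5)[OF b] dbD(3,5)[OF c] hom_smult[OF dbD(4)[OF c p(3)] cl]
   by (auto simp: slice_pure[OF V W])
 qed (use dbD(2,3)[OF b] dbD(2,3)[OF c] hom exp in auto)
qed

end

section \<open>Spaces that differ only in their coaction\<close>

lemma with_coact_simps [simp]:
 "Car (wco V rh) = Car V" "add (wco V rh) = add V" "smult (wco V rh) = smult V"
 "zero (wco V rh) = zero V" "coact (wco V rh) = rh" "mult (wco V rh) = mult V"
 "one (wco V rh) = one V"
 by (simp_all add: with_coact_def)

context scalars
begin

lemma ten_assoc_space_cong:
 assumes "Car V = Car V'" "add V = add V'" "smult V = smult V'"
  "Car W = Car W'" "add W = add W'" "smult W = smult W'"
  "Car P = Car P'" "add P = add P'" "smult P = smult P'"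
 shows "tensor_assoc K V W P = tensor_assoc K V' W' P'"
proof -
 have e: "ten K V W = ten K V' W'" "pt K V W = pt K V' W'"
  "ten K W P = ten K W' P'" "pt K W P = pt K W' P'"
  by (rule ten_space_cong; use assms in simp)+
 have e2: "ten K V (ten K W' P') = ten K V' (ten K W' P')"
  "pt K V (ten K W' P') = pt K V' (ten K W' P')"
  by (rule ten_space_cong; use assms in simp)+
 have e3: "tlift K V W Q bt = tlift K V' W' Q bt" for Q bt
  by (rule tlift_space_cong) (use assms in simp_all)
 have e4: "tlift K Q P Q' bt = tlift K Q P' Q' bt" for Q Q' bt
  by (rule tlift_space_cong) (use assms in simp_all)
 show ?thesis unfolding tensor_assoc_def Let_def e e2 e3 e4 ..
qed

text \<open>The linear constructions do not look at the coaction, so the simplifier may strip it;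
  statements about comodules thereby reduce to their underlying spaces.\<close>

lemma with_coact_cong [simp]:
 "ten K (wco V rh) W = ten K V W"
 "ten K W (wco V rh) = ten K W V"
 "pt K (wco V rh) W = pt K V W"
 "pt K W (wco V rh) = pt K W V"
 "tlift K (wco V rh) W P = tlift K V W P"
 "tlift K W (wco V rh) P = tlift K W V P"
 "tlift K W P (wco V rh) = tlift K W P V"
 "tmap K (wco V rh) W P Q = tmap K V W P Q"
 "tmap K W (wco V rh) P Q = tmap K W V P Q"
 "tmap K W P (wco V rh) Q = tmap K W P V Q"
 "tmap K W P Q (wco V rh) = tmap K W P Q V"
 "tensor_assoc K (wco V rh) W P = tensor_assoc K V W P"
 "Lin K (wco V rh) W = Lin K V W"
 "Lin K W (wco V rh) = Lin K W V"
 "lin_maps K (wco V rh) W = lin_maps K V W"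
 "lin_maps K W (wco V rh) = lin_maps K W V"
 "Fs (wco V rh) = Fs V"
 by ((rule ten_space_cong ten_assoc_space_cong module_hom_cong finsum_cong_space; simp)
   | (rule ext, rule tlift_space_cong; simp) | (rule ext, rule ext, rule tmap_space_cong; simp))+

lemma with_coact_vs [simp]: "vsp K (wco V rh) \<longleftrightarrow> vsp K V"
 using vectorspace_cong[of V "wco V rh"] vectorspace_cong[of "wco V rh" V] by auto

lemma with_coact_basis [simp]:
 "bilin (wco V rh) W P bt = bilin V W P bt"
 "indep (wco V rh) I e = indep V I e"
 "dual_fam (wco V rh) I e phi = dual_fam V I e phi"
 "dbasis (wco V rh) I e phi = dbasis V I e phi"
 "slice (wco V rh) W f = slice V W f"
 "tsum (wco V rh) W I v w = tsum V W I v w"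
 unfolding bilin_def indep_def dual_fam_def dbasis_def slice_def tsum_def by simp_all

subsection \<open>Copies of vector spaces on a given type\<close>

text \<open>The condition under which copies have the intended meaning: without a space of the right
  dimension on \<open>'v\<close> the choice made in \<open>copy\<close> would be arbitrary.\<close>

definition all_dims :: "'v itself => bool" where
 "all_dims TV \<longleftrightarrow> (ALL n. EX V :: ('k, 'v) module.
  vsp K V & vectorspace.fin_dim K V & vdim K V = n)"

lemma all_dims_dbasis:
 assumes "all_dims TYPE('v)" and I: "finite I"
 shows "EX (V :: ('k, 'v) module) e phi. vsp K V & dbasis V I e phi"
proof -
 obtain V :: "('k, 'v) module" where V: "vsp K V" "vectorspace.fin_dim K V" "vdim K V = card I"
  using assms unfolding all_dims_def by blast
 obtain e phi where b: "dbasis V {..<card I} e phi" using dbasis_ex[OF V(1,2)] V(3) by auto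
 obtain h where h: "bij_betw h I {..<card I}" using ex_bij_betw_finite_nat[OF I] by (auto simp: atLeast0LessThan)
 show ?thesis using dbasis_reindex[OF V(1) b h] V(1) by blast
qed

lemma copy:
 fixes M :: "('k, 's) module"
 assumes ad: "all_dims TYPE('v)" and M: "vsp K M" and b: "dbasis M I e phi"
 shows copy_vs: "vsp K (copy_space K M :: ('k, 'v) module)"
  and copy_iso: "(copy_map K M :: 's => 'v):lin_isos K M (copy_space K M)"
proof -
 obtain V :: "('k, 'v) module" and f ps where V: "vsp K V" "dbasis V I f ps"
  using all_dims_dbasis[OF ad dbD(2)[OF b]] by blast
 obtain T where "T:lin_isos K M V" using iso_ex[OF M V(1) b V(2) refl] by blast
 then have "EX p :: ('k, 'v) module \<times> ('s => 'v). vsp K (fst p) & snd p:lin_isos K M (fst p)"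
  using V(1) by (intro exI[of _ "(V, T)"]) simp
 from someI_ex[OF this] show "vsp K (copy_space K M :: ('k, 'v) module)"
  "(copy_map K M :: 's => 'v):lin_isos K M (copy_space K M)"
  unfolding copy_space_def copy_map_def copy_def by blast+
qed

lemma copy_facts:
 fixes M :: "('k, 's) module"
 assumes ad: "all_dims TYPE('v)" and M: "vsp K M" and b: "dbasis M I e phi"
 defines "C == (copy_space K M :: ('k, 'v) module)" and "c == (copy_map K M :: 's => 'v)"
  and "d == (uncopy_map K M :: 'v => 's)"
 shows "c:Lin K M C" "d:Lin K C M" "c:lin_maps K M C"
  "x .: M ==> d (c x) = x" "y .: C ==> c (d y) = y"
  "x .: M ==> c x .: C" "y .: C ==> d y .: M"
  "bij_betw c (Car M) (Car C)" "vsp K C" "dbasis C I (%i. c (e i)) (%i x. phi i (d x))"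
proof -
 note iso = copy_iso[OF ad M b, folded C_def c_def]
 show C: "vsp K C" unfolding C_def by (rule copy_vs[OF ad M b])
 show l: "c:lin_maps K M C" and bij: "bij_betw c (Car M) (Car C)" using iso by (auto simp: lin_isos_def)
 show h: "c:Lin K M C" by (rule lm_hom[OF l])
 have d: "d = inv_into (Car M) c" unfolding d_def uncopy_map_def c_def ..
 show hd: "d:Lin K C M" unfolding d by (rule hom_inv[OF M h bij])
 show "x .: M ==> d (c x) = x" "y .: C ==> c (d y) = y"
  unfolding d using bij by (simp_all add: bij_betw_inv_into_left bij_betw_inv_into_right)
 show "x .: M ==> c x .: C" "y .: C ==> d y .: M"
  using hom_cl[OF h] hom_cl[OF hd] by auto
 show "dbasis C I (%i. c (e i)) (%i x. phi i (d x))"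
  unfolding d by (rule iso_dbasis[OF M C b h bij])
qed

lemma slice_tensor_map:
 assumes V: "vsp K V" and W: "vsp K W" and V': "vsp K V'" and W': "vsp K W'"
  and f: "f:Lin K V V'" and g: "g:Lin K W W'" and phi: "phi:Lin K V' (ssp K)"
  and t: "t .: ten K V W"
 shows "slice V' W' phi (tmap K V W V' W' f g t) = g (slice V W (%v. phi (f v)) t)"
 by (rule ten_hom_eqI[OF V W _ _ _ t,
    OF hom_comp[OF tmap_hom[OF V W V' W' f g] slice_hom[OF V' W' phi]]
     hom_comp[OF slice_hom[OF V W hom_comp[OF f phi]] g]])
  (use V W V' W' in "simp add: tmap_pure[OF V W V' W' f g] slice_pure[OF V' W' phi]
    slice_pure[OF V W hom_comp[OF f phi]] hom_cl[OF f] hom_cl[OF g] hom_smult[OF g] hom_cl[OF hom_comp[OF f phi], simplified]")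

lemma tmap_tsum:
 assumes V: "vsp K V" and W: "vsp K W" and V': "vsp K V'" and W': "vsp K W'"
  and f: "f:Lin K V V'" and g: "g:Lin K W W'"
  and v: "!!i. i:I ==> v i .: V" and w: "!!i. i:I ==> w i .: W"
 shows "tmap K V W V' W' f g (tsum V W I v w) = tsum V' W' I (%i. f (v i)) (%i. g (w i))"
proof -
 have "tmap K V W V' W' f g (tsum V W I v w)
  = Fs (ten K V' W') (%i. tmap K V W V' W' f g (pt K V W (v i) (w i))) I"
  by (rule hom_tsum[OF V W ten_vs[OF V' W'] tmap_hom[OF V W V' W' f g]]) (use v w in auto)
 also have "... = tsum V' W' I (%i. f (v i)) (%i. g (w i))"
  unfolding tsum_def
  by (rule vsum_cong) (use V' W' v w in "auto simp: tmap_pure[OF V W V' W' f g] hom_cl[OF f] hom_cl[OF g]")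
 finally show ?thesis .
qed

lemma tmap_comp:
 assumes V: "vsp K V" and W: "vsp K W" and V': "vsp K V'" and W': "vsp K W'"
  and V'': "vsp K V''" and W'': "vsp K W''"
  and f: "f:Lin K V V'" and g: "g:Lin K W W'"
  and f': "f':Lin K V' V''" and g': "g':Lin K W' W''"
  and t: "t .: ten K V W"
 shows "tmap K V' W' V'' W'' f' g' (tmap K V W V' W' f g t)
  = tmap K V W V'' W'' (%x. f' (f x)) (%x. g' (g x)) t"
 by (rule ten_hom_eqI[OF V W _ _ _ t,
    OF hom_comp[OF tmap_hom[OF V W V' W' f g] tmap_hom[OF V' W' V'' W'' f' g']]
     tmap_hom[OF V W V'' W'' hom_comp[OF f f'] hom_comp[OF g g']]])
  (simp add: tmap_pure[OF V W V' W' f g] tmap_pure[OF V' W' V'' W'' f' g']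
    tmap_pure[OF V W V'' W'' hom_comp[OF f f'] hom_comp[OF g g']] hom_cl[OF f] hom_cl[OF g])

lemma tmap_id:
 assumes V: "vsp K V" and W: "vsp K W" and t: "t .: ten K V W"
  and f: "f:Lin K V V" "!!x. x .: V ==> f x = x" and g: "g:Lin K W W" "!!x. x .: W ==> g x = x"
 shows "tmap K V W V W f g t = t"
 by (rule ten_hom_eqI[OF V W tmap_hom[OF V W V W f(1) g(1)] hom_id _ t])
  (simp add: tmap_pure[OF V W V W f(1) g(1)] f g)

text \<open>Tensoring an injective map with the identity. Expanded along \<open>e\<close>, both
  tensors keep their slices after \<open>f\<close> is applied, and these can be read off because the
  images of the basis remain independent.\<close>

lemma tmap_inj:
 assumes V: "vsp K V" and W: "vsp K W" and V': "vsp K V'"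
  and f: "f:Lin K V V'" and b: "dbasis V I e phi" and ind: "indep V' I (%i. f (e i))"
  and s: "s .: ten K V W" and t: "t .: ten K V W"
  and eq: "tmap K V W V' W f (%x. x) s = tmap K V W V' W f (%x. x) t"
 shows "s = t"
proof -
 have cl: "slice V W (phi i) u .: W" if "i:I" "u .: ten K V W" for i u
  using hom_cl[OF slice_hom[OF V W dbD(4)[OF b]]] that by blast
 have *: "tmap K V W V' W f (%x. x) u = tsum V' W I (%i. f (e i)) (%i. slice V W (phi i) u)"
  if u: "u .: ten K V W" for u
 proof -
  have "tmap K V W V' W f (%x. x) (tsum V W I e (%i. slice V W (phi i) u))
   = tsum V' W I (%i. f (e i)) (%i. slice V W (phi i) u)"
   by (rule tmap_tsum[OF V W V' W f hom_id]) (use dbD(3)[OF b] cl u in auto)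
  then show ?thesis using dbasis_tsum[OF V W b u] by simp
 qed
 have "ALL i:I. slice V W (phi i) s = slice V W (phi i) t"
  using tsum_eq_iff[OF V' W ind, of "%i. slice V W (phi i) s" "%i. slice V W (phi i) t"] cl s t eq *[OF s] *[OF t]
  by simp
 then have "tsum V W I e (%i. slice V W (phi i) s) = tsum V W I e (%i. slice V W (phi i) t)"
  using dbD(3)[OF b] cl t by (intro tsum_cong V W) auto
 then show ?thesis using dbasis_tsum[OF V W b s] dbasis_tsum[OF V W b t] by simp
qed

text \<open>On a vector whose coaction is given by a matrix \<open>m\<close>, applying the coaction
  twice produces the square of \<open>m\<close> with entries multiplied by \<otimes>. Only linearity
  of \<open>rh\<close> enters, so the formula can be used to prove coassociativity as well as to
  exploit it, and \<open>e\<close> may be dependent, for instance a row of a matrix.\<close>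

lemma coassoc_lhs_tsum:
 assumes Y: "vsp K Y" and A_vs: "vsp K A" and rh: "rh:Lin K Y (ten K Y A)" and I: "finite I"
  and e: "!!i. i:I ==> e i .: Y" and m: "!!p q. p:I ==> q:I ==> m p q .: A"
  and eq: "!!q. q:I ==> rh (e q) = tsum Y A I e (%p. m p q)" and q: "q:I"
 shows "tensor_assoc K Y A A (tmap K Y A (ten K Y A) A rh (%x. x) (rh (e q)))
  = tsum Y (ten K A A) I e (%r. tsum A A I (m r) (%p. m p q))"
proof -
 let ?T = "ten K Y (ten K A A)"
 have T: "vsp K ?T" and YA: "vsp K (ten K Y A)" using Y A_vs by simp_all
 have rhe: "rh (e p) .: ten K Y A" if "p:I" for p using hom_cl[OF rh e[OF that]] .
 have "tmap K Y A (ten K Y A) A rh (%x. x) (rh (e q))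
  = tsum (ten K Y A) A I (%p. rh (e p)) (%p. m p q)"
  unfolding eq[OF q] by (rule tmap_tsum[OF Y A_vs YA A_vs rh hom_id]) (use e m q in auto)
 then have "tensor_assoc K Y A A (tmap K Y A (ten K Y A) A rh (%x. x) (rh (e q)))
  = Fs ?T (%p. tensor_assoc K Y A A (pt K (ten K Y A) A (rh (e p)) (m p q))) I"
  using hom_tsum[OF YA A_vs T ten_assoc_hom[OF Y A_vs A_vs], of I "%p. rh (e p)" "%p. m p q"] rhe m q by simp
 also have "... = Fs ?T (%p. Fs ?T (%r. pt K Y (ten K A A) (e r) (pt K A A (m r p) (m p q))) I) I"
 proof (rule vsum_cong[OF T refl])
  fix p assume p: "p:I"
  show "Fs ?T (%r. pt K Y (ten K A A) (e r) (pt K A A (m r p) (m p q))) I .: ?T"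
   using T p q e m A_vs Y by (intro vsum_closed) auto
  have "tensor_assoc K Y A A (pt K (ten K Y A) A (rh (e p)) (m p q))
   = tmap K Y A Y (ten K A A) (%v. v) (%w. pt K A A w (m p q)) (tsum Y A I e (%r. m r p))"
   using ten_assoc_pure2[OF Y A_vs A_vs rhe[OF p] m[OF p q]] eq[OF p] by simp
  also have "... = tsum Y (ten K A A) I e (%r. pt K A A (m r p) (m p q))"
   by (rule tmap_tsum[OF Y A_vs Y ten_vs[OF A_vs A_vs] hom_id pure_hom(2)[OF A_vs A_vs m[OF p q]]]) (use e m p in auto)
  finally show "tensor_assoc K Y A A (pt K (ten K Y A) A (rh (e p)) (m p q))
   = Fs ?T (%r. pt K Y (ten K A A) (e r) (pt K A A (m r p) (m p q))) I" by (simp add: tsum_def)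
 qed
 also have "... = Fs ?T (%r. Fs ?T (%p. pt K Y (ten K A A) (e r) (pt K A A (m r p) (m p q))) I) I"
  using T I q e m A_vs Y by (intro vsum_swap) auto
 also have "... = tsum Y (ten K A A) I e (%r. tsum A A I (m r) (%p. m p q))"
  unfolding tsum_def[of Y "ten K A A"]
 proof (rule vsum_cong[OF T refl])
  fix r assume r: "r:I"
  show "pt K Y (ten K A A) (e r) (tsum A A I (m r) (%p. m p q)) .: ?T"
   using Y A_vs r q e m by auto
  show "Fs ?T (%p. pt K Y (ten K A A) (e r) (pt K A A (m r p) (m p q))) I
   = pt K Y (ten K A A) (e r) (tsum A A I (m r) (%p. m p q))"
   unfolding tsum_def using r q m by (intro hom_sum[OF ten_vs[OF A_vs A_vs] T pure_hom(1)[OF Y ten_vs[OF A_vs A_vs] e[OF r]], symmetric]) auto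
 qed
 finally show ?thesis .
qed

end

section \<open>Comodules and multiplicative matrices\<close>

locale hopf_setup = scalars K + hopf_algebra K A
 for K :: "('k, 'r) ring_scheme" and A :: "('k, 'a, 'm) hopf_scheme"
begin

lemma A_vs [simp]: "vsp K A"
 using A.module vs_iff_module by blast

lemma A_cring: "cring A"
 using A.M_cring .

abbreviation "AA == ten K A A"

lemma AA_vs [simp]: "vsp K AA" by simp

lemma
 shows am_closed [simp]: "[|x .: A; y .: A|] ==> x **[A] y .: A"
  and am_one_closed [simp]: "1[A] .: A"
  and am_assoc: "[|x .: A; y .: A; z .: A|] ==> (x **[A] y) **[A] z = x **[A] (y **[A] z)"
  and am_comm: "[|x .: A; y .: A|] ==> x **[A] y = y **[A] x"
  and am_l_one [simp]: "x .: A ==> 1[A] **[A] x = x"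
  and am_r_one [simp]: "x .: A ==> x **[A] 1[A] = x"
  and am_l_distr: "[|x .: A; y .: A; z .: A|] ==> (x +[A] y) **[A] z = x **[A] z +[A] y **[A] z"
  and am_r_distr: "[|x .: A; y .: A; z .: A|] ==> z **[A] (x +[A] y) = z **[A] x +[A] z **[A] y"
  and am_smult_l: "[|c .: K; x .: A; y .: A|] ==> (c *[A] x) **[A] y = c *[A] (x **[A] y)"
  and am_smult_r: "[|c .: K; x .: A; y .: A|] ==> x **[A] (c *[A] y) = c *[A] (x **[A] y)"
proof -
 note R = cring.cring_simprules[OF A_cring]
 show "[|x .: A; y .: A|] ==> x **[A] y .: A" "1[A] .: A" by (rule R; assumption)+
 show c: "[|x .: A; y .: A|] ==> x **[A] y = y **[A] x" for x y by (rule R; assumption)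
 show "[|x .: A; y .: A; z .: A|] ==> (x **[A] y) **[A] z = x **[A] (y **[A] z)" by (rule R; assumption)
 show "x .: A ==> 1[A] **[A] x = x" "x .: A ==> x **[A] 1[A] = x"
  using R c[of x "1[A]"] by simp_all
 show "[|x .: A; y .: A; z .: A|] ==> (x +[A] y) **[A] z = x **[A] z +[A] y **[A] z" by (rule R; assumption)
 show "[|x .: A; y .: A; z .: A|] ==> z **[A] (x +[A] y) = z **[A] x +[A] z **[A] y" by (rule R; assumption)
 show s: "[|c .: K; x .: A; y .: A|] ==> (c *[A] x) **[A] y = c *[A] (x **[A] y)" for x y
  by (rule A.smult_assoc2)
 show "[|c .: K; x .: A; y .: A|] ==> x **[A] (c *[A] y) = c *[A] (x **[A] y)"
  using s[of y x] c[of x y] c[of x "c *[A] y"] by simp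
qed

lemma am_bilin: "bilin A A A (mult A)"
 by (rule bilinI) (simp_all add: am_l_distr am_r_distr am_smult_l am_smult_r)

lemma comult_closed [simp]: "a .: A ==> comult A a .: AA"
 by (rule hom_cl[OF comult_linear])

lemma counit_closed [simp]: "a .: A ==> counit A a .: K"
 using hom_cl[OF counit_linear] by simp

text \<open>The Hopf algebra as a right comodule over itself. It is usually infinite-dimensional and
  so lies outside \<open>Comod K A\<close>, yet the maps from finite dimensional comodules into it
  are the matrix coefficients. The truncation gives the module record to which a coaction can be
  attached.\<close>

definition reg where "reg = wco (module.truncate A) (comult A)"

lemma reg_simps [simp]:
 "Car reg = Car A" "add reg = add A" "smult reg = smult A" "zero reg = zero A" "coact reg = comult A"
 by (simp_all add: reg_def module.truncate_def)

lemma reg_cong [simp]: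
 "ten K reg W = ten K A W"
 "pt K reg W = pt K A W"
 "tlift K reg W P = tlift K A W P"
 "tlift K W P reg = tlift K W P A"
 "tmap K reg W P Q = tmap K A W P Q"
 "tmap K W P reg Q = tmap K W P A Q"
 "tensor_assoc K reg W P = tensor_assoc K A W P"
 "Lin K reg W = Lin K A W"
 "Lin K W reg = Lin K W A"
 "lin_maps K reg W = lin_maps K A W"
 "lin_maps K W reg = lin_maps K W A"
 "Fs reg = Fs A"
 by ((rule ten_space_cong ten_assoc_space_cong module_hom_cong finsum_cong_space; simp)
   | (rule ext, rule tlift_space_cong; simp) | (rule ext, rule ext, rule tmap_space_cong; simp))+

lemma reg_vs [simp]: "vsp K reg"
 by (rule vectorspace_cong[OF A_vs]) simp_all

lemma reg_basis [simp]:
 "indep reg I e = indep A I e" "slice reg W f = slice A W f" "tsum reg W I v w = tsum A W I v w"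
 unfolding indep_def slice_def tsum_def by simp_all

lemma reg_comodule: "rcom K A reg"
 unfolding right_comodule_def right_comodule_axioms_def
 using comult_linear coassoc counit_right by simp

lemma coD:
 assumes "rcom K A Y"
 shows "vsp K Y" "coact Y:Lin K Y (ten K Y A)"
  "v .: Y ==> coact Y v .: ten K Y A"
  "v .: Y ==>
   tensor_assoc K Y A A (tmap K Y A (ten K Y A) A (coact Y) (%x. x) (coact Y v))
    = tmap K Y A Y AA (%x. x) (comult A) (coact Y v)"
  "v .: Y ==> tlift K Y A Y (%w a. counit A a *[Y] w) (coact Y v) = v"
 using assms hom_cl[of "coact Y" Y "ten K Y A" v]
 unfolding right_comodule_def right_comodule_axioms_def by auto

lemma counit_bilin: "vsp K V ==> bilin V A V (%w a. counit A a *[V] w)"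
 using counit_closed by (intro bilin_homI hom_smult_map hom_id hom_smult_l counit_linear) auto

text \<open>A multiplicative matrix, which is a comodule in coordinates. It consists of finitely
  many elements and finitely many equations, the form in which comodules pass to and from an
  ultraproduct.\<close>

definition mmat where
 "mmat I m \<longleftrightarrow> finite I & (ALL p:I. ALL q:I. m p q .: A
  & comult A (m p q) = tsum A A I (%r. m p r) (%r. m r q)
  & counit A (m p q) = (if p = q then 1[K] else 0[K]))"

lemma mmD:
 assumes "mmat I m"
 shows "finite I" "[|p:I; q:I|] ==> m p q .: A"
  "[|p:I; q:I|] ==> comult A (m p q) = tsum A A I (%r. m p r) (%r. m r q)"
  "[|p:I; q:I|] ==> counit A (m p q) = (if p = q then 1[K] else 0[K])"
 using assms unfolding mmat_def by auto

lemma counit_tsum: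
 assumes Y: "vsp K Y" and e: "!!i. i:I ==> e i .: Y" and m: "!!p. p:I ==> m p .: A"
 shows "tlift K Y A Y (%w a. counit A a *[Y] w) (tsum Y A I e m) = Fs Y (%p. counit A (m p) *[Y] e p) I"
 by (rule tlift_tsum[OF Y A_vs Y counit_bilin[OF Y]]) (use e m in auto)

text \<open>Compare the coefficients of the independent vectors \<open>e\<close> in the
  coassociativity and counit laws. Since \<open>e\<close> need not span \<open>Y\<close>, this also
  applies to finite dimensional pieces of the regular comodule.\<close>

lemma comodule_matrix:
 assumes Y: "rcom K A Y" and ind: "indep Y I e"
  and m: "!!p q. p:I ==> q:I ==> m p q .: A"
  and eq: "!!q. q:I ==> coact Y (e q) = tsum Y A I e (%p. m p q)"
 shows "mmat I m"
 unfolding mmat_def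
proof (intro conjI ballI)
 note Yv = coD(1)[OF Y] and e = indepD(2)[OF ind] and fin = indepD(1)[OF ind]
 show "finite I" by fact
 fix p q assume p: "p:I" and q: "q:I"
 show "m p q .: A" using m p q .
 have "tsum Y AA I e (%r. comult A (m r q)) = tmap K Y A Y AA (%x. x) (comult A) (coact Y (e q))"
  unfolding eq[OF q] by (rule tmap_tsum[OF Yv A_vs Yv AA_vs hom_id comult_linear, symmetric]) (use e m q in auto)
 also have "... = tsum Y AA I e (%r. tsum A A I (m r) (%p. m p q))"
  using coassoc_lhs_tsum[where e=e and m=m, OF Yv A_vs coD(2)[OF Y] fin e m eq q] coD(4)[OF Y e[OF q]] by simp
 finally show "comult A (m p q) = tsum A A I (m p) (%r. m r q)"
  using tsum_eq_iff[OF Yv AA_vs ind, of "%r. comult A (m r q)" "%r. tsum A A I (m r) (%p. m p q)"] m p q by simp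
 obtain phi where phi: "dual_fam Y I e phi" using indep_dual[OF Yv ind] by blast
 have "e q = Fs Y (%p. counit A (m p q) *[Y] e p) I"
  using coD(5)[OF Y e[OF q]] counit_tsum[OF Yv, of I e "%p. m p q"] eq[OF q] e m q by simp
 then have "phi p (e q) = counit A (m p q)"
  using dual_fam_coeff[OF Yv phi p, of "%p. counit A (m p q)"] m q by simp
 then show "counit A (m p q) = (if p = q then 1[K] else 0[K])" using dual_famD(4)[OF phi p q] by simp
qed

text \<open>Both comodule laws are linear in the vector, so it suffices to check them on the basis,
  where they become the two identities demanded by \<open>mmat\<close>.\<close>

lemma matrix_comodule:
 assumes Y: "vsp K Y" and b: "dbasis Y I e phi" and mm: "mmat I m"
  and rh: "coact Y:Lin K Y (ten K Y A)"
  and eq: "!!q. q:I ==> coact Y (e q) = tsum Y A I e (%p. m p q)"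
 shows "rcom K A Y"
 unfolding right_comodule_def right_comodule_axioms_def
proof (intro conjI allI impI Y rh)
 note e = dbD(3)[OF b] and m = mmD(2)[OF mm] and fin = dbD(2)[OF b]
 have YA: "vsp K (ten K Y A)" using Y by simp
 fix v assume v: "v .: Y"
 show "tensor_assoc K Y A A (tmap K Y A (ten K Y A) A (coact Y) (%x. x) (coact Y v))
    = tmap K Y A Y AA (%x. x) (comult A) (coact Y v)"
 proof (rule dbasis_hom_eqI[OF Y _ b _ _ _ v])
  show "vsp K (ten K Y AA)" using Y by simp
  show "(%v. tensor_assoc K Y A A (tmap K Y A (ten K Y A) A (coact Y) (%x. x) (coact Y v)))
   : Lin K Y (ten K Y AA)"
   by (rule hom_comp[OF hom_comp[OF rh tmap_hom[OF Y A_vs YA A_vs rh hom_id]] ten_assoc_hom[OF Y A_vs A_vs]])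
  show "(%v. tmap K Y A Y AA (%x. x) (comult A) (coact Y v)):Lin K Y (ten K Y AA)"
   by (rule hom_comp[OF rh tmap_hom[OF Y A_vs Y AA_vs hom_id comult_linear]])
  fix q assume q: "q:I"
  have "tmap K Y A Y AA (%x. x) (comult A) (coact Y (e q)) = tsum Y AA I e (%r. comult A (m r q))"
   unfolding eq[OF q] by (rule tmap_tsum[OF Y A_vs Y AA_vs hom_id comult_linear]) (use e m q in auto)
  also have "... = tsum Y AA I e (%r. tsum A A I (m r) (%p. m p q))"
   by (rule tsum_cong) (use Y e m q mmD(3)[OF mm] in auto)
  finally show "tensor_assoc K Y A A (tmap K Y A (ten K Y A) A (coact Y) (%x. x) (coact Y (e q)))
   = tmap K Y A Y AA (%x. x) (comult A) (coact Y (e q))"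
   using coassoc_lhs_tsum[where e=e and m=m, OF Y A_vs rh fin e m eq q] by simp
 qed
 show "tlift K Y A Y (%w a. counit A a *[Y] w) (coact Y v) = v"
 proof (rule dbasis_hom_eqI[OF Y Y b hom_comp[OF rh tlift_hom[OF Y A_vs Y counit_bilin[OF Y]]] hom_id _ v])
  fix q assume q: "q:I"
  have "tlift K Y A Y (%w a. counit A a *[Y] w) (coact Y (e q)) = Fs Y (%p. counit A (m p q) *[Y] e p) I"
   unfolding eq[OF q] by (rule counit_tsum[OF Y]) (use e m q in auto)
  also have "... = Fs Y (%p. (if p = q then 1[K] else 0[K]) *[Y] e p) I"
   by (rule vsum_cong[OF Y]) (use e q Y mmD(4)[OF mm] in auto)
  also have "... = e q" by (rule vsum_delta(1)[OF Y fin q e])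
  finally show "tlift K Y A Y (%w a. counit A a *[Y] w) (coact Y (e q)) = e q" .
 qed
qed

lemma comodule_basis_matrix:
 assumes Y: "rcom K A Y" and b: "dbasis Y I e phi"
 defines "m == %p q. slice Y A (phi p) (coact Y (e q))"
 shows "mmat I m" "q:I ==> coact Y (e q) = tsum Y A I e (%p. m p q)"
proof -
 note Yv = coD(1)[OF Y]
 show eq: "coact Y (e q) = tsum Y A I e (%p. m p q)" if "q:I" for q
  unfolding m_def by (rule dbasis_tsum[OF Yv A_vs b coD(3)[OF Y dbD(3)[OF b that]]])
 have cl: "m p q .: A" if "p:I" "q:I" for p q unfolding m_def
  by (rule hom_cl[OF slice_hom[OF Yv A_vs dbD(4)[OF b that(1)]] coD(3)[OF Y dbD(3)[OF b that(2)]]])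
 show "mmat I m"
  by (rule comodule_matrix[where e=e, OF Y dbasis_indep[OF Yv b] cl eq])
qed

lemma Comod_simps:
 "OB K A = {X. rcom K A X & vectorspace.fin_dim K X}"
 "Hom (Comod K A) = chom K A"
 by (simp_all add: Comod_def)

lemma matrix_object:
 assumes ad: "all_dims TYPE('v)" and mm: "mmat I m"
 shows "EX (Y :: ('k, 'a, 'v) comodule) e phi. Y:OB K A & dbasis Y I e phi
  & (ALL q:I. coact Y (e q) = tsum Y A I e (%p. m p q))"
proof -
 obtain V :: "('k, 'v) module" and e phi where V: "vsp K V" and b: "dbasis V I e phi"
  using all_dims_dbasis[OF ad mmD(1)[OF mm]] by blast
 obtain rh where rh: "rh:Lin K V (ten K V A)" "ALL q:I. rh (e q) = tsum V A I e (%p. m p q)"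
  using dbasis_hom_ex[OF V ten_vs[OF V A_vs] b, of "%q. tsum V A I e (%p. m p q)"]
   dbD(3)[OF b] mmD(2)[OF mm] V by auto
 let ?Y = "wco V rh"
 have b': "dbasis ?Y I e phi" using b by simp
 have "rcom K A ?Y"
  by (rule matrix_comodule[OF _ b' mm]) (use V rh in auto)
 moreover have "vectorspace.fin_dim K ?Y" by (rule dbasis_dim(1)[OF _ b']) (simp add: V)
 ultimately show ?thesis using b' rh
  by (intro exI[of _ ?Y] exI[of _ e] exI[of _ phi]) (auto simp: Comod_simps)
qed

lemma comod_homI:
 assumes Y: "rcom K A Y" and Z: "rcom K A Z" and b: "dbasis Y I e phi"
  and T: "T:lin_maps K Y Z"
  and eq: "!!q. q:I ==> coact Z (T (e q)) = tmap K Y A Z A T (%a. a) (coact Y (e q))"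
 shows "T:chom K A Y Z"
proof -
 note Yv = coD(1)[OF Y] and Zv = coD(1)[OF Z] and Th = lm_hom[OF T]
 have "coact Z (T v) = tmap K Y A Z A T (%a. a) (coact Y v)" if v: "v .: Y" for v
  by (rule dbasis_hom_eqI[OF Yv _ b hom_comp[OF Th coD(2)[OF Z]]
     hom_comp[OF coD(2)[OF Y] tmap_hom[OF Yv A_vs Zv A_vs Th hom_id]] eq v])
   (use Zv in auto)
 then show ?thesis using T by (simp add: comod_hom_def)
qed

lemma chD:
 assumes "T:chom K A Y Z"
 shows "T:lin_maps K Y Z" "T:Lin K Y Z"
  "v .: Y ==> coact Z (T v) = tmap K Y A Z A T (%a. a) (coact Y v)"
  "v .: Y ==> T v .: Z"
 using assms hom_cl[of T Y Z v] by (auto simp: comod_hom_def lin_maps_def)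

lemma comod_hom_comp:
 assumes X: "rcom K A X" and Y: "rcom K A Y" and Z: "rcom K A Z"
  and S: "S:chom K A X Y" and T: "T:chom K A Y Z"
 shows "compose (Car X) T S:chom K A X Z"
proof -
 note Xv = coD(1)[OF X] and Yv = coD(1)[OF Y] and Zv = coD(1)[OF Z]
 have h: "(%x. T (S x)):Lin K X Z" by (rule hom_comp[OF chD(2)[OF S] chD(2)[OF T]])
 have "coact Z (T (S v)) = tmap K X A Z A (compose (Car X) T S) (%a. a) (coact X v)" if v: "v .: X" for v
 proof -
  have "coact Z (T (S v)) = tmap K Y A Z A T (%a. a) (tmap K X A Y A S (%a. a) (coact X v))"
   using chD(3)[OF T chD(4)[OF S v]] chD(3)[OF S v] by simp
  also have "... = tmap K X A Z A (%x. T (S x)) (%a. a) (coact X v)"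
   by (rule tmap_comp[OF Xv A_vs Yv A_vs Zv A_vs chD(2)[OF S] hom_id chD(2)[OF T] hom_id coD(3)[OF X v]])
  also have "tmap K X A Z A (%x. T (S x)) (%a. a) = tmap K X A Z A (compose (Car X) T S) (%a. a)"
   by (rule tmap_cong) (simp_all add: compose_eq)
  finally show ?thesis .
 qed
 moreover have "compose (Car X) T S:lin_maps K X Z"
  using lm_restrict[OF Xv h] by (simp add: compose_def)
 ultimately show ?thesis by (simp add: comod_hom_def compose_eq)
qed

lemma comod_hom_id: "rcom K A X ==> (\<lambda>x\<in>Car X. x):chom K A X X"
proof -
 assume X: "rcom K A X"
 note Xv = coD(1)[OF X]
 have h: "(\<lambda>x\<in>Car X. x):lin_maps K X X" by (rule lm_restrict[OF Xv hom_id])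
 have "coact X v = tmap K X A X A (\<lambda>x\<in>Car X. x) (%a. a) (coact X v)" if "v .: X" for v
  by (rule tmap_id[OF Xv A_vs coD(3)[OF X that] lm_hom[OF h] _ hom_id, symmetric]) simp_all
 then show ?thesis using h by (simp add: comod_hom_def)
qed

lemma comod_hom_inv:
 assumes X: "rcom K A X" and Y: "rcom K A Y"
  and T: "T:chom K A X Y" and bij: "bij_betw T (Car X) (Car Y)"
 shows "restrict (inv_into (Car X) T) (Car Y):chom K A Y X"
proof -
 note Xv = coD(1)[OF X] and Yv = coD(1)[OF Y] and Th = chD(2)[OF T]
 let ?S = "inv_into (Car X) T"
 note S = hom_inv[OF Xv Th bij]
 have ST: "?S (T x) = x" if "x .: X" for x using that bij by (simp add: bij_betw_inv_into_left)
 have TS: "T (?S y) = y" if "y .: Y" for y using that bij by (simp add: bij_betw_inv_into_right)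
 have "coact X (?S y) = tmap K Y A X A (restrict ?S (Car Y)) (%a. a) (coact Y y)" if y: "y .: Y" for y
 proof -
  have Sy: "?S y .: X" by (rule hom_cl[OF S y])
  have "tmap K Y A X A (restrict ?S (Car Y)) (%a. a) (coact Y y)
   = tmap K Y A X A ?S (%a. a) (coact Y y)"
   by (rule arg_cong[where f="%f. f (coact Y y)"], rule tmap_cong) simp_all
  also have "... = tmap K Y A X A ?S (%a. a) (tmap K X A Y A T (%a. a) (coact X (?S y)))"
   using chD(3)[OF T Sy] TS[OF y] by simp
  also have "... = tmap K X A X A (%x. ?S (T x)) (%a. a) (coact X (?S y))"
   by (rule tmap_comp[OF Xv A_vs Yv A_vs Xv A_vs Th hom_id S hom_id coD(3)[OF X Sy]])
  also have "... = coact X (?S y)"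
   by (rule tmap_id[OF Xv A_vs coD(3)[OF X Sy] hom_comp[OF Th S] ST hom_id]) simp_all
  finally show ?thesis by simp
 qed
 then show ?thesis using lm_restrict[OF Yv S] by (simp add: comod_hom_def)
qed

subsection \<open>Matrix coefficients\<close>

lemma coef_slice: "coef K A Y f v = slice Y A f (coact Y v)"
 by (simp add: coefficient_def slice_def)

lemma coef_hom:
 assumes Y: "rcom K A Y" and f: "f:Lin K Y (ssp K)"
 shows "coef K A Y f:Lin K Y A"
 using hom_comp[OF coD(2)[OF Y] slice_hom[OF coD(1)[OF Y] A_vs f]]
 unfolding coef_slice[abs_def] .

lemma coef_closed:
 "rcom K A Y ==> f:Lin K Y (ssp K) ==> v .: Y ==> coef K A Y f v .: A"
 using hom_cl[OF coef_hom] .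

lemma coef_cong:
 "(!!v. v .: Y ==> f v = g v) ==> coef K A Y f v = coef K A Y g v"
 unfolding coefficient_def by (rule arg_cong[where f="%h. h (coact Y v)"]) (rule tlift_cong, simp)

lemma coef_comod_hom:
 assumes Y: "rcom K A Y" and Z: "rcom K A Z" and T: "T:chom K A Y Z"
  and f: "f:Lin K Z (ssp K)" and v: "v .: Y"
 shows "coef K A Z f (T v) = coef K A Y (%y. f (T y)) v"
 unfolding coef_slice chD(3)[OF T v]
 by (rule slice_tensor_map[OF coD(1)[OF Y] A_vs coD(1)[OF Z] A_vs chD(2)[OF T] hom_id f coD(3)[OF Y v]])

lemma slice_add:
 assumes V: "vsp K V" and W: "vsp K W" and f: "f:Lin K V (ssp K)"
  and g: "g:Lin K V (ssp K)" and t: "t .: ten K V W"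
 shows "slice V W (%v. f v +[K] g v) t = slice V W f t +[W] slice V W g t"
proof -
 have fg: "(%v. f v +[K] g v):Lin K V (ssp K)"
  using hom_add_map[OF vs_ssp f g] by simp
 show ?thesis
  by (rule ten_hom_eqI[OF V W slice_hom[OF V W fg] hom_add_map[OF W slice_hom[OF V W f] slice_hom[OF V W g]] _ t])
   (use W hom_cl[OF f] hom_cl[OF g] in "simp add: slice_pure[OF V W] f g fg vs_sm_l_distr")
qed

lemma slice_smult:
 assumes V: "vsp K V" and W: "vsp K W" and f: "f:Lin K V (ssp K)"
  and c: "c .: K" and t: "t .: ten K V W"
 shows "slice V W (%v. c **[K] f v) t = c *[W] slice V W f t"
proof -
 have fg: "(%v. c **[K] f v):Lin K V (ssp K)"
  using hom_smult_map[OF vs_ssp f c] by simp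
 show ?thesis
  by (rule ten_hom_eqI[OF V W slice_hom[OF V W fg] hom_smult_map[OF W slice_hom[OF V W f] c] _ t])
   (use W c hom_cl[OF f] in "simp add: slice_pure[OF V W] f fg vs_sm_smult")
qed

text \<open>Apply \<open>f\<close> to the counit law. Thus the map into the regular comodule given
  by a functional determines the functional back, by composition with the counit.\<close>

lemma counit_coefficient:
 assumes Y: "rcom K A Y" and f: "f:Lin K Y (ssp K)" and v: "v .: Y"
 shows "counit A (coef K A Y f v) = f v"
proof -
 note Yv = coD(1)[OF Y]
 have "counit A (slice Y A f (coact Y v)) = f (tlift K Y A Y (%w a. counit A a *[Y] w) (coact Y v))"
  by (rule ten_hom_eqI[OF Yv A_vs hom_comp[OF slice_hom[OF Yv A_vs f] counit_linear]
     hom_comp[OF tlift_hom[OF Yv A_vs Yv counit_bilin[OF Yv]] f] _ coD(3)[OF Y v]])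
   (use hom_cl[OF f] in "simp add: slice_pure[OF Yv A_vs f] tlift_pure[OF Yv A_vs Yv counit_bilin[OF Yv]]
     hom_smult[OF f] hom_smult[OF counit_linear] K.m_comm")
 then show ?thesis using coD(5)[OF Y v] by (simp add: coef_slice)
qed

text \<open>Slice the coassociativity law with \<open>f\<close>. In other words, forming
  coefficients with a fixed functional is a comodule map into the regular comodule.\<close>

lemma comult_coefficient:
 assumes Y: "rcom K A Y" and f: "f:Lin K Y (ssp K)" and v: "v .: Y"
 shows "comult A (coef K A Y f v) = tmap K Y A A A (coef K A Y f) (%a. a) (coact Y v)"
proof -
 note Yv = coD(1)[OF Y] and rh = coD(2)[OF Y] and g = coef_hom[OF Y f]
 have YA: "vsp K (ten K Y A)" and YAA: "vsp K (ten K Y AA)" using Yv by simp_all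
 let ?t = "coact Y v"
 note t = coD(3)[OF Y v]
 have 1: "slice Y AA f (tmap K Y A Y AA (%v. v) (%w. pt K A A w a) s) = pt K A A (slice Y A f s) a"
  if "a .: A" "s .: ten K Y A" for a s
  using slice_tensor_map[OF Yv A_vs Yv AA_vs hom_id pure_hom(2)[OF A_vs A_vs that(1)] f that(2)] .
 have "slice Y AA f (tensor_assoc K Y A A (tmap K Y A (ten K Y A) A (coact Y) (%x. x) ?t))
  = tmap K Y A A A (coef K A Y f) (%a. a) ?t"
  by (rule ten_hom_eqI[OF Yv A_vs hom_comp[OF hom_comp[OF tmap_hom[OF Yv A_vs YA A_vs rh hom_id]
      ten_assoc_hom[OF Yv A_vs A_vs]] slice_hom[OF Yv AA_vs f]]
     tmap_hom[OF Yv A_vs A_vs A_vs g hom_id] _ t])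
   (simp add: tmap_pure[OF Yv A_vs YA A_vs rh hom_id] ten_assoc_pure2[OF Yv A_vs A_vs] coD(3)[OF Y] 1
     tmap_pure[OF Yv A_vs A_vs A_vs g hom_id] coef_slice)
 moreover have "slice Y AA f (tmap K Y A Y AA (%x. x) (comult A) ?t) = comult A (slice Y A f ?t)"
  using slice_tensor_map[OF Yv A_vs Yv AA_vs hom_id comult_linear f t] .
 ultimately show ?thesis using coD(4)[OF Y v] by (simp add: coef_slice)
qed

lemma coef_comod_hom_reg:
 assumes Y: "rcom K A Y" and f: "f:Lin K Y (ssp K)"
 shows "restrict (coef K A Y f) (Car Y):chom K A Y reg"
proof -
 have "tmap K Y A A A (coef K A Y f) (%a. a)
  = tmap K Y A A A (restrict (coef K A Y f) (Car Y)) (%a. a)"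
  by (rule tmap_cong) simp_all
 then show ?thesis
  using lm_restrict[OF coD(1)[OF Y] coef_hom[OF Y f]] comult_coefficient[OF Y f]
  by (simp add: comod_hom_def)
qed

lemma comult_coefficient_tsum:
 assumes Y: "rcom K A Y" and f: "f:Lin K Y (ssp K)" and v: "v .: Y"
  and b: "dbasis Y I e phi"
 shows "comult A (coef K A Y f v) = tsum A A I (%p. coef K A Y f (e p)) (%p. coef K A Y (phi p) v)"
proof -
 note Yv = coD(1)[OF Y]
 have "tmap K Y A A A (coef K A Y f) (%a. a) (tsum Y A I e (%p. coef K A Y (phi p) v))
  = tsum A A I (%p. coef K A Y f (e p)) (%p. coef K A Y (phi p) v)"
  by (rule tmap_tsum[OF Yv A_vs A_vs A_vs coef_hom[OF Y f] hom_id])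
   (use dbD[OF b] v coef_closed[OF Y] in auto)
 then show ?thesis using comult_coefficient[OF Y f v] dbasis_tsum[OF Yv A_vs b coD(3)[OF Y v]]
  by (simp add: coef_slice)
qed

text \<open>The image of \<open>g\<close> is a subcomodule of \<open>N\<close>, but it has to be
  realised on \<open>'v\<close> and not on the type of \<open>N\<close>. A maximal independent
  subfamily of the vectors g(e q) is a basis of the image; the matrix of the coaction in it is
  multiplicative and defines \<open>Z\<close>.\<close>

lemma image_factorization:
 fixes N :: "('k, 'a, 'n) comodule"
 assumes ad: "all_dims TYPE('v)" and Y: "rcom K A Y" and b: "dbasis Y I e phi"
  and N: "rcom K A N" and g: "g:chom K A Y N"
 shows "EX (Z :: ('k, 'a, 'v) comodule) pj j. Z:OB K A & pj:chom K A Y Z & j:chom K A Z N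
  & inj_on j (Car Z) & (ALL y:Car Y. g y = j (pj y))"
proof -
 note Yv = coD(1)[OF Y] and Nv = coD(1)[OF N] and gh = chD(2)[OF g]
 note e = dbD(3)[OF b] and fin = dbD(2)[OF b]
 define m where "m = (%p q. slice Y A (phi p) (coact Y (e q)))"
 have mm: "mmat I m" and rhe: "q:I ==> coact Y (e q) = tsum Y A I e (%p. m p q)" for q
  using comodule_basis_matrix[OF Y b] unfolding m_def by auto
 note m = mmD(2)[OF mm]
 let ?g = "%q. g (e q)"
 have gN: "?g q .: N" if "q:I" for q using hom_cl[OF gh e[OF that]] .
 have "EX J<=I. indep N J ?g & (ALL j:I. EX c. (ALL i:J. c i .: K) & ?g j = Fs N (%i. c i *[N] ?g i) J)"
  by (rule maximal_indep_subfamily[OF Nv fin gN])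
 then obtain J where JI: "J <= I" and ind: "indep N J ?g"
  and "ALL j:I. EX c. (ALL i:J. c i .: K) & ?g j = Fs N (%i. c i *[N] ?g i) J"
  by (elim exE conjE) (rule that)
 then obtain P where P: "!!q l. q:I ==> l:J ==> P q l .: K"
  and gP: "!!q. q:I ==> ?g q = Fs N (%l. P q l *[N] ?g l) J" by metis
 have finJ: "finite J" using JI fin finite_subset by blast
 have J: "l:J ==> l:I" for l using JI by auto
 \<comment> \<open>The coaction of g(e l) is the sum of the g(e q) \<otimes> \<open>m q l\<close>.
   Rewriting each g(e q) through the chosen basis with the coefficients \<open>P\<close> collects
   these entries in front of g(e s).\<close>
 define n where "n = (%s l. Fs A (%q. P q s *[A] m q l) I)"
 have n: "n s l .: A" if "s:J" "l:I" for s l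
  unfolding n_def using that P m J by (intro vsum_closed) auto
 have NA: "vsp K (ten K N A)" using Nv by simp
 note pb = bilinD[OF pure_bilin[OF Nv A_vs]]
 have rhg: "coact N (?g l) = tsum N A J ?g (%s. n s l)" if l: "l:I" for l
 proof -
  have "coact N (?g l) = tmap K Y A N A g (%a. a) (tsum Y A I e (%p. m p l))"
   using chD(3)[OF g e[OF l]] rhe[OF l] by simp
  also have "... = tsum N A I ?g (%p. m p l)"
   by (rule tmap_tsum[OF Yv A_vs Nv A_vs gh hom_id]) (use e m l in auto)
  also have "... = Fs (ten K N A) (%q. Fs (ten K N A) (%s. pt K N A (?g s) (P q s *[A] m q l)) J) I"
   unfolding tsum_def
  proof (rule vsum_cong[OF NA refl])
   fix q assume q: "q:I"
   show "Fs (ten K N A) (%s. pt K N A (?g s) (P q s *[A] m q l)) J .: ten K N A"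
    using NA q l m P gN J by (intro vsum_closed) auto
   have "pt K N A (?g q) (m q l) = pt K N A (Fs N (%s. P q s *[N] ?g s) J) (m q l)"
    using gP[OF q] by simp
   also have "... = Fs (ten K N A) (%s. pt K N A (P q s *[N] ?g s) (m q l)) J"
    using P q gN J Nv by (intro hom_sum[OF Nv NA pure_hom(2)[OF Nv A_vs m[OF q l]]]) auto
   also have "... = Fs (ten K N A) (%s. pt K N A (?g s) (P q s *[A] m q l)) J"
    using P q l gN J m NA by (intro vsum_cong) (auto simp: pb(6,7))
   finally show "pt K N A (?g q) (m q l) = Fs (ten K N A) (%s. pt K N A (?g s) (P q s *[A] m q l)) J" .
  qed
  also have "... = Fs (ten K N A) (%s. Fs (ten K N A) (%q. pt K N A (?g s) (P q s *[A] m q l)) I) J"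
   using NA fin finJ l m P gN J by (intro vsum_swap) auto
  also have "... = tsum N A J ?g (%s. n s l)" unfolding tsum_def n_def
  proof (rule vsum_cong[OF NA refl])
   fix s assume s: "s:J"
   show "pt K N A (g (e s)) (Fs A (%q. P q s *[A] m q l) I) .: ten K N A"
    using n[OF s l] gN[OF J[OF s]] by (simp add: n_def)
   show "Fs (ten K N A) (%q. pt K N A (?g s) (P q s *[A] m q l)) I
    = pt K N A (g (e s)) (Fs A (%q. P q s *[A] m q l) I)"
    using P s l m by (intro hom_sum[OF A_vs NA pure_hom(1)[OF Nv A_vs gN[OF J[OF s]]], symmetric]) auto
  qed
  finally show ?thesis .
 qed
 have nn: "mmat J n"
  by (rule comodule_matrix[where e="?g", OF N ind n[OF _ J] rhg[OF J]])
 obtain Z :: "('k, 'a, 'v) comodule" and z ze where Z: "Z:OB K A" and zb: "dbasis Z J z ze"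
  and rhz: "ALL q:J. coact Z (z q) = tsum Z A J z (%p. n p q)"
  using matrix_object[OF ad nn] by blast
 have Zc: "rcom K A Z" using Z by (simp add: Comod_simps)
 note Zv = coD(1)[OF Zc] and zc = dbD(3)[OF zb]
 obtain j0 where j0: "j0:Lin K Z N" "ALL l:J. j0 (z l) = ?g l"
  using dbasis_hom_ex[OF Zv Nv zb, of ?g] gN J by auto
 define j where "j = restrict j0 (Car Z)"
 have jl: "j:lin_maps K Z N" unfolding j_def by (rule lm_restrict[OF Zv j0(1)])
 note jh = lm_hom[OF jl]
 have jz: "j (z l) = ?g l" if "l:J" for l using j0(2) zc that by (simp add: j_def)
 have jc: "j:chom K A Z N"
 proof (rule comod_homI[OF Zc N zb jl])
  fix q assume q: "q:J"
  have "tmap K Z A N A j (%a. a) (coact Z (z q)) = tsum N A J (%l. j (z l)) (%p. n p q)"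
   unfolding bspec[OF rhz q] by (rule tmap_tsum[OF Zv A_vs Nv A_vs jh hom_id]) (use zc n J q in auto)
  also have "... = tsum N A J ?g (%p. n p q)"
   by (rule tsum_cong) (use Nv jz gN n J q in auto)
  finally show "coact N (j (z q)) = tmap K Z A N A j (%a. a) (coact Z (z q))"
   using rhg[OF J[OF q]] jz[OF q] by simp
 qed
 have indj: "indep N J (%i. j (z i))"
 proof -
  have "Fs N (%i. c i *[N] j (z i)) J = Fs N (%i. c i *[N] ?g i) J"
   if "ALL i:J. c i .: K" for c
   by (rule vsum_cong[OF Nv refl]) (use that jz Nv gN[OF J] in auto)
  then show ?thesis using ind jz unfolding indep_def by simp
 qed
 have inj: "inj_on j (Car Z)"
  unfolding hom_inj_iff[OF Zv Nv jh]
 proof (intro ballI impI)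
  fix x assume x: "x .: Z" "j x = 0[N]"
  have "j (Fs Z (%i. ze i x *[Z] z i) J) = Fs N (%i. j (ze i x *[Z] z i)) J"
   using dbD[OF zb] x Zv by (intro hom_sum[OF Zv Nv jh]) auto
  also have "... = Fs N (%i. ze i x *[N] j (z i)) J"
   using dbD[OF zb] x Nv by (intro vsum_cong) (auto simp: hom_smult[OF jh] hom_cl[OF jh])
  finally have "Fs N (%i. ze i x *[N] j (z i)) J = 0[N]" using dbD(7)[OF zb x(1)] x by simp
  then have "ze i x = 0[K]" if "i:J" for i
   using indepD(3)[OF indj, of "%i. ze i x" i] dbD(6)[OF zb] x that by auto
  then have "Fs Z (%i. ze i x *[Z] z i) J = 0[Z]" using Zv zc by (intro vsum_zero) auto
  then show "x = 0[Z]" using dbD(7)[OF zb x(1)] by simp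
 qed
 let ?pj = "%q. Fs Z (%l. P q l *[Z] z l) J"
 have pjc: "?pj q .: Z" if "q:I" for q using Zv P zc that by (intro vsum_closed) auto
 obtain pj0 where pj0: "pj0:Lin K Y Z" "ALL q:I. pj0 (e q) = ?pj q"
  using dbasis_hom_ex[OF Yv Zv b, of ?pj] pjc by auto
 define pj where "pj = restrict pj0 (Car Y)"
 have pjl: "pj:lin_maps K Y Z" unfolding pj_def by (rule lm_restrict[OF Yv pj0(1)])
 note pjh = lm_hom[OF pjl]
 have jpj: "j (pj y) = g y" if y: "y .: Y" for y
 proof (rule dbasis_hom_eqI[OF Yv Nv b hom_comp[OF pjh jh] gh _ y])
  fix q assume q: "q:I"
  have "j (pj (e q)) = j (?pj q)" using pj0(2) q e by (simp add: pj_def)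
  also have "... = Fs N (%l. j (P q l *[Z] z l)) J"
   using Zv P zc q by (intro hom_sum[OF Zv Nv jh]) auto
  also have "... = Fs N (%l. P q l *[N] ?g l) J"
   using Nv P zc q gN J by (intro vsum_cong) (auto simp: hom_smult[OF jh] jz)
  finally show "j (pj (e q)) = g (e q)" using gP[OF q] by simp
 qed
 \<comment> \<open>Compatibility of \<open>pj\<close> is checked after the injective map
   \<open>j \<otimes> 1\<close>, where it becomes the compatibility of \<open>g\<close>
   itself.\<close>
 have "pj:chom K A Y Z"
 proof (rule comod_homI[OF Y Zc b pjl])
  fix q assume q: "q:I"
  have pjq: "pj (e q) .: Z" by (rule hom_cl[OF pjh e[OF q]])
  have "tmap K Z A N A j (%a. a) (coact Z (pj (e q))) = coact N (g (e q))"
   using chD(3)[OF jc pjq] jpj[OF e[OF q]] by simp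
  also have "... = tmap K Y A N A g (%a. a) (coact Y (e q))" by (rule chD(3)[OF g e[OF q]])
  also have "tmap K Y A N A g (%a. a) = tmap K Y A N A (%y. j (pj y)) (%a. a)"
   by (rule tmap_cong) (simp_all add: jpj)
  also have "tmap K Y A N A (%y. j (pj y)) (%a. a) (coact Y (e q))
   = tmap K Z A N A j (%a. a) (tmap K Y A Z A pj (%a. a) (coact Y (e q)))"
   by (rule tmap_comp[OF Yv A_vs Zv A_vs Nv A_vs pjh hom_id jh hom_id coD(3)[OF Y e[OF q]], symmetric])
  finally show "coact Z (pj (e q)) = tmap K Y A Z A pj (%a. a) (coact Y (e q))"
   by (intro tmap_inj[OF Zv A_vs Nv jh zb indj coD(3)[OF Zc pjq]
      hom_cl[OF tmap_hom[OF Yv A_vs Zv A_vs pjh hom_id] coD(3)[OF Y e[OF q]]]])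
 qed
 then show ?thesis using Z jc inj jpj by (intro exI[of _ Z] exI[of _ pj] exI[of _ j]) auto
qed

end

section \<open>Finite-dimensional spaces and their chosen tensor products\<close>

context scalars
begin

definition fd where "fd X \<longleftrightarrow> vsp K X & vectorspace.fin_dim K X"

lemma fd_vs [simp]: "fd X ==> vsp K X" by (simp add: fd_def)

lemma fd_dbasis: "fd X ==> EX e phi. dbasis X {..<vdim K X} e phi"
 unfolding fd_def using dbasis_ex by blast

lemma dbasis_fd: "vsp K X ==> dbasis X I e phi ==> fd X"
 unfolding fd_def using dbasis_dim(1) by blast

lemma fd_tensor [simp]:
 assumes "fd X" "fd Y"
 shows "fd (ten K X Y)"
proof -
 obtain e phi f ps where "dbasis X {..<vdim K X} e phi" "dbasis Y {..<vdim K Y} f ps"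
  using fd_dbasis assms by meson
 from ten_dbasis[OF fd_vs[OF assms(1)] fd_vs[OF assms(2)] this] show ?thesis
  using dbasis_fd[OF ten_vs[OF fd_vs[OF assms(1)] fd_vs[OF assms(2)]]] by blast
qed

lemma scalar_dbasis: "dbasis (ssp K) {()} (%_. 1[K]) (%_ x. x)"
 unfolding dbasis_def dual_fam_def
 using vsum_single[OF vs_ssp, of "{()}" "()"] by (auto simp: hom_id)

lemma fd_scalar [simp]: "fd (ssp K)"
 using dbasis_fd[OF vs_ssp scalar_dbasis] .

lemma fd_copy:
 fixes M :: "('k, 's) module"
 assumes ad: "all_dims TYPE('v)" and M: "fd M"
 defines "C == (copy_space K M :: ('k, 'v) module)" and "c == (copy_map K M :: 's => 'v)"
  and "d == (uncopy_map K M :: 'v => 's)"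
 shows "c:Lin K M C" "d:Lin K C M"
  "x .: M ==> d (c x) = x" "y .: C ==> c (d y) = y"
  "x .: M ==> c x .: C" "y .: C ==> d y .: M"
  "bij_betw c (Car M) (Car C)" "fd C" "vsp K C" "c:lin_maps K M C"
proof -
 obtain e phi where b: "dbasis M {..<vdim K M} e phi" using fd_dbasis[OF M] by blast
 note * = copy_facts[OF ad fd_vs[OF M] b, folded C_def c_def d_def]
 show "c:Lin K M C" "d:Lin K C M"
  "x .: M ==> d (c x) = x" "y .: C ==> c (d y) = y"
  "x .: M ==> c x .: C" "y .: C ==> d y .: M"
  "bij_betw c (Car M) (Car C)" "vsp K C" "c:lin_maps K M C"
  using * by blast+
 show "fd C" by (rule dbasis_fd[OF *(9,10)])
qed

text \<open>The universal property of the tensor product, carried over to its copy on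
  \<open>'v\<close>. The copy exists because the tensor product of finite-dimensional spaces is
  finite-dimensional.\<close>

lemma vtensor:
 fixes X :: "('k, 'v, 'x) module_scheme" and Y :: "('k, 'v, 'y) module_scheme"
 assumes ad: "all_dims TYPE('v)" and X: "fd X" and Y: "fd Y"
 shows vtensor_fd: "fd (vten K X Y)"
  and vtensor_vs: "vsp K (vten K X Y)"
  and vpure_bilin: "bilin X Y (vten K X Y) (vpure K X Y)"
  and vpure_closed: "[|x .: X; y .: Y|] ==> vpure K X Y x y .: vten K X Y"
  and vlift_lin: "[|vsp K P; bilin X Y P bt|] ==> vlift K X Y P bt:lin_maps K (vten K X Y) P"
  and vlift_hom: "[|vsp K P; bilin X Y P bt|] ==> vlift K X Y P bt:Lin K (vten K X Y) P"
  and vlift_pure: "[|vsp K P; bilin X Y P bt; x .: X; y .: Y|]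
   ==> vlift K X Y P bt (vpure K X Y x y) = bt x y"
  and vtensor_hom_eqI: "[|S:Lin K (vten K X Y) P; T:Lin K (vten K X Y) P;
   !!x y. [|x .: X; y .: Y|] ==> S (vpure K X Y x y) = T (vpure K X Y x y);
   z .: vten K X Y|] ==> S z = T z"
proof -
 note Xv = fd_vs[OF X] and Yv = fd_vs[OF Y]
 have M: "fd (ten K X Y)" using X Y by simp
 note c = fd_copy[OF ad M]
 show "fd (vten K X Y)" unfolding vtensor_def by (rule c(8))
 show "vsp K (vten K X Y)" unfolding vtensor_def by (rule c(9))
 show "bilin X Y (vten K X Y) (vpure K X Y)"
  unfolding vtensor_def vpure_def[abs_def] by (rule bilin_comp[OF pure_bilin[OF Xv Yv] c(1)])
 show "[|x .: X; y .: Y|] ==> vpure K X Y x y .: vten K X Y"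
  unfolding vtensor_def vpure_def by (rule c(5)) simp
 show lin: "vlift K X Y P bt:lin_maps K (vten K X Y) P" if "vsp K P" "bilin X Y P bt" for P :: "('k, 'p, 'q) module_scheme" and bt
  unfolding vlift_def vtensor_def
  by (rule lm_restrict[OF c(9) hom_comp[OF c(2) tlift_hom[OF Xv Yv that]]])
 show "vlift K X Y P bt:Lin K (vten K X Y) P" if "vsp K P" "bilin X Y P bt"
  by (rule lm_hom[OF lin[OF that]])
 show "[|vsp K P; bilin X Y P bt; x .: X; y .: Y|]
   ==> vlift K X Y P bt (vpure K X Y x y) = bt x y"
  unfolding vlift_def vtensor_def vpure_def by (simp add: c(3,5) tlift_pure[OF Xv Yv])
 show "S z = T z" if S: "S:Lin K (vten K X Y) P" and T: "T:Lin K (vten K X Y) P"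
  and eq: "!!x y. [|x .: X; y .: Y|] ==> S (vpure K X Y x y) = T (vpure K X Y x y)"
  and z: "z .: vten K X Y"
 proof -
  have "S (copy_map K (ten K X Y) t) = T (copy_map K (ten K X Y) t)"
   if "t .: ten K X Y" for t
   by (rule ten_hom_eqI[OF Xv Yv hom_comp[OF c(1) S[unfolded vtensor_def]] hom_comp[OF c(1) T[unfolded vtensor_def]] _ that])
    (use eq in "simp add: vpure_def")
  from this[OF c(6)[OF z[unfolded vtensor_def]]] show ?thesis by (simp add: c(4)[OF z[unfolded vtensor_def]])
 qed
qed

lemma vtensor_space_cong:
 assumes "Car V = Car V'" "add V = add V'" "smult V = smult V'"
  "Car W = Car W'" "add W = add W'" "smult W = smult W'"
 shows "vten K V W = vten K V' W'" "vpure K V W = vpure K V' W'"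
 unfolding vtensor_def vpure_def[abs_def] ten_space_cong[OF assms] by simp_all

lemma vlift_space_cong:
 assumes "Car V = Car V'" "add V = add V'" "smult V = smult V'"
  "Car W = Car W'" "add W = add W'" "smult W = smult W'"
  "Car P = Car P'" "add P = add P'" "smult P = smult P'"
 shows "vlift K V W P = vlift K V' W' P'"
 unfolding vlift_def[abs_def] ten_space_cong[OF assms(1-6)] vtensor_space_cong[OF assms(1-6)]
 by (intro ext) (simp add: tlift_space_cong[OF assms])

subsection \<open>Tensor products of bilinear maps\<close>

text \<open>The map taking \<open>x \<otimes> z\<close> and \<open>y \<otimes> w\<close> to
  \<open>mu x y \<otimes> nu z w\<close>. The multiplication of a tensor product of algebras and the
  coaction on a tensor product of comodules are both instances.\<close>

definition pair_map where
 "pair_map X Z Y W P Q mu nu s t =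
  tlift K X Z (ten K P Q) (%x z. tlift K Y W (ten K P Q)
   (%y w. pt K P Q (mu x y) (nu z w)) t) s"

lemma pair_map:
 assumes X: "vsp K X" and Z: "vsp K Z" and Y: "vsp K Y" and W: "vsp K W"
  and P: "vsp K P" and Q: "vsp K Q" and mu: "bilin X Y P mu" and nu: "bilin Z W Q nu"
 shows pair_map_bilin: "bilin (ten K X Z) (ten K Y W) (ten K P Q) (pair_map X Z Y W P Q mu nu)"
  and pair_map_pure: "[|x .: X; z .: Z; y .: Y; w .: W|] ==>
   pair_map X Z Y W P Q mu nu (pt K X Z x z) (pt K Y W y w) = pt K P Q (mu x y) (nu z w)"
proof -
 let ?T = "ten K P Q"
 have T: "vsp K ?T" and YW: "vsp K (ten K Y W)" using P Q Y W by simp_all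
 let ?g = "%x z y w. pt K P Q (mu x y) (nu z w)"
 have b: "bilin Y W ?T (?g x z)" if "x .: X" "z .: Z" for x z
  by (rule bilin_comp2[OF pure_bilin[OF P Q] bilinD(1)[OF mu that(1)] bilinD(1)[OF nu that(2)]])
 have hx: "(%x. ?g x z y w):Lin K X ?T" if "z .: Z" "y .: Y" "w .: W" for z y w
  using hom_comp[OF bilinD(2)[OF mu that(2)] pure_hom(2)[OF P Q bilinD(3)[OF nu that(1,3)]]] .
 have hz: "(%z. ?g x z y w):Lin K Z ?T" if "x .: X" "y .: Y" "w .: W" for x y w
  using hom_comp[OF bilinD(2)[OF nu that(3)] pure_hom(1)[OF P Q bilinD(3)[OF mu that(1,2)]]] .
 let ?h = "%t x z. tlift K Y W ?T (?g x z) t"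
 have bh: "bilin X Z ?T (?h t)" if t: "t .: ten K Y W" for t
 proof (rule bilin_homI)
  fix x assume x: "x .: X"
  show "?h t x:Lin K Z ?T"
   using bilinD(2)[OF bilin_lift_right[OF Y W Z T b[OF x] hz[OF x]] t] .
 next
  fix z assume z: "z .: Z"
  show "(%x. ?h t x z):Lin K X ?T"
   using bilinD(2)[OF bilin_lift_right[OF Y W X T b[OF _ z] hx[OF z]] t] .
 qed
 have hh: "(%t. ?h t x z):Lin K (ten K Y W) ?T" if "x .: X" "z .: Z" for x z
  by (rule tlift_hom[OF Y W T b[OF that]])
 show "bilin (ten K X Z) (ten K Y W) ?T (pair_map X Z Y W P Q mu nu)"
  unfolding pair_map_def[abs_def] by (rule bilin_lift_left[OF X Z YW T bh hh])
 show "pair_map X Z Y W P Q mu nu (pt K X Z x z) (pt K Y W y w) = pt K P Q (mu x y) (nu z w)"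
  if "x .: X" "z .: Z" "y .: Y" "w .: W" for x y z w
  unfolding pair_map_def using that
  by (subst tlift_pure[OF X Z T bh]) (simp_all add: tlift_pure[OF Y W T b])
qed

lemma pair_map_tsum:
 assumes X: "vsp K X" and Z: "vsp K Z" and Y: "vsp K Y" and W: "vsp K W"
  and P: "vsp K P" and Q: "vsp K Q" and mu: "bilin X Y P mu" and nu: "bilin Z W Q nu"
  and I: "finite I" and J: "finite J"
  and x: "!!i. i:I ==> x i .: X" and z: "!!i. i:I ==> z i .: Z"
  and y: "!!j. j:J ==> y j .: Y" and w: "!!j. j:J ==> w j .: W"
 shows "pair_map X Z Y W P Q mu nu (tsum X Z I x z) (tsum Y W J y w)
  = tsum P Q (I \<times> J) (%(i, j). mu (x i) (y j)) (%(i, j). nu (z i) (w j))"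
proof -
 note vs = X Z Y W P Q mu nu
 let ?T = "ten K P Q"
 let ?m = "pair_map X Z Y W P Q mu nu"
 note b = pair_map_bilin[OF vs]
 have T: "vsp K ?T" using P Q by simp
 have cl: "pt K P Q (mu (x i) (y j)) (nu (z i) (w j)) .: ?T" if "i:I" "j:J" for i j
  using that x y z w bilinD(3)[OF mu] bilinD(3)[OF nu] by simp
 have t: "tsum Y W J y w .: ten K Y W" using Y W y w by simp
 have "?m (tsum X Z I x z) (tsum Y W J y w) = Fs ?T (%i. ?m (pt K X Z (x i) (z i)) (tsum Y W J y w)) I"
  by (rule hom_tsum[OF X Z T bilinD(2)[OF b t]]) (use x z in auto)
 also have "... = Fs ?T (%i. Fs ?T (%j. pt K P Q (mu (x i) (y j)) (nu (z i) (w j))) J) I"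
 proof (rule vsum_cong[OF T refl])
  fix i assume i: "i:I"
  show "Fs ?T (%j. pt K P Q (mu (x i) (y j)) (nu (z i) (w j))) J .: ?T"
   using cl i by (intro vsum_closed[OF T]) auto
  have p: "pt K X Z (x i) (z i) .: ten K X Z" using x z i by simp
  have "?m (pt K X Z (x i) (z i)) (tsum Y W J y w)
   = Fs ?T (%j. ?m (pt K X Z (x i) (z i)) (pt K Y W (y j) (w j))) J"
   by (rule hom_tsum[OF Y W T bilinD(1)[OF b p]]) (use y w in auto)
  also have "... = Fs ?T (%j. pt K P Q (mu (x i) (y j)) (nu (z i) (w j))) J"
   by (rule vsum_cong[OF T refl]) (use cl i x z y w in "auto simp: pair_map_pure[OF vs]")
  finally show "?m (pt K X Z (x i) (z i)) (tsum Y W J y w)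
   = Fs ?T (%j. pt K P Q (mu (x i) (y j)) (nu (z i) (w j))) J" .
 qed
 also have "... = tsum P Q (I \<times> J) (%(i, j). mu (x i) (y j)) (%(i, j). nu (z i) (w j))"
  unfolding tsum_def by (subst vsum_Times[OF T I J]) (use cl in auto)
 finally show ?thesis .
qed

text \<open>If \<open>h\<close> turns \<open>mu\<close> into the product of \<open>f\<close> and
  \<open>g\<close>, slicing by \<open>h\<close> splits into slicing by \<open>f\<close> and by
  \<open>g\<close>. For the coaction on a tensor product this says that coefficients
  multiply.\<close>

lemma slice_pair_map:
 assumes X: "vsp K X" and Z: "vsp K Z" and Y: "vsp K Y" and W: "vsp K W"
  and P: "vsp K P" and Q: "vsp K Q" and mu: "bilin X Y P mu" and nu: "bilin Z W Q nu"
  and f: "f:Lin K X (ssp K)" and g: "g:Lin K Y (ssp K)"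
  and h: "h:Lin K P (ssp K)"
  and hfg: "!!x y. x .: X ==> y .: Y ==> h (mu x y) = f x **[K] g y"
  and s: "s .: ten K X Z" and t: "t .: ten K Y W"
 shows "slice P Q h (pair_map X Z Y W P Q mu nu s t) = nu (slice X Z f s) (slice Y W g t)"
proof -
 note vs = X Z Y W P Q mu nu
 note b = pair_map_bilin[OF vs] and sh = slice_hom[OF P Q h]
 note fc = hom_cl[OF f, simplified] and gc = hom_cl[OF g, simplified]
 have st: "slice Y W g t .: W" by (rule hom_cl[OF slice_hom[OF Y W g] t])
 show ?thesis
 proof (rule ten_hom_eqI[OF X Z hom_comp[OF bilinD(2)[OF b t] sh] hom_comp[OF slice_hom[OF X Z f] bilinD(2)[OF nu st]] _ s])
  fix x z assume xz: "x .: X" "z .: Z"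
  have p: "pt K X Z x z .: ten K X Z" and c: "f x *[Z] z .: Z"
   using xz Z fc by simp_all
  show "slice P Q h (pair_map X Z Y W P Q mu nu (pt K X Z x z) t) = nu (slice X Z f (pt K X Z x z)) (slice Y W g t)"
   unfolding slice_pure[OF X Z f xz]
  proof (rule ten_hom_eqI[OF Y W hom_comp[OF bilinD(1)[OF b p] sh] hom_comp[OF slice_hom[OF Y W g] bilinD(1)[OF nu c]] _ t])
   fix y w assume yw: "y .: Y" "w .: W"
   show "slice P Q h (pair_map X Z Y W P Q mu nu (pt K X Z x z) (pt K Y W y w))
    = nu (f x *[Z] z) (slice Y W g (pt K Y W y w))"
    using xz yw fc gc Z W Q
    by (simp add: pair_map_pure[OF vs] slice_pure[OF P Q h] slice_pure[OF Y W g] bilinD[OF mu] bilinD[OF nu] hfg vs_sm_smult K.m_comm)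
  qed
 qed
qed

text \<open>Terms outside the image of \<open>h\<close> vanish, one of their factors being zero.
  This is how sums over a block matrix shrink to a single block.\<close>

lemma tsum_support:
 assumes V: "vsp K V" and W: "vsp K W" and L: "finite L" and h: "inj_on h I" "h ` I <= L"
  and v: "!!l. l:L ==> v l .: V" and w: "!!l. l:L ==> w l .: W"
  and z: "!!l. l:L ==> l ~: h ` I ==> v l = 0[V] | w l = 0[W]"
 shows "tsum V W L v w = tsum V W I (%i. v (h i)) (%i. w (h i))"
proof -
 let ?T = "ten K V W"
 have T: "vsp K ?T" using V W by simp
 have zero: "pt K V W (v l) (w l) = 0[?T]" if "l:L - h ` I" for l
  using z[of l] that v w hom_zero[OF V T pure_hom(2)[OF V W]] hom_zero[OF W T pure_hom(1)[OF V W]] by fastforce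
 have L': "L = h ` I Un (L - h ` I)" using h by auto
 have fI: "finite I" using L h by (meson finite_imageD finite_subset)
 have "tsum V W L v w = Fs ?T (%l. pt K V W (v l) (w l)) (h ` I Un (L - h ` I))"
  using L' unfolding tsum_def by simp
 also have "... = Fs ?T (%l. pt K V W (v l) (w l)) (h ` I) +[?T] Fs ?T (%l. pt K V W (v l) (w l)) (L - h ` I)"
  using L h v w fI by (intro vsum_Un[OF T]) auto
 also have "Fs ?T (%l. pt K V W (v l) (w l)) (L - h ` I) = 0[?T]"
  using zero by (rule vsum_zero[OF T])
 also have "Fs ?T (%l. pt K V W (v l) (w l)) (h ` I) = tsum V W I (%i. v (h i)) (%i. w (h i))"
  unfolding tsum_def using h v w by (intro vsum_reindex[OF T]) auto
 finally show ?thesis using V W h v w by (simp add: image_subset_iff)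
qed

end

context hopf_setup
begin

subsection \<open>Tensor products, units and direct sums of comodules\<close>

definition tmul where "tmul = pair_map A A A A A A (mult A) (mult A)"

lemma ten_algebra_simps:
 "Car (tensor_algebra K A A) = Car AA" "mult (tensor_algebra K A A) = tmul"
 "one (tensor_algebra K A A) = pt K A A 1[A] 1[A]"
 by (simp_all add: tensor_algebra_def Let_def tmul_def pair_map_def[abs_def])

lemma tmul_bilin: "bilin AA AA AA tmul"
 unfolding tmul_def by (rule pair_map_bilin[OF A_vs A_vs A_vs A_vs A_vs A_vs am_bilin am_bilin])

lemma tmul_pure: "[|a .: A; b .: A; c .: A; d .: A|] ==>
  tmul (pt K A A a b) (pt K A A c d) = pt K A A (a **[A] c) (b **[A] d)"
 unfolding tmul_def by (rule pair_map_pure[OF A_vs A_vs A_vs A_vs A_vs A_vs am_bilin am_bilin])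

lemma comult_mult: "[|a .: A; b .: A|] ==> comult A (a **[A] b) = tmul (comult A a) (comult A b)"
 using ring_hom_mult[OF comult_hom] by (simp add: ten_algebra_simps)

lemma comult_one: "comult A 1[A] = pt K A A 1[A] 1[A]"
 using ring_hom_one[OF comult_hom] by (simp add: ten_algebra_simps)

lemma counit_mult: "[|a .: A; b .: A|] ==> counit A (a **[A] b) = counit A a **[K] counit A b"
 using ring_hom_mult[OF counit_hom] by simp

lemma counit_one [simp]: "counit A 1[A] = 1[K]"
 using ring_hom_one[OF counit_hom] by simp

lemma counit_zero [simp]: "counit A 0[A] = 0[K]"
 using hom_zero[OF A_vs vs_ssp counit_linear] by simp

lemma comult_zero [simp]: "comult A 0[A] = 0[AA]"
 using hom_zero[OF A_vs AA_vs comult_linear] .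

lemma ObjD:
 assumes "X:OB K A"
 shows "rcom K A X" "fd X" "vsp K X"
 using assms coD(1)[of X] by (auto simp: Comod_simps fd_def)

lemma ObjI: "rcom K A X ==> fd X ==> X:OB K A"
 by (simp add: Comod_simps fd_def)

text \<open>Copying does not change the matrix of a coaction in corresponding bases. This serves
  both for tensor products and for the unit object.\<close>

lemma copy_comodule_object:
 fixes M :: "('k, 's) module"
 assumes ad: "all_dims TYPE('v)" and M: "vsp K M" and b: "dbasis M I e phi"
  and rh: "rh:Lin K M (ten K M A)" and mm: "mmat I m"
  and eq: "!!q. q:I ==> rh (e q) = tsum M A I e (%p. m p q)"
 shows "(copy_comodule K A M rh :: ('k, 'a, 'v) comodule):OB K A"
  and "dbasis (copy_comodule K A M rh :: ('k, 'a, 'v) comodule) I (%i. copy_map K M (e i)) (%i x. phi i (uncopy_map K M x))"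
  and "x .: M ==> coact (copy_comodule K A M rh :: ('k, 'a, 'v) comodule) (copy_map K M x)
   = tmap K M A (copy_space K M) A (copy_map K M) (%a. a) (rh x)"
proof -
 let ?C = "copy_space K M :: ('k, 'v) module"
 let ?Y = "copy_comodule K A M rh :: ('k, 'a, 'v) comodule"
 note c = copy_facts[OF ad M b]
 have tm: "tmap K M A ?C A (copy_map K M) (%a. a):Lin K (ten K M A) (ten K ?C A)"
  by (rule tmap_hom[OF M A_vs c(9) A_vs c(1) hom_id])
 show co: "coact ?Y (copy_map K M x) = tmap K M A (copy_space K M) A (copy_map K M) (%a. a) (rh x)"
  if "x .: M" for x
  using that by (simp add: copy_comodule_def c(4))
 show b': "dbasis ?Y I (%i. copy_map K M (e i)) (%i x. phi i (uncopy_map K M x))"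
  using c(10) by (simp add: copy_comodule_def)
 have Yv: "vsp K ?Y" using c(9) by (simp add: copy_comodule_def)
 have "rcom K A ?Y"
 proof (rule matrix_comodule[OF Yv b' mm])
  show "coact ?Y:Lin K ?Y (ten K ?Y A)"
   using hom_comp[OF hom_comp[OF c(2) rh] tm] by (simp add: copy_comodule_def)
  show "coact ?Y (copy_map K M (e q)) = tsum ?Y A I (%i. copy_map K M (e i)) (%p. m p q)" if q: "q:I" for q
  proof -
   have "coact ?Y (copy_map K M (e q)) = tmap K M A ?C A (copy_map K M) (%a. a) (tsum M A I e (%p. m p q))"
    using co[OF dbD(3)[OF b q]] eq[OF q] by simp
   also have "... = tsum ?C A I (%i. copy_map K M (e i)) (%p. m p q)"
    by (rule tmap_tsum[OF M A_vs c(9) A_vs c(1) hom_id]) (use dbD(3)[OF b] mmD(2)[OF mm] q in auto)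
   finally show ?thesis by (simp add: copy_comodule_def)
  qed
 qed
 then show "?Y:OB K A" using dbasis_fd[OF Yv b'] by (rule ObjI)
qed

abbreviation copair where
 "copair X Y == pair_map X A Y A (ten K X Y) A (pt K X Y) (mult A)"

lemma ten_coact_alt:
 "tensor_coact K A X Y = tlift K X Y (ten K (ten K X Y) A)
  (%x y. copair X Y (coact X x) (coact Y y))"
 unfolding tensor_coact_def Let_def pair_map_def ..

lemma copair_bilin:
 "vsp K X ==> vsp K Y ==>
  bilin (ten K X A) (ten K Y A) (ten K (ten K X Y) A) (copair X Y)"
 by (rule pair_map_bilin) (simp_all add: pure_bilin am_bilin)

lemma tensor_coact:
 assumes X: "rcom K A X" and Y: "rcom K A Y"
 shows ten_coact_hom: "tensor_coact K A X Y:Lin K (ten K X Y) (ten K (ten K X Y) A)"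
  and ten_coact_pure: "[|x .: X; y .: Y|] ==>
   tensor_coact K A X Y (pt K X Y x y) = copair X Y (coact X x) (coact Y y)"
proof -
 note Xv = coD(1)[OF X] and Yv = coD(1)[OF Y]
 have T: "vsp K (ten K (ten K X Y) A)" using Xv Yv by simp
 note b = bilin_comp2[OF copair_bilin[OF Xv Yv] coD(2)[OF X] coD(2)[OF Y]]
 show "tensor_coact K A X Y:Lin K (ten K X Y) (ten K (ten K X Y) A)"
  unfolding ten_coact_alt by (rule tlift_hom[OF Xv Yv T b])
 show "[|x .: X; y .: Y|] ==>
   tensor_coact K A X Y (pt K X Y x y) = copair X Y (coact X x) (coact Y y)"
  unfolding ten_coact_alt by (rule tlift_pure[OF Xv Yv T b])
qed

text \<open>The Kronecker product of two multiplicative matrices; it is multiplicative because the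
  comultiplication and the counit are algebra maps.\<close>

lemma mult_matrix_Times:
 assumes m: "mmat I m" and n: "mmat J n"
 shows "mmat (I \<times> J) (%(p, p') (q, q'). m p q **[A] n p' q')"
 unfolding mmat_def
proof (intro conjI ballI)
 note mc = mmD(1,2)[OF m] and nc = mmD(1,2)[OF n]
 show "finite (I \<times> J)" using mc nc by simp
 fix P Q assume "P:I \<times> J" "Q:I \<times> J"
 then obtain p p' q q' where *: "P = (p, p')" "Q = (q, q')" "p:I" "q:I" "p':J" "q':J" by auto
 note mpq = mc(2)[OF *(3,4)] and npq = nc(2)[OF *(5,6)]
 show "(case P of (p, p') => %(q, q'). m p q **[A] n p' q') Q .: A" using * mpq npq by simp
 have "comult A (m p q **[A] n p' q') = tmul (tsum A A I (m p) (%r. m r q)) (tsum A A J (n p') (%r. n r q'))"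
  using comult_mult[OF mpq npq] mmD(3)[OF m] mmD(3)[OF n] * by simp
 also have "... = tsum A A (I \<times> J) (%(i, j). m p i **[A] n p' j) (%(i, j). m i q **[A] n j q')"
  unfolding tmul_def
  by (rule pair_map_tsum[OF A_vs A_vs A_vs A_vs A_vs A_vs am_bilin am_bilin mc(1) nc(1)]) (use mc nc * in auto)
 finally show "comult A ((case P of (p, p') => %(q, q'). m p q **[A] n p' q') Q)
  = tsum A A (I \<times> J) ((case P of (p, p') => %(q, q'). m p q **[A] n p' q')) (%r. (case r of (p, p') => %(q, q'). m p q **[A] n p' q') Q)"
  using * by (simp add: case_prod_beta')
 show "counit A ((case P of (p, p') => %(q, q'). m p q **[A] n p' q') Q) = (if P = Q then 1[K] else 0[K])"
  using * counit_mult[OF mpq npq] mmD(4)[OF m] mmD(4)[OF n] by simp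
qed

lemma ct_object:
 fixes X Y :: "('k, 'a, 'v) comodule"
 assumes ad: "all_dims TYPE('v)" and X: "X:OB K A" and Y: "Y:OB K A"
 shows "comod_tensor K A X Y:OB K A"
  and "vdim K (comod_tensor K A X Y) = vdim K X * vdim K Y"
  and "[|x .: X; y .: Y|] ==> coact (comod_tensor K A X Y) (vpure K X Y x y)
   = tmap K (ten K X Y) A (vten K X Y) A (copy_map K (ten K X Y)) (%a. a)
     (copair X Y (coact X x) (coact Y y))"
  and ct_simps: "Car (comod_tensor K A X Y) = Car (vten K X Y)" "add (comod_tensor K A X Y) = add (vten K X Y)"
   "smult (comod_tensor K A X Y) = smult (vten K X Y)" "zero (comod_tensor K A X Y) = zero (vten K X Y)"
proof -
 note Xo = ObjD[OF X] and Yo = ObjD[OF Y]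
 let ?M = "ten K X Y"
 obtain e phi f ps where b: "dbasis X {..<vdim K X} e phi" and c: "dbasis Y {..<vdim K Y} f ps"
  using fd_dbasis Xo(2) Yo(2) by meson
 let ?I = "{..<vdim K X}" and ?J = "{..<vdim K Y}"
 obtain ch where d: "dbasis ?M (?I \<times> ?J) (%(i, j). pt K X Y (e i) (f j)) ch"
  using ten_dbasis[OF Xo(3) Yo(3) b c] by blast
 define m where "m = (%p q. slice X A (phi p) (coact X (e q)))"
 define n where "n = (%p q. slice Y A (ps p) (coact Y (f q)))"
 have m: "mmat ?I m" "!!q. q:?I ==> coact X (e q) = tsum X A ?I e (%p. m p q)"
  using comodule_basis_matrix[OF Xo(1) b] unfolding m_def by auto
 have n: "mmat ?J n" "!!q. q:?J ==> coact Y (f q) = tsum Y A ?J f (%p. n p q)"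
  using comodule_basis_matrix[OF Yo(1) c] unfolding n_def by auto
 have M: "vsp K ?M" using Xo Yo by simp
 have eq: "tensor_coact K A X Y (case q of (i, j) => pt K X Y (e i) (f j))
  = tsum ?M A (?I \<times> ?J) (%(i, j). pt K X Y (e i) (f j)) (%p. (%(p, p') (q, q'). m p q **[A] n p' q') p q)"
  if q0: "q:?I \<times> ?J" for q
 proof -
  obtain i j where q: "q = (i, j)" "i:?I" "j:?J" using q0 by auto
  have "tensor_coact K A X Y (pt K X Y (e i) (f j)) = copair X Y (tsum X A ?I e (%p. m p i)) (tsum Y A ?J f (%p. n p j))"
   using ten_coact_pure[OF Xo(1) Yo(1) dbD(3)[OF b q(2)] dbD(3)[OF c q(3)]] m(2)[OF q(2)] n(2)[OF q(3)] by simp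
  also have "... = tsum ?M A (?I \<times> ?J) (%(i, j). pt K X Y (e i) (f j)) (%(p, p'). m p i **[A] n p' j)"
   by (rule pair_map_tsum[OF Xo(3) A_vs Yo(3) A_vs M A_vs pure_bilin[OF Xo(3) Yo(3)] am_bilin])
    (use dbD(3)[OF b] dbD(3)[OF c] mmD(2)[OF m(1)] mmD(2)[OF n(1)] q in auto)
  finally show ?thesis using q by (simp add: case_prod_beta')
 qed
 note * = copy_comodule_object[OF ad M d ten_coact_hom[OF Xo(1) Yo(1)] mult_matrix_Times[OF m(1) n(1)] eq, folded comod_tensor_def]
 show ob: "comod_tensor K A X Y:OB K A" by (rule *(1))
 show "vdim K (comod_tensor K A X Y) = vdim K X * vdim K Y"
  using dbasis_dim(2)[OF ObjD(3)[OF ob] *(2)] by (simp add: card_cartesian_product)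
 show "coact (comod_tensor K A X Y) (vpure K X Y x y)
   = tmap K (ten K X Y) A (vten K X Y) A (copy_map K (ten K X Y)) (%a. a)
     (copair X Y (coact X x) (coact Y y))" if "x .: X" "y .: Y"
  unfolding vpure_def vtensor_def using *(3)[OF _ pure_closed[OF that]] ten_coact_pure[OF Xo(1) Yo(1) that] by simp
 show "Car (comod_tensor K A X Y) = Car (vten K X Y)" "add (comod_tensor K A X Y) = add (vten K X Y)"
   "smult (comod_tensor K A X Y) = smult (vten K X Y)" "zero (comod_tensor K A X Y) = zero (vten K X Y)"
  by (simp_all add: comod_tensor_def copy_comodule_def vtensor_def)
qed

text \<open>The unit object is the comodule of the 1-by-1 multiplicative matrix with entry
  \<open>1[A]\<close>.\<close>

lemma cu_object:
 assumes ad: "all_dims TYPE('v)"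
 shows "(comod_unit K A :: ('k, 'a, 'v) comodule):OB K A"
  and "vdim K (comod_unit K A :: ('k, 'a, 'v) comodule) = 1"
  and "r .: K ==> coact (comod_unit K A :: ('k, 'a, 'v) comodule) (copy_map K (ssp K) r)
   = pt K (copy_space K (ssp K)) A (copy_map K (ssp K) r) 1[A]"
  and cu_simps: "Car (comod_unit K A) = Car (copy_space K (ssp K))"
   "add (comod_unit K A) = add (copy_space K (ssp K))"
   "smult (comod_unit K A) = smult (copy_space K (ssp K))"
   "zero (comod_unit K A) = zero (copy_space K (ssp K))"
proof -
 let ?S = "ssp K"
 let ?rh = "%r. pt K ?S A r 1[A]"
 have mm: "mmat {()} (%_ _. 1[A])"
  unfolding mmat_def tsum_def using vsum_single[OF AA_vs, of "{()}" "()"] by (simp add: comult_one)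
 have rh: "?rh:Lin K ?S (ten K ?S A)" by (rule pure_hom(2)) simp_all
 have eq: "?rh 1[K] = tsum ?S A {()} (%_. 1[K]) (%p. 1[A])"
  unfolding tsum_def using vsum_single[OF ten_vs[OF vs_ssp A_vs], of "{()}" "()" "%_. ?rh 1[K]"] by simp
 note * = copy_comodule_object[OF ad vs_ssp scalar_dbasis rh mm eq, folded comod_unit_def]
 show ob: "(comod_unit K A :: ('k, 'a, 'v) comodule):OB K A" by (rule *(1))
 show "vdim K (comod_unit K A :: ('k, 'a, 'v) comodule) = 1"
  using dbasis_dim(2)[OF ObjD(3)[OF ob] *(2)] by simp
 show "coact (comod_unit K A :: ('k, 'a, 'v) comodule) (copy_map K (ssp K) r)
   = pt K (copy_space K (ssp K)) A (copy_map K (ssp K) r) 1[A]" if "r .: K"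
  using *(3)[of r] that tmap_pure[OF vs_ssp A_vs copy_facts(9)[OF ad vs_ssp scalar_dbasis] A_vs
    copy_facts(1)[OF ad vs_ssp scalar_dbasis] hom_id, of r "1[A]"] by simp
 show "Car (comod_unit K A) = Car (copy_space K (ssp K))"
   "add (comod_unit K A) = add (copy_space K (ssp K))"
   "smult (comod_unit K A) = smult (copy_space K (ssp K))"
   "zero (comod_unit K A) = zero (copy_space K (ssp K))"
  by (simp_all add: comod_unit_def copy_comodule_def)
qed

text \<open>The functional \<open>f \<otimes> g\<close> slices the coaction of the tensor product
  into the product of the two slices, so products of coefficients are again coefficients.\<close>

lemma coef_tensor:
 fixes X Y :: "('k, 'a, 'v) comodule"
 assumes ad: "all_dims TYPE('v)" and X: "X:OB K A" and Y: "Y:OB K A"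
  and f: "f:Lin K X (ssp K)" and g: "g:Lin K Y (ssp K)"
  and x: "x .: X" and y: "y .: Y"
 defines "h == vlift K X Y (ssp K) (%x y. f x **[K] g y)"
 shows "h:Lin K (comod_tensor K A X Y) (ssp K)"
  and "coef K A (comod_tensor K A X Y) h (vpure K X Y x y) = coef K A X f x **[A] coef K A Y g y"
proof -
 note Xo = ObjD[OF X] and Yo = ObjD[OF Y] and vt = vtensor[OF ad Xo(2) Yo(2)]
 have b: "bilin X Y (ssp K) (%x y. f x **[K] g y)"
  using hom_cl[OF f] hom_cl[OF g] hom_add[OF f] hom_add[OF g] hom_smult[OF f] hom_smult[OF g]
  by (intro bilinI) (auto simp: K.l_distr K.r_distr K.m_ac)
 note hh = vt(6)[OF vs_ssp b, folded h_def] and hp = vt(7)[OF vs_ssp b, folded h_def]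
 let ?M = "ten K X Y"
 have M: "vsp K ?M" using Xo Yo by simp
 note c = fd_copy[OF ad fd_tensor[OF Xo(2) Yo(2)], folded vtensor_def]
 show "h:Lin K (comod_tensor K A X Y) (ssp K)"
  using hh by (simp add: module_hom_cong(1)[OF ct_simps(1-3)[OF ad X Y] refl refl refl])
 have s: "copair X Y (coact X x) (coact Y y) .: (ten K ?M A)"
  by (rule bilinD(3)[OF copair_bilin[OF Xo(3) Yo(3)] coD(3)[OF Xo(1) x] coD(3)[OF Yo(1) y]])
 have "coef K A (comod_tensor K A X Y) h (vpure K X Y x y)
  = slice (vten K X Y) A h (tmap K ?M A (vten K X Y) A (copy_map K ?M) (%a. a) (copair X Y (coact X x) (coact Y y)))"
  unfolding coef_slice ct_object(3)[OF ad X Y x y] slice_def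
  by (rule arg_cong[where f="%h. h _"], rule tlift_space_cong)
   (simp_all add: ct_simps[OF ad X Y])
 also have "... = slice ?M A (%v. h (copy_map K ?M v)) (copair X Y (coact X x) (coact Y y))"
  by (rule slice_tensor_map[OF M A_vs vt(2) A_vs c(1) hom_id hh s])
 also have "... = slice X A f (coact X x) **[A] slice Y A g (coact Y y)"
  by (rule slice_pair_map[OF Xo(3) A_vs Yo(3) A_vs M A_vs pure_bilin[OF Xo(3) Yo(3)] am_bilin f g hom_comp[OF c(1) hh] _
     coD(3)[OF Xo(1) x] coD(3)[OF Yo(1) y]])
   (use hp in "simp add: vpure_def")
 finally show "coef K A (comod_tensor K A X Y) h (vpure K X Y x y) = coef K A X f x **[A] coef K A Y g y"
  by (simp add: coef_slice)
qed

lemma coef_unit: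
 assumes ad: "all_dims TYPE('v)" and r: "r .: K"
  and f: "f:Lin K (copy_space K (ssp K) :: ('k, 'v) module) (ssp K)"
 shows "coef K A (comod_unit K A :: ('k, 'a, 'v) comodule) f (copy_map K (ssp K) r)
  = f (copy_map K (ssp K) r) *[A] 1[A]"
proof -
 note c = fd_copy[OF ad fd_scalar]
 have "coef K A (comod_unit K A :: ('k, 'a, 'v) comodule) f (copy_map K (ssp K) r)
  = slice (copy_space K (ssp K)) A f (pt K (copy_space K (ssp K)) A (copy_map K (ssp K) r) 1[A])"
  unfolding coef_slice cu_object(3)[OF ad r] slice_def
  by (rule arg_cong[where f="%h. h _"], rule tlift_space_cong)
   (simp_all add: cu_simps[OF ad])
 then show ?thesis using r c(5)[of r] slice_pure[OF c(9) A_vs f] by simp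
qed

text \<open>\<open>h\<close> embeds one index set as a block of another. Vanishing entries on one
  side of the block make the inclusion a comodule map, and vanishing entries on the other side do so
  for the projection.\<close>

lemma block_homs:
 assumes X: "rcom K A X" and b: "dbasis X I e phi"
  and rh: "!!q. q:I ==> coact X (e q) = tsum X A I e (%p. m p q)" and m: "!!p q. p:I ==> q:I ==> m p q .: A"
  and Z: "rcom K A Z" and c: "dbasis Z L z ze"
  and rhz: "!!q. q:L ==> coact Z (z q) = tsum Z A L z (%p. n p q)" and n: "!!p q. p:L ==> q:L ==> n p q .: A"
  and h: "inj_on h I" "h ` I <= L"
  and nm: "!!p q. p:I ==> q:I ==> n (h p) (h q) = m p q"
  and n0: "!!p q. p:I ==> q:L ==> q ~: h ` I ==> n (h p) q = 0[A]"
  and n0': "!!p q. p:I ==> q:L ==> q ~: h ` I ==> n q (h p) = 0[A]"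
 shows "EX i:chom K A X Z. EX p:chom K A Z X. (ALL q:I. i (e q) = z (h q)) & (ALL q:I. p (z (h q)) = e q)
  & (ALL l:L. l ~: h ` I --> p (z l) = 0[X])"
proof -
 note Xv = coD(1)[OF X] and Zv = coD(1)[OF Z]
 note e = dbD(3)[OF b] and zc = dbD(3)[OF c] and finL = dbD(2)[OF c]
 have hL: "h q:L" if "q:I" for q using h that by auto
 obtain i0 where i0: "i0:Lin K X Z" "ALL q:I. i0 (e q) = z (h q)"
  using dbasis_hom_ex[OF Xv Zv b, of "%q. z (h q)"] zc hL by auto
 define w where "w l = (if l:h ` I then e (the_inv_into I h l) else 0[X])" for l
 have wh: "w (h q) = e q" if "q:I" for q using that h by (simp add: w_def the_inv_into_f_f)
 have w0: "w l = 0[X]" if "l ~: h ` I" for l using that by (simp add: w_def)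
 have wc: "w l .: X" if "l:L" for l
  using Xv e h by (cases "l:h ` I") (auto simp: w0 wh)
 obtain p0 where p0: "p0:Lin K Z X" "ALL l:L. p0 (z l) = w l"
  using dbasis_hom_ex[OF Zv Xv c, of w] wc by auto
 define i where "i = restrict i0 (Car X)"
 define p where "p = restrict p0 (Car Z)"
 have il: "i:lin_maps K X Z" unfolding i_def by (rule lm_restrict[OF Xv i0(1)])
 have pl: "p:lin_maps K Z X" unfolding p_def by (rule lm_restrict[OF Zv p0(1)])
 have ie: "i (e q) = z (h q)" if "q:I" for q using i0(2) e that by (simp add: i_def)
 have pz: "p (z l) = w l" if "l:L" for l using p0(2) zc that by (simp add: p_def)
 have "i:chom K A X Z"
 proof (rule comod_homI[OF X Z b il])
  fix q assume q: "q:I"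
  have "tmap K X A Z A i (%a. a) (coact X (e q)) = tsum Z A I (%p. i (e p)) (%p. m p q)"
   unfolding rh[OF q] by (rule tmap_tsum[OF Xv A_vs Zv A_vs lm_hom[OF il] hom_id]) (use e m q in auto)
  also have "... = tsum Z A I (%p. z (h p)) (%p. n (h p) (h q))"
   by (rule tsum_cong) (use Zv zc hL n q ie nm m in auto)
  also have "... = tsum Z A L z (%p. n p (h q))"
   by (rule tsum_support[OF Zv A_vs finL h, symmetric]) (use zc n hL q n0' in auto)
  finally show "coact Z (i (e q)) = tmap K X A Z A i (%a. a) (coact X (e q))"
   using rhz[OF hL[OF q]] ie[OF q] by simp
 qed
 moreover have "p:chom K A Z X"
 proof (rule comod_homI[OF Z X c pl])
  fix q assume q: "q:L"
  have "tmap K Z A X A p (%a. a) (coact Z (z q)) = tsum X A L (%l. p (z l)) (%l. n l q)"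
   unfolding rhz[OF q] by (rule tmap_tsum[OF Zv A_vs Xv A_vs lm_hom[OF pl] hom_id]) (use zc n q in auto)
  also have "... = tsum X A L w (%l. n l q)"
   by (rule tsum_cong) (use Xv wc n q pz in auto)
  also have "... = tsum X A I (%p. w (h p)) (%p. n (h p) q)"
   by (rule tsum_support[OF Xv A_vs finL h]) (use wc n q w0 in auto)
  also have "... = coact X (w q)"
  proof (cases "q:h ` I")
   case True
   then obtain q' where q': "q':I" "q = h q'" by auto
   have "tsum X A I (%p. w (h p)) (%p. n (h p) q) = tsum X A I e (%p. m p q')"
    by (rule tsum_cong) (use Xv e m q' wh nm in auto)
   then show ?thesis using rh[OF q'(1)] q' wh by simp
  next
   case False
   have "tsum X A I (%p. w (h p)) (%p. n (h p) q) = 0[ten K X A]"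
    unfolding tsum_def
   proof (rule vsum_zero)
    fix p assume p: "p:I"
    show "pt K X A (w (h p)) (n (h p) q) = 0[ten K X A]"
     using hom_zero[OF A_vs _ pure_hom(1)[OF Xv A_vs wc[OF hL[OF p]]]] Xv n0[OF p q False] by simp
   qed (use Xv in simp)
   then show ?thesis using hom_zero[OF Xv _ coD(2)[OF X]] Xv w0[OF False] by simp
  qed
  finally show "coact X (p (z q)) = tmap K Z A X A p (%a. a) (coact Z (z q))"
   using pz[OF q] by simp
 qed
 ultimately show ?thesis using ie pz wh w0 hL by (intro bexI[of _ i] bexI[of _ p]) auto
qed

text \<open>Built from a block diagonal matrix and not from a product of carriers, because the sum
  must again live on \<open>'v\<close>.\<close>

lemma direct_sum:
 fixes X Y :: "('k, 'a, 'v) comodule"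
 assumes ad: "all_dims TYPE('v)" and X: "X:OB K A" and Y: "Y:OB K A"
 shows "EX (Z :: ('k, 'a, 'v) comodule) i j p q. Z:OB K A
  & i:chom K A X Z & j:chom K A Y Z & p:chom K A Z X & q:chom K A Z Y
  & (ALL x:Car X. p (i x) = x & q (i x) = 0[Y]) & (ALL y:Car Y. q (j y) = y & p (j y) = 0[X])
  & vdim K Z = vdim K X + vdim K Y"
proof -
 note Xo = ObjD[OF X] and Yo = ObjD[OF Y]
 let ?I = "{..<vdim K X}" and ?J = "{..<vdim K Y}"
 let ?L = "?I <+> ?J"
 obtain e phi f ps where b: "dbasis X ?I e phi" and c: "dbasis Y ?J f ps"
  using fd_dbasis Xo(2) Yo(2) by meson
 define m where "m = (%p q. slice X A (phi p) (coact X (e q)))"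
 define n where "n = (%p q. slice Y A (ps p) (coact Y (f q)))"
 have m: "mmat ?I m" "!!q. q:?I ==> coact X (e q) = tsum X A ?I e (%p. m p q)"
  using comodule_basis_matrix[OF Xo(1) b] unfolding m_def by auto
 have n: "mmat ?J n" "!!q. q:?J ==> coact Y (f q) = tsum Y A ?J f (%p. n p q)"
  using comodule_basis_matrix[OF Yo(1) c] unfolding n_def by auto
 define M where "M P Q = (case P of Inl p => (case Q of Inl q => m p q | Inr q => 0[A])
  | Inr p => (case Q of Inl q => 0[A] | Inr q => n p q))" for P Q
 have Ms: "M (Inl p) (Inl q) = m p q" "M (Inl p) (Inr q') = 0[A]" "M (Inr p') (Inl q) = 0[A]" "M (Inr p') (Inr q') = n p' q'" for p q p' q'
  by (simp_all add: M_def)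
 note mc = mmD(2)[OF m(1)] and nc = mmD(2)[OF n(1)]
 have Mc: "M P Q .: A" if "P:?L" "Q:?L" for P Q
  using that mc nc by (auto simp: Ms)
 have fin: "finite ?L" by simp
 have injl: "inj_on Inl ?I" "Inl ` ?I <= ?L" and injr: "inj_on Inr ?J" "Inr ` ?J <= ?L" by auto
 \<comment> \<open>In an off-diagonal position every term has a zero factor, so the sum reduces to
   the one over the empty index set, with arbitrary embedding.\<close>
 have sp: "tsum A A ?L (M P) (%r. M r Q) = 0[AA]" if z: "!!r. r:?L ==> M P r = 0[A] | M r Q = 0[A]" and "P:?L" "Q:?L" for P Q
 proof -
  have "tsum A A ?L (M P) (%r. M r Q) = tsum A A {} (%i. M P (undefined i)) (%i. M (undefined i) Q)"
   by (rule tsum_support[OF A_vs A_vs fin]) (use z Mc that in auto)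
  then show ?thesis by (simp add: tsum_def)
 qed
 have "mmat ?L M"
  unfolding mmat_def
 proof (intro conjI ballI fin)
  fix P Q assume PQ: "P:?L" "Q:?L"
  show "M P Q .: A" by (rule Mc[OF PQ])
  consider (ll) p q where "P = Inl p" "Q = Inl q" "p:?I" "q:?I" | (lr) p q where "P = Inl p" "Q = Inr q" "p:?I" "q:?J"
   | (rl) p q where "P = Inr p" "Q = Inl q" "p:?J" "q:?I" | (rr) p q where "P = Inr p" "Q = Inr q" "p:?J" "q:?J"
   using PQ by (elim PlusE) blast+
  note cs = this
  show "comult A (M P Q) = tsum A A ?L (M P) (%r. M r Q)"
  proof (cases rule: cs)
   case ll
   have "tsum A A ?L (M P) (%r. M r Q) = tsum A A ?I (%i. M P (Inl i)) (%i. M (Inl i) Q)"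
    by (rule tsum_support[OF A_vs A_vs fin injl]) (use Mc PQ ll in "auto simp: Ms")
   then show ?thesis using ll mmD(3)[OF m(1)] by (simp add: Ms)
  next
   case rr
   have "tsum A A ?L (M P) (%r. M r Q) = tsum A A ?J (%i. M P (Inr i)) (%i. M (Inr i) Q)"
    by (rule tsum_support[OF A_vs A_vs fin injr]) (use Mc PQ rr in "auto simp: Ms")
   then show ?thesis using rr mmD(3)[OF n(1)] by (simp add: Ms)
  next
   case lr
   have "tsum A A ?L (M P) (%r. M r Q) = 0[AA]" by (rule sp[OF _ PQ]) (use lr in "auto simp: Ms")
   then show ?thesis using lr by (simp add: Ms)
  next
   case rl
   have "tsum A A ?L (M P) (%r. M r Q) = 0[AA]" by (rule sp[OF _ PQ]) (use rl in "auto simp: Ms")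
   then show ?thesis using rl by (simp add: Ms)
  qed
  show "counit A (M P Q) = (if P = Q then 1[K] else 0[K])"
   by (cases rule: cs) (use mmD(4)[OF m(1)] mmD(4)[OF n(1)] in "auto simp: Ms")
 qed
 then obtain Z :: "('k, 'a, 'v) comodule" and z ze where Z: "Z:OB K A" and d: "dbasis Z ?L z ze"
  and rhz: "ALL q:?L. coact Z (z q) = tsum Z A ?L z (%p. M p q)"
  using matrix_object[OF ad] by blast
 note Zo = ObjD[OF Z]
 have l0: "M (Inl p) q = 0[A]" "M q (Inl p) = 0[A]" if "p:?I" "q:?L" "q ~: Inl ` ?I" for p q
  using that by (auto simp: Ms)
 have r0: "M (Inr p) q = 0[A]" "M q (Inr p) = 0[A]" if "p:?J" "q:?L" "q ~: Inr ` ?J" for p q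
  using that by (auto simp: Ms)
 have "EX i:chom K A X Z. EX p:chom K A Z X. (ALL q:?I. i (e q) = z (Inl q)) & (ALL q:?I. p (z (Inl q)) = e q)
  & (ALL l:?L. l ~: Inl ` ?I --> p (z l) = 0[X])"
  by (rule block_homs[where e=e and z=z and m=m and n=M and h=Inl, OF Xo(1) b m(2) mc Zo(1) d bspec[OF rhz] Mc injl Ms(1) l0])
 then obtain i p where i: "i:chom K A X Z" "p:chom K A Z X" "ALL q:?I. i (e q) = z (Inl q)" "ALL q:?I. p (z (Inl q)) = e q"
  "ALL l:?L. l ~: Inl ` ?I --> p (z l) = 0[X]" by (elim bexE conjE) (rule that)
 have "EX i:chom K A Y Z. EX p:chom K A Z Y. (ALL q:?J. i (f q) = z (Inr q)) & (ALL q:?J. p (z (Inr q)) = f q)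
  & (ALL l:?L. l ~: Inr ` ?J --> p (z l) = 0[Y])"
  by (rule block_homs[where e=f and z=z and m=n and n=M and h=Inr, OF Yo(1) c n(2) nc Zo(1) d bspec[OF rhz] Mc injr Ms(4) r0])
 then obtain j q where j: "j:chom K A Y Z" "q:chom K A Z Y" "ALL q:?J. j (f q) = z (Inr q)" "ALL l:?J. q (z (Inr l)) = f l"
  "ALL l:?L. l ~: Inr ` ?J --> q (z l) = 0[Y]" by (elim bexE conjE) (rule that)
 note ih = chD(2)[OF i(1)] and ph = chD(2)[OF i(2)] and jh = chD(2)[OF j(1)] and qh = chD(2)[OF j(2)]
 have "p (i x) = x" if "x .: X" for x
  by (rule dbasis_hom_eqI[OF Xo(3) Xo(3) b hom_comp[OF ih ph] hom_id _ that]) (use i in auto)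
 moreover have "q (i x) = 0[Y]" if "x .: X" for x
  by (rule dbasis_hom_eqI[OF Xo(3) Yo(3) b hom_comp[OF ih qh] hom_zero_map[OF Yo(3)] _ that])
   (use i(3) j(5) in "simp add: InlI image_iff")
 moreover have "q (j y) = y" if "y .: Y" for y
  by (rule dbasis_hom_eqI[OF Yo(3) Yo(3) c hom_comp[OF jh qh] hom_id _ that]) (use j in auto)
 moreover have "p (j y) = 0[X]" if "y .: Y" for y
  by (rule dbasis_hom_eqI[OF Yo(3) Xo(3) c hom_comp[OF jh ph] hom_zero_map[OF Xo(3)] _ that])
   (use j(3) i(5) in "simp add: InrI image_iff")
 moreover have "vdim K Z = vdim K X + vdim K Y"
  using dbasis_dim(2)[OF Zo(3) d] by (simp add: card_Plus)
 ultimately show ?thesis using Z i(1,2) j(1,2)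
  by (intro exI[of _ Z] exI[of _ i] exI[of _ j] exI[of _ p] exI[of _ q]) auto
qed

end

section \<open>Codimension of the common kernel of finitely many functionals\<close>

context scalars
begin

text \<open>Modulo the span of as many vectors as there are functionals, every vector lies in the
  common kernel. The space \<open>L\<close> may be infinite-dimensional, as \<open>L_lim\<close>
  generally is.\<close>

lemma common_kernel_complement:
 assumes L: "vsp K L" and R: "finite R" and ch: "!!r. r:R ==> ch r:Lin K L (ssp K)"
 shows "EX g. (ALL r:R. g r .: L) & (ALL x:Car L. EX c. (ALL r:R. c r .: K)
  & (ALL r:R. ch r (x -[L] Fs L (%s. c s *[L] g s) R) = 0[K]))"
 using R ch
proof (induction R)
 case empty
 then show ?case using L by simp
next
 case (insert r R)
 have "EX g. (ALL s:R. g s .: L) & (ALL x:Car L. EX c. (ALL r:R. c r .: K)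
  & (ALL r:R. ch r (x -[L] Fs L (%s. c s *[L] g s) R) = 0[K]))"
  by (rule insert.IH) (use insert.prems in simp)
 then obtain g where g: "ALL s:R. g s .: L"
  and gc: "ALL x:Car L. EX c. (ALL r:R. c r .: K) & (ALL r:R. ch r (x -[L] Fs L (%s. c s *[L] g s) R) = 0[K])"
  by (elim exE conjE) (rule that)
 have chr: "ch r:Lin K L (ssp K)" using insert.prems by simp
 \<comment> \<open>\<open>u\<close> is a vector on which only the new functional is nonzero,
   normalised to 1. If there is none, the new functional already vanishes on the common kernel of
   the old ones, and zero serves as the new vector.\<close>
 define u where "u = (if EX u:Car L. (ALL s:R. ch s u = 0[K]) & ch r u = 1[K]
  then SOME u. u .: L & (ALL s:R. ch s u = 0[K]) & ch r u = 1[K] else 0[L])"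
 have u: "u .: L" "!!s. s:R ==> ch s u = 0[K]"
  and u1: "(EX u:Car L. (ALL s:R. ch s u = 0[K]) & ch r u = 1[K]) ==> ch r u = 1[K]"
 proof -
  have *: "u .: L & (ALL s:R. ch s u = 0[K]) & ch r u = 1[K]" if "EX u:Car L. (ALL s:R. ch s u = 0[K]) & ch r u = 1[K]"
   using someI_ex[of "%u. u .: L & (ALL s:R. ch s u = 0[K]) & ch r u = 1[K]"] that by (auto simp: u_def)
  have **: "u = 0[L]" if "~ (EX u:Car L. (ALL s:R. ch s u = 0[K]) & ch r u = 1[K])"
   using that unfolding u_def by (rule if_not_P)
  have z: "ch s 0[L] = 0[K]" if "s:R" for s
   using hom_zero[OF L vs_ssp insert.prems[of s]] that by simp
  show "u .: L"
   by (cases "EX u:Car L. (ALL s:R. ch s u = 0[K]) & ch r u = 1[K]") (use * ** L in auto)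
  show "ch s u = 0[K]" if "s:R" for s
   by (cases "EX u:Car L. (ALL s:R. ch s u = 0[K]) & ch r u = 1[K]") (use * ** z that in auto)
  show "(EX u:Car L. (ALL s:R. ch s u = 0[K]) & ch r u = 1[K]) ==> ch r u = 1[K]" using * by blast
 qed
 have "EX c. (ALL s:insert r R. c s .: K)
  & (ALL s:insert r R. ch s (x -[L] Fs L (%s. c s *[L] (g(r := u)) s) (insert r R)) = 0[K])" if x: "x .: L" for x
 proof -
  obtain c where c: "ALL s:R. c s .: K" "ALL s:R. ch s (x -[L] Fs L (%s. c s *[L] g s) R) = 0[K]"
   using bspec[OF gc x] by blast
  let ?y = "x -[L] Fs L (%s. c s *[L] g s) R"
  have S: "Fs L (%s. c s *[L] g s) R .: L" using c(1) g L by (intro vsum_closed) auto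
  then have y: "?y .: L" using x L by simp
  let ?d = "ch r ?y"
  have d: "?d .: K" using hom_cl[OF chr y] by simp
  \<comment> \<open>If the value \<open>?d\<close> is nonzero, rescaling \<open>?y\<close> gives an
    element as sought in the choice of \<open>u\<close>, so the normalised case holds. In either
    case subtracting the multiple \<open>?d\<close> of \<open>u\<close> kills the new
    functional.\<close>
  have du: "ch r ?y = ?d **[K] ch r u"
  proof (cases "?d = 0[K]")
   case True
   then show ?thesis using hom_cl[OF chr u(1)] by simp
  next
   case False
   let ?i = "inv\<^bsub>K\<^esub> ?d"
   have i: "?i .: K" "?i **[K] ?d = 1[K]" using False d field_Units by auto
   have "ch r (?i *[L] ?y) = 1[K]" using hom_smult[OF chr i(1) y] i by simp
   moreover have "ch s (?i *[L] ?y) = 0[K]" if "s:R" for s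
    using hom_smult[of "ch s" L "ssp K", OF _ i(1) y] insert.prems[of s] that c(2) i by simp
   ultimately have "ch r u = 1[K]" using u1 i y L vs_sm_closed[OF L i(1) y] by blast
   then show ?thesis using d by simp
  qed
  let ?c = "c(r := ?d)"
  have "Fs L (%s. ?c s *[L] (g(r := u)) s) (insert r R) = ?c r *[L] (g(r := u)) r +[L] Fs L (%s. ?c s *[L] (g(r := u)) s) R"
   using insert.hyps c(1) d g u L by (intro vsum_insert) auto
  also have "Fs L (%s. ?c s *[L] (g(r := u)) s) R = Fs L (%s. c s *[L] g s) R"
   using insert.hyps c(1) g L by (intro vsum_cong) auto
  finally have e: "Fs L (%s. ?c s *[L] (g(r := u)) s) (insert r R) = ?d *[L] u +[L] Fs L (%s. c s *[L] g s) R" by simp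
  have "x -[L] (?d *[L] u +[L] Fs L (%s. c s *[L] g s) R) = ?y -[L] ?d *[L] u"
  proof -
   interpret L: vectorspace K L by (rule L)
   show ?thesis using x S d u by (simp add: a_minus_def L.M.minus_add L.M.a_ac)
  qed
  moreover have "ch s (?y -[L] ?d *[L] u) = 0[K]" if "s:insert r R" for s
  proof -
   have chs: "ch s:Lin K L (ssp K)" using insert.prems that by simp
   have "ch s ?y = ?d **[K] ch s u" using that du c(2) u(2) d by auto
   then show ?thesis using hom_minus[OF L vs_ssp chs y vs_sm_closed[OF L d u(1)]]
     hom_smult[OF chs d u(1)] hom_cl[OF chs u(1)] d vs_minus_self[OF vs_ssp] by simp
  qed
  moreover have "ALL s:insert r R. ?c s .: K" using c(1) d by simp
  ultimately show ?thesis unfolding e[symmetric] by (intro exI[of _ ?c]) simp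
 qed
 moreover have "ALL s:insert r R. (g(r := u)) s .: L" using g u by simp
 ultimately show ?case by blast
qed

text \<open>The classes of the vectors supplied by \<open>common_kernel_complement\<close> span the
  quotient, and a spanning family contains a basis.\<close>

lemma quot_dim_le:
 assumes J: "subspace K J L" and R: "finite R" and ch: "!!r. r:R ==> ch r:Lin K L (ssp K)"
  and ker: "!!x. x .: L ==> (ALL r:R. ch r x = 0[K]) ==> x:J"
 shows "vectorspace.fin_dim K (quot_space L J)" "vdim K (quot_space L J) <= card R"
proof -
 note L = subD(1)[OF J]
 let ?Q = "quot_space L J"
 have Q: "vsp K ?Q" by (rule quot_vs[OF J])
 note pr = quot_proj_hom[OF J]
 have "EX g. (ALL r:R. g r .: L) & (ALL x:Car L. EX c. (ALL r:R. c r .: K)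
  & (ALL r:R. ch r (x -[L] Fs L (%s. c s *[L] g s) R) = 0[K]))"
  by (rule common_kernel_complement[OF L R]) (rule ch)
 then obtain g where g: "ALL r:R. g r .: L"
  and gc: "ALL x:Car L. EX c. (ALL r:R. c r .: K) & (ALL r:R. ch r (x -[L] Fs L (%s. c s *[L] g s) R) = 0[K])"
  by (elim exE conjE) (rule that)
 let ?g = "%r. a_r_coset L J (g r)"
 have "EX I<=R. EX phi. dbasis ?Q I ?g phi"
 proof (rule spanning_dbasis[OF Q R])
  show "?g r .: ?Q" if "r:R" for r using g that by (simp add: quot_carrier)
 next
  fix v assume "v .: ?Q"
  then obtain x where x: "x .: L" "v = a_r_coset L J x" by (auto simp: quot_carrier)
  obtain c where c: "ALL r:R. c r .: K" "ALL r:R. ch r (x -[L] Fs L (%s. c s *[L] g s) R) = 0[K]"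
   using bspec[OF gc x(1)] by blast
  have S: "Fs L (%s. c s *[L] g s) R .: L" using c(1) g L by (intro vsum_closed) auto
  have "v = a_r_coset L J (Fs L (%s. c s *[L] g s) R)"
   unfolding x(2) using ker[OF vs_minus_closed[OF L x(1) S]] c(2) by (simp add: coset_eq_iff[OF J x(1) S])
  also have "... = Fs ?Q (%s. a_r_coset L J (c s *[L] g s)) R"
   using c(1) g L by (intro hom_sum[OF L Q pr]) auto
  also have "... = Fs ?Q (%s. c s *[?Q] ?g s) R"
   using c(1) g Q by (intro vsum_cong) (auto simp: hom_smult[OF pr] hom_cl[OF pr])
  finally show "EX c. (ALL j:R. c j .: K) & v = Fs ?Q (%j. c j *[?Q] ?g j) R" using c(1) by blast
 qed
 then obtain I phi where I: "I <= R" "dbasis ?Q I ?g phi" by blast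
 show "vectorspace.fin_dim K ?Q" by (rule dbasis_dim(1)[OF Q I(2)])
 show "vdim K ?Q <= card R" using dbasis_dim(2)[OF Q I(2)] card_mono[OF R I(1)] by simp
qed

lemma indep_card_le:
 assumes V: "vsp K V" and fd: "vectorspace.fin_dim K V" and i: "indep V I e"
 shows "card I <= vdim K V"
proof -
 interpret V: vectorspace K V by (rule V)
 have "card (e ` I) <= V.dim"
  by (rule V.li_le_dim(2)[OF fd _ indep_lin_indpt[OF V i]]) (use indepD(2)[OF i] in auto)
 then show ?thesis using card_image[OF indep_inj[OF V i]] by simp
qed

end

context hopf_setup
begin

subsection \<open>Elements that are coefficients of a comodule of given dimension\<close>

text \<open>The dimension is prescribed exactly and not merely bounded, since ultraproducts of bases
  need one index set for all factors.\<close>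

definition coeff_size :: "'v itself => nat => 'a => bool" where
 "coeff_size TV n a \<longleftrightarrow> (EX Y :: ('k, 'a, 'v) comodule. Y:OB K A & vdim K Y = n
  & (EX f:Lin K Y (ssp K). EX v:Car Y. a = coef K A Y f v))"

lemma coeff_size_closed: "coeff_size TV n a ==> a .: A"
 unfolding coeff_size_def by (elim exE conjE bexE) (simp add: coef_closed ObjD(1))

text \<open>In the direct sum, the sum of the two vectors and the sum of the two functionals produce
  the sum of the coefficients; the mixed terms vanish.\<close>

lemma coeff_size_add:
 assumes ad: "all_dims TYPE('v)" and a: "coeff_size TYPE('v) n a" and b: "coeff_size TYPE('v) m b"
 shows "coeff_size TYPE('v) (n + m) (a +[A] b)"
proof -
 obtain X :: "('k, 'a, 'v) comodule" and f x where X: "X:OB K A" "vdim K X = n"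
  "f:Lin K X (ssp K)" "x .: X" "a = coef K A X f x"
  using a unfolding coeff_size_def by blast
 obtain Y :: "('k, 'a, 'v) comodule" and g y where Y: "Y:OB K A" "vdim K Y = m"
  "g:Lin K Y (ssp K)" "y .: Y" "b = coef K A Y g y"
  using b unfolding coeff_size_def by blast
 obtain Z :: "('k, 'a, 'v) comodule" and i j p q where Z: "Z:OB K A"
  and h: "i:chom K A X Z" "j:chom K A Y Z" "p:chom K A Z X" "q:chom K A Z Y"
  and px: "ALL x:Car X. p (i x) = x & q (i x) = 0[Y]" and qy: "ALL y:Car Y. q (j y) = y & p (j y) = 0[X]"
  and d: "vdim K Z = vdim K X + vdim K Y"
  using direct_sum[OF ad X(1) Y(1)] by (elim exE conjE) (rule that)
 note Xo = ObjD[OF X(1)] and Yo = ObjD[OF Y(1)] and Zo = ObjD[OF Z]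
 let ?F = "%z. f (p z) +[K] g (q z)"
 note fp = hom_comp[OF chD(2)[OF h(3)] X(3)] and gq = hom_comp[OF chD(2)[OF h(4)] Y(3)]
 have F: "?F:Lin K Z (ssp K)" using hom_add_map[OF vs_ssp fp gq] by simp
 have f0: "f 0[X] = 0[K]" and g0: "g 0[Y] = 0[K]"
  using hom_zero[OF Xo(3) vs_ssp X(3)] hom_zero[OF Yo(3) vs_ssp Y(3)] by auto
 note fc = hom_cl[OF X(3), simplified] and gc = hom_cl[OF Y(3), simplified]
 have "coef K A Z ?F (i x +[Z] j y) = coef K A Z ?F (i x) +[A] coef K A Z ?F (j y)"
  using hom_add[OF coef_hom[OF Zo(1) F] chD(4)[OF h(1) X(4)] chD(4)[OF h(2) Y(4)]] .
 also have "coef K A Z ?F (i x) = coef K A X (%x. ?F (i x)) x"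
  by (rule coef_comod_hom[OF Xo(1) Zo(1) h(1) F X(4)])
 also have "... = a" unfolding X(5) by (rule coef_cong) (use px fc g0 in simp)
 also have "coef K A Z ?F (j y) = coef K A Y (%x. ?F (j x)) y"
  by (rule coef_comod_hom[OF Yo(1) Zo(1) h(2) F Y(4)])
 also have "... = b" unfolding Y(5) by (rule coef_cong) (use qy gc f0 in simp)
 finally have "a +[A] b = coef K A Z ?F (i x +[Z] j y)" by simp
 moreover have "i x +[Z] j y .: Z" using Zo(3) chD(4)[OF h(1) X(4)] chD(4)[OF h(2) Y(4)] by simp
 ultimately show ?thesis unfolding coeff_size_def using Z d X(2) Y(2) F by blast
qed

lemma coeff_size_smult:
 assumes c: "c .: K" and a: "coeff_size TYPE('v) n a"
 shows "coeff_size TYPE('v) n (c *[A] a)"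
proof -
 obtain X :: "('k, 'a, 'v) comodule" and f x where X: "X:OB K A" "vdim K X = n"
  "f:Lin K X (ssp K)" "x .: X" "a = coef K A X f x"
  using a unfolding coeff_size_def by blast
 have "c *[A] a = coef K A X f (c *[X] x)"
  using hom_smult[OF coef_hom[OF ObjD(1)[OF X(1)] X(3)] c X(4)] X(5) by simp
 moreover have "c *[X] x .: X" using ObjD(3)[OF X(1)] c X(4) by simp
 ultimately show ?thesis unfolding coeff_size_def using X by blast
qed

lemma coeff_size_mult:
 assumes ad: "all_dims TYPE('v)" and a: "coeff_size TYPE('v) n a" and b: "coeff_size TYPE('v) m b"
 shows "coeff_size TYPE('v) (n * m) (a **[A] b)"
proof -
 obtain X :: "('k, 'a, 'v) comodule" and f x where X: "X:OB K A" "vdim K X = n"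
  "f:Lin K X (ssp K)" "x .: X" "a = coef K A X f x"
  using a unfolding coeff_size_def by blast
 obtain Y :: "('k, 'a, 'v) comodule" and g y where Y: "Y:OB K A" "vdim K Y = m"
  "g:Lin K Y (ssp K)" "y .: Y" "b = coef K A Y g y"
  using b unfolding coeff_size_def by blast
 note * = coef_tensor[OF ad X(1) Y(1) X(3) Y(3) X(4) Y(4)]
 have "vpure K X Y x y .: comod_tensor K A X Y"
  using vpure_closed[OF ad ObjD(2)[OF X(1)] ObjD(2)[OF Y(1)] X(4) Y(4)] by (simp add: ct_simps[OF ad X(1) Y(1)])
 then show ?thesis unfolding coeff_size_def X(5) Y(5)
  using ct_object(1,2)[OF ad X(1) Y(1)] X(2) Y(2) *(1) *(2)[symmetric] by blast
qed

lemma coeff_size_one: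
 assumes ad: "all_dims TYPE('v)"
 shows "coeff_size TYPE('v) 1 1[A]"
proof -
 note c = fd_copy[OF ad fd_scalar]
 let ?S = "copy_space K (ssp K) :: ('k, 'v) module" and ?u = "comod_unit K A :: ('k, 'a, 'v) comodule"
 have "coef K A ?u (uncopy_map K (ssp K)) (copy_map K (ssp K) 1[K]) = 1[A]"
  using coef_unit[OF ad K.one_closed c(2)] c(3) by simp
 moreover have "uncopy_map K (ssp K):Lin K ?u (ssp K)"
  using c(2) by (simp add: module_hom_cong(1)[OF cu_simps(1-3)[OF ad] refl refl refl])
 moreover have "copy_map K (ssp K) 1[K] .: ?u" using c(5) by (simp add: cu_simps[OF ad])
 ultimately show ?thesis unfolding coeff_size_def using cu_object(1,2)[OF ad] by metis
qed

lemma coef_tsum: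
 assumes Y: "rcom K A Y" and f: "f:Lin K Y (ssp K)" and v: "v .: Y"
  and eq: "coact Y v = tsum Y A I e m" and e: "!!p. p:I ==> e p .: Y" and m: "!!p. p:I ==> m p .: A"
 shows "coef K A Y f v = Fs A (%p. f (e p) *[A] m p) I"
 unfolding coefficient_def eq
 by (rule tlift_tsum[OF coD(1)[OF Y] A_vs A_vs slice_bilin[OF coD(1)[OF Y] A_vs f]]) (use e m in auto)

text \<open>Together with \<open>coeff_size_ex_matrix\<close> this replaces a comodule, a vector and
  a functional by a multiplicative matrix and two families of scalars, so that no carriers
  remain.\<close>

lemma coeff_size_matrix:
 assumes ad: "all_dims TYPE('v)" and mm: "mmat I m"
  and f: "!!p. p:I ==> f p .: K" and v: "!!p. p:I ==> v p .: K"
 shows "coeff_size TYPE('v) (card I) (Fs A (%q. v q *[A] Fs A (%p. f p *[A] m p q) I) I)"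
proof -
 note m = mmD(2)[OF mm]
 obtain Y :: "('k, 'a, 'v) comodule" and e phi where Y: "Y:OB K A" and b: "dbasis Y I e phi"
  and rh: "ALL q:I. coact Y (e q) = tsum Y A I e (%p. m p q)" using matrix_object[OF ad mm] by blast
 note Yo = ObjD[OF Y] and e = dbD(3)[OF b]
 obtain F where F: "F:Lin K Y (ssp K)" "ALL p:I. F (e p) = f p"
  using dbasis_hom_ex[OF Yo(3) vs_ssp b, of f] f by auto
 let ?v = "Fs Y (%q. v q *[Y] e q) I"
 have vc: "?v .: Y" using v e Yo(3) by (intro vsum_closed) auto
 note g = coef_hom[OF Yo(1) F(1)]
 have "coef K A Y F ?v = Fs A (%q. coef K A Y F (v q *[Y] e q)) I"
  using v e Yo(3) by (intro hom_sum[OF Yo(3) A_vs g]) auto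
 also have "... = Fs A (%q. v q *[A] Fs A (%p. f p *[A] m p q) I) I"
 proof (rule vsum_cong[OF A_vs refl])
  fix q assume q: "q:I"
  have "Fs A (%p. f p *[A] m p q) I .: A" using f m q by (intro vsum_closed) auto
  then show "v q *[A] Fs A (%p. f p *[A] m p q) I .: A" using v q by simp
  have "coef K A Y F (e q) = Fs A (%p. F (e p) *[A] m p q) I"
   by (rule coef_tsum[OF Yo(1) F(1) e[OF q] bspec[OF rh q]]) (use e m q in auto)
  also have "... = Fs A (%p. f p *[A] m p q) I"
   by (rule vsum_cong[OF A_vs refl]) (use F(2) f m q in auto)
  finally show "coef K A Y F (v q *[Y] e q) = v q *[A] Fs A (%p. f p *[A] m p q) I"
   using hom_smult[OF g v[OF q] e[OF q]] by simp
 qed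
 finally have "Fs A (%q. v q *[A] Fs A (%p. f p *[A] m p q) I) I = coef K A Y F ?v" by simp
 then show ?thesis unfolding coeff_size_def using Y dbasis_dim(2)[OF Yo(3) b] F(1) vc by blast
qed

lemma coeff_size_ex_matrix:
 assumes "coeff_size TYPE('v) n a"
 shows "EX m f v. mmat {..<n} m & (ALL p<n. f p .: K) & (ALL p<n. v p .: K)
  & a = Fs A (%q. v q *[A] Fs A (%p. f p *[A] m p q) {..<n}) {..<n}"
proof -
 obtain Y :: "('k, 'a, 'v) comodule" and F x where Y: "Y:OB K A" "vdim K Y = n"
  "F:Lin K Y (ssp K)" "x .: Y" "a = coef K A Y F x"
  using assms unfolding coeff_size_def by blast
 note Yo = ObjD[OF Y(1)]
 let ?I = "{..<n}"
 obtain e phi where b: "dbasis Y ?I e phi" using fd_dbasis[OF Yo(2)] Y(2) by auto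
 define m where "m = (%p q. slice Y A (phi p) (coact Y (e q)))"
 have mm: "mmat ?I m" and rh: "q:?I ==> coact Y (e q) = tsum Y A ?I e (%p. m p q)" for q
  using comodule_basis_matrix[OF Yo(1) b] unfolding m_def by auto
 note e = dbD(3)[OF b] and m = mmD(2)[OF mm] and g = coef_hom[OF Yo(1) Y(3)]
 note Fc = hom_cl[OF Y(3), simplified]
 have "a = coef K A Y F (Fs Y (%q. phi q x *[Y] e q) ?I)" using dbD(7)[OF b Y(4)] Y(5) by simp
 also have "... = Fs A (%q. coef K A Y F (phi q x *[Y] e q)) ?I"
  using dbD(6)[OF b] Y(4) e Yo(3) by (intro hom_sum[OF Yo(3) A_vs g]) auto
 also have "... = Fs A (%q. phi q x *[A] Fs A (%p. F (e p) *[A] m p q) ?I) ?I"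
 proof (rule vsum_cong[OF A_vs refl])
  fix q assume q: "q:?I"
  have "Fs A (%p. F (e p) *[A] m p q) ?I .: A" using Fc e m q by (intro vsum_closed) auto
  then show "phi q x *[A] Fs A (%p. F (e p) *[A] m p q) ?I .: A" using dbD(6)[OF b q Y(4)] by simp
  have "coef K A Y F (e q) = Fs A (%p. F (e p) *[A] m p q) ?I"
   by (rule coef_tsum[OF Yo(1) Y(3) e[OF q] rh[OF q]]) (use e m q in auto)
  then show "coef K A Y F (phi q x *[Y] e q) = phi q x *[A] Fs A (%p. F (e p) *[A] m p q) ?I"
   using hom_smult[OF g dbD(6)[OF b q Y(4)] e[OF q]] by simp
 qed
 finally show ?thesis using mm Fc e dbD(6)[OF b _ Y(4)]
  by (intro exI[of _ m] exI[of _ "%p. F (e p)"] exI[of _ "%q. phi q x"]) auto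
qed

text \<open>The comultiplication needs at most \<open>n\<close> terms, and all factors keep the size
  \<open>n\<close>. This uniformity lets the comultiplication of the ultraproduct land in the tensor
  square of the restricted ultraproduct.\<close>

lemma coeff_size_comult:
 assumes "coeff_size TYPE('v) n a"
 shows "EX x y. (ALL p<n. coeff_size TYPE('v) n (x p) & coeff_size TYPE('v) n (y p)) & comult A a = tsum A A {..<n} x y"
proof -
 obtain Y :: "('k, 'a, 'v) comodule" and F v where Y: "Y:OB K A" "vdim K Y = n"
  "F:Lin K Y (ssp K)" "v .: Y" "a = coef K A Y F v"
  using assms unfolding coeff_size_def by blast
 note Yo = ObjD[OF Y(1)]
 obtain e phi where b: "dbasis Y {..<n} e phi" using fd_dbasis[OF Yo(2)] Y(2) by auto
 show ?thesis
  unfolding Y(5) comult_coefficient_tsum[OF Yo(1) Y(3,4) b]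
  by (rule exI[of _ "%p. coef K A Y F (e p)"], rule exI[of _ "%p. coef K A Y (phi p) v"])
   (use Y dbD[OF b] in "auto simp: coeff_size_def")
qed

text \<open>Contract the last factor of the coassociativity law at \<open>a\<close> with the
  functional dual to \<open>c j\<close>: on one side only the comultiplication of \<open>b j\<close>
  survives. Hence the left factors \<open>b\<close> span a subcomodule of the regular
  comodule.\<close>

lemma coassoc_independent:
 assumes a: "a .: A" and b: "indep A I b" and c: "indep A I c" and ga: "dual_fam A I c ga"
  and eq: "comult A a = tsum A A I b c" and j: "j:I"
 shows "comult A (b j) = tsum A A I b (%l. tlift K A A A (%x y. ga j y *[A] x) (comult A (c l)))"
proof -
 let ?R = "tlift K A A A (%x y. ga j y *[A] x)"
 note gah = dual_famD(3)[OF ga j] and bc = indepD(2)[OF b] and cc = indepD(2)[OF c] and fin = indepD(1)[OF b]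
 have bl: "bilin A A A (%x y. ga j y *[A] x)"
  using bilin_flip[OF slice_bilin[OF A_vs A_vs gah]] .
 note Rh = tlift_hom[OF A_vs A_vs A_vs bl] and Rp = tlift_pure[OF A_vs A_vs A_vs bl]
 note gac = hom_cl[OF gah, simplified]
 let ?T = "tmap K A AA A A (%x. x) ?R"
 note Th = tmap_hom[OF A_vs AA_vs A_vs A_vs hom_id Rh]
 have 1: "?T (tmap K A A A AA (%x. x) (%w. pt K A A w d) s) = ga j d *[AA] s"
  if d: "d .: A" and s: "s .: AA" for d s
 proof (rule ten_hom_eqI[OF A_vs A_vs hom_comp[OF tmap_hom[OF A_vs A_vs A_vs AA_vs hom_id pure_hom(2)[OF A_vs A_vs d]] Th]
    hom_smult_map[OF AA_vs hom_id gac[OF d]] _ s])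
  fix v w assume "v .: A" "w .: A"
  then show "?T (tmap K A A A AA (%x. x) (%w. pt K A A w d) (pt K A A v w)) = ga j d *[AA] pt K A A v w"
   using d gac by (simp add: tmap_pure[OF A_vs A_vs A_vs AA_vs hom_id pure_hom(2)[OF A_vs A_vs d]]
     tmap_pure[OF A_vs AA_vs A_vs A_vs hom_id Rh] Rp bilinD[OF pure_bilin[OF A_vs A_vs]])
 qed
 have Deb: "comult A (b i) .: AA" if "i:I" for i using bc that by simp
 let ?as = "tensor_assoc K A A A"
 note ash = ten_assoc_hom[OF A_vs A_vs A_vs]
 have "tmap K A A AA A (comult A) (%x. x) (comult A a) = tsum AA A I (%i. comult A (b i)) c"
  unfolding eq by (rule tmap_tsum[OF A_vs A_vs AA_vs A_vs comult_linear hom_id]) (use bc cc in auto)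
 then have "?T (?as (tmap K A A AA A (comult A) (%x. x) (comult A a)))
  = Fs AA (%i. ?T (?as (pt K AA A (comult A (b i)) (c i)))) I"
  using hom_tsum[OF AA_vs A_vs AA_vs hom_comp[OF ash Th], of I "%i. comult A (b i)" c] bc cc by simp
 also have "... = Fs AA (%i. (if j = i then 1[K] else 0[K]) *[AA] comult A (b i)) I"
  by (rule vsum_cong[OF AA_vs refl]) (use bc cc 1 dual_famD(4)[OF ga j] in "auto simp: ten_assoc_pure2[OF A_vs A_vs A_vs]")
 also have "... = comult A (b j)" by (rule vsum_delta(2)[OF AA_vs fin j Deb])
 finally have L: "?T (?as (tmap K A A AA A (comult A) (%x. x) (comult A a))) = comult A (b j)" .
 have "?T (tmap K A A A AA (%x. x) (comult A) (comult A a)) = ?T (tsum A AA I b (%l. comult A (c l)))"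
  unfolding eq by (subst tmap_tsum[OF A_vs A_vs A_vs AA_vs hom_id comult_linear]) (use bc cc in auto)
 also have "... = tsum A A I b (%l. ?R (comult A (c l)))"
  by (rule tmap_tsum[OF A_vs AA_vs A_vs A_vs hom_id Rh]) (use bc cc in auto)
 finally show ?thesis using L coassoc[OF a] by simp
qed

text \<open>The right counit law places \<open>a\<close> in the subcomodule spanned by
  \<open>b\<close>, and the left counit law exhibits each \<open>b j\<close> as the coefficient of
  itself for the functional given by the counit. The comodule has dimension
  \<open>card I\<close>.\<close>

lemma coeff_size_comult_rank:
 assumes ad: "all_dims TYPE('v)" and a: "a .: A" and b: "indep A I b" and c: "indep A I c"
  and eq: "comult A a = tsum A A I b c"
 shows "coeff_size TYPE('v) (card I) a"
proof -
 obtain ga where ga: "dual_fam A I c ga" using indep_dual[OF A_vs c] by blast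
 note bc = indepD(2)[OF b] and cc = indepD(2)[OF c] and fin = indepD(1)[OF b]
 define m where "m l j = tlift K A A A (%x y. ga j y *[A] x) (comult A (c l))" for l j
 have Deb: "comult A (b j) = tsum A A I b (%l. m l j)" if "j:I" for j
  unfolding m_def by (rule coassoc_independent[OF a b c ga eq that])
 have m: "m l j .: A" if "l:I" "j:I" for l j
  unfolding m_def
  by (rule hom_cl[OF tlift_hom[OF A_vs A_vs A_vs bilin_flip[OF slice_bilin[OF A_vs A_vs dual_famD(3)[OF ga that(2)]]]]])
   (use cc that in simp)
 have mm: "mmat I m"
  by (rule comodule_matrix[OF reg_comodule, of I b]) (use b m Deb in auto)
 have be: "b j = Fs A (%p. counit A (b p) *[A] m p j) I" if j: "j:I" for j
 proof -
  have "b j = tlift K A A A (%x y. counit A x *[A] y) (tsum A A I b (%l. m l j))"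
   using counit_left[OF bc[OF j]] Deb[OF j] by simp
  also have "... = Fs A (%p. counit A (b p) *[A] m p j) I"
   by (rule tlift_tsum[OF A_vs A_vs A_vs slice_bilin[OF A_vs A_vs counit_linear]]) (use bc m j in auto)
  finally show ?thesis .
 qed
 have "a = tlift K A A A (%b c. counit A c *[A] b) (tsum A A I b c)"
  using counit_right[OF a] eq by simp
 also have "... = Fs A (%l. counit A (c l) *[A] b l) I"
  by (rule tlift_tsum[OF A_vs A_vs A_vs counit_bilin[OF A_vs]]) (use bc cc in auto)
 also have "... = Fs A (%l. counit A (c l) *[A] Fs A (%p. counit A (b p) *[A] m p l) I) I"
  by (rule vsum_cong[OF A_vs refl]) (use be[symmetric] bc cc in auto)
 finally show ?thesis
  using coeff_size_matrix[OF ad mm, of "%p. counit A (b p)" "%l. counit A (c l)"] bc cc by simp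
qed

text \<open>The finiteness theorem for comodules: every element lies in a finite-dimensional
  subcomodule of the regular comodule.\<close>

lemma coeff_size_ex:
 assumes ad: "all_dims TYPE('v)" and a: "a .: A"
 shows "EX n. coeff_size TYPE('v) n a"
 using tsum_indep_ex[OF A_vs A_vs comult_closed[OF a]] coeff_size_comult_rank[OF ad a] by metis

subsection \<open>Coefficients and the antipode\<close>

lemma tmul_closed [simp]: "x .: AA ==> y .: AA ==> tmul x y .: AA"
 by (rule bilinD(3)[OF tmul_bilin])

lemma tmul_assoc:
 assumes x: "x .: AA" and y: "y .: AA" and z: "z .: AA"
 shows "tmul (tmul x y) z = tmul x (tmul y z)"
proof -
 note h1 = bilinD(1)[OF tmul_bilin] and h2 = bilinD(2)[OF tmul_bilin]
 show ?thesis
 proof (rule ten_hom_eqI[OF A_vs A_vs hom_comp[OF h2[OF y] h2[OF z]] h2[OF tmul_closed[OF y z]] _ x])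
  fix a b assume ab: "a .: A" "b .: A"
  have p: "pt K A A a b .: AA" using ab by simp
  show "tmul (tmul (pt K A A a b) y) z = tmul (pt K A A a b) (tmul y z)"
  proof (rule ten_hom_eqI[OF A_vs A_vs hom_comp[OF h1[OF p] h2[OF z]] hom_comp[OF h2[OF z] h1[OF p]] _ y])
   fix c d assume cd: "c .: A" "d .: A"
   have p2: "pt K A A c d .: AA" using cd by simp
   show "tmul (tmul (pt K A A a b) (pt K A A c d)) z = tmul (pt K A A a b) (tmul (pt K A A c d) z)"
    by (rule ten_hom_eqI[OF A_vs A_vs h1[OF tmul_closed[OF p p2]] hom_comp[OF h1[OF p2] h1[OF p]] _ z])
     (use ab cd in "simp add: tmul_pure am_assoc")
  qed
 qed
qed

lemma tmul_one:
 assumes x: "x .: AA"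
 shows "tmul (pt K A A 1[A] 1[A]) x = x" "tmul x (pt K A A 1[A] 1[A]) = x"
proof -
 have p: "pt K A A 1[A] 1[A] .: AA" by simp
 show "tmul (pt K A A 1[A] 1[A]) x = x"
  by (rule ten_hom_eqI[OF A_vs A_vs bilinD(1)[OF tmul_bilin p] hom_id _ x]) (simp add: tmul_pure)
 show "tmul x (pt K A A 1[A] 1[A]) = x"
  by (rule ten_hom_eqI[OF A_vs A_vs bilinD(2)[OF tmul_bilin p] hom_id _ x]) (simp add: tmul_pure)
qed

text \<open>The transposed image of \<open>m\<close> under the antipode is the matrix of the dual
  comodule. Over the tensor square, the matrix of comultiplied entries of \<open>m\<close> has the
  comultiplied entries of \<open>S m\<close> as left inverse and the expected anti-multiplicative
  expression as right inverse. The two inverses coincide, so the reversal of the comultiplication by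
  the antipode is obtained directly on matrix entries.\<close>

lemma antipode_matrix:
 assumes S: "S:Lin K A A"
  and S1: "!!a. a .: A ==> tlift K A A A (%b c. S b **[A] c) (comult A a) = counit A a *[A] 1[A]"
  and S2: "!!a. a .: A ==> tlift K A A A (%b c. b **[A] S c) (comult A a) = counit A a *[A] 1[A]"
  and mm: "mmat I m"
 shows "mmat I (%p q. S (m q p))"
proof -
 note m = mmD(2)[OF mm] and fin = mmD(1)[OF mm] and Sc = hom_cl[OF S]
 let ?de = "%p q. if p = q then 1[K] else 0[K]"
 let ?T1 = "pt K A A 1[A] 1[A]"
 have T1: "?T1 .: AA" by simp
 have Sm: "Fs A (%r. S (m p r) **[A] m r q) I = ?de p q *[A] 1[A]"
  and mS: "Fs A (%r. m p r **[A] S (m r q)) I = ?de p q *[A] 1[A]" if pq: "p:I" "q:I" for p q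
 proof -
  have "tlift K A A A (%b c. S b **[A] c) (comult A (m p q)) = Fs A (%r. S (m p r) **[A] m r q) I"
   unfolding mmD(3)[OF mm pq]
   by (rule tlift_tsum[OF A_vs A_vs A_vs bilin_comp2[OF am_bilin S hom_id]]) (use m pq in auto)
  then show "Fs A (%r. S (m p r) **[A] m r q) I = ?de p q *[A] 1[A]"
   using S1[OF m[OF pq]] mmD(4)[OF mm pq] by simp
  have "tlift K A A A (%b c. b **[A] S c) (comult A (m p q)) = Fs A (%r. m p r **[A] S (m r q)) I"
   unfolding mmD(3)[OF mm pq]
   by (rule tlift_tsum[OF A_vs A_vs A_vs bilin_comp2[OF am_bilin hom_id S]]) (use m pq in auto)
  then show "Fs A (%r. m p r **[A] S (m r q)) I = ?de p q *[A] 1[A]"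
   using S2[OF m[OF pq]] mmD(4)[OF mm pq] by simp
 qed
 have de1: "?de p q *[A] 1[A] .: A" for p q :: 'b by simp
 define x where "x p q = comult A (S (m p q))" for p q
 define M where "M p q = comult A (m p q)" for p q
 define y where "y p q = tsum A A I (%r. S (m r q)) (%r. S (m p r))" for p q
 have x: "x p q .: AA" and M: "M p q .: AA" and y: "y p q .: AA" if "p:I" "q:I" for p q
  using m Sc that by (auto simp: x_def M_def y_def)
 have xM: "Fs AA (%r. tmul (x p r) (M r q)) I = ?de p q *[AA] ?T1" if pq: "p:I" "q:I" for p q
 proof -
  have "Fs AA (%r. tmul (x p r) (M r q)) I = Fs AA (%r. comult A (S (m p r) **[A] m r q)) I"
   by (rule vsum_cong[OF AA_vs refl]) (use m Sc pq in "auto simp: x_def M_def comult_mult")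
  also have "... = comult A (Fs A (%r. S (m p r) **[A] m r q) I)"
   by (rule hom_sum[OF A_vs AA_vs comult_linear, symmetric]) (use m Sc pq in auto)
  also have "... = ?de p q *[AA] ?T1" using Sm[OF pq] hom_smult[OF comult_linear, of "?de p q" "1[A]"] by (simp add: comult_one)
  finally show ?thesis .
 qed
 \<comment> \<open>After interchanging the sums, the sum over \<open>r\<close> collapses by
   \<open>mS\<close> to a Kronecker delta in the second factor; then the sum over \<open>s\<close>
   collapses by \<open>mS\<close> in the first.\<close>
 have My: "Fs AA (%r. tmul (M p r) (y r q)) I = ?de p q *[AA] ?T1" if pq: "p:I" "q:I" for p q
 proof -
  let ?c = "%r (s, t). pt K A A (m p s **[A] S (m t q)) (m s r **[A] S (m r t))"
  have cc: "?c r st .: AA" if "r:I" "st:I \<times> I" for r st using that m Sc pq by auto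
  have "Fs AA (%r. tmul (M p r) (y r q)) I = Fs AA (%r. Fs AA (?c r) (I \<times> I)) I"
  proof (rule vsum_cong[OF AA_vs refl])
   fix r assume r: "r:I"
   show "Fs AA (?c r) (I \<times> I) .: AA" using cc r by (intro vsum_closed[OF AA_vs]) auto
   have "tmul (M p r) (y r q) = tsum A A (I \<times> I) (%(s, t). m p s **[A] S (m t q)) (%(s, t). m s r **[A] S (m r t))"
    unfolding M_def y_def mmD(3)[OF mm pq(1) r] tmul_def
    by (rule pair_map_tsum[OF A_vs A_vs A_vs A_vs A_vs A_vs am_bilin am_bilin fin fin]) (use m Sc pq r in auto)
   then show "tmul (M p r) (y r q) = Fs AA (?c r) (I \<times> I)" by (simp add: tsum_def case_prod_beta')
  qed
  also have "... = Fs AA (%st. Fs AA (%r. ?c r st) I) (I \<times> I)"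
   by (rule vsum_swap[OF AA_vs fin]) (use fin cc in auto)
  also have "... = Fs AA (%s. Fs AA (%t. Fs AA (%r. ?c r (s, t)) I) I) I"
   by (rule vsum_Times[OF AA_vs fin fin]) (use cc in "auto intro!: vsum_closed")
  also have "... = Fs AA (%s. pt K A A (m p s **[A] S (m s q)) 1[A]) I"
  proof (rule vsum_cong[OF AA_vs refl])
   fix s assume s: "s:I"
   show "pt K A A (m p s **[A] S (m s q)) 1[A] .: AA" using m Sc pq s by simp
   have in_r: "Fs AA (%r. ?c r (s, t)) I = pt K A A (m p s **[A] S (m t q)) (?de s t *[A] 1[A])" if t: "t:I" for t
   proof -
    have u: "m p s **[A] S (m t q) .: A" using m Sc pq s t by simp
    have "pt K A A (m p s **[A] S (m t q)) (Fs A (%r. m s r **[A] S (m r t)) I) = Fs AA (%r. ?c r (s, t)) I"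
     using hom_sum[OF A_vs AA_vs pure_hom(1)[OF A_vs A_vs u], of I "%r. m s r **[A] S (m r t)"] m Sc s t by simp
    then show ?thesis using mS[OF s t] by simp
   qed
   have "Fs AA (%t. Fs AA (%r. ?c r (s, t)) I) I
    = Fs AA (%t. pt K A A (m p s **[A] S (m t q)) (?de s t *[A] 1[A])) I"
    by (rule vsum_cong[OF AA_vs refl]) (use m Sc pq s in_r in auto)
   also have "... = pt K A A (m p s **[A] S (m s q)) (?de s s *[A] 1[A])"
   proof (rule vsum_single[OF AA_vs fin s])
    fix t assume t: "t:I" "t ~= s"
    have u: "m p s **[A] S (m t q) .: A" using m Sc pq s t by simp
    show "pt K A A (m p s **[A] S (m t q)) (?de s t *[A] 1[A]) = 0[AA]"
     using hom_zero[OF A_vs AA_vs pure_hom(1)[OF A_vs A_vs u]] t by simp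
   qed (use m Sc pq s in simp)
   finally show "Fs AA (%t. Fs AA (%r. ?c r (s, t)) I) I = pt K A A (m p s **[A] S (m s q)) 1[A]" by simp
  qed
  also have "... = pt K A A (Fs A (%s. m p s **[A] S (m s q)) I) 1[A]"
   by (rule hom_sum[OF A_vs AA_vs pure_hom(2)[OF A_vs A_vs am_one_closed], symmetric]) (use m Sc pq in auto)
  also have "... = ?de p q *[AA] ?T1" using mS[OF pq] by (simp add: bilinD(6)[OF pure_bilin[OF A_vs A_vs]])
  finally show ?thesis .
 qed
 \<comment> \<open>The usual comparison of inverses, x = x (M y) = (x M) y = y, written out for
   matrices over the tensor square.\<close>
 have xy: "x p q = y p q" if pq: "p:I" "q:I" for p q
 proof -
  have Z: "Fs AA (%r. tmul (x p r) (Fs AA (%s. tmul (M r s) (y s q)) I)) I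
   = Fs AA (%s. tmul (Fs AA (%r. tmul (x p r) (M r s)) I) (y s q)) I"
  proof -
   have "Fs AA (%r. tmul (x p r) (Fs AA (%s. tmul (M r s) (y s q)) I)) I
    = Fs AA (%r. Fs AA (%s. tmul (tmul (x p r) (M r s)) (y s q)) I) I"
   proof (rule vsum_cong[OF AA_vs refl])
    fix r assume r: "r:I"
    show "Fs AA (%s. tmul (tmul (x p r) (M r s)) (y s q)) I .: AA"
     using x M y pq r by (intro vsum_closed[OF AA_vs]) auto
    have "tmul (x p r) (Fs AA (%s. tmul (M r s) (y s q)) I) = Fs AA (%s. tmul (x p r) (tmul (M r s) (y s q))) I"
     by (rule hom_sum[OF AA_vs AA_vs bilinD(1)[OF tmul_bilin x[OF pq(1) r]]]) (use M y pq r in auto)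
    also have "... = Fs AA (%s. tmul (tmul (x p r) (M r s)) (y s q)) I"
     by (rule vsum_cong[OF AA_vs refl]) (use x M y pq r in "auto simp: tmul_assoc")
    finally show "tmul (x p r) (Fs AA (%s. tmul (M r s) (y s q)) I) = Fs AA (%s. tmul (tmul (x p r) (M r s)) (y s q)) I" .
   qed
   also have "... = Fs AA (%s. Fs AA (%r. tmul (tmul (x p r) (M r s)) (y s q)) I) I"
    by (rule vsum_swap[OF AA_vs fin fin]) (use x M y pq in auto)
   also have "... = Fs AA (%s. tmul (Fs AA (%r. tmul (x p r) (M r s)) I) (y s q)) I"
   proof (rule vsum_cong[OF AA_vs refl])
    fix s assume s: "s:I"
    have c: "Fs AA (%r. tmul (x p r) (M r s)) I .: AA" using x M pq s by (intro vsum_closed[OF AA_vs]) auto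
    show "tmul (Fs AA (%r. tmul (x p r) (M r s)) I) (y s q) .: AA" using c y s pq by simp
    show "Fs AA (%r. tmul (tmul (x p r) (M r s)) (y s q)) I = tmul (Fs AA (%r. tmul (x p r) (M r s)) I) (y s q)"
     by (rule hom_sum[OF AA_vs AA_vs bilinD(2)[OF tmul_bilin y[OF s pq(2)]], symmetric]) (use x M pq s in auto)
   qed
   finally show ?thesis .
  qed
  have "Fs AA (%r. tmul (x p r) (Fs AA (%s. tmul (M r s) (y s q)) I)) I = Fs AA (%r. tmul (x p r) (?de r q *[AA] ?T1)) I"
   by (rule vsum_cong[OF AA_vs refl]) (use x T1 My pq in auto)
  also have "... = tmul (x p q) (?de q q *[AA] ?T1)"
  proof (rule vsum_single[OF AA_vs fin pq(2)])
   fix r assume "r:I" "r ~= q"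
   then show "tmul (x p r) (?de r q *[AA] ?T1) = 0[AA]"
    using hom_zero[OF AA_vs AA_vs bilinD(1)[OF tmul_bilin x[OF pq(1)]]] T1 by simp
  qed (use x T1 pq in simp)
  also have "... = x p q" using x pq T1 by (simp add: tmul_one)
  finally have 1: "Fs AA (%r. tmul (x p r) (Fs AA (%s. tmul (M r s) (y s q)) I)) I = x p q" .
  have "Fs AA (%s. tmul (Fs AA (%r. tmul (x p r) (M r s)) I) (y s q)) I = Fs AA (%s. tmul (?de p s *[AA] ?T1) (y s q)) I"
   by (rule vsum_cong[OF AA_vs refl]) (use y T1 xM pq in auto)
  also have "... = tmul (?de p p *[AA] ?T1) (y p q)"
  proof (rule vsum_single[OF AA_vs fin pq(1)])
   fix s assume "s:I" "s ~= p"
   then show "tmul (?de p s *[AA] ?T1) (y s q) = 0[AA]"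
    using hom_zero[OF AA_vs AA_vs bilinD(2)[OF tmul_bilin y[OF _ pq(2)]]] T1 by simp
  qed (use y T1 pq in simp)
  also have "... = y p q" using y pq T1 by (simp add: tmul_one)
  finally show ?thesis using 1 Z by simp
 qed
 show ?thesis
  unfolding mmat_def
 proof (intro conjI ballI fin)
  fix p q assume pq: "p:I" "q:I"
  show "S (m q p) .: A" using Sc m pq by simp
  show "comult A (S (m q p)) = tsum A A I (%r. S (m r p)) (%r. S (m q r))"
   using xy[OF pq(2,1)] by (simp add: x_def y_def)
  have "counit A (Fs A (%r. S (m q r) **[A] m r p) I) = Fs (ssp K) (%r. counit A (S (m q r) **[A] m r p)) I"
   by (rule hom_sum[OF A_vs vs_ssp counit_linear]) (use m Sc pq in auto)
  also have "... = Fs (ssp K) (%r. counit A (S (m q r)) **[K] ?de r p) I"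
   by (rule vsum_cong[OF vs_ssp refl]) (use m Sc pq mmD(4)[OF mm] in "auto simp: counit_mult")
  also have "... = counit A (S (m q p)) **[K] ?de p p"
   by (rule vsum_single[OF vs_ssp fin pq(1)]) (use m Sc pq in auto)
  finally have "counit A (S (m q p)) = counit A (?de q p *[A] 1[A])" using Sm[OF pq(2,1)] m Sc pq by simp
  also have "... = ?de q p" using hom_smult[OF counit_linear, of "?de q p" "1[A]"] by simp
  finally show "counit A (S (m q p)) = (if p = q then 1[K] else 0[K])" by auto
 qed
qed

lemma coeff_size_antipode:
 assumes ad: "all_dims TYPE('v)" and S: "S:Lin K A A"
  and S1: "!!a. a .: A ==> tlift K A A A (%b c. S b **[A] c) (comult A a) = counit A a *[A] 1[A]"
  and S2: "!!a. a .: A ==> tlift K A A A (%b c. b **[A] S c) (comult A a) = counit A a *[A] 1[A]"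
  and a: "coeff_size TYPE('v) n a"
 shows "coeff_size TYPE('v) n (S a)"
proof -
 obtain m f v where mm: "mmat {..<n} m" and f: "ALL p<n. f p .: K" and v: "ALL p<n. v p .: K"
  and ae: "a = Fs A (%q. v q *[A] Fs A (%p. f p *[A] m p q) {..<n}) {..<n}"
  using coeff_size_ex_matrix[OF a] by blast
 let ?I = "{..<n}"
 note m = mmD(2)[OF mm] and Sc = hom_cl[OF S]
 have fc: "p:?I ==> f p .: K" and vc: "p:?I ==> v p .: K" for p using f v by auto
 have c1: "Fs A (%p. f p *[A] m p q) ?I .: A" if "q:?I" for q using fc m that by (intro vsum_closed) auto
 have "S a = Fs A (%q. S (v q *[A] Fs A (%p. f p *[A] m p q) ?I)) ?I"
  unfolding ae by (rule hom_sum[OF A_vs A_vs S]) (use c1 vc in auto)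
 also have "... = Fs A (%q. Fs A (%p. v q *[A] (f p *[A] S (m p q))) ?I) ?I"
 proof (rule vsum_cong[OF A_vs refl])
  fix q assume q: "q:?I"
  show "Fs A (%p. v q *[A] (f p *[A] S (m p q))) ?I .: A" using fc vc m Sc q by (intro vsum_closed) auto
  have "S (Fs A (%p. f p *[A] m p q) ?I) = Fs A (%p. S (f p *[A] m p q)) ?I"
   by (rule hom_sum[OF A_vs A_vs S]) (use fc m q in auto)
  also have "... = Fs A (%p. f p *[A] S (m p q)) ?I"
   by (rule vsum_cong[OF A_vs refl]) (use fc m q Sc in "auto simp: hom_smult[OF S]")
  finally have "S (v q *[A] Fs A (%p. f p *[A] m p q) ?I) = v q *[A] Fs A (%p. f p *[A] S (m p q)) ?I"
   using hom_smult[OF S vc[OF q] c1[OF q]] by simp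
  also have "... = Fs A (%p. v q *[A] (f p *[A] S (m p q))) ?I"
   by (rule vsum_smult[OF A_vs, symmetric]) (use fc vc m q Sc in auto)
  finally show "S (v q *[A] Fs A (%p. f p *[A] m p q) ?I) = Fs A (%p. v q *[A] (f p *[A] S (m p q))) ?I" .
 qed
 also have "... = Fs A (%p. Fs A (%q. v q *[A] (f p *[A] S (m p q))) ?I) ?I"
  by (rule vsum_swap[OF A_vs]) (use fc vc m Sc in auto)
 also have "... = Fs A (%p. f p *[A] Fs A (%q. v q *[A] S (m p q)) ?I) ?I"
 proof (rule vsum_cong[OF A_vs refl])
  fix p assume p: "p:?I"
  have c2: "Fs A (%q. v q *[A] S (m p q)) ?I .: A" using vc m Sc p by (intro vsum_closed) auto
  then show "f p *[A] Fs A (%q. v q *[A] S (m p q)) ?I .: A" using fc p by simp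
  have "Fs A (%q. v q *[A] (f p *[A] S (m p q))) ?I = Fs A (%q. f p *[A] (v q *[A] S (m p q))) ?I"
   by (rule vsum_cong[OF A_vs refl]) (use fc vc m Sc p in "auto simp: vs_sm_smult K.m_comm")
  also have "... = f p *[A] Fs A (%q. v q *[A] S (m p q)) ?I"
   by (rule vsum_smult[OF A_vs]) (use fc vc m Sc p in auto)
  finally show "Fs A (%q. v q *[A] (f p *[A] S (m p q))) ?I = f p *[A] Fs A (%q. v q *[A] S (m p q)) ?I" .
 qed
 \<comment> \<open>Passing to the transposed matrix exchanges the roles of the two families of
   scalars.\<close>
 finally show ?thesis
  using coeff_size_matrix[OF ad antipode_matrix[OF S S1 S2 mm], of v f] fc vc by simp
qed

end

section \<open>Finite powers of a space\<close>

context scalars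
begin

lemma power_space_simps:
 "Car (power_space V n) = {..<n} \<rightarrow>\<^sub>E Car V" "zero (power_space V n) = (\<lambda>j\<in>{..<n}. 0[V])"
 "add (power_space V n) = (%x y. \<lambda>j\<in>{..<n}. x j +[V] y j)"
 "smult (power_space V n) = (%c x. \<lambda>j\<in>{..<n}. c *[V] x j)"
 by (simp_all add: power_space_def)

lemma power_space_vs:
 assumes V: "vsp K V"
 shows "vsp K (power_space V n)"
 unfolding vs_iff_module
proof (rule module_criteria)
 show "ALL v:Car (power_space V n). EX neg_v:Car (power_space V n). v +[power_space V n] neg_v = 0[power_space V n]"
 proof
  fix v assume v: "v .: power_space V n"
  then have "v +[power_space V n] (\<lambda>j\<in>{..<n}. -[V] v j) = 0[power_space V n]"
   using V by (auto simp: power_space_simps fun_eq_iff restrict_def PiE_def Pi_def)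
  moreover have "(\<lambda>j\<in>{..<n}. -[V] v j) .: power_space V n"
   using v V by (auto simp: power_space_simps PiE_def Pi_def)
  ultimately show "EX neg_v:Car (power_space V n). v +[power_space V n] neg_v = 0[power_space V n]" by blast
 qed
qed (use V is_cring in "auto simp: power_space_simps fun_eq_iff PiE_def Pi_def extensional_def
   vs_add_assoc vs_sm_smult vs_sm_l_distr vs_sm_r_distr intro: vs_add_comm")

lemma power_inj_hom:
 assumes V: "vsp K V" and j: "j < n"
 shows "power_inj V n j:Lin K V (power_space V n)"
 using V j by (intro homI) (auto simp: power_inj_def power_space_simps fun_eq_iff PiE_def)

lemma power_proj_hom:
 assumes j: "j < n"
 shows "(%x. x j):Lin K (power_space V n) V"
 using j by (intro homI) (auto simp: power_space_simps PiE_def)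

lemma power_expand:
 assumes V: "vsp K V" and x: "x .: power_space V n"
 shows "Fs (power_space V n) (%j. power_inj V n j (x j)) {..<n} = x"
proof -
 let ?P = "power_space V n"
 note P = power_space_vs[OF V, of n]
 have xj: "x j .: V" if "j < n" for j using x that by (auto simp: power_space_simps PiE_def)
 have cl: "power_inj V n j (x j) .: ?P" if "j < n" for j
  using hom_cl[OF power_inj_hom[OF V that] xj[OF that]] .
 have S: "Fs ?P (%j. power_inj V n j (x j)) {..<n} .: ?P" using cl by (intro vsum_closed[OF P]) auto
 show ?thesis
 proof (rule PiE_ext[of _ "{..<n}" "%_. Car V"])
  fix l assume l: "l : {..<n}"
  have "Fs ?P (%j. power_inj V n j (x j)) {..<n} l = Fs V (%j. power_inj V n j (x j) l) {..<n}"
   by (rule hom_sum[OF P V power_proj_hom]) (use l cl in auto)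
  also have "... = power_inj V n l (x l) l"
   by (rule vsum_single[OF V _ l]) (use l V xj in "auto simp: power_inj_def")
  finally show "Fs ?P (%j. power_inj V n j (x j)) {..<n} l = x l" using l by (simp add: power_inj_def)
 qed (use S x in "auto simp: power_space_simps")
qed

end

context hopf_setup
begin

subsection \<open>The algebras of endomorphisms of the fibre functor\<close>

lemma power_coact_inj:
 assumes X: "rcom K A X" and j: "j < n" and x: "x .: X"
 shows "coact (power_comodule K A X n) (power_inj X n j x)
  = tmap K X A (power_space X n) A (power_inj X n j) (%a. a) (coact X x)"
proof -
 note Xv = coD(1)[OF X] and P = power_space_vs[OF coD(1)[OF X], of n]
 let ?P = "power_space X n"
 let ?t = "%l. tmap K X A ?P A (power_inj X n l) (%a. a)"
 have PA: "vsp K (ten K ?P A)" and XA: "vsp K (ten K X A)" using P Xv by simp_all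
 have th: "?t l:Lin K (ten K X A) (ten K ?P A)" if "l < n" for l
  by (rule tmap_hom[OF Xv A_vs P A_vs power_inj_hom[OF Xv that] hom_id])
 have ij: "power_inj X n j x l = (if l = j then x else 0[X])" if "l < n" for l using that by (simp add: power_inj_def)
 have "coact (power_comodule K A X n) (power_inj X n j x)
  = Fs (ten K ?P A) (%l. ?t l (coact X (power_inj X n j x l))) {..<n}"
  by (simp add: power_comodule_def)
 also have "... = ?t j (coact X (power_inj X n j x j))"
  by (rule vsum_single[OF PA])
   (use j x ij hom_zero[OF Xv XA coD(2)[OF X]] hom_zero[OF XA PA th] hom_cl[OF th] coD(3)[OF X] in auto)
 finally show ?thesis using ij[OF j] by simp
qed

lemma power_component_hom:
 assumes X: "rcom K A X" and Q: "rcom K A Q"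
  and p: "p:chom K A (power_comodule K A X n) Q" and j: "j < n"
 shows "(\<lambda>x\<in>Car X. p (power_inj X n j x)):chom K A X Q"
proof -
 note Xv = coD(1)[OF X] and Qv = coD(1)[OF Q] and P = power_space_vs[OF coD(1)[OF X], of n]
 note ih = power_inj_hom[OF Xv j]
 have ph: "p:Lin K (power_space X n) Q"
  using chD(2)[OF p] by (simp add: power_comodule_def)
 note pi = hom_comp[OF ih ph]
 have "coact Q (p (power_inj X n j x)) = tmap K X A Q A (\<lambda>x\<in>Car X. p (power_inj X n j x)) (%a. a) (coact X x)"
  if x: "x .: X" for x
 proof -
  have ix: "power_inj X n j x .: power_comodule K A X n"
   using hom_cl[OF ih x] by (simp add: power_comodule_def)
  have "coact Q (p (power_inj X n j x)) = tmap K (power_space X n) A Q A p (%a. a)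
    (tmap K X A (power_space X n) A (power_inj X n j) (%a. a) (coact X x))"
   using chD(3)[OF p ix] power_coact_inj[OF X j x] by (simp add: power_comodule_def)
  also have "... = tmap K X A Q A (%x. p (power_inj X n j x)) (%a. a) (coact X x)"
   by (rule tmap_comp[OF Xv A_vs P A_vs Qv A_vs ih hom_id ph hom_id coD(3)[OF X x]])
  also have "tmap K X A Q A (%x. p (power_inj X n j x)) (%a. a)
   = tmap K X A Q A (\<lambda>x\<in>Car X. p (power_inj X n j x)) (%a. a)"
   by (rule tmap_cong) simp_all
  finally show ?thesis .
 qed
 then show ?thesis using lm_restrict[OF Xv pi] by (simp add: comod_hom_def)
qed

text \<open>\<open>Z\<close> is a quotient of its first power, so its subobjects qualify. The work
  lies in identifying that power, whose elements are functions on a one-element index set, with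
  \<open>Z\<close>.\<close>

lemma generated_subobject:
 fixes X Z :: "('k, 'a, 'v) comodule"
 assumes X: "X:OB K A" and Z: "Z:OB K A" and i: "i:chom K A X Z" "inj_on i (Car X)"
 shows "X:generated K A Z"
proof -
 note Zc = ObjD(1)[OF Z] and Zv = ObjD(3)[OF Z] and P = power_space_vs[OF ObjD(3)[OF Z], of 1]
 let ?P = "power_space Z 1"
 let ?p = "\<lambda>x\<in>Car ?P. x 0"
 have ph: "?p:lin_maps K ?P Z" by (rule lm_restrict[OF P power_proj_hom]) simp
 have ih: "power_inj Z 1 0:Lin K Z ?P" by (rule power_inj_hom[OF Zv]) simp
 have pi: "?p (power_inj Z 1 0 x) = x" if "x .: Z" for x
  using hom_cl[OF ih that] by (simp add: power_inj_def)
 have x0: "power_inj Z 1 0 (x 0) = x" "x 0 .: Z" if "x .: ?P" for x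
  using that by (auto simp: power_inj_def power_space_simps PiE_def extensional_def fun_eq_iff)
 have "coact Z (?p x) = tmap K ?P A Z A ?p (%a. a) (coact (power_comodule K A Z 1) x)" if x: "x .: ?P" for x
 proof -
  have "coact (power_comodule K A Z 1) x = tmap K Z A ?P A (power_inj Z 1 0) (%a. a) (coact Z (x 0))"
   using power_coact_inj[OF Zc _ x0(2)[OF x], of 0 1] x0(1)[OF x] by simp
  then have "tmap K ?P A Z A ?p (%a. a) (coact (power_comodule K A Z 1) x)
   = tmap K Z A Z A (%x. ?p (power_inj Z 1 0 x)) (%a. a) (coact Z (x 0))"
   using tmap_comp[OF Zv A_vs P A_vs Zv A_vs ih hom_id lm_hom[OF ph] hom_id coD(3)[OF Zc x0(2)[OF x]]] by simp
  also have "... = coact Z (x 0)"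
   by (rule tmap_id[OF Zv A_vs coD(3)[OF Zc x0(2)[OF x]] hom_comp[OF ih lm_hom[OF ph]] pi hom_id]) simp_all
  finally show ?thesis using x by simp
 qed
 then have "?p:chom K A (power_comodule K A Z 1) Z"
  using ph by (simp add: comod_hom_def power_comodule_def)
 moreover have "?p ` Car (power_comodule K A Z 1) = Car Z"
 proof -
  have "Car Z <= ?p ` Car ?P"
  proof
   fix x assume x: "x .: Z"
   show "x:?p ` Car ?P"
    by (rule image_eqI[of _ ?p "power_inj Z 1 0 x"]) (rule pi[OF x, symmetric], rule hom_cl[OF ih x])
  qed
  moreover have "?p ` Car ?P <= Car Z" using x0(2) by auto
  ultimately show ?thesis by (simp add: power_comodule_def)
 qed
 ultimately show ?thesis unfolding generated_def using X Z i by blast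
qed

lemma generated_self:
 assumes "(X :: ('k, 'a, 'v) comodule):OB K A"
 shows "X:generated K A X"
 by (rule generated_subobject[OF assms assms comod_hom_id[OF ObjD(1)[OF assms]]]) (simp add: inj_on_def)

lemma generated_Obj: "X:generated K A Y ==> X:OB K A"
 by (simp add: generated_def)

lemma nfamD:
 assumes "natural_family K A X La"
 shows "Y:generated K A X ==> La Y:lin_maps K Y Y"
  "[|Y:generated K A X; Z:generated K A X; f:chom K A Y Z; y .: Y|] ==> f (La Y y) = La Z (f y)"
 using assms unfolding natural_family_def by auto

text \<open>The value at \<open>X\<close> is determined by the value at the quotient
  \<open>Q\<close> of a power of \<open>Y\<close>, and that by the value at \<open>Y\<close>. A
  power of \<open>Y\<close> lives on another type and is not an object at which the family could be
  evaluated, so naturality is applied to the components of \<open>p\<close>, which are morphisms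
  from \<open>Y\<close> to \<open>Q\<close>.\<close>

lemma natural_family_unique:
 fixes X Y :: "('k, 'a, 'v) comodule"
 assumes Y: "Y:OB K A" and La: "natural_family K A Y La" and M: "natural_family K A Y M"
  and eq: "La Y = M Y" and X: "X:generated K A Y"
 shows "La X = M X"
proof -
 obtain n and Q :: "('k, 'a, 'v) comodule" and p j where Q: "Q:OB K A"
  and p: "p:chom K A (power_comodule K A Y n) Q" "p ` Car (power_comodule K A Y n) = Car Q"
  and j: "j:chom K A X Q" "inj_on j (Car X)"
  using X unfolding generated_def by blast
 have Qg: "Q:generated K A Y" unfolding generated_def
  using Q p comod_hom_id[OF ObjD(1)[OF Q]] by (intro CollectI conjI exI[of _ n] bexI[of _ Q] bexI[of _ p] bexI[of _ "\<lambda>x\<in>Car Q. x"]) (auto simp: inj_on_def)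
 note Yg = generated_self[OF Y] and Yc = ObjD(1)[OF Y] and Yv = ObjD(3)[OF Y] and Qv = ObjD(3)[OF Q]
 note P = power_space_vs[OF Yv, of n]
 have ph: "p:Lin K (power_space Y n) Q" using chD(2)[OF p(1)] by (simp add: power_comodule_def)
 have *: "La Q y = M Q y" if y: "y .: Q" for y
 proof -
  obtain x where x: "x .: power_space Y n" "y = p x"
   using y p(2) by (auto simp: power_comodule_def)
  have xj: "x l .: Y" if "l < n" for l using x(1) that by (auto simp: power_space_simps PiE_def)
  have cl: "power_inj Y n l (x l) .: power_space Y n" if "l < n" for l
   using hom_cl[OF power_inj_hom[OF Yv that] xj[OF that]] .
  have y': "y = Fs Q (%l. p (power_inj Y n l (x l))) {..<n}"
   using hom_sum[OF P Qv ph, of "{..<n}" "%l. power_inj Y n l (x l)"] power_expand[OF Yv x(1)] cl x(2) by simp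
  have N: "N Q y = Fs Q (%l. p (power_inj Y n l (N Y (x l)))) {..<n}" if N: "natural_family K A Y N" for N
  proof -
   note NQ = lm_hom[OF nfamD(1)[OF N Qg]] and NY = lm_hom[OF nfamD(1)[OF N Yg]]
   have pc: "p (power_inj Y n l z) .: Q" if "l < n" "z .: Y" for l z
    using hom_cl[OF ph hom_cl[OF power_inj_hom[OF Yv that(1)] that(2)]] .
   have "N Q y = Fs Q (%l. N Q (p (power_inj Y n l (x l)))) {..<n}"
    unfolding y' by (rule hom_sum[OF Qv Qv NQ]) (use pc xj in auto)
   also have "... = Fs Q (%l. p (power_inj Y n l (N Y (x l)))) {..<n}"
   proof (rule vsum_cong[OF Qv refl])
    fix l assume l: "l : {..<n}"
    then have l': "l < n" by simp
    show "p (power_inj Y n l (N Y (x l))) .: Q" using pc[OF l' hom_cl[OF NY xj[OF l']]] .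
    show "N Q (p (power_inj Y n l (x l))) = p (power_inj Y n l (N Y (x l)))"
     using nfamD(2)[OF N Yg Qg power_component_hom[OF Yc ObjD(1)[OF Q] p(1) l'] xj[OF l']]
      xj[OF l'] hom_cl[OF NY xj[OF l']] by simp
   qed
   finally show ?thesis .
  qed
  show ?thesis using N[OF La] N[OF M] eq by simp
 qed
 show ?thesis
 proof (rule lm_eqI[OF nfamD(1)[OF La X] nfamD(1)[OF M X]])
  fix x assume x: "x .: X"
  have "j (La X x) = j (M X x)"
   using nfamD(2)[OF La X Qg j(1) x] nfamD(2)[OF M X Qg j(1) x] *[OF chD(4)[OF j(1) x]] by simp
  then show "La X x = M X x"
   using j(2) hom_cl[OF lm_hom[OF nfamD(1)[OF La X]] x] hom_cl[OF lm_hom[OF nfamD(1)[OF M X]] x]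
   by (auto dest: inj_onD)
 qed
qed

lemma L_trans_eq:
 fixes X Y :: "('k, 'a, 'v) comodule"
 assumes Y: "Y:OB K A" and La: "natural_family K A Y La" and X: "X:generated K A Y"
 shows "L_trans K A X Y (La Y) = La X"
 unfolding L_trans_def
proof (rule the_equality)
 show "EX M. natural_family K A Y M & M Y = La Y & M X = La X" using La by blast
 show "l = La X" if "EX M. natural_family K A Y M & M Y = La Y & M X = l" for l
  using that natural_family_unique[OF Y _ La _ X] by blast
qed

text \<open>Linear endomorphisms of the forgetful functor on the whole category, in the extensional
  form in which they occur in \<open>L_lim\<close>.\<close>

definition nendo :: "(('k, 'a, 'v) comodule => 'v => 'v) => bool" where
 "nendo La \<longleftrightarrow> La:extensional (OB K A) & (ALL X:OB K A. La X:lin_maps K X X)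
  & (ALL X:OB K A. ALL Y:OB K A. ALL f:chom K A X Y. ALL x:Car X. f (La X x) = La Y (f x))"

lemma neD:
 assumes "nendo La"
 shows "La:extensional (OB K A)" "X:OB K A ==> La X:lin_maps K X X"
  "X:OB K A ==> La X:Lin K X X"
  "[|X:OB K A; x .: X|] ==> La X x .: X"
  "[|X:OB K A; Y:OB K A; f:chom K A X Y; x .: X|] ==> f (La X x) = La Y (f x)"
 using assms hom_cl[of "La X" X X x] unfolding nendo_def by (auto simp: lin_maps_def)

lemma nat_endo_natural_family:
 assumes n: "nendo La"
 shows "natural_family K A Y La"
 unfolding natural_family_def
 by (intro conjI ballI)
  (erule neD(2)[OF n generated_Obj], erule (3) neD(5)[OF n generated_Obj generated_Obj])

text \<open>A compatible family comes from natural families on each category generated by one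
  object. It is natural for an arbitrary morphism because source and target are both generated by
  their direct sum.\<close>

lemma L_lim_carrier:
 fixes La :: "('k, 'a, 'v) comodule => 'v => 'v"
 assumes ad: "all_dims TYPE('v)"
 shows "La .: L_lim K A \<longleftrightarrow> nendo La"
proof
 let ?Ob = "OB K A :: ('k, 'a, 'v) comodule set"
 assume n: "nendo La"
 have "La Y:L_alg K A Y" for Y unfolding L_alg_def using nat_endo_natural_family[OF n] by blast
 then show "La .: L_lim K A" using L_trans_eq[OF _ nat_endo_natural_family[OF n]] neD(1)[OF n]
  by (auto simp: L_lim_def Let_def PiE_def)
next
 let ?Ob = "OB K A :: ('k, 'a, 'v) comodule set"
 assume L: "La .: L_lim K A"
 then have ext: "La:extensional ?Ob" and alg: "!!X. X:?Ob ==> La X:L_alg K A X"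
  and tr: "!!X Y. Y:?Ob ==> X:generated K A Y ==> L_trans K A X Y (La Y) = La X"
  by (auto simp: L_lim_def Let_def PiE_def)
 have fam: "EX Ga. natural_family K A Z Ga & (ALL X:generated K A Z. Ga X = La X)" if Z: "Z:?Ob" for Z
 proof -
  obtain Ga where "natural_family K A Z Ga" "La Z = Ga Z" using alg[OF Z] unfolding L_alg_def by blast
  then show ?thesis using L_trans_eq[OF Z] tr[OF Z] by metis
 qed
 show "nendo La"
  unfolding nendo_def
 proof (intro conjI ballI ext)
  fix X assume X: "X:?Ob"
  then show "La X:lin_maps K X X" using fam[OF X] generated_self[OF X] nfamD(1) by metis
 next
  fix X Y f x assume X: "X:?Ob" and Y: "Y:?Ob" and f: "f:chom K A X Y" and x: "x .: X"
  obtain Z :: "('k, 'a, 'v) comodule" and i j p q where Z: "Z:?Ob"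
   and ij: "i:chom K A X Z" "j:chom K A Y Z"
   and pq: "ALL x:Car X. p (i x) = x & q (i x) = 0[Y]" "ALL y:Car Y. q (j y) = y & p (j y) = 0[X]"
   using direct_sum[OF ad X Y] by (elim exE conjE) (rule that)
  have "inj_on i (Car X)" "inj_on j (Car Y)" using pq by (metis inj_onI)+
  then have "X:generated K A Z" "Y:generated K A Z"
   using generated_subobject[OF X Z ij(1)] generated_subobject[OF Y Z ij(2)] by auto
  then show "f (La X x) = La Y (f x)" using fam[OF Z] nfamD(2)[OF _ _ _ f x] by metis
 qed
qed

lemma L_lim_simps:
 fixes La M :: "('k, 'a, 'v) comodule => 'v => 'v"
 assumes "X:OB K A" "x .: X"
 shows "(La **[L_lim K A] M) X x = La X (M X x)" "1[L_lim K A] X x = x" "(0[L_lim K A] :: ('k, 'a, 'v) comodule => 'v => 'v) X x = 0[X]"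
  "(La +[L_lim K A] M) X x = La X x +[X] M X x" "(c *[L_lim K A] La) X x = c *[X] La X x"
 using assms by (auto simp: L_lim_def Let_def compose_def)

lemma nat_endo_eqI:
 fixes La M :: "('k, 'a, 'v) comodule => 'v => 'v"
 assumes "nendo La" "nendo M" "!!X x. X:OB K A ==> x .: X ==> La X x = M X x"
 shows "La = M"
proof (rule extensionalityI[OF neD(1)[OF assms(1)] neD(1)[OF assms(2)]])
 fix X :: "('k, 'a, 'v) comodule" assume X: "X:OB K A"
 show "La X = M X" by (rule lm_eqI[OF neD(2)[OF assms(1) X] neD(2)[OF assms(2) X]]) (rule assms(3)[OF X])
qed

lemma nat_endoI:
 fixes La :: "('k, 'a, 'v) comodule => 'v => 'v"
 assumes "!!X. X:OB K A ==> La X:Lin K X X"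
  "!!X Y f x. [|X:OB K A; Y:OB K A; f:chom K A X Y; x .: X|] ==> f (La X x) = La Y (f x)"
 shows "nendo (\<lambda>X\<in>OB K A. \<lambda>x\<in>Car X. La X x)"
 unfolding nendo_def
proof (intro conjI ballI)
 fix X :: "('k, 'a, 'v) comodule" assume X: "X:OB K A"
 show "(\<lambda>X\<in>OB K A. \<lambda>x\<in>Car X. La X x) X:lin_maps K X X"
  using lm_restrict[OF ObjD(3)[OF X] assms(1)[OF X]] X by simp
next
 fix X Y :: "('k, 'a, 'v) comodule" and f x
 assume *: "X:OB K A" "Y:OB K A" "f:chom K A X Y" "x .: X"
 show "f ((\<lambda>X\<in>OB K A. \<lambda>x\<in>Car X. La X x) X x) = (\<lambda>X\<in>OB K A. \<lambda>x\<in>Car X. La X x) Y (f x)"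
  using * assms(2)[OF *] chD(4)[OF *(3,4)] by simp
qed simp

lemma nat_endo_ops:
 fixes La M :: "('k, 'a, 'v) comodule => 'v => 'v"
 assumes La: "nendo La" and M: "nendo M" and c: "c .: K"
 shows "nendo (La **[L_lim K A] M)" "nendo (1[L_lim K A] :: ('k, 'a, 'v) comodule => 'v => 'v)"
  "nendo (0[L_lim K A] :: ('k, 'a, 'v) comodule => 'v => 'v)" "nendo (La +[L_lim K A] M)" "nendo (c *[L_lim K A] La)"
proof -
 note l = neD[OF La] and m = neD[OF M]
 have "nendo (\<lambda>X\<in>OB K A. \<lambda>x\<in>Car X. La X (M X x))"
  by (rule nat_endoI) (use l m hom_comp[OF m(3) l(3)] in auto)
 then show "nendo (La **[L_lim K A] M)" by (simp add: L_lim_def Let_def compose_def)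
 have "nendo (\<lambda>X\<in>OB K A :: ('k, 'a, 'v) comodule set. \<lambda>x\<in>Car X. x)"
  by (rule nat_endoI) (auto simp: hom_id)
 then show "nendo (1[L_lim K A] :: ('k, 'a, 'v) comodule => 'v => 'v)" by (simp add: L_lim_def Let_def)
 have "nendo (\<lambda>X\<in>OB K A :: ('k, 'a, 'v) comodule set. \<lambda>x\<in>Car X. 0[X])"
  by (rule nat_endoI) (auto intro: hom_zero_map ObjD(3) hom_zero[OF ObjD(3) ObjD(3) chD(2)])
 then show "nendo (0[L_lim K A] :: ('k, 'a, 'v) comodule => 'v => 'v)" by (simp add: L_lim_def Let_def)
 have "nendo (\<lambda>X\<in>OB K A. \<lambda>x\<in>Car X. La X x +[X] M X x)"
 proof (rule nat_endoI)
  fix X Y :: "('k, 'a, 'v) comodule" and f x assume *: "X:OB K A" "Y:OB K A" "f:chom K A X Y" "x .: X"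
  show "f (La X x +[X] M X x) = La Y (f x) +[Y] M Y (f x)"
   using hom_add[OF chD(2)[OF *(3)] l(4)[OF *(1,4)] m(4)[OF *(1,4)]] l(5)[OF *] m(5)[OF *] by simp
 qed (rule hom_add_map[OF ObjD(3) l(3) m(3)])
 then show "nendo (La +[L_lim K A] M)" by (simp add: L_lim_def Let_def)
 have "nendo (\<lambda>X\<in>OB K A. \<lambda>x\<in>Car X. c *[X] La X x)"
 proof (rule nat_endoI)
  fix X Y :: "('k, 'a, 'v) comodule" and f x assume *: "X:OB K A" "Y:OB K A" "f:chom K A X Y" "x .: X"
  show "f (c *[X] La X x) = c *[Y] La Y (f x)"
   using hom_smult[OF chD(2)[OF *(3)] c l(4)[OF *(1,4)]] l(5)[OF *] by simp
 qed (rule hom_smult_map[OF ObjD(3) l(3) c])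
 then show "nendo (c *[L_lim K A] La)" by (simp add: L_lim_def Let_def)
qed

lemma L_lim_vs:
 assumes ad: "all_dims TYPE('v)"
 shows "vsp K (L_lim K A :: ('k, ('k, 'a, 'v) comodule => 'v => 'v) module)"
 unfolding vs_iff_module
proof (rule module_criteria)
 let ?L = "L_lim K A :: ('k, ('k, 'a, 'v) comodule => 'v => 'v) module"
 note car = L_lim_carrier[OF ad] and ops = nat_endo_ops
 have m1: "-[K] 1[K] .: K" by simp
 show "cring K" by (rule K.is_cring)
 show "0[?L] .: ?L"
 proof -
  have "nendo (\<lambda>X\<in>OB K A :: ('k, 'a, 'v) comodule set. \<lambda>x\<in>Car X. x)" by (rule nat_endoI) (auto simp: hom_id)
  from ops(3)[OF this this K.zero_closed] show ?thesis by (simp add: car)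
 qed
 show "ALL v w. v .: ?L & w .: ?L --> v +[?L] w .: ?L" using ops(4) K.zero_closed by (auto simp: car)
 show "ALL c v. c .: K & v .: ?L --> c *[?L] v .: ?L" using ops(5) by (auto simp: car)
 show "ALL v:Car ?L. EX neg_v:Car ?L. v +[?L] neg_v = 0[?L]"
 proof
  fix v assume "v .: ?L"
  then have v: "nendo v" by (simp add: car)
  note nv = ops(5)[OF v v m1]
  have "v +[?L] ((-[K] 1[K]) *[?L] v) = 0[?L]"
  proof (rule nat_endo_eqI[OF ops(4)[OF v nv m1] ops(3)[OF v v m1]])
   fix X :: "('k, 'a, 'v) comodule" and x assume X: "X:OB K A" "x .: X"
   note Xv = ObjD(3)[OF X(1)] and vx = neD(4)[OF v X]
   have "v X x +[X] (-[K] 1[K]) *[X] v X x = (1[K] +[K] -[K] 1[K]) *[X] v X x"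
    using vs_sm_l_distr[OF Xv K.one_closed m1 vx] Xv vx by simp
   then show "(v +[?L] ((-[K] 1[K]) *[?L] v)) X x = 0[?L] X x"
    using X Xv vx by (simp add: L_lim_simps K.r_neg)
  qed
  then show "EX neg_v:Car ?L. v +[?L] neg_v = 0[?L]" using nv by (auto simp: car)
 qed
 have eqI: "La = M" if "nendo La" "nendo M"
  "!!X x. X:OB K A ==> x .: X ==> vsp K X ==> La X x = M X x" for La M :: "('k, 'a, 'v) comodule => 'v => 'v"
  using nat_endo_eqI[OF that(1,2) that(3)[OF _ _ ObjD(3)]] by blast
 show "ALL v w. v .: ?L & w .: ?L --> v +[?L] w = w +[?L] v"
 proof (intro allI impI, elim conjE)
  fix v w assume "v .: ?L" "w .: ?L"
  then have n: "nendo v" "nendo w" by (simp_all add: car)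
  note c = neD(4)[OF n(1)] neD(4)[OF n(2)]
  show "v +[?L] w = w +[?L] v"
  proof (rule eqI[OF ops(4)[OF n m1] ops(4)[OF n(2,1) m1]])
   fix X :: "('k, 'a, 'v) comodule" and x assume X: "X:OB K A" "x .: X" "vsp K X"
   show "(v +[?L] w) X x = (w +[?L] v) X x"
    using vs_add_comm[OF X(3) c(1)[OF X(1,2)] c(2)[OF X(1,2)]] X by (simp add: L_lim_simps)
  qed
 qed
 show "ALL v w x. v .: ?L & w .: ?L & x .: ?L --> v +[?L] w +[?L] x = v +[?L] (w +[?L] x)"
 proof (intro allI impI, elim conjE)
  fix v w x assume "v .: ?L" "w .: ?L" "x .: ?L"
  then have n: "nendo v" "nendo w" "nendo x" by (simp_all add: car)
  note c = neD(4)[OF n(1)] neD(4)[OF n(2)] neD(4)[OF n(3)]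
  show "v +[?L] w +[?L] x = v +[?L] (w +[?L] x)"
   by (rule eqI) (simp_all add: ops(4)[OF _ _ m1] n L_lim_simps c vs_add_assoc)
 qed
 show "ALL v:Car ?L. v +[?L] 0[?L] = v"
 proof
  fix v assume "v .: ?L"
  then have n: "nendo v" by (simp add: car)
  show "v +[?L] 0[?L] = v"
   by (rule eqI) (simp_all add: ops(3)[OF n n m1] ops(4)[OF _ _ m1] n L_lim_simps neD(4)[OF n])
 qed
 show "ALL a b v. a .: K & b .: K & v .: ?L --> (a **[K] b) *[?L] v = a *[?L] (b *[?L] v)"
 proof (intro allI impI, elim conjE)
  fix a b v assume k: "a .: K" "b .: K" and "v .: ?L"
  then have n: "nendo v" by (simp add: car)
  show "(a **[K] b) *[?L] v = a *[?L] (b *[?L] v)"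
   by (rule eqI) (simp_all add: ops(5)[OF _ n] k n L_lim_simps neD(4)[OF n] vs_sm_smult)
 qed
 show "ALL v:Car ?L. 1[K] *[?L] v = v"
 proof
  fix v assume "v .: ?L"
  then have n: "nendo v" by (simp add: car)
  show "1[K] *[?L] v = v"
   by (rule eqI) (simp_all add: ops(5)[OF _ n] n L_lim_simps neD(4)[OF n])
 qed
 show "ALL a b v. a .: K & b .: K & v .: ?L --> (a +[K] b) *[?L] v = a *[?L] v +[?L] b *[?L] v"
 proof (intro allI impI, elim conjE)
  fix a b v assume k: "a .: K" "b .: K" and "v .: ?L"
  then have n: "nendo v" by (simp add: car)
  show "(a +[K] b) *[?L] v = a *[?L] v +[?L] b *[?L] v"
   by (rule eqI) (simp_all add: ops(5)[OF _ n] ops(4)[OF _ _ m1] k n L_lim_simps neD(4)[OF n] vs_sm_l_distr)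
 qed
 show "ALL a v w. a .: K & v .: ?L & w .: ?L --> a *[?L] (v +[?L] w) = a *[?L] v +[?L] a *[?L] w"
 proof (intro allI impI, elim conjE)
  fix a v w assume k: "a .: K" and "v .: ?L" "w .: ?L"
  then have n: "nendo v" "nendo w" by (simp_all add: car)
  show "a *[?L] (v +[?L] w) = a *[?L] v +[?L] a *[?L] w"
   by (rule eqI) (simp_all add: ops(5)[OF _ n(1)] ops(4)[OF _ _ m1] k n L_lim_simps neD(4)[OF n(1)] neD(4)[OF n(2)] vs_sm_r_distr)
 qed
qed

lemma L_lim_ring:
 assumes ad: "all_dims TYPE('v)"
 shows "ring (L_lim K A :: ('k, ('k, 'a, 'v) comodule => 'v => 'v) module)"
proof (rule ringI)
 let ?L = "L_lim K A :: ('k, ('k, 'a, 'v) comodule => 'v => 'v) module"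
 note car = L_lim_carrier[OF ad] and ops = nat_endo_ops[OF _ _ K.zero_closed]
 show "abelian_group ?L" using L_lim_vs[OF ad] by (simp add: vs_iff_module module_def)
 show "monoid ?L"
 proof (rule monoidI)
  show "1[?L] .: ?L"
  proof -
   have "nendo (\<lambda>X\<in>OB K A :: ('k, 'a, 'v) comodule set. \<lambda>x\<in>Car X. x)" by (rule nat_endoI) (auto simp: hom_id)
   from ops(2)[OF this this] show ?thesis by (simp add: car)
  qed
 next
  fix x y z assume "x .: ?L" "y .: ?L" "z .: ?L"
  then have n: "nendo x" "nendo y" "nendo z" by (simp_all add: car)
  show "x **[?L] y **[?L] z = x **[?L] (y **[?L] z)"
   by (rule nat_endo_eqI) (use n neD(4)[OF n(3)] neD(4)[OF n(2)] in "auto simp: L_lim_simps intro!: ops(1)")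
 next
  fix x assume "x .: ?L"
  then have n: "nendo x" by (simp add: car)
  show "1[?L] **[?L] x = x"
   by (rule nat_endo_eqI) (use n neD(4)[OF n] in "auto simp: L_lim_simps intro!: ops(1,2)")
  show "x **[?L] 1[?L] = x"
   by (rule nat_endo_eqI) (use n neD(4) in "auto simp: L_lim_simps intro!: ops(1,2)")
 qed (use ops(1) in "auto simp: car")
 fix x y z assume "x .: ?L" "y .: ?L" "z .: ?L"
 then have n: "nendo x" "nendo y" "nendo z" by (simp_all add: car)
 show "(x +[?L] y) **[?L] z = x **[?L] z +[?L] y **[?L] z"
  by (rule nat_endo_eqI) (use n neD(4)[OF n(3)] in "auto simp: L_lim_simps intro!: ops(1,4)")
 note c = neD(4)[OF n(1)] neD(4)[OF n(2)] neD(4)[OF n(3)]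
 show "z **[?L] (x +[?L] y) = z **[?L] x +[?L] z **[?L] y"
  by (rule nat_endo_eqI) (simp_all add: ops(1) ops(4) n L_lim_simps c hom_add[OF neD(3)[OF n(3)]] vs_add_closed[OF ObjD(3)])
qed

text \<open>Every quantity natural in the comodule depends on a vector and a functional only through
  their coefficient. Both pairs are moved into the direct sum, with the functional
  \<open>?F\<close>; by \<open>counit_coefficient\<close> this functional is the counit composed
  with the map to the regular comodule, so it factors through the image \<open>W\<close>, where
  equal coefficients have become equal vectors. The value type of \<open>h\<close> is left open: one
  use evaluates endomorphisms, another forms coefficients over a second Hopf algebra.\<close>

lemma coef_natural:
 fixes Y :: "('k, 'a, 'v) comodule" and Y' :: "('k, 'a, 'v) comodule"
  and h :: "('k, 'a, 'v) comodule => ('v => 'k) => 'v => 's"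
 assumes ad: "all_dims TYPE('v)" and Y: "Y:OB K A" and Y': "Y':OB K A"
  and f: "f:Lin K Y (ssp K)" and f': "f':Lin K Y' (ssp K)"
  and v: "v .: Y" and v': "v' .: Y'" and eq: "coef K A Y f v = coef K A Y' f' v'"
  and cong: "!!X g g' x. [|X:OB K A; x .: X; !!z. z .: X ==> g z = g' z|] ==> h X g x = h X g' x"
  and nat: "!!X Z T g x. [|X:OB K A; Z:OB K A; T:chom K A X Z;
   g:Lin K Z (ssp K); x .: X|] ==> h Z g (T x) = h X (%x. g (T x)) x"
 shows "h Y f v = h Y' f' v'"
proof -
 obtain Z :: "('k, 'a, 'v) comodule" and i j p q where Z: "Z:OB K A"
  and t: "i:chom K A Y Z" "j:chom K A Y' Z" "p:chom K A Z Y" "q:chom K A Z Y'"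
  and px: "ALL x:Car Y. p (i x) = x & q (i x) = 0[Y']" and qy: "ALL y:Car Y'. q (j y) = y & p (j y) = 0[Y]"
  using direct_sum[OF ad Y Y'] by (elim exE conjE) (rule that)
 note Yo = ObjD[OF Y] and Yo' = ObjD[OF Y'] and Zo = ObjD[OF Z]
 let ?F = "%z. f (p z) +[K] f' (q z)"
 note fp = hom_comp[OF chD(2)[OF t(3)] f] and gq = hom_comp[OF chD(2)[OF t(4)] f']
 have F: "?F:Lin K Z (ssp K)" using hom_add_map[OF vs_ssp fp gq] by simp
 have f0: "f 0[Y] = 0[K]" and g0: "f' 0[Y'] = 0[K]"
  using hom_zero[OF Yo(3) vs_ssp f] hom_zero[OF Yo'(3) vs_ssp f'] by auto
 note fc = hom_cl[OF f, simplified] and gc = hom_cl[OF f', simplified]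
 have Fi: "?F (i x) = f x" if "x .: Y" for x using px fc g0 that by simp
 have Fj: "?F (j x) = f' x" if "x .: Y'" for x using qy gc f0 that by simp
 let ?g = "restrict (coef K A Z ?F) (Car Z)"
 note g = coef_comod_hom_reg[OF Zo(1) F]
 obtain e phi where b: "dbasis Z {..<vdim K Z} e phi" using fd_dbasis[OF Zo(2)] by blast
 obtain W :: "('k, 'a, 'v) comodule" and pj l where W: "W:OB K A" and pj: "pj:chom K A Z W"
  and l: "l:chom K A W reg" "inj_on l (Car W)" and lp: "ALL z:Car Z. ?g z = l (pj z)"
  using image_factorization[OF ad Zo(1) b reg_comodule g] by (elim exE conjE) (rule that)
 have lp': "coef K A Z ?F z = l (pj z)" if "z .: Z" for z using lp that by simp
 have Fep: "?F z = counit A (l (pj z))" if z: "z .: Z" for z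
  using counit_coefficient[OF Zo(1) F z] lp'[OF z] by simp
 have epl: "(%w. counit A (l w)):Lin K W (ssp K)"
  using hom_comp[OF chD(2)[OF l(1)], of "counit A"] counit_linear by simp
 note iv = chD(4)[OF t(1) v] and jv = chD(4)[OF t(2) v']
 have "l (pj (i v)) = coef K A Y f v"
  using lp'[OF iv] coef_comod_hom[OF Yo(1) Zo(1) t(1) F v] coef_cong[of Y "%x. ?F (i x)" f v] Fi by simp
 moreover have "l (pj (j v')) = coef K A Y' f' v'"
  using lp'[OF jv] coef_comod_hom[OF Yo'(1) Zo(1) t(2) F v'] coef_cong[of Y' "%x. ?F (j x)" f' v'] Fj by simp
 ultimately have eqpj: "pj (i v) = pj (j v')"
  using eq inj_onD[OF l(2)] chD(4)[OF pj iv] chD(4)[OF pj jv] by simp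
 have hW: "h Z ?F z = h W (%w. counit A (l w)) (pj z)" if z: "z .: Z" for z
  unfolding nat[OF Z W pj epl z] by (rule cong[OF Z z Fep])
 have "h Y f v = h Z ?F (i v)" unfolding nat[OF Y Z t(1) F v] by (rule cong[OF Y v Fi[symmetric]])
 also have "... = h Z ?F (j v')" unfolding hW[OF iv] hW[OF jv] eqpj ..
 also have "... = h Y' f' v'" unfolding nat[OF Y' Z t(2) F v'] by (rule cong[OF Y' v' Fj])
 finally show ?thesis .
qed

lemma coef_faithful:
 fixes Y :: "('k, 'a, 'v) comodule" and Y' :: "('k, 'a, 'v) comodule"
 assumes "all_dims TYPE('v)" "Y:OB K A" "Y':OB K A"
  "f:Lin K Y (ssp K)" "f':Lin K Y' (ssp K)"
  "v .: Y" "v' .: Y'" "coef K A Y f v = coef K A Y' f' v'" and La: "nendo La"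
 shows "f (La Y v) = f' (La Y' v')"
 by (rule coef_natural[OF assms(1-8), of "%Y f v. f (La Y v)"])
  (use neD(4)[OF La] neD(5)[OF La] in auto)

text \<open>Independence of the way an element is written as a coefficient is what makes the
  description in \<open>dual_embedding\<close> denote a function; it comes from
  \<open>coef_faithful\<close>.\<close>

lemma dual_embedding_eq:
 fixes Y :: "('k, 'a, 'v) comodule"
 assumes ad: "all_dims TYPE('v)" and Y: "Y:OB K A"
  and f: "f:Lin K Y (ssp K)" and v: "v .: Y" and La: "nendo La"
 shows "dual_embedding K A (coef K A Y f v) La = f (La Y v)"
proof -
 let ?al = "%La::('k, 'a, 'v) comodule => 'v => 'v. f (La Y v)"
 let ?f = "restrict f (Car Y)"
 have "dual_embedding K A (coef K A Y f v) = restrict ?al (Car (L_lim K A))"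
  unfolding dual_embedding_def
 proof (rule the_equality)
  have "?f:lin_maps K Y (ssp K)" by (rule lm_restrict[OF ObjD(3)[OF Y] f])
  moreover have "coef K A Y ?f v = coef K A Y f v" by (rule coef_cong) simp
  moreover have "restrict ?al (Car (L_lim K A)) = (\<lambda>La\<in>Car (L_lim K A). ?f (La Y v))"
   by (rule restrict_ext) (use neD(4)[OF _ Y v] in "simp add: L_lim_carrier[OF ad]")
  ultimately show "EX Y':OB K A. EX u:Car Y'. EX g:lin_maps K Y' (ssp K).
   coef K A Y' g u = coef K A Y f v
    & restrict ?al (Car (L_lim K A)) = (\<lambda>La\<in>Car (L_lim K A). g ((La::('k, 'a, 'v) comodule => 'v => 'v) Y' u))"
   using Y v by blast
 next
  fix al assume "EX Y':OB K A. EX u:Car Y'. EX g:lin_maps K Y' (ssp K).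
   coef K A Y' g u = coef K A Y f v & al = (\<lambda>La\<in>Car (L_lim K A). g ((La::('k, 'a, 'v) comodule => 'v => 'v) Y' u))"
  then obtain Y' :: "('k, 'a, 'v) comodule" and u g where *: "Y':OB K A" "u .: Y'" "g:lin_maps K Y' (ssp K)"
   "coef K A Y' g u = coef K A Y f v" "al = (\<lambda>La\<in>Car (L_lim K A). g (La Y' u))" by blast
  show "al = restrict ?al (Car (L_lim K A))" unfolding *(5)
   by (rule restrict_ext) (use coef_faithful[OF ad *(1) Y lm_hom[OF *(3)] f *(2) v *(4)] in "simp add: L_lim_carrier[OF ad]")
 qed
 then show ?thesis using La by (simp add: L_lim_carrier[OF ad])
qed

text \<open>The action of the dual algebra: a functional \<open>l\<close> acts on each comodule by
  \<open>1 \<otimes> l\<close> after the coaction. It provides enough elements of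
  \<open>L_lim\<close> to bound codimensions from below.\<close>

definition functional_endo :: "('a => 'k) => ('k, 'a, 'v) comodule => 'v => 'v" where
 "functional_endo l = (\<lambda>X\<in>OB K A. \<lambda>x\<in>Car X. tlift K X A X (%w a. l a *[X] w) (coact X x))"

lemma right_slice_bilin:
 assumes "vsp K X" "l:Lin K A (ssp K)"
 shows "bilin X A X (%w a. l a *[X] w)"
 using bilin_flip[OF slice_bilin[OF A_vs assms(1,2)]] .

lemma right_slice_tensor_map:
 assumes X: "vsp K X" and Y: "vsp K Y" and l: "l:Lin K A (ssp K)"
  and f: "f:Lin K X Y" and t: "t .: ten K X A"
 shows "tlift K Y A Y (%w a. l a *[Y] w) (tmap K X A Y A f (%a. a) t) = f (tlift K X A X (%w a. l a *[X] w) t)"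
proof -
 note bX = right_slice_bilin[OF X l] and bY = right_slice_bilin[OF Y l] and tm = tmap_hom[OF X A_vs Y A_vs f hom_id]
 note lc = hom_cl[OF l, simplified]
 show ?thesis
  by (rule ten_hom_eqI[OF X A_vs hom_comp[OF tm tlift_hom[OF Y A_vs Y bY]] hom_comp[OF tlift_hom[OF X A_vs X bX] f] _ t])
   (simp add: tmap_pure[OF X A_vs Y A_vs f hom_id] tlift_pure[OF Y A_vs Y bY] tlift_pure[OF X A_vs X bX]
     hom_cl[OF f] hom_smult[OF f] lc)
qed

lemma functional_endo_nat:
 assumes l: "l:Lin K A (ssp K)"
 shows "nendo (functional_endo l :: ('k, 'a, 'v) comodule => 'v => 'v)"
 unfolding functional_endo_def
proof (rule nat_endoI)
 fix X :: "('k, 'a, 'v) comodule" assume X: "X:OB K A"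
 note Xo = ObjD[OF X]
 show "(%x. tlift K X A X (%w a. l a *[X] w) (coact X x)):Lin K X X"
  by (rule hom_comp[OF coD(2)[OF Xo(1)] tlift_hom[OF Xo(3) A_vs Xo(3) right_slice_bilin[OF Xo(3) l]]])
next
 fix X Y :: "('k, 'a, 'v) comodule" and f x
 assume X: "X:OB K A" and Y: "Y:OB K A" and f: "f:chom K A X Y" and x: "x .: X"
 show "f (tlift K X A X (%w a. l a *[X] w) (coact X x)) = tlift K Y A Y (%w a. l a *[Y] w) (coact Y (f x))"
  using right_slice_tensor_map[OF ObjD(3)[OF X] ObjD(3)[OF Y] l chD(2)[OF f] coD(3)[OF ObjD(1)[OF X] x]]
   chD(3)[OF f x] by simp
qed

lemma functional_endo_coefficient:
 fixes Y :: "('k, 'a, 'v) comodule"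
 assumes Y: "Y:OB K A" and f: "f:Lin K Y (ssp K)" and v: "v .: Y"
  and l: "l:Lin K A (ssp K)"
 shows "f (functional_endo l Y v) = l (coef K A Y f v)"
  and "coef K A Y f (functional_endo l Y v)
   = tlift K A A A (%w a. l a *[A] w) (comult A (coef K A Y f v))"
proof -
 note Yo = ObjD[OF Y]
 have e: "functional_endo l Y v = tlift K Y A Y (%w a. l a *[Y] w) (coact Y v)"
  using Y v by (simp add: functional_endo_def)
 note b = right_slice_bilin[OF Yo(3) l] and fc = hom_cl[OF f, simplified] and lc = hom_cl[OF l, simplified]
 have "f (tlift K Y A Y (%w a. l a *[Y] w) (coact Y v)) = l (slice Y A f (coact Y v))"
  by (rule ten_hom_eqI[OF Yo(3) A_vs hom_comp[OF tlift_hom[OF Yo(3) A_vs Yo(3) b] f]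
     hom_comp[OF slice_hom[OF Yo(3) A_vs f] l] _ coD(3)[OF Yo(1) v]])
   (simp add: tlift_pure[OF Yo(3) A_vs Yo(3) b] slice_pure[OF Yo(3) A_vs f] hom_smult[OF f] hom_smult[OF l] fc lc K.m_comm)
 then show "f (functional_endo l Y v) = l (coef K A Y f v)" unfolding e coef_slice .
 show "coef K A Y f (functional_endo l Y v)
   = tlift K A A A (%w a. l a *[A] w) (comult A (coef K A Y f v))"
  unfolding e comult_coefficient[OF Yo(1) f v]
  by (rule right_slice_tensor_map[OF Yo(3) A_vs l coef_hom[OF Yo(1) f] coD(3)[OF Yo(1) v], symmetric])
qed

lemma L_lim_eval_hom:
 fixes Y :: "('k, 'a, 'v) comodule"
 assumes "Y:OB K A" "v .: Y"
  and ad: "all_dims TYPE('v)"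
 shows "(%La. La Y v):Lin K (L_lim K A) Y"
 by (rule homI) (use assms neD(4) in "auto simp: L_lim_simps L_lim_carrier[OF ad]")

definition killing_ideal where
 "killing_ideal L al m J \<longleftrightarrow> ideal J L & subspace K J L & vectorspace.fin_dim K (quot_space L J)
  & vdim K (quot_space L J) = m & (ALL x:J. al x = 0[K])"

text \<open>The endomorphisms acting as zero on \<open>Y\<close> form an ideal killed by every
  coefficient of \<open>Y\<close>. It is the common kernel of the n^2 matrix entries of the action,
  hence the bound.\<close>

lemma coeff_size_killing_ideal:
 assumes ad: "all_dims TYPE('v)" and a: "coeff_size TYPE('v) n a"
 shows "EX m J. m <= n * n & killing_ideal (L_lim K A :: ('k, ('k, 'a, 'v) comodule => 'v => 'v) module) (dual_embedding K A a) m J"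
proof -
 let ?L = "L_lim K A :: ('k, ('k, 'a, 'v) comodule => 'v => 'v) module"
 note car = L_lim_carrier[OF ad] and L = L_lim_vs[OF ad] and R = L_lim_ring[OF ad]
 obtain Y :: "('k, 'a, 'v) comodule" and f v where Y: "Y:OB K A" "vdim K Y = n"
  "f:Lin K Y (ssp K)" "v .: Y" "a = coef K A Y f v"
  using a unfolding coeff_size_def by blast
 note Yo = ObjD[OF Y(1)]
 let ?I = "{..<n}"
 obtain e phi where b: "dbasis Y ?I e phi" using fd_dbasis[OF Yo(2)] Y(2) by auto
 let ?J = "{La:Car ?L. ALL y:Car Y. La Y y = 0[Y]}"
 have J: "subspace K ?J ?L"
 proof (rule subspace_I[OF L])
  show "0[?L] : ?J" using L Y(1) by (simp add: L_lim_simps)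
  show "x +[?L] y:?J" if "x:?J" "y:?J" for x y using that L Y(1) Yo(3) by (simp add: L_lim_simps)
  show "c *[?L] x:?J" if "c .: K" "x:?J" for c x using that L Y(1) Yo(3) by (simp add: L_lim_simps)
 qed auto
 have id: "ideal ?J ?L"
 proof (rule idealI[OF R])
  show "subgroup ?J (add_monoid ?L)"
  proof
   show "?J <= Car (add_monoid ?L)" by auto
   show "x **[add_monoid ?L] y:?J" if "x:?J" "y:?J" for x y using subD(4)[OF J that] by simp
   show "1[add_monoid ?L] : ?J" using subD(3)[OF J] by simp
   show "inv\<^bsub>add_monoid ?L\<^esub> x:?J" if "x:?J" for x using subD(6)[OF J that] by (simp add: a_inv_def)
  qed
 next
  fix La M assume "La:?J" and M: "M .: ?L"
  then have La: "La .: ?L" "ALL y:Car Y. La Y y = 0[Y]" by auto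
  have nM: "nendo M" using M by (simp add: car)
  have "M Y 0[Y] = 0[Y]" by (rule hom_zero[OF Yo(3) Yo(3) neD(3)[OF nM Y(1)]])
  then show "M **[?L] La:?J" using La M Y(1) monoid.m_closed[OF ring.is_monoid[OF R]] by (simp add: L_lim_simps)
  show "La **[?L] M:?J" using La M Y(1) neD(4)[OF nM Y(1)] monoid.m_closed[OF ring.is_monoid[OF R]] by (simp add: L_lim_simps)
 qed
 let ?ch = "%(p, q). %La. phi p (La Y (e q))"
 have ch: "?ch r:Lin K ?L (ssp K)" if "r:?I \<times> ?I" for r
  using that hom_comp[OF L_lim_eval_hom[OF Y(1) _ ad] dbD(4)[OF b]] dbD(3)[OF b] by auto
 have ker: "La:?J" if La: "La .: ?L" and z: "ALL r:?I \<times> ?I. ?ch r La = 0[K]" for La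
 proof -
  have nLa: "nendo La" using La by (simp add: car)
  have "La Y (e q) = 0[Y]" if q: "q:?I" for q
  proof -
   have "phi p (La Y (e q)) = 0[K]" if "p:?I" for p using z q that by auto
   then have "Fs Y (%p. phi p (La Y (e q)) *[Y] e p) ?I = 0[Y]"
    using dbD(3)[OF b] Yo(3) by (intro vsum_zero) auto
   then show ?thesis using dbD(7)[OF b neD(4)[OF nLa Y(1) dbD(3)[OF b q]]] by simp
  qed
  then have "La Y y = 0[Y]" if "y .: Y" for y
   by (rule dbasis_hom_eqI[OF Yo(3) Yo(3) b neD(3)[OF nLa Y(1)] hom_zero_map[OF Yo(3)] _ that])
  then show ?thesis using La by simp
 qed
 have fin: "finite (?I \<times> ?I)" by simp
 have q: "vectorspace.fin_dim K (quot_space ?L ?J)" "vdim K (quot_space ?L ?J) <= card (?I \<times> ?I)"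
  by (rule quot_dim_le[where ch="?ch", OF J fin ch ker]; assumption)+
 have "dual_embedding K A a La = 0[K]" if "La:?J" for La
 proof -
  have "nendo La" using that by (simp add: car)
  from dual_embedding_eq[OF ad Y(1) Y(3,4) this]
  have "dual_embedding K A a La = f (La Y v)" unfolding Y(5) .
  also have "La Y v = 0[Y]" using that Y(4) by simp
  finally show ?thesis using hom_zero[OF Yo(3) vs_ssp Y(3)] by simp
 qed
 then have "killing_ideal ?L (dual_embedding K A a) (vdim K (quot_space ?L ?J)) ?J"
  unfolding killing_ideal_def using id J q(1) by blast
 then show ?thesis using q(2) by (auto simp: card_cartesian_product)
qed

lemma hopf_rank_alt:
 "hopf_rank TYPE('v) K A a
  = (LEAST m. EX J. killing_ideal (L_lim K A :: ('k, ('k, 'a, 'v) comodule => 'v => 'v) module) (dual_embedding K A a) m J)"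
 unfolding hopf_rank_def functional_rank_def killing_ideal_def ..

lemma hopf_rank_le:
 assumes ad: "all_dims TYPE('v)" and a: "coeff_size TYPE('v) n a"
 shows "hopf_rank TYPE('v) K A a <= n * n"
proof -
 obtain m J where "m <= n * n" "killing_ideal (L_lim K A :: ('k, ('k, 'a, 'v) comodule => 'v => 'v) module) (dual_embedding K A a) m J"
  using coeff_size_killing_ideal[OF ad a] by blast
 then show ?thesis unfolding hopf_rank_alt by (intro order.trans[OF Least_le, of _ m]) blast
qed

text \<open>Write the comultiplication of \<open>a\<close> with independent factors \<open>b\<close>
  and \<open>c\<close>. The endomorphisms given by functionals dual to \<open>c\<close> stay
  independent modulo every ideal killed by \<open>a\<close>, so the number of terms is at most the
  rank; and \<open>a\<close> is a coefficient of a comodule of that dimension.\<close>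

lemma coeff_size_hopf_rank:
 assumes ad: "all_dims TYPE('v)" and a: "a .: A"
 shows "EX n <= hopf_rank TYPE('v) K A a. coeff_size TYPE('v) n a"
proof -
 let ?L = "L_lim K A :: ('k, ('k, 'a, 'v) comodule => 'v => 'v) module"
 note car = L_lim_carrier[OF ad] and L = L_lim_vs[OF ad] and R = L_lim_ring[OF ad]
 let ?al = "dual_embedding K A a :: (('k, 'a, 'v) comodule => 'v => 'v) => 'k"
 obtain n0 where a0: "coeff_size TYPE('v) n0 a" using coeff_size_ex[OF ad a] by blast
 \<comment> \<open>The least codimension is attained once some killed ideal has finite codimension;
   the converse estimate supplies one.\<close>
 obtain m0 J0 where "killing_ideal ?L ?al m0 J0" using coeff_size_killing_ideal[OF ad a0] by blast
 then have "EX m J. killing_ideal ?L ?al m J" by blast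
 then have "EX J. killing_ideal ?L ?al (hopf_rank TYPE('v) K A a) J" unfolding hopf_rank_alt by (rule LeastI_ex)
 then obtain J where id: "ideal J ?L" and J: "subspace K J ?L" and fd: "vectorspace.fin_dim K (quot_space ?L J)"
  and dim: "vdim K (quot_space ?L J) = hopf_rank TYPE('v) K A a" and kill: "ALL x:J. ?al x = 0[K]"
  unfolding killing_ideal_def by blast
 let ?Q = "quot_space ?L J"
 have Q: "vsp K ?Q" by (rule quot_vs[OF J])
 note pr = quot_proj_hom[OF J]
 obtain Y :: "('k, 'a, 'v) comodule" and f v where Y: "Y:OB K A"
  and f: "f:Lin K Y (ssp K)" and v: "v .: Y" and ac: "a = coef K A Y f v"
  using a0 unfolding coeff_size_def by blast
 note Yo = ObjD[OF Y]
 have al: "?al La = f (La Y v)" if "nendo La" for La using dual_embedding_eq[OF ad Y f v that] ac by simp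
 obtain I :: "nat set" and b c where b: "indep A I b" and c: "indep A I c" and eq: "comult A a = tsum A A I b c"
  using tsum_indep_ex[OF A_vs A_vs comult_closed[OF a]] by blast
 obtain bt where bt: "dual_fam A I b bt" using indep_dual[OF A_vs b] by blast
 obtain ga where ga: "dual_fam A I c ga" using indep_dual[OF A_vs c] by blast
 note fin = indepD(1)[OF b] and bc = indepD(2)[OF b] and cc = indepD(2)[OF c]
 let ?E = "%l. functional_endo l :: ('k, 'a, 'v) comodule => 'v => 'v"
 have nE: "nendo (?E l)" if "l:Lin K A (ssp K)" for l by (rule functional_endo_nat[OF that])
 have "indep ?Q I (%l. a_r_coset ?L J (?E (ga l)))"
  unfolding indep_def
 proof (intro conjI ballI allI impI fin)
  fix l assume l: "l:I"
  show "a_r_coset ?L J (?E (ga l)) .: ?Q" using nE[OF dual_famD(3)[OF ga l]] by (simp add: quot_carrier car)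
 next
  fix x j assume x: "ALL l:I. x l .: K" and z: "Fs ?Q (%l. x l *[?Q] a_r_coset ?L J (?E (ga l))) I = 0[?Q]" and j: "j:I"
  have Ec: "?E (ga l) .: ?L" if "l:I" for l using nE[OF dual_famD(3)[OF ga that]] by (simp add: car)
  let ?N = "Fs ?L (%l. x l *[?L] ?E (ga l)) I"
  have Nc: "?N .: ?L" using L x Ec by (intro vsum_closed) auto
  have "a_r_coset ?L J ?N = Fs ?Q (%l. a_r_coset ?L J (x l *[?L] ?E (ga l))) I"
   by (rule hom_sum[OF L Q pr]) (use L x Ec in auto)
  also have "... = Fs ?Q (%l. x l *[?Q] a_r_coset ?L J (?E (ga l))) I"
   by (rule vsum_cong[OF Q refl]) (use Q x Ec in "auto simp: hom_smult[OF pr] hom_cl[OF pr]")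
  finally have "a_r_coset ?L J ?N = a_r_coset ?L J 0[?L]" using z quot_zero[OF J] by simp
  then have "?N -[?L] 0[?L] : J" using coset_eq_iff[OF J Nc vs_zero_closed[OF L]] by simp
  moreover have "?N -[?L] 0[?L] = ?N"
  proof -
   interpret L: vectorspace K ?L by (rule L)
   show ?thesis using Nc by (simp add: a_minus_def)
  qed
  ultimately have NJ: "?N:J" by simp
  note btj = dual_famD(3)[OF bt j]
  \<comment> \<open>Multiplying by the endomorphism of the functional dual to \<open>b j\<close>
    stays in the ideal. On the product of this endomorphism with that of \<open>ga l\<close> the
    functional of \<open>a\<close> takes the Kronecker delta as value, so the coefficient
    \<open>x j\<close> is isolated.\<close>
  let ?M = "?E (bt j)"
  have "?M **[?L] ?N:J" using ideal.I_l_closed[OF id NJ] nE[OF btj] by (simp add: car)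
  then have "?al (?M **[?L] ?N) = 0[K]" using kill by blast
  moreover have "nendo (?M **[?L] ?N)" using nat_endo_ops(1)[OF nE[OF btj] _ K.zero_closed] Nc by (simp add: car)
  ultimately have "f ((?M **[?L] ?N) Y v) = 0[K]" using al by simp
  then have 0: "f (?M Y (?N Y v)) = 0[K]" using Y v by (simp add: L_lim_simps)
  have Mh: "(%y. f (?M Y y)):Lin K Y (ssp K)"
   by (rule hom_comp[OF neD(3)[OF nE[OF btj] Y] f])
  have "?N Y v = Fs Y (%l. (x l *[?L] ?E (ga l)) Y v) I"
   by (rule hom_sum[OF L Yo(3) L_lim_eval_hom[OF Y v ad]]) (use L x Ec in auto)
  also have "... = Fs Y (%l. x l *[Y] ?E (ga l) Y v) I"
   by (rule vsum_cong[OF Yo(3) refl]) (use Yo(3) x neD(4)[OF nE[OF dual_famD(3)[OF ga]] Y v] Y v in "auto simp: L_lim_simps")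
  finally have "f (?M Y (?N Y v)) = f (?M Y (Fs Y (%l. x l *[Y] ?E (ga l) Y v) I))" by simp
  also have "... = Fs (ssp K) (%l. f (?M Y (x l *[Y] ?E (ga l) Y v))) I"
   by (rule hom_sum[OF Yo(3) vs_ssp Mh]) (use Yo(3) x neD(4)[OF nE[OF dual_famD(3)[OF ga]] Y v] in auto)
  also have "... = Fs (ssp K) (%l. x l **[K] (if j = l then 1[K] else 0[K])) I"
  proof (rule vsum_cong[OF vs_ssp refl])
   fix l assume l: "l:I"
   show "x l **[K] (if j = l then 1[K] else 0[K]) .: ssp K" using x l by simp
   note gal = dual_famD(3)[OF ga l]
   have Ev: "?E (ga l) Y v .: Y" by (rule neD(4)[OF nE[OF gal] Y v])
   have "f (?M Y (?E (ga l) Y v)) = bt j (coef K A Y f (?E (ga l) Y v))"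
    by (rule functional_endo_coefficient(1)[OF Y f Ev btj])
   also have "coef K A Y f (?E (ga l) Y v) = tlift K A A A (%w a. ga l a *[A] w) (tsum A A I b c)"
    using functional_endo_coefficient(2)[OF Y f v gal] eq ac by simp
   also have "... = Fs A (%i. ga l (c i) *[A] b i) I"
    by (rule tlift_tsum[OF A_vs A_vs A_vs right_slice_bilin[OF A_vs gal]]) (use bc cc in auto)
   also have "... = Fs A (%i. (if l = i then 1[K] else 0[K]) *[A] b i) I"
    by (rule vsum_cong[OF A_vs refl]) (use bc l dual_famD(4)[OF ga] in auto)
   also have "... = b l" by (rule vsum_delta(2)[OF A_vs fin l bc])
   finally have "f (?M Y (?E (ga l) Y v)) = (if j = l then 1[K] else 0[K])" using dual_famD(4)[OF bt j l] by simp
   then show "f (?M Y (x l *[Y] ?E (ga l) Y v)) = x l **[K] (if j = l then 1[K] else 0[K])"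
    using hom_smult[OF Mh _ Ev, of "x l"] x l by simp
  qed
  also have "... = x j **[K] (if j = j then 1[K] else 0[K])"
   by (rule vsum_single[OF vs_ssp fin j]) (use x j in auto)
  finally show "x j = 0[K]" using 0 x j by simp
 qed
 from indep_card_le[OF Q fd this] have "card I <= hopf_rank TYPE('v) K A a" using dim by simp
 then show ?thesis using coeff_size_comult_rank[OF ad a b c eq] by blast
qed

end

section \<open>Ultraproducts\<close>

locale ultra_fields =
 fixes U :: "'i filter" and K :: "'i => ('k, 'r) ring_scheme"
 assumes U_proper: "U ~= bot" and U_ultra: "eventually P U | eventually (%i. ~ P i) U"
  and K_field: "field (K i)"
begin

abbreviation "cl == ucls U"
abbreviation "kk == uprod_ring U K"
abbreviation "up == uprod_module U"

sublocale S: scalars "K i" for i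
 by (simp add: scalars_def K_field)

lemma not_ev: "~ eventually P U \<longleftrightarrow> eventually (%i. ~ P i) U"
proof -
 have "~ (eventually P U & eventually (%i. ~ P i) U)"
  using U_proper eventually_conj[of P U "%i. ~ P i"] by auto
 then show ?thesis using U_ultra[of P] by blast
qed

text \<open>An ultrafilter selects one of finitely many alternatives. Through this lemma bounded
  dimensions and bounded sizes become constant ones.\<close>

lemma ev_bounded:
 assumes "eventually (%i. d i <= (m::nat)) U"
 shows "EX n<=m. eventually (%i. d i = n) U"
proof (rule ccontr)
 assume "~ ?thesis"
 then have "ALL n:{..m}. eventually (%i. d i ~= n) U" by (auto simp: not_ev)
 then have "eventually (%i. ALL n:{..m}. d i ~= n) U" by (simp add: eventually_ball_finite_distrib)
 with assms have "eventually (%i. False) U" by eventually_elim auto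
 then show False using U_proper by simp
qed

lemma cl_eq: "cl f = cl g \<longleftrightarrow> eventually (%i. f i = g i) U"
proof
 assume "cl f = cl g"
 moreover have "f:cl f" by (simp add: ucls_def)
 ultimately show "eventually (%i. f i = g i) U" by (auto simp: ucls_def)
next
 assume e: "eventually (%i. f i = g i) U"
 have "eventually (%i. h i = f i) U \<longleftrightarrow> eventually (%i. h i = g i) U" for h
  by (rule eventually_cong[OF e]) simp_all
 then show "cl f = cl g" by (simp add: ucls_def)
qed

lemma urep_cl: "eventually (%i. urep (cl f) i = f i) U"
proof -
 have "urep (cl f):cl f" unfolding urep_def by (rule someI[of _ f]) (simp add: ucls_def)
 then show ?thesis by (simp add: ucls_def)
qed

lemma umap_cl [simp]: "umap1 U op1 (cl f) = cl (%i. op1 i (f i))" "umap2 U op2 (cl f) (cl g) = cl (%i. op2 i (f i) (g i))"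
 unfolding umap1_def umap2_def cl_eq using urep_cl[of f] urep_cl[of g] by (eventually_elim, simp)+

lemma umap2_cong: "eventually (%i. op i = op' i) U ==> umap2 U op = umap2 U op'"
 by (intro ext) (auto simp: umap2_def cl_eq elim: eventually_mono)

lemma uprod_set_cl: "cl f:uprod_set U S \<longleftrightarrow> eventually (%i. f i:S i) U"
proof
 assume "cl f:uprod_set U S"
 then obtain g where "eventually (%i. f i = g i) U" "eventually (%i. g i:S i) U"
  by (auto simp: uprod_set_def cl_eq)
 then show "eventually (%i. f i:S i) U" by eventually_elim simp
qed (auto simp: uprod_set_def)

lemma uprod_set_cong: "eventually (%i. S i = S' i) U ==> uprod_set U S = uprod_set U S'"
proof -
 assume e: "eventually (%i. S i = S' i) U"
 have "eventually (%i. f i:S i) U \<longleftrightarrow> eventually (%i. f i:S' i) U" for f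
  by (rule eventually_cong[OF e]) simp
 then show ?thesis by (simp add: uprod_set_def)
qed

text \<open>Membership may be arranged at every index and not just almost everywhere, by changing
  the representative on an exceptional set. Later arguments can then work pointwise, without
  \<open>eventually\<close>.\<close>

lemma uprod_set_cases:
 assumes "x:uprod_set U S" "!!i. S i ~= {}"
 obtains f where "!!i. f i:S i" "x = cl f"
proof -
 obtain g where g: "x = cl g" "eventually (%i. g i:S i) U" using assms(1) by (auto simp: uprod_set_def)
 let ?f = "%i. if g i:S i then g i else (SOME y. y:S i)"
 have "?f i:S i" for i using assms(2)[of i] by (simp add: some_in_eq)
 moreover have "x = cl ?f" unfolding g(1) cl_eq using g(2) by eventually_elim simp
 ultimately show thesis by (rule that)
qed

lemma up_simps:
 "Car (up V) = uprod_set U (%i. Car (V i))" "0[up V] = cl (%i. 0[V i])"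
 "cl f +[up V] cl g = cl (%i. f i +[V i] g i)" "cl f **[up V] cl g = cl (%i. f i **[V i] g i)"
 "cl c *[up V] cl g = cl (%i. c i *[V i] g i)" "1[up V] = cl (%i. 1[V i])"
 by (simp_all add: uprod_module_def)

lemma kk_simps [simp]:
 "0[kk] = cl (%i. 0[K i])" "1[kk] = cl (%i. 1[K i])"
 "cl f +[kk] cl g = cl (%i. f i +[K i] g i)" "cl f **[kk] cl g = cl (%i. f i **[K i] g i)"
 by (simp_all add: uprod_ring_def)

lemma kk_carrier: "Car kk = uprod_set U (%i. Car (K i))"
 by (simp add: uprod_ring_def)

lemma kk_cl: "(!!i. c i .: K i) ==> cl c .: kk"
 by (simp add: kk_carrier uprod_set_cl)

lemma kk_cases:
 assumes "x .: kk"
 obtains c where "!!i. c i .: K i" "x = cl c"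
 by (rule uprod_set_cases[OF assms[unfolded kk_carrier]]) (use S.K.zero_closed in blast, rule that)

lemma kk_field: "field kk"
proof (rule cring.cring_fieldI2)
 show "cring kk"
 proof (rule cringI)
  show "abelian_group kk"
  proof (rule abelian_groupI)
   fix x assume "x .: kk"
   then show "EX y:Car kk. y +[kk] x = 0[kk]"
   proof (rule kk_cases)
    fix c assume c: "!!i. c i .: K i" "x = cl c"
    then show ?thesis by (intro bexI[of _ "cl (%i. -[K i] c i)"]) (auto intro: kk_cl simp: S.K.l_neg)
   qed
  next
   show "x +[kk] y = y +[kk] x" if "x .: kk" "y .: kk" for x y
    by (rule kk_cases[OF that(1)], rule kk_cases[OF that(2)]) (simp add: S.K.a_comm)
  qed (auto elim!: kk_cases intro!: kk_cl arg_cong[where f = cl] simp: S.K.a_assoc)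
  show "comm_monoid kk"
  proof (rule comm_monoidI)
   show "x **[kk] y = y **[kk] x" if "x .: kk" "y .: kk" for x y
    by (rule kk_cases[OF that(1)], rule kk_cases[OF that(2)]) (simp add: S.K.m_comm)
  qed (auto elim!: kk_cases intro!: kk_cl arg_cong[where f = cl] simp: S.K.m_assoc)
 qed (auto elim!: kk_cases intro!: arg_cong[where f = cl] simp: S.K.l_distr)
 show "0[kk] ~= 1[kk]" using U_proper by (simp add: cl_eq)
 fix x assume x: "x .: kk" and nz: "x ~= 0[kk]"
 obtain c where c: "!!i. c i .: K i" "x = cl c" by (rule kk_cases[OF x]) (rule that)
 \<comment> \<open>The value zero at the exceptional indices only keeps the family inside the
   carriers.\<close>
 let ?d = "%i. if c i = 0[K i] then 0[K i] else inv\<^bsub>K i\<^esub> c i"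
 have u: "c i:Units (K i)" if "c i ~= 0[K i]" for i using c(1)[of i] that S.field_Units by auto
 have "eventually (%i. c i ~= 0[K i]) U" using nz c(2) by (simp add: cl_eq not_ev)
 then have "eventually (%i. c i **[K i] ?d i = 1[K i]) U" by eventually_elim (simp add: u)
 then have "x **[kk] cl ?d = 1[kk]" unfolding c(2) by (simp add: cl_eq)
 moreover have "cl ?d .: kk" by (rule kk_cl) (simp add: u)
 ultimately show "EX y:Car kk. x **[kk] y = 1[kk]" by blast
qed

sublocale k: scalars kk
 by (simp add: scalars_def kk_field)

text \<open>An equality of records, so functionals on an ultraproduct of spaces are covered by the
  lemmas on maps between ultraproducts.\<close>

lemma scalar_space_up: "ssp kk = up (%i. ssp (K i))"
 by (simp add: scalar_space_def uprod_ring_def uprod_module_def)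

lemma up_cl: "(!!i. f i .: V i) ==> cl f .: up V"
 by (simp add: up_simps uprod_set_cl)

lemma up_cases:
 assumes "!!i. vsp (K i) (V i)" "x .: up V"
 obtains f where "!!i. f i .: V i" "x = cl f"
 by (rule uprod_set_cases[OF assms(2)[unfolded up_simps]]) (use S.vs_zero_closed[OF assms(1)] in blast, rule that)

lemma up_cong: "eventually (%i. V i = V' i) U ==> up V = up V'"
 by (auto simp: uprod_module_def cl_eq intro!: umap2_cong uprod_set_cong elim: eventually_mono)

lemma up_vs:
 assumes V: "!!i. vsp (K i) (V i)"
 shows "vsp kk (up V)"
 unfolding k.vs_iff_module
proof (rule module_criteria)
 show "ALL v:Car (up V). EX w:Car (up V). v +[up V] w = 0[up V]"
 proof
  fix v assume "v .: up V"
  then obtain f where f: "!!i. f i .: V i" "v = cl f" by (rule up_cases[OF V]) (rule that)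
  show "EX w:Car (up V). v +[up V] w = 0[up V]"
   using f V by (intro bexI[of _ "cl (%i. -[V i] f i)"]) (simp_all add: up_simps(2-) up_cl S.vs_neg_closed[OF V] S.vs_r_neg[OF V])
 qed
next
 have "v +[up V] w = w +[up V] v" if "v .: up V" "w .: up V" for v w
  by (rule up_cases[OF V that(1)], rule up_cases[OF V that(2)]) (simp add: up_simps(2-) S.vs_add_comm[OF V])
 then show "ALL v w. v .: up V & w .: up V --> v +[up V] w = w +[up V] v" by blast
qed (simp only: k.is_cring, (auto simp: up_simps(2-) S.vs_zero_closed[OF V] S.vs_add_closed[OF V] S.vs_sm_closed[OF V]
  S.vs_add_assoc[OF V] S.vs_sm_smult[OF V] S.vs_sm_l_distr[OF V] S.vs_sm_r_distr[OF V] S.vs_r_zero[OF V] S.vs_sm_one[OF V]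
  elim!: up_cases[OF V] kk_cases intro!: up_cl)+)

lemma up_hom:
 assumes V: "!!i. vsp (K i) (V i)" and T: "!!i. T i:Lin (K i) (V i) (W i)"
 shows "umap1 U T:Lin kk (up V) (up W)"
 by (rule k.homI) (auto simp: up_simps(2-) S.hom_add[OF T] S.hom_smult[OF T] S.hom_cl[OF T]
  elim!: up_cases[OF V] kk_cases intro!: up_cl arg_cong[where f = cl])

lemma up_bilin:
 assumes V: "!!i. vsp (K i) (V i)" and W: "!!i. vsp (K i) (W i)" and b: "!!i. S.bilin i (V i) (W i) (P i) (bt i)"
 shows "k.bilin (up V) (up W) (up P) (umap2 U bt)"
 by (rule k.bilinI) (auto simp: up_simps(2-) S.bilinD[OF b] elim!: up_cases[OF V] up_cases[OF W] kk_cases intro!: up_cl arg_cong[where f = cl])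

lemma up_sum:
 assumes V: "!!i. vsp (K i) (V i)" and "finite I" and f: "!!i j. j:I ==> f j i .: V i"
 shows "Fs (up V) (%j. cl (f j)) I = cl (%i. Fs (V i) (%j. f j i) I)"
 using assms(2,3)
proof (induction I)
 case (insert j J)
 have "Fs (up V) (%j. cl (f j)) (insert j J) = cl (f j) +[up V] Fs (up V) (%j. cl (f j)) J"
  by (rule k.vsum_insert[OF up_vs[OF V]]) (use insert in "auto intro: up_cl")
 also have "... = cl (%i. f j i +[V i] Fs (V i) (%j. f j i) J)" using insert by (simp add: up_simps)
 also have "... = cl (%i. Fs (V i) (%j. f j i) (insert j J))"
  by (rule arg_cong[where f = cl], rule ext, rule S.vsum_insert[OF V, symmetric]) (use insert in auto)
 finally show ?case .
qed (simp add: up_vs V up_simps S.vsum_empty[OF V])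

text \<open>One finite index set for all factors is what makes the classes of basis vectors a basis;
  dimensions are therefore made constant before ultraproducts are formed.\<close>

lemma up_dbasis:
 assumes V: "!!i. vsp (K i) (V i)" and b: "!!i. S.dbasis i (V i) I (e i) (phi i)"
 shows "k.dbasis (up V) I (%q. cl (%i. e i q)) (%q. umap1 U (%i. phi i q))"
proof -
 note d = S.dbD[OF b]
 have "x = Fs (up V) (%q. umap1 U (%i. phi i q) x *[up V] cl (%i. e i q)) I" if "x .: up V" for x
 proof -
  obtain f where f: "!!i. f i .: V i" "x = cl f" by (rule up_cases[OF V `x \<in> carrier (up V)`]) (rule that)
  have "Fs (up V) (%q. umap1 U (%i. phi i q) x *[up V] cl (%i. e i q)) I
   = Fs (up V) (%q. cl (%i. phi i q (f i) *[V i] e i q)) I" by (simp add: f up_simps)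
  also have "... = cl (%i. Fs (V i) (%q. phi i q (f i) *[V i] e i q) I)"
   by (rule up_sum[OF V d(2)]) (rule S.vs_sm_closed[OF V d(6) d(3)], use f in auto)
  finally show ?thesis using d(7) f by simp
 qed
 moreover have "umap1 U (%i. phi i q):Lin kk (up V) (ssp kk)" if "q:I" for q
  unfolding scalar_space_up by (rule up_hom[OF V d(4)[OF that]])
 ultimately show ?thesis using d(2,3,5) by (auto simp: k.dbasis_def k.dual_fam_def intro!: up_cl arg_cong[where f = cl])
qed

text \<open>If almost every factor carried a nontrivial relation, the classes of its coefficients
  would form a relation in the ultraproduct. All these classes would vanish, and since
  \<open>I\<close> is finite the coefficients would vanish simultaneously at almost every
  index.\<close>

lemma ev_indep:
 assumes V: "!!i. vsp (K i) (V i)" and e: "!!i q. q:I ==> e i q .: V i"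
  and ind: "k.indep (up V) I (%q. cl (%i. e i q))"
 shows "eventually (%i. S.indep i (V i) I (e i)) U"
proof (rule ccontr)
 assume "~ ?thesis"
 then have n: "eventually (%i. ~ S.indep i (V i) I (e i)) U" by (simp add: not_ev)
 note I = k.indepD(1)[OF ind]
 \<comment> \<open>The zero relation is taken where the family is independent, so that
   \<open>c\<close> can be chosen at every index.\<close>
 have "EX c. (ALL q:I. c q .: K i) & Fs (V i) (%q. c q *[V i] e i q) I = 0[V i]
  & (S.indep i (V i) I (e i) | (EX q:I. c q ~= 0[K i]))" for i
 proof (cases "S.indep i (V i) I (e i)")
  case True
  then show ?thesis
   by (intro exI[of _ "%_. 0[K i]"]) (use e in "auto intro!: S.vsum_zero[OF V] simp: S.vs_sm_l_zero[OF V]")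
 next
  case False
  then show ?thesis using I e unfolding S.indep_def by blast
 qed
 then obtain c where c: "ALL i. (ALL q:I. c i q .: K i) & Fs (V i) (%q. c i q *[V i] e i q) I = 0[V i]
  & (S.indep i (V i) I (e i) | (EX q:I. c i q ~= 0[K i]))" by metis
 have "Fs (up V) (%q. cl (%i. c i q) *[up V] cl (%i. e i q)) I = cl (%i. Fs (V i) (%q. c i q *[V i] e i q) I)"
  unfolding up_simps by (rule up_sum[OF V I]) (rule S.vs_sm_closed[OF V], use e c in auto)
 also have "... = 0[up V]" using c by (simp add: up_simps)
 finally have z: "Fs (up V) (%q. cl (%i. c i q) *[up V] cl (%i. e i q)) I = 0[up V]" .
 have "ALL q:I. eventually (%i. c i q = 0[K i]) U"
  using k.indepD(3)[OF ind _ z] c by (auto simp: cl_eq intro!: kk_cl)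
 then have "eventually (%i. ALL q:I. c i q = 0[K i]) U" using I by (simp add: eventually_ball_finite_distrib)
 with n have "eventually (%i. False) U"
 proof eventually_elim
  case (elim i)
  then show ?case using c by blast
 qed
 then show False using U_proper by simp
qed

text \<open>\<open>V'\<close> is a subspace of the ultraproduct of the spaces \<open>V i\<close>.\<close>

definition usub :: "('i => ('k, 'v, 'm) module_scheme) => (('i => 'k) set, ('i => 'v) set, 'n) module_scheme => bool" where
 "usub V V' \<longleftrightarrow> (ALL i. vsp (K i) (V i)) & vsp kk V' & Car V' <= Car (up V)
  & add V' = add (up V) & smult V' = smult (up V) & zero V' = zero (up V)"

lemma usubD:
 assumes "usub V V'"
 shows "vsp (K i) (V i)" "vsp kk V'" "x .: V' ==> x .: up V"
  "add V' = add (up V)" "smult V' = smult (up V)" "zero V' = zero (up V)" "(%x. x):Lin kk V' (up V)"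
 using assms by (auto simp: usub_def intro: k.homI)

lemma usub_up: "(!!i. vsp (K i) (V i)) ==> usub V (up V)"
 by (simp add: usub_def up_vs)

lemma usub_with_coact [simp]: "usub V (wco V' rh) = usub V V'"
 by (simp add: usub_def)

lemma usub_cases:
 assumes "usub V V'" "x .: V'"
 obtains f where "!!i. f i .: V i" "x = cl f"
 by (rule up_cases[OF usubD(1)[OF assms(1)] usubD(3)[OF assms]]) (rule that)

lemma usub_sum:
 assumes V': "usub V V'" and "finite I" and f: "!!i j. j:I ==> f j i .: V i" "!!j. j:I ==> cl (f j) .: V'"
 shows "Fs V' (%j. cl (f j)) I = cl (%i. Fs (V i) (%j. f j i) I)"
proof -
 note d = usubD[OF V']
 have "Fs V' (%j. cl (f j)) I = Fs (up V) (%j. cl (f j)) I"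
  by (rule k.hom_sum[OF d(2) up_vs[OF d(1)] d(7) f(2)])
 then show ?thesis using up_sum[OF d(1) assms(2) f(1)] by simp
qed

text \<open>The comparison map from a tensor product of subspaces of ultraproducts to the
  ultraproduct of the tensor products. It is used for the tensor square of \<open>RA\<close> and for
  a comodule tensored with \<open>RA\<close>.\<close>

definition utens where
 "utens V W V' W' = tlift kk V' W' (up (%i. ten (K i) (V i) (W i))) (umap2 U (%i. pt (K i) (V i) (W i)))"

lemma utens:
 assumes V: "usub V V'" and W: "usub W W'"
 shows utens_hom: "utens V W V' W':Lin kk (ten kk V' W') (up (%i. ten (K i) (V i) (W i)))"
  and utens_pure: "[|cl v .: V'; cl w .: W'|]
   ==> utens V W V' W' (pt kk V' W' (cl v) (cl w)) = cl (%i. pt (K i) (V i) (W i) (v i) (w i))"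
proof -
 let ?T = "up (%i. ten (K i) (V i) (W i))"
 note dV = usubD[OF V] and dW = usubD[OF W]
 have T: "vsp kk ?T" by (rule up_vs[OF S.ten_vs[OF dV(1) dW(1)]])
 have b: "k.bilin V' W' ?T (umap2 U (%i. pt (K i) (V i) (W i)))"
  by (rule k.bilin_comp2[OF up_bilin[OF dV(1) dW(1) S.pure_bilin[OF dV(1) dW(1)]] dV(7) dW(7)])
 note t = k.tlift_hom[OF dV(2) dW(2) T b] k.tlift_pure[OF dV(2) dW(2) T b]
 show "utens V W V' W':Lin kk (ten kk V' W') ?T" unfolding utens_def by (rule t(1))
 show "[|cl v .: V'; cl w .: W'|]
   ==> utens V W V' W' (pt kk V' W' (cl v) (cl w)) = cl (%i. pt (K i) (V i) (W i) (v i) (w i))"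
  unfolding utens_def by (simp add: t(2))
qed

lemma utens_tsum:
 assumes V: "usub V V'" and W: "usub W W'" and I: "finite I"
  and v: "!!i j. j:I ==> v i j .: V i" "!!j. j:I ==> cl (%i. v i j) .: V'"
  and w: "!!i j. j:I ==> w i j .: W i" "!!j. j:I ==> cl (%i. w i j) .: W'"
 shows "utens V W V' W' (k.tsum V' W' I (%j. cl (%i. v i j)) (%j. cl (%i. w i j))) = cl (%i. S.tsum i (V i) (W i) I (v i) (w i))"
proof -
 let ?T = "%i. ten (K i) (V i) (W i)"
 note dV = usubD[OF V] and dW = usubD[OF W]
 have T: "vsp (K i) (?T i)" for i using dV dW by simp
 have "utens V W V' W' (k.tsum V' W' I (%j. cl (%i. v i j)) (%j. cl (%i. w i j)))
  = Fs (up ?T) (%j. utens V W V' W' (pt kk V' W' (cl (%i. v i j)) (cl (%i. w i j)))) I"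
  by (rule k.hom_tsum[OF dV(2) dW(2) up_vs[OF T] utens_hom[OF V W] v(2) w(2)])
 also have "... = Fs (up ?T) (%j. cl (%i. pt (K i) (V i) (W i) (v i j) (w i j))) I"
  by (rule k.vsum_cong[OF up_vs[OF T] refl]) (use v w dV dW in "auto simp: utens_pure[OF V W] intro!: up_cl")
 also have "... = cl (%i. Fs (?T i) (%j. pt (K i) (V i) (W i) (v i j) (w i j)) I)"
  by (rule up_sum[OF T I]) (use v w in simp)
 finally show ?thesis by (simp add: S.tsum_def)
qed

text \<open>Write a tensor in the kernel with independent families. The first family lifts to
  families independent at almost every index, where the vanishing of the tensor forces all second
  factors to be zero; so their classes are zero as well.\<close>

lemma utens_inj:
 assumes V: "usub V V'" and W: "usub W W'"
 shows "inj_on (utens V W V' W') (Car (ten kk V' W'))"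
proof -
 let ?T = "%i. ten (K i) (V i) (W i)"
 note dV = usubD[OF V] and dW = usubD[OF W]
 have T: "vsp (K i) (?T i)" for i using dV dW by simp
 have VW: "vsp kk (ten kk V' W')" using dV dW by simp
 have "t = 0[ten kk V' W']" if t: "t .: ten kk V' W'" and z: "utens V W V' W' t = 0[up ?T]" for t
 proof -
  obtain I :: "nat set" and v w where v: "k.indep V' I v" and w: "k.indep W' I w" and eq: "t = k.tsum V' W' I v w"
   using k.tsum_indep_ex[OF dV(2) dW(2) t] by blast
  note I = k.indepD(1)[OF v] and vc = k.indepD(2)[OF v] and wc = k.indepD(2)[OF w]
  have "EX f. (ALL i. f i .: V i) & v j = cl f" if "j:I" for j using usub_cases[OF V vc[OF that]] by metis
  then obtain f where f: "!!i j. j:I ==> f j i .: V i" "!!j. j:I ==> v j = cl (f j)" by metis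
  have "EX g. (ALL i. g i .: W i) & w j = cl g" if "j:I" for j using usub_cases[OF W wc[OF that]] by metis
  then obtain g where g: "!!i j. j:I ==> g j i .: W i" "!!j. j:I ==> w j = cl (g j)" by metis
  have "t = k.tsum V' W' I (%j. cl (%i. f j i)) (%j. cl (%i. g j i))"
   unfolding eq by (rule k.tsum_cong[OF dV(2) dW(2) refl]) (use f g vc wc in auto)
  then have "cl (%i. S.tsum i (V i) (W i) I (%j. f j i) (%j. g j i)) = 0[up ?T]"
   using utens_tsum[OF V W I, of "%i j. f j i" "%i j. g j i"] f g vc wc z by simp
  then have z: "eventually (%i. S.tsum i (V i) (W i) I (%j. f j i) (%j. g j i) = 0[?T i]) U" by (simp add: up_simps cl_eq)
  \<comment> \<open>Independence in the subspace \<open>V'\<close> is independence in the full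
    ultraproduct, because the operations agree; there \<open>ev_indep\<close> applies.\<close>
  have "k.indep (up V) I (%j. cl (%i. f j i))"
   unfolding k.indep_def
  proof (intro conjI I ballI allI impI)
   show "cl (%i. f j i) .: up V" if "j:I" for j using f(1)[OF that] by (rule up_cl)
   fix c j assume c: "ALL j:I. c j .: kk" and s: "Fs (up V) (%j. c j *[up V] cl (%i. f j i)) I = 0[up V]" and j: "j:I"
   have vs: "c j *[up V] v j .: V'" if "j:I" for j
    using k.vs_sm_closed[OF dV(2), of "c j" "v j"] dV(5) c vc that by simp
   have "Fs V' (%j. c j *[V'] v j) I = Fs (up V) (%j. c j *[up V] v j) I"
    unfolding dV(5) by (rule k.hom_sum[OF dV(2) up_vs[OF dV(1)] dV(7)]) (rule vs)
   also have "... = Fs (up V) (%j. c j *[up V] cl (%i. f j i)) I"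
    by (rule k.vsum_cong[OF up_vs[OF dV(1)] refl]) (use vs f(2) dV(3) in "simp_all")
   finally show "c j = 0[kk]" using k.indepD(3)[OF v _ _ j, of c] c s dV(6) by simp
  qed
  with dV(1) have "eventually (%i. S.indep i (V i) I (%j. f j i)) U" by (intro ev_indep) (use f in auto)
  with z have "eventually (%i. ALL j:I. g j i = 0[W i]) U"
  proof eventually_elim
   case (elim i)
   then show ?case using S.tsum_eq_zero[OF dV(1) dW(1) elim(2), of "%j. g j i"] g(1) by blast
  qed
  then have "ALL j:I. w j = 0[W']" using I g(2) dW(6) by (auto simp: eventually_ball_finite_distrib up_simps cl_eq)
  then have "pt kk V' W' (v j) (w j) = 0[ten kk V' W']" if "j:I" for j
   using k.hom_zero[OF dW(2) VW k.pure_hom(1)[OF dV(2) dW(2) vc[OF that]]] that by simp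
  then show ?thesis unfolding eq k.tsum_def by (rule k.vsum_zero[OF VW])
 qed
 then show ?thesis using k.hom_inj_iff[OF VW up_vs[OF T] utens_hom[OF V W]] by blast
qed

lemma utens_eqI:
 assumes "usub V V'" "usub W W'" "s .: ten kk V' W'" "t .: ten kk V' W'"
  "utens V W V' W' s = utens V W V' W' t"
 shows "s = t"
 using inj_onD[OF utens_inj[OF assms(1,2)] assms(5,3,4)] .

lemma utens_cong: "eventually (%i. V i = V' i) U ==> utens V W = utens V' W"
 unfolding utens_def[abs_def]
 by (intro ext arg_cong2[where f = "tlift kk _ _"] up_cong umap2_cong) (auto elim: eventually_mono)

text \<open>The comultiplication of \<open>RA\<close> and the coactions on ultraproducts are both
  defined by inverting the comparison map on its image; their linearity is this lemma.\<close>

lemma utens_inv_hom: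
 assumes V: "usub V V'" and W: "usub W W'" and h: "h:Lin kk P (up (%i. ten (K i) (V i) (W i)))"
  and im: "!!x. x .: P ==> h x:utens V W V' W' ` Car (ten kk V' W')"
 shows "(%x. inv_into (Car (ten kk V' W')) (utens V W V' W') (h x)):Lin kk P (ten kk V' W')"
proof (rule k.homI)
 let ?T = "ten kk V' W'" and ?u = "utens V W V' W'"
 have T: "vsp kk ?T" using usubD(2)[OF V] usubD(2)[OF W] by simp
 note c = inv_into_into[OF im] and u = f_inv_into_f[OF im] and uh = utens_hom[OF V W]
 fix x assume x: "x .: P"
 show "inv_into (Car ?T) ?u (h x) .: ?T" by (rule c[OF x])
 show "inv_into (Car ?T) ?u (h (x +[P] y)) = inv_into (Car ?T) ?u (h x) +[?T] inv_into (Car ?T) ?u (h y)"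
  if y: "y .: P" for y
  by (rule inv_into_f_eq[OF utens_inj[OF V W] k.vs_add_closed[OF T c[OF x] c[OF y]]])
   (simp add: k.hom_add[OF uh c[OF x] c[OF y]] u[OF x] u[OF y] k.hom_add[OF h x y])
 show "inv_into (Car ?T) ?u (h (d *[P] x)) = d *[?T] inv_into (Car ?T) ?u (h x)" if d: "d .: kk" for d
  by (rule inv_into_f_eq[OF utens_inj[OF V W] k.vs_sm_closed[OF T d c[OF x]]])
   (simp add: k.hom_smult[OF uh d c[OF x]] u[OF x] k.hom_smult[OF h d x])
qed

text \<open>Naturality of the comparison map in the first factor. It is read in both directions: a
  family of comodule maps induces a comodule map, and a comodule map is compatible with the
  coactions at almost every index.\<close>

lemma utens_map:
 assumes V: "usub V V'" and W: "usub W W'" and P: "usub P P'"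
  and f: "!!i. f i:Lin (K i) (V i) (P i)" and f': "F:Lin kk V' P'"
  and F: "!!v. (!!i. v i .: V i) ==> cl v .: V' ==> F (cl v) = cl (%i. f i (v i))"
  and t: "t .: ten kk V' W'"
 shows "utens P W P' W' (tmap kk V' W' P' W' F (%w. w) t)
  = umap1 U (%i. tmap (K i) (V i) (W i) (P i) (W i) (f i) (%w. w)) (utens V W V' W' t)"
proof -
 note dV = usubD[OF V] and dW = usubD[OF W] and dP = usubD[OF P]
 note tm = k.tmap_hom[OF dV(2) dW(2) dP(2) dW(2) f' k.hom_id]
 note ti = S.tmap_hom[OF dV(1) dW(1) dP(1) dW(1) f S.hom_id]
 have VW: "vsp (K i) (ten (K i) (V i) (W i))" for i using dV(1) dW(1) by simp
 show ?thesis
 proof (rule k.ten_hom_eqI[OF dV(2) dW(2) k.hom_comp[OF tm utens_hom[OF P W]] k.hom_comp[OF utens_hom[OF V W] up_hom[OF VW ti]] _ t])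
  fix x y assume x: "x .: V'" and y: "y .: W'"
  obtain v where v: "!!i. v i .: V i" "x = cl v" using usub_cases[OF V x] by metis
  obtain w where w: "!!i. w i .: W i" "y = cl w" using usub_cases[OF W y] by metis
  have Fv: "F (cl v) = cl (%i. f i (v i))" using F v x by simp
  then have "cl (%i. f i (v i)) .: P'" using k.hom_cl[OF f' x] v(2) by simp
  then show "utens P W P' W' (tmap kk V' W' P' W' F (%w. w) (pt kk V' W' x y))
   = umap1 U (%i. tmap (K i) (V i) (W i) (P i) (W i) (f i) (%w. w)) (utens V W V' W' (pt kk V' W' x y))"
   using x y v w Fv by (simp add: k.tmap_pure[OF dV(2) dW(2) dP(2) dW(2) f' k.hom_id] utens_pure[OF V W] utens_pure[OF P W]
     S.tmap_pure[OF dV(1) dW(1) dP(1) dW(1) f S.hom_id])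
 qed
qed

text \<open>Comodules over the ultraproduct have carriers consisting of classes of families in
  \<open>'v\<close>. The supply of spaces on \<open>'v\<close> carries over to that type, so tensor
  products can be copied there too.\<close>

lemma all_dims_up:
 assumes ad: "!!i. S.all_dims i TYPE('v)"
 shows "k.all_dims TYPE(('i => 'v) set)"
 unfolding k.all_dims_def
proof
 fix n :: nat
 have "EX (V :: ('k, 'v) module) e phi. vsp (K i) V & S.dbasis i V {..<n} e phi" for i
  by (rule S.all_dims_dbasis[OF ad finite_lessThan])
 then obtain V :: "'i => ('k, 'v) module" and e phi where V: "!!i. vsp (K i) (V i)" "!!i. S.dbasis i (V i) {..<n} (e i) (phi i)"
  by metis
 show "EX V :: (('i => 'k) set, ('i => 'v) set) module. vsp kk V & vectorspace.fin_dim kk V & vdim kk V = n"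
  using k.dbasis_dim[OF up_vs[OF V(1)] up_dbasis[OF V]] up_vs[OF V(1)] by auto
qed

end

section \<open>The Hopf algebra structure of the restricted ultraproduct\<close>

context hopf_setup
begin

lemma mult_matrix_size:
 assumes ad: "all_dims TYPE('v)" and mm: "mmat I m" and pq: "p:I" "q:I"
 shows "coeff_size TYPE('v) (card I) (m p q)"
proof -
 note m = mmD(2)[OF mm] and fin = mmD(1)[OF mm]
 let ?de = "%p q. if p = q then 1[K] else 0[K]"
 have i: "Fs A (%r. ?de r p *[A] m r s) I = m p s" if "s:I" for s
  by (rule vsum_delta(1)[OF A_vs fin pq(1)]) (rule m[OF _ that])
 have "Fs A (%s. ?de s q *[A] Fs A (%r. ?de r p *[A] m r s) I) I = Fs A (%s. ?de s q *[A] m p s) I"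
  by (rule vsum_cong[OF A_vs refl]) (use m[OF pq(1)] i in auto)
 also have "... = m p q" by (rule vsum_delta(1)[OF A_vs fin pq(2)]) (rule m[OF pq(1)])
 finally show ?thesis using coeff_size_matrix[OF ad mm, of "%r. ?de r p" "%s. ?de s q"] by simp
qed

text \<open>Zero has every size, which qualifies it as the default value of a family at exceptional
  indices.\<close>

lemma coeff_size_zero:
 assumes ad: "all_dims TYPE('v)"
 shows "coeff_size TYPE('v) n 0[A]"
proof (induction n)
 case 0
 have "mmat ({} :: nat set) (%_ _. 0[A])" by (simp add: mmat_def)
 from coeff_size_matrix[OF ad this] show ?case by simp
next
 case (Suc n)
 have "coeff_size TYPE('v) 1 (0[K] *[A] 1[A])" by (rule coeff_size_smult[OF _ coeff_size_one[OF ad]]) simp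
 from coeff_size_add[OF ad Suc this] show ?case by simp
qed

end

text \<open>The parameter \<open>TV\<close> fixes the type on which the comodules of the factors
  live, as this type does not occur in the types of \<open>U\<close>, \<open>K\<close> and
  \<open>A\<close>.\<close>

locale ultra_hopf = ultra_fields U K for U :: "'i filter" and K :: "'i => 'k ring" +
 fixes A :: "'i => ('k, 'a) hopf" and TV :: "'v itself"
 assumes A_hopf: "hopf_algebra (K i) (A i)" and dims: "S.all_dims i TYPE('v)" and TV_eq: "TV = TYPE('v)"
begin

sublocale H: hopf_setup "K i" "A i" for i
 by (simp add: hopf_setup_def A_hopf S.scalars_axioms)

abbreviation "RA == restr_uprod_hopf TV U K A"
abbreviation "csize i == H.coeff_size i TV"

lemmas cs_add = H.coeff_size_add[OF dims, folded TV_eq]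
 and cs_mult = H.coeff_size_mult[OF dims, folded TV_eq]
 and cs_zero = H.coeff_size_zero[OF dims, folded TV_eq]
 and cs_one = H.coeff_size_one[OF dims, folded TV_eq]
 and cs_entry = H.mult_matrix_size[OF dims, folded TV_eq]
 and cs_antipode = H.coeff_size_antipode[OF dims, folded TV_eq]
 and cs_rank = H.coeff_size_hopf_rank[OF dims, folded TV_eq]
 and rank_cs = H.hopf_rank_le[OF dims, folded TV_eq]
 and cs_smult = H.coeff_size_smult[where 'v = 'v, folded TV_eq]
 and cs_comult = H.coeff_size_comult[where 'v = 'v, folded TV_eq]
 and cs_matrix = H.coeff_size_ex_matrix[where 'v = 'v, folded TV_eq]
 and cs_closed = H.coeff_size_closed

lemma RA_simps [simp]:
 "Car RA = restr_carrier TV U K A" "add RA = add (up A)" "zero RA = zero (up A)" "smult RA = smult (up A)"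
 "mult RA = mult (up A)" "one RA = one (up A)" "counit RA = umap1 U (%i. counit (A i))"
 by (simp_all add: restr_uprod_hopf_def Let_def)

text \<open>A bound on the ranks bounds the sizes, the ultrafilter selects a single size, and zero
  fills the exceptional indices. Conversely elements of size \<open>n\<close> have rank at most
  \<open>n * n\<close>.\<close>

lemma RA_carrier: "x .: RA \<longleftrightarrow> (EX n a. (ALL i. csize i n (a i)) & x = cl a)"
proof
 assume "x .: RA"
 then obtain a m where x: "x = cl a" and a: "eventually (%i. a i .: A i) U"
  and r: "eventually (%i. hopf_rank TV (K i) (A i) (a i) <= m) U" by (auto simp: restr_carrier_def)
 let ?d = "%i. SOME n. n <= m & csize i n (a i)"
 have d: "eventually (%i. ?d i <= m & csize i (?d i) (a i)) U"
  using a r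
 proof eventually_elim
  case (elim i)
  then have "EX n. n <= m & csize i n (a i)" using cs_rank by (meson le_trans)
  then show ?case by (rule someI_ex)
 qed
 then have "eventually (%i. ?d i <= m) U" by (rule eventually_mono) simp
 from ev_bounded[OF this] obtain n where "eventually (%i. ?d i = n) U" by blast
 with d have n: "eventually (%i. csize i n (a i)) U" by eventually_elim auto
 let ?b = "%i. if csize i n (a i) then a i else 0[A i]"
 have "csize i n (?b i)" for i using cs_zero by simp
 moreover have "x = cl ?b" unfolding x cl_eq using n by eventually_elim simp
 ultimately show "EX n a. (ALL i. csize i n (a i)) & x = cl a" by (intro exI[of _ n] exI[of _ ?b]) auto
next
 assume "EX n a. (ALL i. csize i n (a i)) & x = cl a"
 then obtain n a where a: "!!i. csize i n (a i)" "x = cl a" by blast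
 have "eventually (%i. hopf_rank TV (K i) (A i) (a i) <= n * n) U"
  using rank_cs[OF a(1)] by simp
 moreover have "eventually (%i. a i .: A i) U" using cs_closed[OF a(1)] by simp
 ultimately show "x .: RA" unfolding RA_simps(1) restr_carrier_def a(2) by blast
qed

lemma RA_cl: "(!!i. csize i n (a i)) ==> cl a .: RA"
 using RA_carrier by blast

lemma RA_cases:
 assumes "x .: RA"
 obtains n a where "!!i. csize i n (a i)" "!!i. a i .: A i" "x = cl a"
proof -
 obtain n a where "!!i. csize i n (a i)" "x = cl a" using assms RA_carrier by blast
 then show thesis using cs_closed that by blast
qed

lemma RA_sub: "usub A RA"
proof -
 have sub: "Car RA <= Car (up A)" by (auto elim!: RA_cases intro!: up_cl simp del: RA_simps(1))
 have "subspace kk (Car RA) (up A)"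
 proof (rule k.subspace_I[OF up_vs[OF H.A_vs] sub])
  show "0[up A] .: RA" unfolding up_simps by (rule RA_cl[OF cs_zero])
 next
  fix x y assume x: "x .: RA" and y: "y .: RA"
  show "x +[up A] y .: RA"
   by (rule RA_cases[OF x], rule RA_cases[OF y]) (simp only: up_simps, rule RA_cl[OF cs_add])
 next
  fix c x assume c: "c .: kk" and x: "x .: RA"
  show "c *[up A] x .: RA"
   by (rule RA_cases[OF x], rule kk_cases[OF c]) (simp only: up_simps, rule RA_cl[OF cs_smult])
 qed
 from k.subspace_vs[OF this] have "vsp kk RA" by (rule k.vectorspace_cong) simp_all
 then show ?thesis using sub by (simp add: usub_def)
qed

lemmas RA_vs = usubD(2)[OF RA_sub]

lemma RA_algebra: "algebra kk RA"
proof -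
 have m: "x **[RA] y .: RA" if x: "x .: RA" and y: "y .: RA" for x y
  by (rule RA_cases[OF x], rule RA_cases[OF y]) (simp only: RA_simps up_simps, rule RA_cl[OF cs_mult, simplified])
 have o: "1[RA] .: RA" unfolding RA_simps(6) up_simps by (rule RA_cl[OF cs_one])
 have c: "x **[RA] y = y **[RA] x" if x: "x .: RA" and y: "y .: RA" for x y
  by (rule RA_cases[OF x], rule RA_cases[OF y]) (simp add: up_simps H.am_comm)
 have "comm_monoid RA"
 proof (rule comm_monoidI[OF m o _ _ c])
  fix x y z assume x: "x .: RA" and y: "y .: RA" and z: "z .: RA"
  show "x **[RA] y **[RA] z = x **[RA] (y **[RA] z)"
   by (rule RA_cases[OF x], rule RA_cases[OF y], rule RA_cases[OF z]) (simp add: up_simps H.am_assoc)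
  show "1[RA] **[RA] x = x" by (rule RA_cases[OF x]) (simp add: up_simps)
 qed
 moreover have "abelian_group RA" using RA_vs by (simp only: k.vs_iff_module module_def)
 moreover have "(x +[RA] y) **[RA] z = x **[RA] z +[RA] y **[RA] z"
  if x: "x .: RA" and y: "y .: RA" and z: "z .: RA" for x y z
  by (rule RA_cases[OF x], rule RA_cases[OF y], rule RA_cases[OF z]) (simp add: up_simps H.am_l_distr)
 ultimately have "cring RA" by (intro cringI)
 moreover have "(c *[RA] x) **[RA] y = c *[RA] (x **[RA] y)" if c: "c .: kk" and x: "x .: RA" and y: "y .: RA" for c x y
  by (rule kk_cases[OF c], rule RA_cases[OF x], rule RA_cases[OF y]) (simp add: up_simps H.am_smult_l)
 ultimately show ?thesis using RA_vs by (simp only: k.vs_iff_module algebra_def algebra_axioms_def) blast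
qed

lemma RA_bilin: "k.bilin RA RA RA (mult RA)"
proof (rule k.bilinI)
 show "x **[RA] y .: RA" if "x .: RA" "y .: RA" for x y
  using cring.cring_simprules(5)[OF algebra.M_cring[OF RA_algebra] that] .
qed ((erule RA_cases | erule kk_cases)+, simp add: up_simps H.am_l_distr H.am_r_distr H.am_smult_l H.am_smult_r)+

abbreviation "RR == ten kk RA RA"
abbreviation "Ph == utens A A RA RA"

lemma RR_vs: "vsp kk RR"
 by (rule k.ten_vs[OF RA_vs RA_vs])

text \<open>The definition forms the tensor product from the full ultraproduct with its carrier
  replaced. This is the same space as \<open>RR\<close>, because tensor products see only carrier
  and operations.\<close>

lemma comult_RA: "comult RA x = inv_into (Car RR) Ph (umap1 U (%i. comult (A i)) x)"
proof -
 let ?R = "(up A)\<lparr>carrier := restr_carrier TV U K A\<rparr>"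
 have "ten kk ?R ?R = RR" by (rule k.ten_space_cong) simp_all
 note 1 = this
 have 2: "uprod_tensor U K A ?R = Ph"
  unfolding uprod_tensor_def utens_def by (rule k.tlift_space_cong) simp_all
 have "comult RA x = inv_into (Car (ten kk ?R ?R)) (uprod_tensor U K A ?R) (umap1 U (%i. comult (A i)) x)"
  by (simp add: restr_uprod_hopf_def Let_def)
 then show ?thesis unfolding 1 2 .
qed

text \<open>By injectivity of the comparison map, a componentwise formula for the comultiplication
  with common index set and common size becomes a formula for the comultiplication of
  \<open>RA\<close>.\<close>

lemma RA_comult_tsum:
 assumes a: "!!i. comult (A i) (a i) = S.tsum i (A i) (A i) I (x i) (y i)" and I: "finite I"
  and x: "!!i p. p:I ==> csize i n (x i p)" and y: "!!i p. p:I ==> csize i n (y i p)"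
 shows "comult RA (cl a) = k.tsum RA RA I (%p. cl (%i. x i p)) (%p. cl (%i. y i p))"
 unfolding comult_RA
proof (rule inv_into_f_eq[OF utens_inj[OF RA_sub RA_sub]])
 show "k.tsum RA RA I (%p. cl (%i. x i p)) (%p. cl (%i. y i p)) .: RR"
  by (rule k.tsum_closed[OF RA_vs RA_vs]) (rule RA_cl, erule x y)+
 show "Ph (k.tsum RA RA I (%p. cl (%i. x i p)) (%p. cl (%i. y i p))) = umap1 U (%i. comult (A i)) (cl a)"
  using utens_tsum[OF RA_sub RA_sub I, of x y] cs_closed[OF x] cs_closed[OF y] RA_cl[OF x] RA_cl[OF y] a by simp
qed

lemma RA_comult_ex:
 assumes "!!i. csize i n (a i)"
 shows "EX x y. (ALL i. ALL p<n. csize i n (x i p) & csize i n (y i p)) & (ALL i. comult (A i) (a i) = S.tsum i (A i) (A i) {..<n} (x i) (y i))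
  & comult RA (cl a) = k.tsum RA RA {..<n} (%p. cl (%i. x i p)) (%p. cl (%i. y i p))"
proof -
 have "EX x y. (ALL p<n. csize i n (x p) & csize i n (y p)) & comult (A i) (a i) = S.tsum i (A i) (A i) {..<n} x y" for i
  by (rule cs_comult[OF assms])
 then obtain x y where xy: "!!i. (ALL p<n. csize i n (x i p) & csize i n (y i p)) & comult (A i) (a i) = S.tsum i (A i) (A i) {..<n} (x i) (y i)" by metis
 have "comult RA (cl a) = k.tsum RA RA {..<n} (%p. cl (%i. x i p)) (%p. cl (%i. y i p))"
  by (rule RA_comult_tsum) (use xy in auto)
 then show ?thesis using xy by blast
qed

lemma RA_comult:
 assumes x: "x .: RA"
 shows "comult RA x .: RR" and "Ph (comult RA x) = umap1 U (%i. comult (A i)) x"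
proof -
 obtain n a where a: "!!i. csize i n (a i)" "x = cl a" by (rule RA_cases[OF x]) (rule that)
 obtain y z where yz: "ALL i. ALL p<n. csize i n (y i p) & csize i n (z i p)"
  "ALL i. comult (A i) (a i) = S.tsum i (A i) (A i) {..<n} (y i) (z i)"
  "comult RA (cl a) = k.tsum RA RA {..<n} (%p. cl (%i. y i p)) (%p. cl (%i. z i p))"
  using RA_comult_ex[OF a(1)] by (elim exE conjE) (rule that)
 have yz': "csize i n (y i p)" "csize i n (z i p)" if "p : {..<n}" for i p using yz(1) that by auto
 note c = cs_closed[OF yz'(1)] cs_closed[OF yz'(2)] RA_cl[OF yz'(1)] RA_cl[OF yz'(2)]
 show "comult RA x .: RR" unfolding a(2) yz(3) by (rule k.tsum_closed[OF RA_vs RA_vs c(3,4)])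
 show "Ph (comult RA x) = umap1 U (%i. comult (A i)) x"
  unfolding a(2) yz(3) using utens_tsum[where v=y and w=z, OF RA_sub RA_sub finite_lessThan c(1,3) c(2,4)] yz(2) by simp
qed

lemma RA_eqI:
 assumes "s .: RR" "t .: RR" "Ph s = Ph t"
 shows "s = t"
 by (rule utens_eqI[OF RA_sub RA_sub assms])

lemma RA_comult_linear: "comult RA:Lin kk RA RR"
proof -
 let ?h = "umap1 U (%i. comult (A i))"
 have h: "?h:Lin kk RA (up (%i. H.AA i))"
  using k.hom_comp[OF usubD(7)[OF RA_sub] up_hom[OF H.A_vs H.comult_linear]] .
 have "?h x:Ph ` Car RR" if "x .: RA" for x
  using RA_comult[OF that] by (metis image_eqI)
 from utens_inv_hom[OF RA_sub RA_sub h this] show ?thesis unfolding comult_RA[abs_def] .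
qed

lemma RA_comult_hom: "comult RA:ring_hom RA (tensor_algebra kk RA RA)"
proof -
 have T: "Car (tensor_algebra kk RA RA) = Car RR" "one (tensor_algebra kk RA RA) = pt kk RA RA 1[RA] 1[RA]"
  "add (tensor_algebra kk RA RA) = add RR" "mult (tensor_algebra kk RA RA) = k.pair_map RA RA RA RA RA RA (mult RA) (mult RA)"
  by (simp_all add: tensor_algebra_def Let_def k.pair_map_def[abs_def] del: RA_simps)
 show ?thesis
 proof (rule ring_hom_memI, unfold T)
  fix x y assume x: "x .: RA" and y: "y .: RA"
  note xy = k.bilinD(3)[OF RA_bilin x y]
  show "comult RA x .: RR" by (rule RA_comult(1)[OF x])
  show "comult RA (x +[RA] y) = comult RA x +[RR] comult RA y" by (rule k.hom_add[OF RA_comult_linear x y])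
  obtain n a where a: "!!i. csize i n (a i)" "!!i. a i .: A i" "x = cl a" by (rule RA_cases[OF x]) (rule that)
  obtain m b where b: "!!i. csize i m (b i)" "!!i. b i .: A i" "y = cl b" by (rule RA_cases[OF y]) (rule that)
  obtain p q where p: "ALL i. ALL r<n. csize i n (p i r) & csize i n (q i r)" "ALL i. comult (A i) (a i) = S.tsum i (A i) (A i) {..<n} (p i) (q i)"
   "comult RA (cl a) = k.tsum RA RA {..<n} (%r. cl (%i. p i r)) (%r. cl (%i. q i r))"
   using RA_comult_ex[OF a(1)] by (elim exE conjE) (rule that)
  obtain s t where s: "ALL i. ALL r<m. csize i m (s i r) & csize i m (t i r)" "ALL i. comult (A i) (b i) = S.tsum i (A i) (A i) {..<m} (s i) (t i)"
   "comult RA (cl b) = k.tsum RA RA {..<m} (%r. cl (%i. s i r)) (%r. cl (%i. t i r))"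
   using RA_comult_ex[OF b(1)] by (elim exE conjE) (rule that)
  have p': "csize i n (p i r)" "csize i n (q i r)" if "r : {..<n}" for i r using p(1) that by auto
  have s': "csize i m (s i r)" "csize i m (t i r)" if "r : {..<m}" for i r using s(1) that by auto
  note pc = cs_closed[OF p'(1)] cs_closed[OF p'(2)] and sc = cs_closed[OF s'(1)] cs_closed[OF s'(2)]
  let ?I = "{..<n} \<times> {..<m}"
  let ?l = "%i (r, r'). p i r **[A i] s i r'" and ?r = "%i (r, r'). q i r **[A i] t i r'"
  have De: "comult (A i) (a i **[A i] b i) = S.tsum i (A i) (A i) ?I (?l i) (?r i)" for i
   using p(2) s(2) H.comult_mult[OF a(2) b(2)] S.pair_map_tsum[OF H.A_vs H.A_vs H.A_vs H.A_vs H.A_vs H.A_vs H.am_bilin H.am_bilin,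
    where I="{..<n}" and J="{..<m}" and x="p i" and z="q i" and y="s i" and w="t i"] pc sc
   by (simp add: H.tmul_def)
  have "x **[RA] y = cl (%i. a i **[A i] b i)" using a b by (simp add: up_simps)
  then have "comult RA (x **[RA] y) = comult RA (cl (%i. a i **[A i] b i))" by (simp only:)
  also have "... = k.tsum RA RA ?I (%j. cl (%i. ?l i j)) (%j. cl (%i. ?r i j))"
   by (rule RA_comult_tsum[where n="n * m"]) (use De p' s' in "auto intro!: cs_mult")
  also have "... = k.tsum RA RA ?I (%(r, r'). cl (%i. p i r) **[RA] cl (%i. s i r')) (%(r, r'). cl (%i. q i r) **[RA] cl (%i. t i r'))"
   by (rule arg_cong2[where f="k.tsum RA RA ?I"]) (auto simp only: RA_simps(5) up_simps fun_eq_iff split: prod.splits)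
  also have "... = k.pair_map RA RA RA RA RA RA (mult RA) (mult RA) (comult RA x) (comult RA y)"
   unfolding a(3) b(3) p(3) s(3)
   by (rule k.pair_map_tsum[OF RA_vs RA_vs RA_vs RA_vs RA_vs RA_vs RA_bilin RA_bilin _ _ RA_cl[OF p'(1)] RA_cl[OF p'(2)] RA_cl[OF s'(1)] RA_cl[OF s'(2)], symmetric]) simp_all
  finally show "comult RA (x **[RA] y) = k.pair_map RA RA RA RA RA RA (mult RA) (mult RA) (comult RA x) (comult RA y)" .
 next
  have 1: "1[RA] = cl (%i. 1[A i])" by (simp add: up_simps)
  have o: "cl (%i. 1[A i]) .: RA" by (rule RA_cl[OF cs_one])
  show "comult RA 1[RA] = pt kk RA RA 1[RA] 1[RA]" unfolding 1
   by (rule RA_eqI[OF RA_comult(1)[OF o] k.pure_closed[OF o o]])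
    (simp add: RA_comult(2)[OF o] utens_pure[OF RA_sub RA_sub o o] H.comult_one)
 qed
qed

lemma RA_sum:
 assumes "finite I" "!!i j. j:I ==> csize i n (f j i)"
 shows "Fs RA (%j. cl (f j)) I = cl (%i. Fs (A i) (%j. f j i) I)"
 by (rule usub_sum[OF RA_sub assms(1) cs_closed[OF assms(2)] RA_cl[OF assms(2)]])

text \<open>A comparison map for triple tensor products is avoided. Every element of
  \<open>RA\<close> is a linear combination of entries of one multiplicative matrix over
  \<open>RA\<close>, and on such entries both sides of coassociativity are the same double
  sum.\<close>

lemma RA_coassoc:
 assumes x: "x .: RA"
 shows "tensor_assoc kk RA RA RA (tmap kk RA RA RR RA (comult RA) (%x. x) (comult RA x))
  = tmap kk RA RA RA RR (%x. x) (comult RA) (comult RA x)" (is "?L x = ?R x")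
proof -
 let ?T = "ten kk RA RR"
 note De = RA_comult_linear
 have T: "vsp kk ?T" by (rule k.ten_vs[OF RA_vs RR_vs])
 have L: "?L:Lin kk RA ?T"
  by (rule k.hom_comp[OF k.hom_comp[OF De k.tmap_hom[OF RA_vs RA_vs RR_vs RA_vs De k.hom_id]] k.ten_assoc_hom[OF RA_vs RA_vs RA_vs]])
 have R: "?R:Lin kk RA ?T"
  by (rule k.hom_comp[OF De k.tmap_hom[OF RA_vs RA_vs RA_vs RR_vs k.hom_id De]])
 obtain n a where a: "!!i. csize i n (a i)" "!!i. a i .: A i" "x = cl a" by (rule RA_cases[OF x]) (rule that)
 let ?I = "{..<n}"
 have "ALL i. EX m f v. H.mmat i ?I m & (ALL p<n. f p .: K i) & (ALL p<n. v p .: K i)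
  & a i = Fs (A i) (%q. v q *[A i] Fs (A i) (%p. f p *[A i] m p q) ?I) ?I"
  using cs_matrix[OF a(1)] by (rule allI)
 then obtain m f v where "ALL i. H.mmat i ?I (m i) & (ALL p<n. f i p .: K i) & (ALL p<n. v i p .: K i)
  & a i = Fs (A i) (%q. v i q *[A i] Fs (A i) (%p. f i p *[A i] m i p q) ?I) ?I"
  unfolding choice_iff by (elim exE) (rule that)
 then have mm: "!!i. H.mmat i ?I (m i)" and f: "!!i p. p:?I ==> f i p .: K i" and v: "!!i p. p:?I ==> v i p .: K i"
  and am: "!!i. a i = Fs (A i) (%q. v i q *[A i] Fs (A i) (%p. f i p *[A i] m i p q) ?I) ?I" by auto
 have ms: "csize i n (m i p q)" if "p:?I" "q:?I" for i p q using cs_entry[OF mm that] by simp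
 note mc = H.mmD(2)[OF mm]
 define M where "M p q = cl (%i. m i p q)" for p q
 have M: "M p q .: RA" if "p:?I" "q:?I" for p q unfolding M_def by (rule RA_cl[OF ms[OF that]])
 have DeM: "comult RA (M p q) = k.tsum RA RA ?I (M p) (%r. M r q)" if "p:?I" "q:?I" for p q
  unfolding M_def by (rule RA_comult_tsum[OF H.mmD(3)[OF mm that] finite_lessThan ms ms]) (use that in auto)
 have LR: "?L (M p q) = ?R (M p q)" if p: "p:?I" and q: "q:?I" for p q
 proof -
  have "?L (M p q) = k.tsum RA RR ?I (M p) (%r. k.tsum RA RA ?I (M r) (%p. M p q))"
   by (rule k.coassoc_lhs_tsum[where e="M p" and m=M, OF RA_vs RA_vs De finite_lessThan M[OF p] M DeM[OF p] q])
  also have "... = k.tsum RA RR ?I (M p) (%r. comult RA (M r q))"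
   by (rule k.tsum_cong[OF RA_vs RR_vs refl]) (use M p q DeM[OF _ q] RA_comult(1)[OF M[OF _ q]] in auto)
  also have "... = ?R (M p q)" unfolding DeM[OF p q]
   by (rule k.tmap_tsum[OF RA_vs RA_vs RA_vs RR_vs k.hom_id De, symmetric]) (use M p q in auto)
  finally show ?thesis .
 qed
 note F = kk_cl[OF f] and V = kk_cl[OF v]
 let ?s = "%q. Fs RA (%p. cl (%i. f i p) *[RA] M p q) ?I"
 have sc: "?s q .: RA" if "q:?I" for q
  by (rule k.vsum_closed[OF RA_vs]) (rule k.vs_sm_closed[OF RA_vs F M[OF _ that]])
 have s: "?s q = cl (%i. Fs (A i) (%p. f i p *[A i] m i p q) ?I)" if q: "q:?I" for q
  unfolding RA_simps(4) M_def up_simps by (rule RA_sum[OF finite_lessThan cs_smult[OF f ms[OF _ q]]])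
 have vs: "cl (%i. v i q *[A i] Fs (A i) (%p. f i p *[A i] m i p q) ?I) = cl (%i. v i q) *[RA] ?s q" if "q:?I" for q
  by (subst s[OF that]) (simp only: RA_simps(4) up_simps)
 have vc: "cl (%i. v i q) *[RA] ?s q .: RA" if "q:?I" for q by (rule k.vs_sm_closed[OF RA_vs V[OF that] sc[OF that]])
 have fc: "Fs (A i) (%p. f i p *[A i] m i p q) ?I .: A i" if "q:?I" for i q
  by (rule S.vsum_closed[OF H.A_vs]) (rule S.vs_sm_closed[OF H.A_vs f mc[OF _ that]])
 have "x = Fs RA (%q. cl (%i. v i q *[A i] Fs (A i) (%p. f i p *[A i] m i p q) ?I)) ?I"
 proof (subst usub_sum[OF RA_sub finite_lessThan S.vs_sm_closed[OF H.A_vs v fc]])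
  show "x = cl (%i. Fs (A i) (%q. v i q *[A i] Fs (A i) (%p. f i p *[A i] m i p q) ?I) ?I)"
   unfolding a(3) by (rule arg_cong[where f = cl], rule ext, rule am)
 qed (assumption, subst vs, assumption, erule vc)
 also have "... = Fs RA (%q. cl (%i. v i q) *[RA] ?s q) ?I"
  by (rule k.vsum_cong[OF RA_vs refl vc vs])
 finally have xs: "x = Fs RA (%q. cl (%i. v i q) *[RA] ?s q) ?I" .
 \<comment> \<open>Stated for an arbitrary linear map so as to apply to both sides: its value at
   \<open>x\<close> is determined by its values at the entries \<open>M p q\<close>.\<close>
 have G: "G x = Fs ?T (%q. cl (%i. v i q) *[?T] Fs ?T (%p. cl (%i. f i p) *[?T] G (M p q)) ?I) ?I" if G: "G:Lin kk RA ?T" for G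
 proof -
  note Gc = k.hom_cl[OF G M]
  have t: "Fs ?T (%p. cl (%i. f i p) *[?T] G (M p q)) ?I .: ?T" if "q:?I" for q
   by (rule k.vsum_closed[OF T]) (rule k.vs_sm_closed[OF T F Gc[OF _ that]])
  have Gs: "G (?s q) = Fs ?T (%p. cl (%i. f i p) *[?T] G (M p q)) ?I" if q: "q:?I" for q
  proof -
   have "G (?s q) = Fs ?T (%p. G (cl (%i. f i p) *[RA] M p q)) ?I"
    by (rule k.hom_sum[OF RA_vs T G k.vs_sm_closed[OF RA_vs F M[OF _ q]]])
   also have "... = Fs ?T (%p. cl (%i. f i p) *[?T] G (M p q)) ?I"
    by (rule k.vsum_cong[OF T refl k.vs_sm_closed[OF T F Gc[OF _ q]] k.hom_smult[OF G F M[OF _ q]]])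
   finally show ?thesis .
  qed
  have "G x = Fs ?T (%q. G (cl (%i. v i q) *[RA] ?s q)) ?I"
   unfolding xs by (rule k.hom_sum[OF RA_vs T G k.vs_sm_closed[OF RA_vs V sc]])
  also have "... = Fs ?T (%q. cl (%i. v i q) *[?T] Fs ?T (%p. cl (%i. f i p) *[?T] G (M p q)) ?I) ?I"
  proof (rule k.vsum_cong[OF T refl k.vs_sm_closed[OF T V t]], assumption, assumption)
   fix q assume q: "q:?I"
   show "G (cl (%i. v i q) *[RA] ?s q) = cl (%i. v i q) *[?T] Fs ?T (%p. cl (%i. f i p) *[?T] G (M p q)) ?I"
    unfolding k.hom_smult[OF G V[OF q] sc[OF q]] Gs[OF q] ..
  qed
  finally show ?thesis .
 qed
 have inner: "Fs ?T (%p. cl (%i. f i p) *[?T] ?L (M p q)) ?I = Fs ?T (%p. cl (%i. f i p) *[?T] ?R (M p q)) ?I" if "q:?I" for q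
  by (rule k.vsum_cong[OF T refl k.vs_sm_closed[OF T F k.hom_cl[OF R M[OF _ that]]]]) (assumption, assumption, subst LR[OF _ that], assumption, rule refl)
 show ?thesis unfolding G[OF L] G[OF R]
  by (rule k.vsum_cong[OF T refl k.vs_sm_closed[OF T V k.vsum_closed[OF T k.vs_sm_closed[OF T F k.hom_cl[OF R M]]]]])
   (assumption+, subst inner, assumption, rule refl)
qed

lemma RA_counit_linear: "counit RA:Lin kk RA (ssp kk)"
 unfolding RA_simps(7) scalar_space_up by (rule k.hom_comp[OF usubD(7)[OF RA_sub] up_hom[OF H.A_vs H.counit_linear]])

lemma RA_counit_hom: "counit RA:ring_hom RA kk"
proof (rule ring_hom_memI)
 fix x y assume x: "x .: RA" and y: "y .: RA"
 show "counit RA x .: kk" "counit RA (x +[RA] y) = counit RA x +[kk] counit RA y"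
  using k.hom_cl[OF RA_counit_linear x] k.hom_add[OF RA_counit_linear x y] by simp_all
 show "counit RA (x **[RA] y) = counit RA x **[kk] counit RA y"
  by (rule RA_cases[OF x], rule RA_cases[OF y]) (simp add: up_simps H.counit_mult)
qed (simp add: up_simps)

text \<open>A bilinear map computed componentwise may be applied to a comultiplication
  componentwise. Both counit laws and both antipode identities are instances.\<close>

lemma RA_lift:
 assumes x: "x .: RA" and ga: "k.bilin RA RA RA ga" and gabt: "!!v w. ga (cl v) (cl w) = cl (%i. bt i (v i) (w i))"
  and bt: "!!i. S.bilin i (A i) (A i) (A i) (bt i)"
 shows "tlift kk RA RA RA ga (comult RA x) = umap1 U (%i a. tlift (K i) (A i) (A i) (A i) (bt i) (comult (A i) a)) x"
proof -
 obtain n a where a: "!!i. csize i n (a i)" "!!i. a i .: A i" "x = cl a" by (rule RA_cases[OF x]) (rule that)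
 obtain y z where yz: "ALL i. ALL p<n. csize i n (y i p) & csize i n (z i p)"
  "ALL i. comult (A i) (a i) = S.tsum i (A i) (A i) {..<n} (y i) (z i)"
  "comult RA (cl a) = k.tsum RA RA {..<n} (%p. cl (%i. y i p)) (%p. cl (%i. z i p))"
  using RA_comult_ex[OF a(1)] by (elim exE conjE) (rule that)
 have yz': "csize i n (y i p)" "csize i n (z i p)" if "p : {..<n}" for i p using yz(1) that by auto
 note c = cs_closed[OF yz'(1)] cs_closed[OF yz'(2)] and R = RA_cl[OF yz'(1)] RA_cl[OF yz'(2)]
 have "tlift kk RA RA RA ga (comult RA x) = Fs RA (%p. ga (cl (%i. y i p)) (cl (%i. z i p))) {..<n}"
  unfolding a(3) yz(3) by (rule k.tlift_tsum[OF RA_vs RA_vs RA_vs ga R])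
 also have "... = Fs RA (%p. cl (%i. bt i (y i p) (z i p))) {..<n}" by (simp add: gabt)
 also have "... = cl (%i. Fs (A i) (%p. bt i (y i p) (z i p)) {..<n})"
  by (rule usub_sum[OF RA_sub finite_lessThan S.bilinD(3)[OF bt c]]) (use k.bilinD(3)[OF ga R] gabt in simp_all)
 also have "... = cl (%i. tlift (K i) (A i) (A i) (A i) (bt i) (comult (A i) (a i)))"
 proof (rule arg_cong[where f = cl], rule ext)
  fix i
  show "Fs (A i) (%p. bt i (y i p) (z i p)) {..<n} = tlift (K i) (A i) (A i) (A i) (bt i) (comult (A i) (a i))"
   unfolding spec[OF yz(2)] using S.tlift_tsum[where I="{..<n}" and v="y i" and w="z i", OF H.A_vs H.A_vs H.A_vs bt c] by simp
 qed
 finally show ?thesis by (simp add: a(3))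
qed

theorem RA_hopf: "hopf_algebra kk RA"
proof -
 have "EX T. T:Lin (K i) (A i) (A i) & (ALL a:Car (A i).
   tlift (K i) (A i) (A i) (A i) (%b c. T b **[A i] c) (comult (A i) a) = counit (A i) a *[A i] 1[A i]
   & tlift (K i) (A i) (A i) (A i) (%b c. b **[A i] T c) (comult (A i) a) = counit (A i) a *[A i] 1[A i])" for i
  using H.antipode by blast
 then obtain T where T: "!!i. T i:Lin (K i) (A i) (A i)"
  and T1: "!!i a. a .: A i ==> tlift (K i) (A i) (A i) (A i) (%b c. T i b **[A i] c) (comult (A i) a) = counit (A i) a *[A i] 1[A i]"
  and T2: "!!i a. a .: A i ==> tlift (K i) (A i) (A i) (A i) (%b c. b **[A i] T i c) (comult (A i) a) = counit (A i) a *[A i] 1[A i]"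
  by metis
 let ?T = "umap1 U T"
 note Tu = up_hom[OF H.A_vs T]
 \<comment> \<open>Antipodes preserve sizes, so the componentwise antipode maps \<open>RA\<close> to
   itself.\<close>
 have Tc: "?T x .: RA" if x: "x .: RA" for x
  by (rule RA_cases[OF x]) (simp only: umap_cl, rule RA_cl[OF cs_antipode[OF T T1 T2]])
 have TR: "?T:Lin kk RA RA"
  by (rule k.homI) (use Tc k.hom_add[OF Tu] k.hom_smult[OF Tu] usubD(3)[OF RA_sub] in "simp_all del: RA_simps(1)")
 note cases = RA_cases[simplified RA_simps] and sb = k.slice_bilin[OF RA_vs RA_vs RA_counit_linear]
  and bs = S.slice_bilin[OF H.A_vs H.A_vs H.counit_linear]
 show ?thesis
 proof (intro hopf_algebra.intro kk_field RA_algebra hopf_algebra_axioms.intro RA_comult_linear RA_comult_hom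
   RA_counit_linear RA_counit_hom RA_coassoc)
  fix x assume x: "x .: RA"
  obtain n a where a: "!!i. csize i n (a i)" "!!i. a i .: A i" "x = cl a" by (rule RA_cases[OF x]) (rule that)
  have "tlift kk RA RA RA (%b c. counit RA b *[RA] c) (comult RA x)
   = umap1 U (%i a. tlift (K i) (A i) (A i) (A i) (%b c. counit (A i) b *[A i] c) (comult (A i) a)) x"
   by (rule RA_lift[OF x sb _ bs]) (simp add: up_simps)
  then show "tlift kk RA RA RA (%b c. counit RA b *[RA] c) (comult RA x) = x"
   using a by (simp add: H.counit_left)
  have "tlift kk RA RA RA (%b c. counit RA c *[RA] b) (comult RA x)
   = umap1 U (%i a. tlift (K i) (A i) (A i) (A i) (%b c. counit (A i) c *[A i] b) (comult (A i) a)) x"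
   by (rule RA_lift[OF x k.bilin_flip[OF sb] _ S.bilin_flip[OF bs]]) (simp add: up_simps)
  then show "tlift kk RA RA RA (%b c. counit RA c *[RA] b) (comult RA x) = x"
   using a by (simp add: H.counit_right)
 next
  show "EX T:Lin kk RA RA. ALL x:Car RA.
   tlift kk RA RA RA (%b c. T b **[RA] c) (comult RA x) = counit RA x *[RA] 1[RA]
   & tlift kk RA RA RA (%b c. b **[RA] T c) (comult RA x) = counit RA x *[RA] 1[RA]"
  proof (intro bexI[OF _ TR] ballI)
   fix x assume x: "x .: RA"
   obtain n a where a: "!!i. csize i n (a i)" "!!i. a i .: A i" "x = cl a" by (rule RA_cases[OF x]) (rule that)
   have "tlift kk RA RA RA (%b c. ?T b **[RA] c) (comult RA x)
    = umap1 U (%i a. tlift (K i) (A i) (A i) (A i) (%b c. T i b **[A i] c) (comult (A i) a)) x"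
    by (rule RA_lift[OF x k.bilin_comp2[OF RA_bilin TR k.hom_id] _ S.bilin_comp2[OF H.am_bilin T S.hom_id]]) (simp add: up_simps)
   moreover have "tlift kk RA RA RA (%b c. b **[RA] ?T c) (comult RA x)
    = umap1 U (%i a. tlift (K i) (A i) (A i) (A i) (%b c. b **[A i] T i c) (comult (A i) a)) x"
    by (rule RA_lift[OF x k.bilin_comp2[OF RA_bilin k.hom_id TR] _ S.bilin_comp2[OF H.am_bilin S.hom_id T]]) (simp add: up_simps)
   ultimately show "tlift kk RA RA RA (%b c. ?T b **[RA] c) (comult RA x) = counit RA x *[RA] 1[RA]
    & tlift kk RA RA RA (%b c. b **[RA] ?T c) (comult RA x) = counit RA x *[RA] 1[RA]"
    using a by (simp add: up_simps T1 T2)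
  qed
 qed
qed

end

section \<open>Maps between chosen tensor products\<close>

context scalars
begin

lemma dbasis_bij:
 assumes V: "vsp K V" and W: "vsp K W" and b: "dbasis V I e phi" and c: "dbasis W I f ps"
  and T: "T:Lin K V W" and eq: "!!i. i:I ==> T (e i) = f i"
 shows "bij_betw T (Car V) (Car W)"
proof -
 obtain S where S: "S:Lin K W V" "ALL i:I. S (f i) = e i"
  using dbasis_hom_ex[OF W V c, of e] dbD(3)[OF b] by blast
 have "S (T x) = x" if "x .: V" for x
  by (rule dbasis_hom_eqI[OF V V b hom_comp[OF T S(1)] hom_id _ that]) (use S eq in simp)
 moreover have "T (S x) = x" if "x .: W" for x
  by (rule dbasis_hom_eqI[OF W W c hom_comp[OF S(1) T] hom_id _ that]) (use S eq in simp)
 ultimately show ?thesis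
  by (intro bij_betw_byWitness[of _ S]) (use hom_cl[OF T] hom_cl[OF S(1)] in auto)
qed

lemma vtensor_with_coact [simp]:
 "vten K (wco V rh) W = vten K V W" "vten K W' (wco V' rh) = vten K W' V'"
 "vpure K (wco V rh) W = vpure K V W" "vpure K W' (wco V' rh) = vpure K W' V'"
 "vlift K (wco V1 rh) W1 P1 = vlift K V1 W1 P1" "vlift K V2 (wco W2 rh) P2 = vlift K V2 W2 P2"
 "vlift K V3 W3 (wco P3 rh) = vlift K V3 W3 P3"
 by (rule vtensor_space_cong vlift_space_cong; simp)+

lemma fd_iff_dbasis: "fd X \<longleftrightarrow> vsp K X & (EX n e phi. dbasis X {..<n::nat} e phi)"
 using fd_dbasis[of X] dbasis_fd[of X] fd_vs[of X] by blast

lemma fd_with_coact [simp]: "fd (wco V rh) = fd V"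
proof -
 have "dbasis (wco V rh) = (dbasis V :: nat set => _)" by (intro ext) simp
 then show ?thesis unfolding fd_iff_dbasis by simp
qed

lemma vtensor_dbasis:
 fixes X :: "('k, 'v, 'x) module_scheme" and Y :: "('k, 'v, 'y) module_scheme"
 assumes ad: "all_dims TYPE('v)" and X: "vsp K X" and Y: "vsp K Y" and b: "dbasis X I e phi" and c: "dbasis Y J f ps"
 shows "EX ch. dbasis (vten K X Y) (I \<times> J) (%(i, j). vpure K X Y (e i) (f j)) ch"
proof -
 obtain ch where d: "dbasis (ten K X Y) (I \<times> J) (%(i, j). pt K X Y (e i) (f j)) ch"
  using ten_dbasis[OF X Y b c] by blast
 from copy_facts(10)[OF ad ten_vs[OF X Y] d] show ?thesis
  unfolding vtensor_def[symmetric] by (auto simp: vpure_def case_prod_unfold)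
qed

definition vmap where
 "vmap V W V' W' f g = vlift K V W (vten K V' W') (%x y. vpure K V' W' (f x) (g y))"

lemma vmap:
 fixes V :: "('k, 'v, 'x) module_scheme" and W :: "('k, 'v, 'y) module_scheme"
  and V' :: "('k, 'v, 'z) module_scheme" and W' :: "('k, 'v, 'w) module_scheme"
 assumes ad: "all_dims TYPE('v)" and V: "fd V" and W: "fd W" and V': "fd V'" and W': "fd W'"
  and f: "f:Lin K V V'" and g: "g:Lin K W W'"
 shows vmap_hom: "vmap V W V' W' f g:Lin K (vten K V W) (vten K V' W')"
  and vmap_lin: "vmap V W V' W' f g:lin_maps K (vten K V W) (vten K V' W')"
  and vmap_pure: "[|x .: V; y .: W|] ==> vmap V W V' W' f g (vpure K V W x y) = vpure K V' W' (f x) (g y)"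
proof -
 note b = bilin_comp2[OF vpure_bilin[OF ad V' W'] f g] and P = vtensor_vs[OF ad V' W']
 show "vmap V W V' W' f g:Lin K (vten K V W) (vten K V' W')"
  unfolding vmap_def by (rule vlift_hom[OF ad V W P b])
 show "vmap V W V' W' f g:lin_maps K (vten K V W) (vten K V' W')"
  unfolding vmap_def by (rule vlift_lin[OF ad V W P b])
 show "[|x .: V; y .: W|] ==> vmap V W V' W' f g (vpure K V W x y) = vpure K V' W' (f x) (g y)"
  unfolding vmap_def by (rule vlift_pure[OF ad V W P b])
qed

definition vassoc where
 "vassoc X Y Z = vlift K (vten K X Y) Z (vten K X (vten K Y Z))
  (%t z. vlift K X Y (vten K X (vten K Y Z)) (%x y. vpure K X (vten K Y Z) x (vpure K Y Z y z)) t)"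

lemma vmap_with_coact [simp]:
 "vmap (wco V rh) W V' W' = vmap V W V' W'" "vmap V1 (wco W1 rh) V1' W1' = vmap V1 W1 V1' W1'"
 "vmap V2 W2 (wco V2' rh) W2' = vmap V2 W2 V2' W2'" "vmap V3 W3 V3' (wco W3' rh) = vmap V3 W3 V3' W3'"
 "vassoc (wco X rh) Y Z = vassoc X Y Z" "vassoc X1 (wco Y1 rh) Z1 = vassoc X1 Y1 Z1" "vassoc X2 Y2 (wco Z2 rh) = vassoc X2 Y2 Z2"
 by (simp_all add: vmap_def[abs_def] vassoc_def)

lemma vassoc:
 fixes X :: "('k, 'v, 'x) module_scheme" and Y :: "('k, 'v, 'y) module_scheme" and Z :: "('k, 'v, 'z) module_scheme"
 assumes ad: "all_dims TYPE('v)" and X: "fd X" and Y: "fd Y" and Z: "fd Z"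
 shows vassoc_hom: "vassoc X Y Z:Lin K (vten K (vten K X Y) Z) (vten K X (vten K Y Z))"
  and vassoc_pure: "[|x .: X; y .: Y; z .: Z|]
   ==> vassoc X Y Z (vpure K (vten K X Y) Z (vpure K X Y x y) z) = vpure K X (vten K Y Z) x (vpure K Y Z y z)"
proof -
 let ?P = "vten K X (vten K Y Z)"
 note YZ = vtensor_fd[OF ad Y Z] and XY = vtensor_fd[OF ad X Y]
 note P = vtensor_vs[OF ad X YZ] and p1 = vpure_bilin[OF ad Y Z] and p2 = vpure_bilin[OF ad X YZ]
 let ?bt = "%z x y. vpure K X (vten K Y Z) x (vpure K Y Z y z)"
 have bt: "bilin X Y ?P (?bt z)" if "z .: Z" for z
  by (rule bilin_comp2[OF p2 hom_id bilinD(2)[OF p1 that]])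
 have "bilin (vten K X Y) Z ?P (%t z. vlift K X Y ?P (?bt z) t)"
 proof (rule bilin_homI)
  show "(%t. vlift K X Y ?P (?bt z) t):Lin K (vten K X Y) ?P" if "z .: Z" for z
   by (rule vlift_hom[OF ad X Y P bt[OF that]])
  fix t assume t: "t .: vten K X Y"
  have l: "vlift K X Y ?P (?bt z) t = tlift K X Y ?P (?bt z) (uncopy_map K (ten K X Y) t)" for z
   using t by (simp add: vlift_def)
  have h: "(%z. ?bt z x y):Lin K Z ?P" if "x .: X" "y .: Y" for x y
   by (rule hom_comp[OF bilinD(1)[OF p1 that(2)] bilinD(1)[OF p2 that(1)]])
  show "(%z. vlift K X Y ?P (?bt z) t):Lin K Z ?P"
   unfolding l
   by (rule bilinD(2)[OF bilin_lift_right[OF fd_vs[OF X] fd_vs[OF Y] fd_vs[OF Z] P bt h]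
      fd_copy(6)[OF ad fd_tensor[OF X Y] t[unfolded vtensor_def]]])
 qed
 note L = vlift_hom[OF ad XY Z P this] vlift_pure[OF ad XY Z P this]
 show "vassoc X Y Z:Lin K (vten K (vten K X Y) Z) ?P" unfolding vassoc_def by (rule L(1))
 show "vassoc X Y Z (vpure K (vten K X Y) Z (vpure K X Y x y) z) = vpure K X (vten K Y Z) x (vpure K Y Z y z)"
  if "x .: X" "y .: Y" "z .: Z" for x y z
  unfolding vassoc_def L(2)[OF vpure_closed[OF ad X Y that(1,2)] that(3)] by (rule vlift_pure[OF ad X Y P bt[OF that(3)] that(1,2)])
qed

lemma vtensor3_hom_eqI:
 fixes X :: "('k, 'v, 'x) module_scheme" and Y :: "('k, 'v, 'y) module_scheme" and Z :: "('k, 'v, 'z) module_scheme"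
 assumes ad: "all_dims TYPE('v)" and X: "fd X" and Y: "fd Y" and Z: "fd Z"
  and S: "S:Lin K (vten K (vten K X Y) Z) P" and T: "T:Lin K (vten K (vten K X Y) Z) P"
  and eq: "!!x y z. [|x .: X; y .: Y; z .: Z|]
   ==> S (vpure K (vten K X Y) Z (vpure K X Y x y) z) = T (vpure K (vten K X Y) Z (vpure K X Y x y) z)"
  and w: "w .: (vten K (vten K X Y) Z)"
 shows "S w = T w"
proof -
 note XY = vtensor_fd[OF ad X Y] and p = vpure_bilin[OF ad vtensor_fd[OF ad X Y] Z]
 have "S (vpure K (vten K X Y) Z t z) = T (vpure K (vten K X Y) Z t z)"
  if t: "t .: vten K X Y" and z: "z .: Z" for t z
  by (rule vtensor_hom_eqI[OF ad X Y hom_comp[OF bilinD(2)[OF p z] S] hom_comp[OF bilinD(2)[OF p z] T] eq[OF _ _ z] t])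
 then show ?thesis by (rule vtensor_hom_eqI[OF ad XY Z S T _ w])
qed

lemma vbraid:
 fixes X :: "('k, 'v, 'x) module_scheme" and Y :: "('k, 'v, 'y) module_scheme"
 assumes ad: "all_dims TYPE('v)" and X: "fd X" and Y: "fd Y"
 shows "vlift K X Y (vten K Y X) (%x y. vpure K Y X y x):Lin K (vten K X Y) (vten K Y X)"
  and "[|x .: X; y .: Y|] ==> vlift K X Y (vten K Y X) (%x y. vpure K Y X y x) (vpure K X Y x y) = vpure K Y X y x"
 using vlift_hom[OF ad X Y vtensor_vs[OF ad Y X] bilin_flip[OF vpure_bilin[OF ad Y X]]]
  vlift_pure[OF ad X Y vtensor_vs[OF ad Y X] bilin_flip[OF vpure_bilin[OF ad Y X]]] by auto

lemma vunit:
 fixes X :: "('k, 'v, 'x) module_scheme"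
 assumes ad: "all_dims TYPE('v)" and X: "fd X"
 defines "I == (copy_space K (ssp K) :: ('k, 'v) module)" and "l == (%r x. uncopy_map K (ssp K) r *[X] x)"
 shows "vlift K I X X l:Lin K (vten K I X) X" "vlift K X I X (%x r. l r x):Lin K (vten K X I) X"
  "[|r .: I; x .: X|] ==> vlift K I X X l (vpure K I X r x) = l r x"
  "[|r .: I; x .: X|] ==> vlift K X I X (%x r. l r x) (vpure K X I x r) = l r x"
proof -
 note c = fd_copy[OF ad fd_scalar, folded I_def]
 have b: "bilin I X X l" unfolding l_def
  using slice_bilin[OF c(9) fd_vs[OF X] c(2)] .
 show "vlift K I X X l:Lin K (vten K I X) X" by (rule vlift_hom[OF ad c(8) X fd_vs[OF X] b])
 show "vlift K X I X (%x r. l r x):Lin K (vten K X I) X" by (rule vlift_hom[OF ad X c(8) fd_vs[OF X] bilin_flip[OF b]])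
 show "[|r .: I; x .: X|] ==> vlift K I X X l (vpure K I X r x) = l r x" by (rule vlift_pure[OF ad c(8) X fd_vs[OF X] b])
 show "[|r .: I; x .: X|] ==> vlift K X I X (%x r. l r x) (vpure K X I x r) = l r x"
  by (rule vlift_pure[OF ad X c(8) fd_vs[OF X] bilin_flip[OF b]])
qed

end

context hopf_setup
begin

lemma Comod_simps2:
 "Ident (Comod K A) X = (\<lambda>x\<in>Car X. x)" "Cmp (Comod K A) X g f = compose (Car X) g f"
 "HAdd (Comod K A) X Y f g = (\<lambda>x\<in>Car X. f x +[Y] g x)" "HScale (Comod K A) X Y r f = (\<lambda>x\<in>Car X. r *[Y] f x)"
 "Tens (Comod K A) = comod_tensor K A" "TensHom (Comod K A) X X' Y Y' f g = vmap X Y X' Y' f g"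
 "UnitObj (Comod K A) = comod_unit K A" "Assoc (Comod K A) X Y Z = vassoc X Y Z"
 "Braid (Comod K A) X Y = vlift K X Y (vten K Y X) (%x y. vpure K Y X y x)"
 "LUnit (Comod K A) X = vlift K (copy_space K (ssp K)) X X (%r x. uncopy_map K (ssp K) r *[X] x)"
 "RUnit (Comod K A) X = vlift K X (copy_space K (ssp K)) X (%x r. uncopy_map K (ssp K) r *[X] x)"
 by (simp_all add: Comod_def vmap_def vassoc_def)

lemma cat_isoI:
 assumes X: "X:OB K A" and Y: "Y:OB K A" and T: "T:chom K A X Y" and bij: "bij_betw T (Car X) (Car Y)"
 shows "cat_iso (Comod K A) X Y T"
 unfolding cat_iso_def Comod_simps(2) Comod_simps2
proof (intro conjI T bexI[OF _ comod_hom_inv[OF ObjD(1)[OF X] ObjD(1)[OF Y] T bij]])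
 show "compose (Car X) (restrict (inv_into (Car X) T) (Car Y)) T = (\<lambda>x\<in>Car X. x)"
  using bij chD(4)[OF T] by (auto simp: compose_def fun_eq_iff bij_betw_inv_into_left)
 show "compose (Car Y) T (restrict (inv_into (Car X) T) (Car Y)) = (\<lambda>x\<in>Car Y. x)"
  using bij by (auto simp: compose_def fun_eq_iff bij_betw_inv_into_right)
qed

lemma cat_isoD:
 assumes "cat_iso (Comod K A) X Y T"
 shows "T:chom K A X Y" "EX S:chom K A Y X. (ALL x:Car X. S (T x) = x) & (ALL y:Car Y. T (S y) = y)"
proof -
 obtain S where S: "T:chom K A X Y" "S:chom K A Y X" "compose (Car X) S T = (\<lambda>x\<in>Car X. x)"
  "compose (Car Y) T S = (\<lambda>x\<in>Car Y. x)" using assms unfolding cat_iso_def Comod_simps(2) Comod_simps2 by blast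
 show "T:chom K A X Y" by (rule S(1))
 show "EX S:chom K A Y X. (ALL x:Car X. S (T x) = x) & (ALL y:Car Y. T (S y) = y)"
 proof (intro bexI[OF _ S(2)] conjI ballI)
  show "S (T x) = x" if "x .: X" for x using fun_cong[OF S(3), of x] that by (simp add: compose_def)
  show "T (S y) = y" if "y .: Y" for y using fun_cong[OF S(4), of y] that by (simp add: compose_def)
 qed
qed

lemma ct_alt: "comod_tensor K A X Y = wco (vten K X Y) (%z. tmap K (ten K X Y) A (vten K X Y) A
  (copy_map K (ten K X Y)) (%a. a) (tensor_coact K A X Y (uncopy_map K (ten K X Y) z)))"
 and cu_alt: "comod_unit K A = wco (copy_space K (ssp K)) (%z. tmap K (ssp K) A (copy_space K (ssp K)) A
  (copy_map K (ssp K)) (%a. a) (pt K (ssp K) A (uncopy_map K (ssp K) z) 1[A]))"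
 by (simp_all add: comod_tensor_def comod_unit_def copy_comodule_def vtensor_def)

lemma coact_tensor_tsum:
 fixes X Y :: "('k, 'a, 'v) comodule"
 assumes ad: "all_dims TYPE('v)" and X: "X:OB K A" and Y: "Y:OB K A"
  and x: "x .: X" and y: "y .: Y" and I: "finite I" and J: "finite J"
  and ex: "coact X x = tsum X A I e a" and ey: "coact Y y = tsum Y A J f b"
  and e: "!!p. p:I ==> e p .: X" and a: "!!p. p:I ==> a p .: A"
  and f: "!!p. p:J ==> f p .: Y" and b: "!!p. p:J ==> b p .: A"
 shows "coact (comod_tensor K A X Y) (vpure K X Y x y)
  = tsum (vten K X Y) A (I \<times> J) (%(p, q). vpure K X Y (e p) (f q)) (%(p, q). a p **[A] b q)"
proof -
 note Xo = ObjD[OF X] and Yo = ObjD[OF Y]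
 let ?M = "ten K X Y"
 have M: "vsp K ?M" using Xo Yo by simp
 note c = fd_copy[OF ad fd_tensor[OF Xo(2) Yo(2)], folded vtensor_def]
 have "copair X Y (coact X x) (coact Y y)
  = tsum ?M A (I \<times> J) (%(p, q). pt K X Y (e p) (f q)) (%(p, q). a p **[A] b q)"
  unfolding ex ey by (rule pair_map_tsum[OF Xo(3) A_vs Yo(3) A_vs M A_vs pure_bilin[OF Xo(3) Yo(3)] am_bilin I J e a f b])
 then have "coact (comod_tensor K A X Y) (vpure K X Y x y) = tmap K ?M A (vten K X Y) A (copy_map K ?M) (%a. a)
  (tsum ?M A (I \<times> J) (%(p, q). pt K X Y (e p) (f q)) (%(p, q). a p **[A] b q))"
  using ct_object(3)[OF ad X Y x y] by simp
 also have "... = tsum (vten K X Y) A (I \<times> J) (%i. copy_map K ?M (case i of (p, q) => pt K X Y (e p) (f q))) (%(p, q). a p **[A] b q)"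
  by (rule tmap_tsum[OF M A_vs c(9) A_vs c(1) hom_id]) (use e f a b in auto)
 finally show ?thesis by (simp add: vpure_def case_prod_unfold)
qed

text \<open>The zero morphism is the default at indices where a family of linear maps fails to be a
  comodule map.\<close>

lemma comod_hom_zero:
 assumes X: "rcom K A X" and Y: "rcom K A Y"
 shows "(\<lambda>x\<in>Car X. 0[Y]):chom K A X Y"
proof -
 note Xv = coD(1)[OF X] and Yv = coD(1)[OF Y]
 let ?z = "\<lambda>x\<in>Car X. 0[Y]"
 have z: "?z:lin_maps K X Y" by (rule lm_restrict[OF Xv hom_zero_map[OF Yv]])
 have YA: "vsp K (ten K Y A)" using Yv by simp
 have "tmap K X A Y A ?z (%a. a) t = 0[ten K Y A]" if t: "t .: ten K X A" for t
 proof (rule ten_hom_eqI[OF Xv A_vs tmap_hom[OF Xv A_vs Yv A_vs lm_hom[OF z] hom_id] hom_zero_map[OF YA] _ t])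
  fix x a assume "x .: X" "a .: A"
  then show "tmap K X A Y A ?z (%a. a) (pt K X A x a) = 0[ten K Y A]"
   using hom_zero[OF Yv YA pure_hom(2)[OF Yv A_vs]] by (simp add: tmap_pure[OF Xv A_vs Yv A_vs lm_hom[OF z] hom_id])
 qed
 then show ?thesis using z coD(3)[OF X] hom_zero[OF Yv YA coD(2)[OF Y]] by (simp add: comod_hom_def)
qed

text \<open>Read off from the fact that zero is a coefficient of some comodule of every dimension.
  These comodules are the default objects at exceptional indices.\<close>

lemma object_of_dim:
 assumes "all_dims TYPE('v)"
 shows "EX Y :: ('k, 'a, 'v) comodule. Y:OB K A & vdim K Y = n"
 using coeff_size_zero[OF assms, of n] unfolding coeff_size_def by blast

end

section \<open>Families of spaces of constant finite dimension\<close>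

context ultra_hopf
begin

sublocale R: hopf_setup kk RA
 by (simp add: hopf_setup_def RA_hopf k.scalars_axioms)

lemmas kdims = all_dims_up[OF dims]

text \<open>A constant dimension at every index, so that bases of all members can be indexed by the
  same set.\<close>

definition gfd :: "('i => ('k, 'v, 'x) module_scheme) => nat => bool" where
 "gfd X n \<longleftrightarrow> (ALL i. S.fd i (X i) & vdim (K i) (X i) = n)"

lemma gfdD:
 assumes "gfd X n"
 shows "S.fd i (X i)" "vsp (K i) (X i)" "usub X (up X)" "vsp kk (up X)"
 using assms S.fd_vs by (auto simp: gfd_def intro!: usub_up up_vs)

lemma gfd_dbasis:
 assumes X: "gfd X n"
 shows "EX e phi. ALL i. S.dbasis i (X i) {..<n} (e i) (phi i)"
proof -
 have "EX e phi. S.dbasis i (X i) {..<n} e phi" for i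
  using S.fd_dbasis[of i "X i"] X unfolding gfd_def by simp
 then show ?thesis by metis
qed

lemma dbasis_gfd: "(!!i. vsp (K i) (X i)) ==> (!!i. S.dbasis i (X i) I (e i) (phi i)) ==> gfd X (card I)"
 using S.dbasis_fd S.dbasis_dim(2) unfolding gfd_def by metis

lemma gfd_up: "gfd X n ==> k.fd (up X)"
proof -
 assume X: "gfd X n"
 obtain e phi where "ALL i. S.dbasis i (X i) {..<n} (e i) (phi i)" using gfd_dbasis[OF X] by blast
 then show ?thesis using k.dbasis_fd[OF up_vs up_dbasis] gfdD(2)[OF X] by blast
qed

abbreviation "VT X Y == %i. vten (K i) (X i) (Y i)"
abbreviation "VI == (%i. copy_space (K i) (ssp (K i)) :: ('k, 'v) module)"

lemma VT_dbasis:
 assumes X: "gfd X n" and Y: "gfd Y m" and e: "!!i. S.dbasis i (X i) I (e i) (phi i)" and f: "!!i. S.dbasis i (Y i) J (f i) (ps i)"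
 shows "EX ch. ALL i. S.dbasis i (VT X Y i) (I \<times> J) (%(p, q). vpure (K i) (X i) (Y i) (e i p) (f i q)) (ch i)"
 using S.vtensor_dbasis[OF dims gfdD(2)[OF X] gfdD(2)[OF Y] e f] by metis

lemma gfd_VT:
 assumes X: "gfd X n" and Y: "gfd Y m"
 shows "gfd (VT X Y) (n * m)"
proof -
 obtain e phi where e: "!!i. S.dbasis i (X i) {..<n} (e i) (phi i)" using gfd_dbasis[OF X] by metis
 obtain f ps where f: "!!i. S.dbasis i (Y i) {..<m} (f i) (ps i)" using gfd_dbasis[OF Y] by metis
 obtain ch where ch: "!!i. S.dbasis i (VT X Y i) ({..<n} \<times> {..<m}) (%(p, q). vpure (K i) (X i) (Y i) (e i p) (f i q)) (ch i)"
  using VT_dbasis[OF X Y e f] by metis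
 from dbasis_gfd[OF S.vtensor_vs[OF dims gfdD(1)[OF X] gfdD(1)[OF Y]] ch] show ?thesis by (simp add: card_cartesian_product)
qed

lemma VI_dbasis: "S.dbasis i (VI i) {()} (%_. copy_map (K i) (ssp (K i)) 1[K i]) (%_ x. uncopy_map (K i) (ssp (K i)) x)"
 by (rule S.copy_facts(10)[OF dims S.vs_ssp S.scalar_dbasis])

lemma gfd_VI: "gfd VI 1"
 using dbasis_gfd[OF S.fd_copy(9)[OF dims S.fd_scalar] VI_dbasis] by simp

subsection \<open>The fibre functor and tensor products\<close>

text \<open>The tensor structure of the fibre functor, formulated for families instead of classes,
  so that no choice of representatives intervenes; \<open>fibre_tensor_cl\<close> makes the
  connection.\<close>

definition cc where
 "cc X Y = vlift kk (up X) (up Y) (up (VT X Y)) (umap2 U (%i. vpure (K i) (X i) (Y i)))"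

text \<open>Bijectivity holds because pure tensors of basis classes go to the classes of the product
  bases; here the constant finite dimensions enter.\<close>

lemma cc:
 assumes X: "gfd X n" and Y: "gfd Y m"
 shows cc_hom: "cc X Y:Lin kk (vten kk (up X) (up Y)) (up (VT X Y))"
  and cc_lin: "cc X Y:lin_maps kk (vten kk (up X) (up Y)) (up (VT X Y))"
  and cc_pure: "[|cl x .: up X; cl y .: up Y|]
   ==> cc X Y (vpure kk (up X) (up Y) (cl x) (cl y)) = cl (%i. vpure (K i) (X i) (Y i) (x i) (y i))"
  and cc_bij: "bij_betw (cc X Y) (Car (vten kk (up X) (up Y))) (Car (up (VT X Y)))"
proof -
 note b = up_bilin[OF gfdD(2)[OF X] gfdD(2)[OF Y] S.vpure_bilin[OF dims gfdD(1)[OF X] gfdD(1)[OF Y]]]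
 note P = gfdD(4)[OF gfd_VT[OF X Y]] and uX = gfd_up[OF X] and uY = gfd_up[OF Y]
 show h: "cc X Y:Lin kk (vten kk (up X) (up Y)) (up (VT X Y))"
  unfolding cc_def by (rule k.vlift_hom[OF kdims uX uY P b])
 show "cc X Y:lin_maps kk (vten kk (up X) (up Y)) (up (VT X Y))"
  unfolding cc_def by (rule k.vlift_lin[OF kdims uX uY P b])
 show p: "cc X Y (vpure kk (up X) (up Y) (cl x) (cl y)) = cl (%i. vpure (K i) (X i) (Y i) (x i) (y i))"
  if "cl x .: up X" "cl y .: up Y" for x y
  unfolding cc_def using k.vlift_pure[OF kdims uX uY P b that] by simp
 obtain e phi where e: "!!i. S.dbasis i (X i) {..<n} (e i) (phi i)" using gfd_dbasis[OF X] by metis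
 obtain f ps where f: "!!i. S.dbasis i (Y i) {..<m} (f i) (ps i)" using gfd_dbasis[OF Y] by metis
 obtain ch where ch: "!!i. S.dbasis i (VT X Y i) ({..<n} \<times> {..<m}) (%(p, q). vpure (K i) (X i) (Y i) (e i p) (f i q)) (ch i)"
  using VT_dbasis[OF X Y e f] by metis
 note E = up_dbasis[OF gfdD(2)[OF X] e] and F = up_dbasis[OF gfdD(2)[OF Y] f] and G = up_dbasis[OF gfdD(2)[OF gfd_VT[OF X Y]] ch]
 obtain ze where ze: "k.dbasis (vten kk (up X) (up Y)) ({..<n} \<times> {..<m})
   (%(p, q). vpure kk (up X) (up Y) (cl (%i. e i p)) (cl (%i. f i q))) ze"
  using k.vtensor_dbasis[OF kdims gfdD(4)[OF X] gfdD(4)[OF Y] E F] by blast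
 show "bij_betw (cc X Y) (Car (vten kk (up X) (up Y))) (Car (up (VT X Y)))"
  by (rule k.dbasis_bij[OF k.vtensor_vs[OF kdims uX uY] P ze G h])
   (use k.dbD(3)[OF E] k.dbD(3)[OF F] p in auto)
qed

text \<open>This and the coherence identities after it equate linear maps on a tensor product. On
  pure tensors of classes both sides are computed componentwise.\<close>

lemma cc_natural:
 assumes X: "gfd X n" and Y: "gfd Y m" and X': "gfd X' n'" and Y': "gfd Y' m'"
  and f: "!!i. f i:Lin (K i) (X i) (X' i)" and g: "!!i. g i:Lin (K i) (Y i) (Y' i)"
  and t: "t .: (vten kk (up X) (up Y))"
 shows "umap1 U (%i. S.vmap i (X i) (Y i) (X' i) (Y' i) (f i) (g i)) (cc X Y t)
  = cc X' Y' (k.vmap (up X) (up Y) (up X') (up Y') (restrict (umap1 U f) (Car (up X))) (restrict (umap1 U g) (Car (up Y))) t)"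
proof -
 note XY = gfd_VT[OF X Y] and uX = gfd_up[OF X] and uY = gfd_up[OF Y] and uX' = gfd_up[OF X'] and uY' = gfd_up[OF Y']
 note fr = k.hom_restrict[OF gfdD(4)[OF X] up_hom[OF gfdD(2)[OF X] f]] and gr = k.hom_restrict[OF gfdD(4)[OF Y] up_hom[OF gfdD(2)[OF Y] g]]
 note vi = S.vmap_hom[OF dims gfdD(1)[OF X] gfdD(1)[OF Y] gfdD(1)[OF X'] gfdD(1)[OF Y'] f g]
  and vk = k.vmap_hom[OF kdims uX uY uX' uY' fr gr]
 show ?thesis
 proof (rule k.vtensor_hom_eqI[OF kdims uX uY k.hom_comp[OF cc_hom[OF X Y] up_hom[OF gfdD(2)[OF XY] vi]] k.hom_comp[OF vk cc_hom[OF X' Y']] _ t])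
  fix v w assume v: "v .: up X" and w: "w .: up Y"
  obtain x where x: "!!i. x i .: X i" "v = cl x" by (rule up_cases[OF gfdD(2)[OF X] v]) (rule that)
  obtain y where y: "!!i. y i .: Y i" "w = cl y" by (rule up_cases[OF gfdD(2)[OF Y] w]) (rule that)
  have fv: "cl (%i. f i (x i)) .: up X'" by (rule up_cl[OF S.hom_cl[OF f x(1)]])
  have gw: "cl (%i. g i (y i)) .: up Y'" by (rule up_cl[OF S.hom_cl[OF g y(1)]])
  show "umap1 U (%i. S.vmap i (X i) (Y i) (X' i) (Y' i) (f i) (g i)) (cc X Y (vpure kk (up X) (up Y) v w))
   = cc X' Y' (k.vmap (up X) (up Y) (up X') (up Y') (restrict (umap1 U f) (Car (up X))) (restrict (umap1 U g) (Car (up Y)))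
     (vpure kk (up X) (up Y) v w))"
   using v w x y by (simp add: cc_pure[OF X Y] k.vmap_pure[OF kdims uX uY uX' uY' fr gr] cc_pure[OF X' Y' fv gw]
     S.vmap_pure[OF dims gfdD(1)[OF X] gfdD(1)[OF Y] gfdD(1)[OF X'] gfdD(1)[OF Y'] f g])
 qed
qed

lemma cc_assoc:
 assumes X: "gfd X n" and Y: "gfd Y m" and Z: "gfd Z l"
  and t: "t .: (vten kk (vten kk (up X) (up Y)) (up Z))"
 shows "umap1 U (%i. S.vassoc i (X i) (Y i) (Z i)) (cc (VT X Y) Z
   (k.vmap (vten kk (up X) (up Y)) (up Z) (up (VT X Y)) (up Z) (cc X Y) (\<lambda>z\<in>Car (up Z). z) t))
  = cc X (VT Y Z) (k.vmap (up X) (vten kk (up Y) (up Z)) (up X) (up (VT Y Z)) (\<lambda>x\<in>Car (up X). x) (cc Y Z)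
    (k.vassoc (up X) (up Y) (up Z) t))"
proof -
 note XY = gfd_VT[OF X Y] and YZ = gfd_VT[OF Y Z] and uX = gfd_up[OF X] and uY = gfd_up[OF Y] and uZ = gfd_up[OF Z]
 note uXY = gfd_up[OF XY] and uYZ = gfd_up[OF YZ] and vXY = k.vtensor_fd[OF kdims uX uY] and vYZ = k.vtensor_fd[OF kdims uY uZ]
 have iX: "(\<lambda>x\<in>Car (up X). x):Lin kk (up X) (up X)" by (rule k.hom_restrict[OF gfdD(4)[OF X] k.hom_id])
 have iZ: "(\<lambda>x\<in>Car (up Z). x):Lin kk (up Z) (up Z)" by (rule k.hom_restrict[OF gfdD(4)[OF Z] k.hom_id])
 note m1 = k.vmap_hom[OF kdims vXY uZ uXY uZ cc_hom[OF X Y] iZ] and m2 = k.vmap_hom[OF kdims uX vYZ uX uYZ iX cc_hom[OF Y Z]]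
 note p1 = k.vmap_pure[OF kdims vXY uZ uXY uZ cc_hom[OF X Y] iZ] and p2 = k.vmap_pure[OF kdims uX vYZ uX uYZ iX cc_hom[OF Y Z]]
 note a = S.vassoc_hom[OF dims gfdD(1)[OF X] gfdD(1)[OF Y] gfdD(1)[OF Z]] and ak = k.vassoc_hom[OF kdims uX uY uZ]
 show ?thesis
 proof (rule k.vtensor3_hom_eqI[OF kdims uX uY uZ k.hom_comp[OF k.hom_comp[OF m1 cc_hom[OF XY Z]] up_hom[OF gfdD(2)[OF gfd_VT[OF XY Z]] a]]
    k.hom_comp[OF k.hom_comp[OF ak m2] cc_hom[OF X YZ]] _ t])
  fix u v w assume u: "u .: up X" and v: "v .: up Y" and w: "w .: up Z"
  obtain x where x: "!!i. x i .: X i" "u = cl x" by (rule up_cases[OF gfdD(2)[OF X] u]) (rule that)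
  obtain y where y: "!!i. y i .: Y i" "v = cl y" by (rule up_cases[OF gfdD(2)[OF Y] v]) (rule that)
  obtain z where z: "!!i. z i .: Z i" "w = cl z" by (rule up_cases[OF gfdD(2)[OF Z] w]) (rule that)
  have uv: "vpure kk (up X) (up Y) u v .: (vten kk (up X) (up Y))" by (rule k.vpure_closed[OF kdims uX uY u v])
  have vw: "vpure kk (up Y) (up Z) v w .: (vten kk (up Y) (up Z))" by (rule k.vpure_closed[OF kdims uY uZ v w])
  have xy: "cl (%i. vpure (K i) (X i) (Y i) (x i) (y i)) .: (up (VT X Y))"
   by (rule up_cl[OF S.vpure_closed[OF dims gfdD(1)[OF X] gfdD(1)[OF Y] x(1) y(1)]])
  have yz: "cl (%i. vpure (K i) (Y i) (Z i) (y i) (z i)) .: (up (VT Y Z))"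
   by (rule up_cl[OF S.vpure_closed[OF dims gfdD(1)[OF Y] gfdD(1)[OF Z] y(1) z(1)]])
  note c = u v w uv vw xy yz
  show "umap1 U (%i. S.vassoc i (X i) (Y i) (Z i)) (cc (VT X Y) Z
    (k.vmap (vten kk (up X) (up Y)) (up Z) (up (VT X Y)) (up Z) (cc X Y) (\<lambda>z\<in>Car (up Z). z)
     (vpure kk (vten kk (up X) (up Y)) (up Z) (vpure kk (up X) (up Y) u v) w)))
   = cc X (VT Y Z) (k.vmap (up X) (vten kk (up Y) (up Z)) (up X) (up (VT Y Z)) (\<lambda>x\<in>Car (up X). x) (cc Y Z)
     (k.vassoc (up X) (up Y) (up Z) (vpure kk (vten kk (up X) (up Y)) (up Z) (vpure kk (up X) (up Y) u v) w)))"
   using c unfolding x(2) y(2) z(2)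
   by (simp add: p1 p2 k.vassoc_pure[OF kdims uX uY uZ] cc_pure[OF X Y] cc_pure[OF Y Z] cc_pure[OF XY Z] cc_pure[OF X YZ]
     S.vassoc_pure[OF dims gfdD(1)[OF X] gfdD(1)[OF Y] gfdD(1)[OF Z] x(1) y(1) z(1)])
 qed
qed

lemma cc_braid:
 assumes X: "gfd X n" and Y: "gfd Y m" and t: "t .: (vten kk (up X) (up Y))"
 shows "umap1 U (%i. vlift (K i) (X i) (Y i) (vten (K i) (Y i) (X i)) (%x y. vpure (K i) (Y i) (X i) y x)) (cc X Y t)
  = cc Y X (vlift kk (up X) (up Y) (vten kk (up Y) (up X)) (%x y. vpure kk (up Y) (up X) y x) t)"
proof -
 note uX = gfd_up[OF X] and uY = gfd_up[OF Y] and bi = S.vbraid[OF dims gfdD(1)[OF X] gfdD(1)[OF Y]]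
 note bk = k.vbraid[OF kdims uX uY]
 show ?thesis
 proof (rule k.vtensor_hom_eqI[OF kdims uX uY k.hom_comp[OF cc_hom[OF X Y] up_hom[OF gfdD(2)[OF gfd_VT[OF X Y]] bi(1)]]
    k.hom_comp[OF bk(1) cc_hom[OF Y X]] _ t])
  fix v w assume v: "v .: up X" and w: "w .: up Y"
  obtain x where x: "!!i. x i .: X i" "v = cl x" by (rule up_cases[OF gfdD(2)[OF X] v]) (rule that)
  obtain y where y: "!!i. y i .: Y i" "w = cl y" by (rule up_cases[OF gfdD(2)[OF Y] w]) (rule that)
  show "umap1 U (%i. vlift (K i) (X i) (Y i) (vten (K i) (Y i) (X i)) (%x y. vpure (K i) (Y i) (X i) y x)) (cc X Y (vpure kk (up X) (up Y) v w))
   = cc Y X (vlift kk (up X) (up Y) (vten kk (up Y) (up X)) (%x y. vpure kk (up Y) (up X) y x) (vpure kk (up X) (up Y) v w))"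
   using v w unfolding x(2) y(2) by (simp add: bk(2) cc_pure[OF X Y] cc_pure[OF Y X] bi(2)[OF x(1) y(1)])
 qed
qed

text \<open>The unit isomorphism of the fibre functor: two independently chosen copies of the
  scalars, one over the ultraproduct field and one in each factor, are matched through the scalars
  themselves.\<close>

definition uu :: "('i => 'v) set => ('i => 'v) set" where
 "uu = (\<lambda>z\<in>Car (copy_space kk (ssp kk)). umap1 U (%i. copy_map (K i) (ssp (K i))) (uncopy_map kk (ssp kk) z))"

abbreviation "VIk == (copy_space kk (ssp kk) :: (('i => 'k) set, ('i => 'v) set) module)"

lemma uu:
 shows uu_lin: "uu:lin_maps kk VIk (up VI)"
  and uu_copy: "cl r .: kk ==> uu (copy_map kk (ssp kk) (cl r)) = cl (%i. copy_map (K i) (ssp (K i)) (r i))"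
  and uu_bij: "bij_betw uu (Car VIk) (Car (up VI))"
proof -
 note ck = k.fd_copy[OF kdims k.fd_scalar] and ci = S.fd_copy[OF dims S.fd_scalar]
 have h: "umap1 U (%i. copy_map (K i) (ssp (K i))):Lin kk (ssp kk) (up VI)"
  unfolding scalar_space_up by (rule up_hom[OF S.vs_ssp ci(1)])
 show l: "uu:lin_maps kk VIk (up VI)" unfolding uu_def by (rule k.lm_restrict[OF ck(9) k.hom_comp[OF ck(2) h]])
 show c: "uu (copy_map kk (ssp kk) (cl r)) = cl (%i. copy_map (K i) (ssp (K i)) (r i))" if "cl r .: kk" for r
  using that ck(3,5)[of "cl r"] by (simp add: uu_def)
 show "bij_betw uu (Car VIk) (Car (up VI))"
  by (rule k.dbasis_bij[OF ck(9) gfdD(4)[OF gfd_VI] k.copy_facts(10)[OF kdims k.vs_ssp k.scalar_dbasis]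
     up_dbasis[OF gfdD(2)[OF gfd_VI] VI_dbasis] k.lm_hom[OF l]])
   (simp add: c[OF k.K.one_closed[unfolded kk_simps]])
qed

lemma cc_unit:
 assumes X: "gfd X n"
 shows "t .: (vten kk VIk (up X)) ==>
   umap1 U (%i. vlift (K i) (VI i) (X i) (X i) (%r x. uncopy_map (K i) (ssp (K i)) r *[X i] x))
    (cc VI X (k.vmap VIk (up X) (up VI) (up X) uu (\<lambda>x\<in>Car (up X). x) t))
   = vlift kk VIk (up X) (up X) (%r x. uncopy_map kk (ssp kk) r *[up X] x) t"
  and "t .: (vten kk (up X) VIk) ==>
   umap1 U (%i. vlift (K i) (X i) (VI i) (X i) (%x r. uncopy_map (K i) (ssp (K i)) r *[X i] x))
    (cc X VI (k.vmap (up X) VIk (up X) (up VI) (\<lambda>x\<in>Car (up X). x) uu t))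
   = vlift kk (up X) VIk (up X) (%x r. uncopy_map kk (ssp kk) r *[up X] x) t"
proof -
 note ck = k.fd_copy[OF kdims k.fd_scalar] and ci = S.fd_copy[OF dims S.fd_scalar]
 note uX = gfd_up[OF X] and uI = gfd_up[OF gfd_VI] and I = gfd_VI and uh = k.lm_hom[OF uu_lin]
 have iX: "(\<lambda>x\<in>Car (up X). x):Lin kk (up X) (up X)" by (rule k.hom_restrict[OF gfdD(4)[OF X] k.hom_id])
 note m1 = k.vmap_hom[OF kdims ck(8) uX uI uX uh iX] and m2 = k.vmap_hom[OF kdims uX ck(8) uX uI iX uh]
 note p1 = k.vmap_pure[OF kdims ck(8) uX uI uX uh iX] and p2 = k.vmap_pure[OF kdims uX ck(8) uX uI iX uh]
 note ui = S.vunit[OF dims gfdD(1)[OF X]] and uk = k.vunit[OF kdims uX]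
 have el: "EX r x. (ALL i. r i .: K i) & (ALL i. x i .: X i) & s = copy_map kk (ssp kk) (cl r) & v = cl x"
  if s: "s .: VIk" and v: "v .: up X" for s v
 proof -
  have "uncopy_map kk (ssp kk) s .: kk" using ck(6)[OF s] by simp
  then obtain r where "!!i. r i .: K i" "uncopy_map kk (ssp kk) s = cl r" by (rule kk_cases) (rule that)
  moreover obtain x where "!!i. x i .: X i" "v = cl x" by (rule up_cases[OF gfdD(2)[OF X] v]) (rule that)
  ultimately show ?thesis using ck(4)[OF s] by metis
 qed
 have ev: "cl r .: kk" "uncopy_map kk (ssp kk) (copy_map kk (ssp kk) (cl r) :: ('i => 'v) set) = cl r"
  "uncopy_map (K i) (ssp (K i)) (copy_map (K i) (ssp (K i)) (r i) :: 'v) = r i"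
  "(copy_map (K i) (ssp (K i)) (r i) :: 'v) .: VI i" "cl (%i. copy_map (K i) (ssp (K i)) (r i)) .: up VI"
  if "!!i. r i .: K i" for r :: "'i => 'k" and i
  using that ck(3)[of "cl r"] kk_cl[of r, OF that] ci(3)[of "r i" i] ci(5)[of "r i" i] ci(5) by (simp_all add: up_cl)
 show "umap1 U (%i. vlift (K i) (VI i) (X i) (X i) (%r x. uncopy_map (K i) (ssp (K i)) r *[X i] x))
    (cc VI X (k.vmap VIk (up X) (up VI) (up X) uu (\<lambda>x\<in>Car (up X). x) t))
   = vlift kk VIk (up X) (up X) (%r x. uncopy_map kk (ssp kk) r *[up X] x) t"
  if t: "t .: (vten kk VIk (up X))"
 proof (rule k.vtensor_hom_eqI[OF kdims ck(8) uX k.hom_comp[OF k.hom_comp[OF m1 cc_hom[OF I X]] up_hom[OF gfdD(2)[OF gfd_VT[OF I X]] ui(1)]] uk(1) _ t])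
  fix s v assume s: "s .: VIk" and v: "v .: up X"
  obtain r x where r: "!!i. r i .: K i" and x: "!!i. x i .: X i" and eq: "s = copy_map kk (ssp kk) (cl r)" "v = cl x"
   using el[OF s v] by blast
  show "umap1 U (%i. vlift (K i) (VI i) (X i) (X i) (%r x. uncopy_map (K i) (ssp (K i)) r *[X i] x))
    (cc VI X (k.vmap VIk (up X) (up VI) (up X) uu (\<lambda>x\<in>Car (up X). x) (vpure kk VIk (up X) s v)))
   = vlift kk VIk (up X) (up X) (%r x. uncopy_map kk (ssp kk) r *[up X] x) (vpure kk VIk (up X) s v)"
   using s v unfolding eq by (simp add: p1 uk(3) uu_copy[OF ev(1)[OF r]] cc_pure[OF I X ev(5)[OF r]] ui(3)[OF ev(4)[OF r] x] ev(2,3)[OF r] up_simps(5))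
 qed
 show "umap1 U (%i. vlift (K i) (X i) (VI i) (X i) (%x r. uncopy_map (K i) (ssp (K i)) r *[X i] x))
    (cc X VI (k.vmap (up X) VIk (up X) (up VI) (\<lambda>x\<in>Car (up X). x) uu t))
   = vlift kk (up X) VIk (up X) (%x r. uncopy_map kk (ssp kk) r *[up X] x) t"
  if t: "t .: (vten kk (up X) VIk)"
 proof (rule k.vtensor_hom_eqI[OF kdims uX ck(8) k.hom_comp[OF k.hom_comp[OF m2 cc_hom[OF X I]] up_hom[OF gfdD(2)[OF gfd_VT[OF X I]] ui(2)]] uk(2) _ t])
  fix v s assume v: "v .: up X" and s: "s .: VIk"
  obtain r x where r: "!!i. r i .: K i" and x: "!!i. x i .: X i" and eq: "s = copy_map kk (ssp kk) (cl r)" "v = cl x"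
   using el[OF s v] by blast
  show "umap1 U (%i. vlift (K i) (X i) (VI i) (X i) (%x r. uncopy_map (K i) (ssp (K i)) r *[X i] x))
    (cc X VI (k.vmap (up X) VIk (up X) (up VI) (\<lambda>x\<in>Car (up X). x) uu (vpure kk (up X) VIk v s)))
   = vlift kk (up X) VIk (up X) (%x r. uncopy_map kk (ssp kk) r *[up X] x) (vpure kk (up X) VIk v s)"
   using s v unfolding eq by (simp add: p2 uk(4) uu_copy[OF ev(1)[OF r]] cc_pure[OF X I _ ev(5)[OF r]] ui(4)[OF ev(4)[OF r] x] ev(2,3)[OF r] up_simps(5))
 qed
qed

end

context ultra_hopf
begin

subsection \<open>Coactions on the ultraproducts\<close>

abbreviation "C == (restr_uprod_Comod U K A :: (('i => ('k, 'a, 'v) comodule) set, ('i => 'v => 'v) set, ('i => 'k) set) tensor_category)"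
abbreviation "D == (Comod kk RA :: ((('i => 'k) set, ('i => 'a) set, ('i => 'v) set) comodule, ('i => 'v) set => ('i => 'v) set, ('i => 'k) set) tensor_category)"

definition good :: "('i => ('k, 'a, 'v) comodule) => nat => bool" where
 "good X n \<longleftrightarrow> (ALL i. X i:OB (K i) (A i) & vdim (K i) (X i) = n)"

lemma goodD:
 assumes "good X n"
 shows "X i:OB (K i) (A i)" "rcom (K i) (A i) (X i)" "gfd X n" "vsp (K i) (X i)"
 using assms H.ObjD[of "X i" i for i] by (auto simp: good_def gfd_def)

text \<open>The bound on dimensions becomes a constant by \<open>ev_bounded\<close>, and exceptional
  indices are filled with some comodule of that dimension. Objects can thus be represented by
  families satisfying all conditions at every index.\<close>

lemma C_obj: "x:Obj C \<longleftrightarrow> (EX X n. good X n & x = cl X)"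
proof
 assume "x:Obj C"
 then obtain X m where x: "x = cl X" and X: "eventually (%i. X i:OB (K i) (A i)) U"
  and d: "eventually (%i. vdim (K i) (X i) <= m) U"
  by (auto simp: restr_uprod_Comod_def restr_uprod_cat_def)
 from ev_bounded[OF d] obtain n where n: "eventually (%i. vdim (K i) (X i) = n) U" by blast
 have "EX Y :: ('k, 'a, 'v) comodule. Y:OB (K i) (A i) & vdim (K i) Y = n" for i
  by (rule H.object_of_dim[OF dims])
 then obtain Y :: "'i => ('k, 'a, 'v) comodule" where Y: "!!i. Y i:OB (K i) (A i) & vdim (K i) (Y i) = n" by metis
 let ?Z = "%i. if X i:OB (K i) (A i) & vdim (K i) (X i) = n then X i else Y i"
 have "good ?Z n" using Y by (simp add: good_def)
 moreover have "x = cl ?Z" unfolding x cl_eq using X n by eventually_elim simp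
 ultimately show "EX X n. good X n & x = cl X" by blast
next
 assume "EX X n. good X n & x = cl X"
 then obtain X n where X: "good X n" "x = cl X" by blast
 have "eventually (%i. X i:OB (K i) (A i)) U" "eventually (%i. vdim (K i) (X i) <= n) U"
  using X(1) by (simp_all add: good_def)
 then show "x:Obj C" unfolding X(2) by (auto simp: restr_uprod_Comod_def restr_uprod_cat_def)
qed

text \<open>The componentwise coaction pulled back along the comparison map, as for the
  comultiplication of \<open>RA\<close>. By \<open>rho_cl\<close> it can be computed from any
  representative of the class.\<close>

definition rho :: "('i => ('k, 'a, 'v) comodule) set => ('i => 'v) set => (('i => 'v) set \<times> ('i => 'a) set => ('i => 'k) set) set" where
 "rho x = (%v. inv_into (Car (ten kk (up (urep x)) RA)) (utens (urep x) A (up (urep x)) RA) (umap1 U (%i. coact (urep x i)) v))"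

lemma rho_cl: "rho (cl X) = (%v. inv_into (Car (ten kk (up X) RA)) (utens X A (up X) RA) (umap1 U (%i. coact (X i)) v))"
proof -
 have "umap1 U (%i. coact (urep (cl X) i)) v = umap1 U (%i. coact (X i)) v" for v
  unfolding umap1_def cl_eq using urep_cl[of X] by eventually_elim simp
 then show ?thesis unfolding rho_def up_cong[OF urep_cl[of X]] utens_cong[OF urep_cl[of X]] by simp
qed

abbreviation "FF X == wco (up X) (rho (cl X))"

lemma rho_tsum:
 assumes X: "gfd X n" and I: "finite I" and v: "!!i. coact (X i) (v i) = S.tsum i (X i) (A i) I (x i) (a i)"
  and x: "!!i p. p:I ==> x i p .: X i" and a: "!!i p. p:I ==> csize i m (a i p)"
 shows "rho (cl X) (cl v) = k.tsum (up X) RA I (%p. cl (%i. x i p)) (%p. cl (%i. a i p))"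
 unfolding rho_cl
proof (rule inv_into_f_eq[OF utens_inj[OF gfdD(3)[OF X] RA_sub]])
 show "k.tsum (up X) RA I (%p. cl (%i. x i p)) (%p. cl (%i. a i p)) .: (ten kk (up X) RA)"
  by (rule k.tsum_closed[OF gfdD(4)[OF X] RA_vs up_cl[OF x] RA_cl[OF a]])
 show "utens X A (up X) RA (k.tsum (up X) RA I (%p. cl (%i. x i p)) (%p. cl (%i. a i p))) = umap1 U (%i. coact (X i)) (cl v)"
  using utens_tsum[where v=x and w=a, OF gfdD(3)[OF X] RA_sub I x up_cl[OF x] cs_closed[OF a] RA_cl[OF a]] v by simp
qed

text \<open>In bases of the factors, the componentwise coaction is a sum of \<open>n\<close> terms
  whose second factors are coefficients of \<open>n\<close>-dimensional comodules. Their classes lie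
  in \<open>RA\<close>, so the pull-back is possible.\<close>

lemma rho_image:
 assumes X: "good X n" and v: "v .: up X"
 shows "umap1 U (%i. coact (X i)) v:utens X A (up X) RA ` Car (ten kk (up X) RA)"
proof -
 note X' = goodD(3)[OF X]
 obtain w where w: "!!i. w i .: X i" "v = cl w" by (rule up_cases[OF gfdD(2)[OF X'] v]) (rule that)
 obtain e phi where b: "!!i. S.dbasis i (X i) {..<n} (e i) (phi i)" using gfd_dbasis[OF X'] by metis
 define a where "a i p = S.slice i (X i) (A i) (phi i p) (coact (X i) (w i))" for i p
 have co: "coact (X i) (w i) = S.tsum i (X i) (A i) {..<n} (e i) (a i)" for i
  unfolding a_def by (rule S.dbasis_tsum[OF gfdD(2)[OF X'] H.A_vs b H.coD(3)[OF goodD(2)[OF X] w(1)]])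
 have a: "csize i n (a i p)" if "p : {..<n}" for i p
  unfolding TV_eq H.coeff_size_def a_def H.coef_slice[symmetric]
  using S.dbD(4)[OF b that] w(1) X by (intro exI[of _ "X i"]) (auto simp: good_def)
 note e = S.dbD(3)[OF b]
 show ?thesis
 proof (rule rev_image_eqI)
  show "k.tsum (up X) RA {..<n} (%p. cl (%i. e i p)) (%p. cl (%i. a i p)) .: (ten kk (up X) RA)"
  by (rule k.tsum_closed[OF gfdD(4)[OF X'] RA_vs up_cl[OF e] RA_cl[OF a]])
  show "umap1 U (%i. coact (X i)) v = utens X A (up X) RA (k.tsum (up X) RA {..<n} (%p. cl (%i. e i p)) (%p. cl (%i. a i p)))"
  using utens_tsum[where v=e and w=a, OF gfdD(3)[OF X'] RA_sub finite_lessThan e up_cl[OF e] cs_closed[OF a] RA_cl[OF a]] co w(2) by simp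
 qed
qed

lemma rho:
 assumes X: "good X n"
 shows rho_closed: "v .: up X ==> rho (cl X) v .: (ten kk (up X) RA)"
  and utens_rho: "v .: up X ==> utens X A (up X) RA (rho (cl X) v) = umap1 U (%i. coact (X i)) v"
  and rho_hom: "rho (cl X):Lin kk (up X) (ten kk (up X) RA)"
proof -
 note im = rho_image[OF X]
 show "rho (cl X) v .: (ten kk (up X) RA)" if "v .: up X"
  unfolding rho_cl by (rule inv_into_into[OF im[OF that]])
 show "utens X A (up X) RA (rho (cl X) v) = umap1 U (%i. coact (X i)) v" if "v .: up X"
  unfolding rho_cl by (rule f_inv_into_f[OF im[OF that]])
 show "rho (cl X):Lin kk (up X) (ten kk (up X) RA)"
  unfolding rho_cl
  by (rule utens_inv_hom[OF gfdD(3)[OF goodD(3)[OF X]] RA_sub up_hom[OF goodD(4)[OF X] H.coD(2)[OF goodD(2)[OF X]]] im])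
qed

lemma good_matrix:
 assumes X: "good X n"
 obtains e phi m where "!!i. S.dbasis i (X i) {..<n} (e i) (phi i)" "!!i. H.mmat i {..<n} (m i)"
  "!!i q. q : {..<n} ==> coact (X i) (e i q) = S.tsum i (X i) (A i) {..<n} (e i) (%p. m i p q)"
proof -
 obtain e phi where b: "!!i. S.dbasis i (X i) {..<n} (e i) (phi i)" using gfd_dbasis[OF goodD(3)[OF X]] by metis
 note m = H.comodule_basis_matrix[OF goodD(2)[OF X] b]
 show thesis
  by (rule that[of e phi "%i p q. S.slice i (X i) (A i) (phi i p) (coact (X i) (e i q))"]) (rule b, rule m(1), erule m(2))
qed

lemma matrix_size: fixes n :: nat shows "(!!i. H.mmat i {..<n} (m i)) ==> p : {..<n} ==> q : {..<n} ==> csize i n (m i p q)"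
 using cs_entry[of i "{..<n}" "m i" p q] by simp

text \<open>The entries of multiplicative \<open>n\<close> by \<open>n\<close> matrices have size
  \<open>n\<close>, hence define elements of \<open>RA\<close>, and the finitely many defining
  equations hold componentwise.\<close>

lemma RA_matrix:
 fixes n :: nat
 assumes mm: "!!i. H.mmat i {..<n} (m i)"
 shows "R.mmat {..<n} (%p q. cl (%i. m i p q))"
 unfolding R.mmat_def
proof (intro conjI ballI finite_lessThan)
 fix p q assume p: "p : {..<n}" and q: "q : {..<n}"
 note ms = matrix_size[of n m, OF mm]
 show "cl (%i. m i p q) .: RA" by (rule RA_cl[OF ms[OF p q]])
 show "comult RA (cl (%i. m i p q)) = k.tsum RA RA {..<n} (%r. cl (%i. m i p r)) (%r. cl (%i. m i r q))"
  by (rule RA_comult_tsum[OF H.mmD(3)[OF mm p q] finite_lessThan ms[OF p] ms[OF _ q]])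
 show "counit RA (cl (%i. m i p q)) = (if p = q then 1[kk] else 0[kk])"
  using H.mmD(4)[OF mm p q] by simp
qed

lemma rho_matrix:
 fixes n :: nat
 assumes X: "good X n" and b: "!!i. S.dbasis i (X i) {..<n} (e i) (phi i)" and mm: "!!i. H.mmat i {..<n} (m i)"
  and co: "!!i q. q : {..<n} ==> coact (X i) (e i q) = S.tsum i (X i) (A i) {..<n} (e i) (%p. m i p q)" and q: "q : {..<n}"
 shows "rho (cl X) (cl (%i. e i q)) = k.tsum (up X) RA {..<n} (%p. cl (%i. e i p)) (%p. cl (%i. m i p q))"
 by (rule rho_tsum[OF goodD(3)[OF X] finite_lessThan co[OF q] S.dbD(3)[OF b] matrix_size[of n m, OF mm _ q]])

lemma FF_object:
 assumes X: "good X n"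
 shows "FF X:Obj D"
proof -
 obtain e phi m where b: "!!i. S.dbasis i (X i) {..<n} (e i) (phi i)" and mm: "!!i. H.mmat i {..<n} (m i)"
  and co: "!!i q. q : {..<n} ==> coact (X i) (e i q) = S.tsum i (X i) (A i) {..<n} (e i) (%p. m i p q)"
  by (rule good_matrix[OF X]) (rule that)
 note v = gfdD(4)[OF goodD(3)[OF X]] and E = up_dbasis[OF gfdD(2)[OF goodD(3)[OF X]] b]
 have "rcom kk RA (FF X)"
  by (rule R.matrix_comodule[OF _ _ RA_matrix[OF mm], where e="%q. cl (%i. e i q)"])
   (use v E rho_hom[OF X] rho_matrix[OF X b mm co] k.module_hom_cong(1)[of "FF X" "up X"] in simp_all)
 then show ?thesis by (rule R.ObjI) (simp add: gfd_up[OF goodD(3)[OF X]])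
qed

lemma fibre_comod_hom:
 assumes X: "good X n" and Y: "good Y m" and f: "!!i. f i:chom (K i) (A i) (X i) (Y i)"
 shows "restrict (umap1 U f) (Car (up X)):chom kk RA (FF X) (FF Y)"
proof -
 let ?f = "restrict (umap1 U f) (Car (up X))"
 note uX = gfdD(3)[OF goodD(3)[OF X]] and uY = gfdD(3)[OF goodD(3)[OF Y]] and vX = gfdD(4)[OF goodD(3)[OF X]] and vY = gfdD(4)[OF goodD(3)[OF Y]]
 note fh = H.chD(2)[OF f]
 have l: "?f:lin_maps kk (up X) (up Y)" by (rule k.lm_restrict[OF vX up_hom[OF goodD(4)[OF X] fh]])
 note h = k.lm_hom[OF l]
 have "rho (cl Y) (?f v) = tmap kk (up X) RA (up Y) RA ?f (%a. a) (rho (cl X) v)" if v: "v .: up X" for v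
 proof (rule utens_eqI[OF uY RA_sub rho_closed[OF Y k.hom_cl[OF h v]]])
  note r = rho_closed[OF X v]
  show "tmap kk (up X) RA (up Y) RA ?f (%a. a) (rho (cl X) v) .: (ten kk (up Y) RA)"
   by (rule k.hom_cl[OF k.tmap_hom[OF vX RA_vs vY RA_vs h k.hom_id] r])
  obtain w where w: "!!i. w i .: X i" "v = cl w" by (rule up_cases[OF goodD(4)[OF X] v]) (rule that)
  have "utens Y A (up Y) RA (tmap kk (up X) RA (up Y) RA ?f (%a. a) (rho (cl X) v))
   = umap1 U (%i. tmap (K i) (X i) (A i) (Y i) (A i) (f i) (%a. a)) (utens X A (up X) RA (rho (cl X) v))"
   by (rule utens_map[OF uX RA_sub uY fh h _ r]) simp
  then show "utens Y A (up Y) RA (rho (cl Y) (?f v)) = utens Y A (up Y) RA (tmap kk (up X) RA (up Y) RA ?f (%a. a) (rho (cl X) v))"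
   using w v utens_rho[OF Y k.hom_cl[OF h v]] utens_rho[OF X v] H.chD(3)[OF f w(1)] by simp
 qed
 then show ?thesis using l k.module_hom_cong(2)[of "FF X" "up X" "FF Y" "up Y"] by (simp add: comod_hom_def)
qed

abbreviation "TT X Y == %i. comod_tensor (K i) (A i) (X i) (Y i)"
abbreviation "TI == (%i. comod_unit (K i) (A i) :: ('k, 'a, 'v) comodule)"

text \<open>The ultraproduct of spaces forgets coactions, so the tensor products of comodules and
  those of their spaces have literally the same ultraproduct.\<close>

lemma up_TT [simp]: "up (TT X Y) = up (VT X Y)" and up_TI [simp]: "up TI = up VI"
 unfolding H.ct_alt H.cu_alt by (simp_all add: uprod_module_def)

lemma good_TT: "good X n ==> good Y m ==> good (TT X Y) (n * m)"
 using H.ct_object(1,2)[OF dims] by (simp add: good_def)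

lemma good_TI: "good TI 1"
 using H.cu_object(1,2)[OF dims] by (simp add: good_def)

text \<open>In the product bases both coactions are given by the Kronecker product of the two
  matrices: once formed over \<open>RA\<close>, once formed in each factor.\<close>

lemma cc_comod:
 assumes X: "good X n" and Y: "good Y m"
 shows "cc X Y:chom kk RA (comod_tensor kk RA (FF X) (FF Y)) (FF (TT X Y))"
proof -
 obtain e phi M where b: "!!i. S.dbasis i (X i) {..<n} (e i) (phi i)" and mm: "!!i. H.mmat i {..<n} (M i)"
  and co: "!!i q. q : {..<n} ==> coact (X i) (e i q) = S.tsum i (X i) (A i) {..<n} (e i) (%p. M i p q)"
  by (rule good_matrix[OF X]) (rule that)
 obtain f ps N where c: "!!i. S.dbasis i (Y i) {..<m} (f i) (ps i)" and nn: "!!i. H.mmat i {..<m} (N i)"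
  and do: "!!i q. q : {..<m} ==> coact (Y i) (f i q) = S.tsum i (Y i) (A i) {..<m} (f i) (%p. N i p q)"
  by (rule good_matrix[OF Y]) (rule that)
 note X' = goodD(3)[OF X] and Y' = goodD(3)[OF Y] and XY = good_TT[OF X Y] and FX = FF_object[OF X] and FY = FF_object[OF Y]
 note E = up_dbasis[OF gfdD(2)[OF X'] b] and F = up_dbasis[OF gfdD(2)[OF Y'] c]
 note Ms = matrix_size[of n M, OF mm] and Ns = matrix_size[of m N, OF nn]
 note Mc = cs_closed[OF Ms] and Nc = cs_closed[OF Ns] and ec = S.dbD(3)[OF b] and fc = S.dbD(3)[OF c]
 let ?I = "{..<n} \<times> {..<m}"
 let ?E = "%p. cl (%i. e i p)" and ?F = "%p. cl (%i. f i p)" and ?M = "%p q. cl (%i. M i p q)" and ?N = "%p q. cl (%i. N i p q)"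
 let ?T = "comod_tensor kk RA (FF X) (FF Y)"
 note Tob = R.ct_object(1)[OF kdims FX FY]
 obtain ze where ze: "k.dbasis (vten kk (up X) (up Y)) ?I (%(p, q). vpure kk (up X) (up Y) (?E p) (?F q)) ze"
  using k.vtensor_dbasis[OF kdims gfdD(4)[OF X'] gfdD(4)[OF Y'] E F] by blast
 show ?thesis
 proof (rule R.comod_homI[OF R.ObjD(1)[OF Tob] R.ObjD(1)[OF FF_object[OF XY]]])
  show "k.dbasis ?T ?I (%(p, q). vpure kk (up X) (up Y) (?E p) (?F q)) ze" using ze by (simp add: R.ct_alt)
  show "cc X Y:lin_maps kk ?T (FF (TT X Y))"
   using cc_lin[OF X' Y'] k.module_hom_cong(2)[of ?T "vten kk (up X) (up Y)" "FF (TT X Y)" "up (VT X Y)"] by (simp add: R.ct_alt)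
  fix z assume "z:?I"
  then obtain p q where z: "z = (p, q)" and p: "p : {..<n}" and q: "q : {..<m}" by auto
  note Ep = k.dbD(3)[OF E p] and Fq = k.dbD(3)[OF F q]
  have "coact (TT X Y i) (vpure (K i) (X i) (Y i) (e i p) (f i q)) = S.tsum i (VT X Y i) (A i) ?I
   (%(p, q). vpure (K i) (X i) (Y i) (e i p) (f i q)) (%(p', q'). M i p' p **[A i] N i q' q)" for i
   by (rule H.coact_tensor_tsum[OF dims goodD(1)[OF X] goodD(1)[OF Y] ec[OF p] fc[OF q] _ _ co[OF p] do[OF q] ec Mc[OF _ p] fc Nc[OF _ q]]) simp_all
  then have co2: "coact (TT X Y i) (vpure (K i) (X i) (Y i) (e i p) (f i q)) = S.tsum i (TT X Y i) (A i) ?I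
   (%(p, q). vpure (K i) (X i) (Y i) (e i p) (f i q)) (%(p', q'). M i p' p **[A i] N i q' q)" for i
   by (simp add: H.ct_alt)
  have "rho (cl (TT X Y)) (cl (%i. vpure (K i) (X i) (Y i) (e i p) (f i q))) = k.tsum (up (TT X Y)) RA ?I
   (%r. cl (%i. case r of (p, q) => vpure (K i) (X i) (Y i) (e i p) (f i q))) (%r. cl (%i. case r of (p', q') => M i p' p **[A i] N i q' q))"
   by (rule rho_tsum[where m="n * m" and x="%i (p, q). vpure (K i) (X i) (Y i) (e i p) (f i q)" and a="%i (p', q'). M i p' p **[A i] N i q' q",
      OF goodD(3)[OF XY] _ co2])
    (use S.vpure_closed[OF dims gfdD(1)[OF X'] gfdD(1)[OF Y'] ec fc] cs_mult[OF Ms[OF _ p] Ns[OF _ q]] in "auto simp: H.ct_alt")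
  moreover have "coact ?T (vpure kk (up X) (up Y) (?E p) (?F q))
   = k.tsum (vten kk (up X) (up Y)) RA ?I (%(p, q). vpure kk (up X) (up Y) (?E p) (?F q)) (%(p', q'). ?M p' p **[RA] ?N q' q)"
   using R.coact_tensor_tsum[where e="?E" and f="?F" and I="{..<n}" and J="{..<m}" and a="%r. ?M r p" and b="%r. ?N r q", OF kdims FX FY]
    Ep Fq rho_matrix[OF X b mm co p] rho_matrix[OF Y c nn do q] k.dbD(3)[OF E] k.dbD(3)[OF F] RA_cl[OF Ms[OF _ p]] RA_cl[OF Ns[OF _ q]]
   by (simp del: RA_simps)
  moreover have "tmap kk ?T RA (FF (TT X Y)) RA (cc X Y) (%a. a)
    (k.tsum (vten kk (up X) (up Y)) RA ?I (%(p, q). vpure kk (up X) (up Y) (?E p) (?F q)) (%(p', q'). ?M p' p **[RA] ?N q' q))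
   = k.tsum (up (VT X Y)) RA ?I (%r. cc X Y (case r of (p, q) => vpure kk (up X) (up Y) (?E p) (?F q))) (%(p', q'). ?M p' p **[RA] ?N q' q)"
  proof -
   have "tmap kk ?T RA (FF (TT X Y)) RA = tmap kk (vten kk (up X) (up Y)) RA (up (VT X Y)) RA"
    by (simp add: R.ct_alt)
   moreover have "tmap kk (vten kk (up X) (up Y)) RA (up (VT X Y)) RA (cc X Y) (%a. a)
    (k.tsum (vten kk (up X) (up Y)) RA ?I (%(p, q). vpure kk (up X) (up Y) (?E p) (?F q)) (%(p', q'). ?M p' p **[RA] ?N q' q))
   = k.tsum (up (VT X Y)) RA ?I (%r. cc X Y (case r of (p, q) => vpure kk (up X) (up Y) (?E p) (?F q))) (%(p', q'). ?M p' p **[RA] ?N q' q)"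
    by (rule k.tmap_tsum[OF k.vtensor_vs[OF kdims gfd_up[OF X'] gfd_up[OF Y']] RA_vs gfdD(4)[OF gfd_VT[OF X' Y']] RA_vs cc_hom[OF X' Y'] k.hom_id])
     (use k.vpure_closed[OF kdims gfd_up[OF X'] gfd_up[OF Y'] k.dbD(3)[OF E] k.dbD(3)[OF F]]
      k.bilinD(3)[OF RA_bilin RA_cl[OF Ms[OF _ p]] RA_cl[OF Ns[OF _ q]]] in "auto simp del: RA_simps")
   ultimately show ?thesis by simp
  qed
  moreover have "k.tsum (up (VT X Y)) RA ?I (%r. cc X Y (case r of (p, q) => vpure kk (up X) (up Y) (?E p) (?F q))) (%(p', q'). ?M p' p **[RA] ?N q' q)
   = k.tsum (up (VT X Y)) RA ?I (%r. cl (%i. case r of (p, q) => vpure (K i) (X i) (Y i) (e i p) (f i q))) (%r. cl (%i. case r of (p', q') => M i p' p **[A i] N i q' q))"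
  proof (rule k.tsum_cong[OF gfdD(4)[OF gfd_VT[OF X' Y']] RA_vs refl])
   fix r assume "r:?I"
   then obtain s t where r: "r = (s, t)" "s : {..<n}" "t : {..<m}" by auto
   note vp = S.vpure_closed[OF dims gfdD(1)[OF X'] gfdD(1)[OF Y'] ec[OF r(2)] fc[OF r(3)]]
   show "cl (%i. case r of (p, q) => vpure (K i) (X i) (Y i) (e i p) (f i q)) .: (up (VT X Y))" unfolding r(1) using vp by (simp add: up_cl)
   show "cl (%i. case r of (p', q') => M i p' p **[A i] N i q' q) .: RA"
    unfolding r(1) prod.case by (rule RA_cl[OF cs_mult[OF Ms[OF r(2) p] Ns[OF r(3) q]]])
   show "cc X Y (case r of (p, q) => vpure kk (up X) (up Y) (?E p) (?F q)) = cl (%i. case r of (p, q) => vpure (K i) (X i) (Y i) (e i p) (f i q))"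
    unfolding r(1) prod.case by (rule cc_pure[OF X' Y' k.dbD(3)[OF E r(2)] k.dbD(3)[OF F r(3)]])
   show "(case r of (p', q') => ?M p' p **[RA] ?N q' q) = cl (%i. case r of (p', q') => M i p' p **[A i] N i q' q)"
    unfolding r(1) by (simp add: up_simps)
  qed
  ultimately show "coact (FF (TT X Y)) (cc X Y (case z of (p, q) => vpure kk (up X) (up Y) (?E p) (?F q)))
   = tmap kk ?T RA (FF (TT X Y)) RA (cc X Y) (%a. a) (coact ?T (case z of (p, q) => vpure kk (up X) (up Y) (?E p) (?F q)))"
   unfolding z prod.case cc_pure[OF X' Y' Ep Fq] by simp
 qed
qed

lemma uu_comod: "uu:chom kk RA (comod_unit kk RA) (FF TI)"
proof -
 let ?J = "comod_unit kk RA :: (('i => 'k) set, ('i => 'a) set, ('i => 'v) set) comodule"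
 let ?c = "copy_map kk (ssp kk) 1[kk] :: ('i => 'v) set" and ?d = "%i. copy_map (K i) (ssp (K i)) 1[K i] :: 'v"
 note ob = R.cu_object[OF kdims] and ck = k.fd_copy[OF kdims k.fd_scalar] and ci = S.fd_copy[OF dims S.fd_scalar]
 have c: "?c .: VIk" by (rule ck(5)) (use k.K.one_closed in simp)
 have d: "?d i .: VI i" for i by (rule ci(5)) simp
 have d': "?d i .: TI i" for i using d by (simp add: H.cu_alt)
 have uc: "uu ?c = cl ?d" unfolding kk_simps by (rule uu_copy) (rule kk_cl, simp)
 have o: "cl (%i. 1[A i]) .: RA" by (rule RA_cl[OF cs_one])
 have oe: "1[RA] = cl (%i. 1[A i])" by (simp add: up_simps)
 have t1: "S.tsum i (TI i) (A i) {()} (%_. ?d i) (%_. 1[A i]) = pt (K i) (VI i) (A i) (?d i) 1[A i]" for i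
  unfolding H.cu_alt S.with_coact_basis S.tsum_def S.with_coact_cong
  by (rule S.vsum_single[OF S.ten_vs[OF ci(9) H.A_vs]]) (use d in auto)
 show ?thesis
 proof (rule R.comod_homI[OF R.ObjD(1)[OF ob(1)] R.ObjD(1)[OF FF_object[OF good_TI]]])
  show "k.dbasis ?J {()} (%_. ?c) (%_ x. uncopy_map kk (ssp kk) x)"
   using k.copy_facts(10)[OF kdims k.vs_ssp k.scalar_dbasis] by (simp add: R.cu_alt)
  show "uu:lin_maps kk ?J (FF TI)"
   using uu_lin k.module_hom_cong(2)[of ?J VIk "FF TI" "up VI"] by (simp add: R.cu_alt)
  have "rho (cl TI) (cl ?d) = k.tsum (up TI) RA {()} (%_. cl ?d) (%_. cl (%i. 1[A i]))"
   by (rule rho_tsum[where m=1, OF goodD(3)[OF good_TI]])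
    (use t1 d' cs_one H.cu_object(3)[OF dims S.K.one_closed] in auto)
  also have "... = pt kk (up VI) RA (cl ?d) (cl (%i. 1[A i]))"
   unfolding up_TI k.tsum_def
   by (rule k.vsum_single[OF k.ten_vs[OF gfdD(4)[OF gfd_VI] RA_vs]]) (use o up_cl[OF d] in "auto simp del: RA_simps")
  also have "... = tmap kk VIk RA (up VI) RA uu (%a. a) (pt kk VIk RA ?c 1[RA])"
   using k.tmap_pure[OF ck(9) RA_vs gfdD(4)[OF gfd_VI] RA_vs k.lm_hom[OF uu_lin] k.hom_id c o] uc unfolding oe by simp
  also have "pt kk VIk RA ?c 1[RA] = coact ?J ?c" by (rule ob(3)[OF k.K.one_closed, symmetric])
  finally show "coact (FF TI) (uu ?c) = tmap kk ?J RA (FF TI) RA uu (%a. a) (coact ?J ?c)"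
   unfolding uc by (simp add: R.cu_alt)
 qed
qed

text \<open>The images of \<open>n\<close> basis vectors lift to the factors and define linear maps
  there. Compatibility with the coactions amounts to \<open>n\<close> equations, each valid at
  almost every index once the comparison map is applied; at the exceptional indices the zero
  morphism is substituted without changing the class.\<close>

lemma fibre_full:
 assumes X: "good X n" and Y: "good Y m" and g: "g:chom kk RA (FF X) (FF Y)"
 shows "EX f. (ALL i. f i:chom (K i) (A i) (X i) (Y i)) & g = restrict (umap1 U f) (Car (up X))"
proof -
 note X' = goodD(3)[OF X] and Y' = goodD(3)[OF Y]
 note uX = gfdD(3)[OF X'] and uY = gfdD(3)[OF Y'] and vX = gfdD(4)[OF X'] and vY = gfdD(4)[OF Y']
 have gl: "g:lin_maps kk (up X) (up Y)"
  using R.chD(1)[OF g] k.module_hom_cong(2)[of "FF X" "up X" "FF Y" "up Y"] by simp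
 note gh = k.lm_hom[OF gl]
 obtain e phi where b: "!!i. S.dbasis i (X i) {..<n} (e i) (phi i)" using gfd_dbasis[OF X'] by metis
 note E = up_dbasis[OF gfdD(2)[OF X'] b] and ec = S.dbD(3)[OF b]
 have "EX y. (ALL i. y i .: Y i) & g (cl (%i. e i q)) = cl y" if "q : {..<n}" for q
  using up_cases[OF gfdD(2)[OF Y'] k.hom_cl[OF gh k.dbD(3)[OF E that]]] by metis
 then obtain y where y: "!!q i. q : {..<n} ==> y q i .: Y i" "!!q. q : {..<n} ==> g (cl (%i. e i q)) = cl (y q)" by metis
 have "EX h. h:lin_maps (K i) (X i) (Y i) & (ALL q:{..<n}. h (e i q) = y q i)" for i
 proof -
  obtain h where "h:Lin (K i) (X i) (Y i)" "ALL q:{..<n}. h (e i q) = y q i"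
   using S.dbasis_hom_ex[OF gfdD(2)[OF X'] gfdD(2)[OF Y'] b, of "%q. y q i"] y(1) by blast
  then show ?thesis using S.lm_restrict[OF gfdD(2)[OF X']] ec by (intro exI[of _ "restrict h (Car (X i))"]) simp
 qed
 then obtain h where h: "!!i. h i:lin_maps (K i) (X i) (Y i)" "!!i q. q : {..<n} ==> h i (e i q) = y q i" by metis
 note hh = S.lm_hom[OF h(1)]
 note hu = up_hom[OF gfdD(2)[OF X'] hh]
 have gu: "g v = umap1 U h v" if "v .: up X" for v
  by (rule k.dbasis_hom_eqI[OF vX vY E gh hu _ that]) (use y(2) h(2) in simp)
 have "eventually (%i. coact (Y i) (h i (e i q)) = tmap (K i) (X i) (A i) (Y i) (A i) (h i) (%a. a) (coact (X i) (e i q))) U"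
  if q: "q : {..<n}" for q
 proof -
  note Eq = k.dbD(3)[OF E q]
  have "umap1 U (%i. tmap (K i) (X i) (A i) (Y i) (A i) (h i) (%a. a)) (utens X A (up X) RA (rho (cl X) (cl (%i. e i q))))
   = utens Y A (up Y) RA (tmap kk (up X) RA (up Y) RA g (%a. a) (rho (cl X) (cl (%i. e i q))))"
   by (rule utens_map[OF uX RA_sub uY hh gh _ rho_closed[OF X Eq], symmetric]) (use gu in simp)
  also have "tmap kk (up X) RA (up Y) RA g (%a. a) (rho (cl X) (cl (%i. e i q))) = rho (cl Y) (g (cl (%i. e i q)))"
   using R.chD(3)[OF g, of "cl (%i. e i q)"] Eq by simp
  also have "utens Y A (up Y) RA (rho (cl Y) (g (cl (%i. e i q)))) = cl (%i. coact (Y i) (h i (e i q)))"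
   using utens_rho[OF Y k.hom_cl[OF gh Eq]] gu[OF Eq] by simp
  finally show ?thesis using utens_rho[OF X Eq] by (simp add: cl_eq eq_commute)
 qed
 then have "eventually (%i. ALL q:{..<n}. coact (Y i) (h i (e i q)) = tmap (K i) (X i) (A i) (Y i) (A i) (h i) (%a. a) (coact (X i) (e i q))) U"
  by (simp add: eventually_ball_finite_distrib)
 then have ev: "eventually (%i. h i:chom (K i) (A i) (X i) (Y i)) U"
  by eventually_elim (rule H.comod_homI[OF goodD(2)[OF X] goodD(2)[OF Y] b h(1)], blast)
 let ?f = "%i. if h i:chom (K i) (A i) (X i) (Y i) then h i else (\<lambda>x\<in>Car (X i). 0[Y i])"
 have f: "?f i:chom (K i) (A i) (X i) (Y i)" for i
  using H.comod_hom_zero[OF goodD(2)[OF X] goodD(2)[OF Y]] by simp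
 have "umap1 U ?f v = umap1 U h v" for v unfolding umap1_def cl_eq using ev by eventually_elim simp
 then have "g = restrict (umap1 U ?f) (Car (up X))"
  using gu gl by (intro extensionalityI[of _ "Car (up X)"]) (auto simp: lin_maps_def)
 then show ?thesis using f by (intro exI[of _ ?f] conjI allI)
qed

text \<open>At each index where the two maps differ, choose a vector on which they differ. The class
  of these vectors would distinguish the induced maps if the indices of difference formed a large
  set.\<close>

lemma fibre_faithful:
 assumes X: "good X n" and f: "!!i. f i:chom (K i) (A i) (X i) (Y i)" and g: "!!i. g i:chom (K i) (A i) (X i) (Y i)"
  and eq: "restrict (umap1 U f) (Car (up X)) = restrict (umap1 U g) (Car (up X))"
 shows "cl f = cl g"
proof -
 have "EX w. w .: X i & (f i = g i | f i w ~= g i w)" for i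
  using S.lm_eqI[OF H.chD(1)[OF f] H.chD(1)[OF g]] S.vs_zero_closed[OF goodD(4)[OF X]] by blast
 then obtain w where w: "!!i. w i .: X i" "!!i. f i = g i | f i (w i) ~= g i (w i)" by metis
 have "umap1 U f (cl w) = umap1 U g (cl w)" using fun_cong[OF eq, of "cl w"] up_cl[of w X, OF w(1)] by simp
 then have "eventually (%i. f i (w i) = g i (w i)) U" by (simp add: cl_eq)
 then show ?thesis unfolding cl_eq by (rule eventually_mono) (use w(2) in blast)
qed

text \<open>The matrix of \<open>Z\<close> in a basis lifts entrywise, and the finitely many
  equations making it multiplicative hold at almost every index. The comodules defined by the lifted
  matrices form the required object, with basis going to basis.\<close>

lemma fibre_ess_surj:
 assumes Z: "Z:Obj D"
 shows "EX X n T. good X n & cat_iso D (FF X) Z T"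
proof -
 define n where "n = vdim kk Z"
 let ?I = "{..<n}"
 note Zo = R.ObjD[OF Z]
 obtain z ze where b: "k.dbasis Z ?I z ze" using k.fd_dbasis[OF Zo(2)] unfolding n_def by blast
 define N where "N p q = k.slice Z RA (ze p) (coact Z (z q))" for p q
 have N: "R.mmat ?I N" "!!q. q:?I ==> coact Z (z q) = k.tsum Z RA ?I z (%p. N p q)"
  using R.comodule_basis_matrix[OF Zo(1) b] unfolding N_def by auto
 \<comment> \<open>The size may vary with the entry at first. Once the lifted entries form
   multiplicative matrices \<open>m i\<close>, all of them have size \<open>n\<close>.\<close>
 have "EX s a. (ALL i. csize i s (a i)) & N p q = cl a" if "p:?I" "q:?I" for p q
  using R.mmD(2)[OF N(1) that] by (rule RA_cases) blast
 then obtain s a where a: "!!p q i. p:?I ==> q:?I ==> csize i (s p q) (a p q i)" "!!p q. p:?I ==> q:?I ==> N p q = cl (a p q)" by metis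
 have "eventually (%i. comult (A i) (a p q i) = S.tsum i (A i) (A i) ?I (%r. a p r i) (%r. a r q i)
   & counit (A i) (a p q i) = (if p = q then 1[K i] else 0[K i])) U" if p: "p:?I" and q: "q:?I" for p q
 proof -
  note ac = cs_closed[OF a(1)] and aR = RA_cl[OF a(1)]
  have "comult RA (cl (a p q)) = k.tsum RA RA ?I (%r. N p r) (%r. N r q)"
   using R.mmD(3)[OF N(1) p q] a(2)[OF p q] by simp
  also have "... = k.tsum RA RA ?I (%r. cl (a p r)) (%r. cl (a r q))"
   by (rule k.tsum_cong[OF RA_vs RA_vs refl aR[OF p] aR[OF _ q] a(2)[OF p] a(2)[OF _ q]])
  finally have "cl (%i. comult (A i) (a p q i)) = Ph (k.tsum RA RA ?I (%r. cl (%i. a p r i)) (%r. cl (%i. a r q i)))"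
   using RA_comult(2)[OF aR[OF p q]] by simp
  also have "... = cl (%i. S.tsum i (A i) (A i) ?I (%r. a p r i) (%r. a r q i))"
   by (rule utens_tsum[where v="%i r. a p r i" and w="%i r. a r q i", OF RA_sub RA_sub finite_lessThan ac[OF p] aR[OF p] ac[OF _ q] aR[OF _ q]])
  finally have "eventually (%i. comult (A i) (a p q i) = S.tsum i (A i) (A i) ?I (%r. a p r i) (%r. a r q i)) U" by (simp add: cl_eq)
  moreover have "eventually (%i. counit (A i) (a p q i) = (if p = q then 1[K i] else 0[K i])) U"
   using R.mmD(4)[OF N(1) p q] a(2)[OF p q] by (simp add: cl_eq split: if_splits)
  ultimately show ?thesis by eventually_elim simp
 qed
 then have "eventually (%i. ALL p:?I. ALL q:?I. comult (A i) (a p q i) = S.tsum i (A i) (A i) ?I (%r. a p r i) (%r. a r q i)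
   & counit (A i) (a p q i) = (if p = q then 1[K i] else 0[K i])) U"
  by (simp add: eventually_ball_finite_distrib)
 then have ev: "eventually (%i. H.mmat i ?I (%p q. a p q i)) U"
  by eventually_elim (use cs_closed[OF a(1)] in "simp add: H.mmat_def")
 \<comment> \<open>A multiplicative matrix of the same format is wanted at the exceptional indices;
   that of any comodule of dimension \<open>n\<close> will do.\<close>
 have "EX m. H.mmat i ?I m" for i
 proof -
  obtain Y :: "('k, 'a, 'v) comodule" where Y: "Y:OB (K i) (A i)" "vdim (K i) Y = n"
   using H.object_of_dim[OF dims] by blast
  obtain e phi where "S.dbasis i Y ?I e phi" using S.fd_dbasis[OF H.ObjD(2)[OF Y(1)]] unfolding Y(2) by blast
  from H.comodule_basis_matrix(1)[OF H.ObjD(1)[OF Y(1)] this] show ?thesis by blast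
 qed
 then obtain m0 where m0: "!!i. H.mmat i ?I (m0 i)" by metis
 define m where "m i = (if H.mmat i ?I (%p q. a p q i) then (%p q. a p q i) else m0 i)" for i
 have mm: "H.mmat i ?I (m i)" for i using m0 by (simp add: m_def)
 have Nm: "N p q = cl (%i. m i p q)" if "p:?I" "q:?I" for p q
  unfolding a(2)[OF that] cl_eq using ev by eventually_elim (simp add: m_def)
 have "EX (Y :: ('k, 'a, 'v) comodule) e phi. Y:OB (K i) (A i) & S.dbasis i Y ?I e phi
   & (ALL q:?I. coact Y (e q) = S.tsum i Y (A i) ?I e (%p. m i p q))" for i
  by (rule H.matrix_object[OF dims mm])
 then have "ALL i. EX (Y :: ('k, 'a, 'v) comodule) e phi. Y:OB (K i) (A i) & S.dbasis i Y ?I e phi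
   & (ALL q:?I. coact Y (e q) = S.tsum i Y (A i) ?I e (%p. m i p q))" by blast
 then obtain X :: "'i => ('k, 'a, 'v) comodule" and e phi where X: "ALL i. X i:OB (K i) (A i) & S.dbasis i (X i) ?I (e i) (phi i)
   & (ALL q:?I. coact (X i) (e i q) = S.tsum i (X i) (A i) ?I (e i) (%p. m i p q))"
  unfolding choice_iff by (elim exE) (rule that)
 then have c: "!!i. S.dbasis i (X i) ?I (e i) (phi i)"
  and co: "!!i q. q:?I ==> coact (X i) (e i q) = S.tsum i (X i) (A i) ?I (e i) (%p. m i p q)" by blast+
 have good: "good X n" unfolding good_def
 proof (intro allI conjI)
  fix i show "X i:OB (K i) (A i)" using X by blast
  then show "vdim (K i) (X i) = n" using S.dbasis_dim(2)[OF H.ObjD(3) c] by simp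
 qed
 note X' = goodD(3)[OF good] and FX = FF_object[OF good]
 note E = up_dbasis[OF gfdD(2)[OF X'] c] and vX = gfdD(4)[OF X']
 let ?E = "%q. cl (%i. e i q)"
 obtain T where T: "T:Lin kk (up X) Z" "ALL q:?I. T (?E q) = z q"
  using k.dbasis_hom_ex[OF vX Zo(3) E, of z] k.dbD(3)[OF b] by blast
 let ?T = "restrict T (Car (up X))"
 have Tl: "?T:lin_maps kk (up X) Z" by (rule k.lm_restrict[OF vX T(1)])
 note Th = k.lm_hom[OF Tl]
 have TE: "?T (?E q) = z q" if "q:?I" for q using T(2) that k.dbD(3)[OF E that] by simp
 have mR: "cl (%i. m i p q) .: RA" if "p:?I" "q:?I" for p q by (rule RA_cl[OF matrix_size[of n m, OF mm that]])
 have "?T:chom kk RA (FF X) Z"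
 proof (rule R.comod_homI[OF R.ObjD(1)[OF FX] Zo(1)])
  show "k.dbasis (FF X) ?I ?E (%q. umap1 U (%i. phi i q))" using E by simp
  show "?T:lin_maps kk (FF X) Z" using Tl k.module_hom_cong(2)[of "FF X" "up X" Z Z] by simp
  fix q assume q: "q:?I"
  have r: "rho (cl X) (?E q) = k.tsum (up X) RA ?I ?E (%p. cl (%i. m i p q))" by (rule rho_matrix[OF good c mm co q])
  have "tmap kk (up X) RA Z RA ?T (%a. a) (rho (cl X) (?E q)) = k.tsum Z RA ?I (%p. ?T (?E p)) (%p. cl (%i. m i p q))"
   unfolding r
   by (rule k.tmap_tsum[OF vX RA_vs Zo(3) RA_vs Th k.hom_id k.dbD(3)[OF E] mR[OF _ q]])
  also have "... = k.tsum Z RA ?I z (%p. N p q)"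
   by (rule k.tsum_cong[OF Zo(3) RA_vs refl k.dbD(3)[OF b] R.mmD(2)[OF N(1) _ q] TE]) (use Nm q in auto)
  finally show "coact Z (?T (?E q)) = tmap kk (FF X) RA Z RA ?T (%a. a) (coact (FF X) (?E q))"
   using N(2)[OF q] TE[OF q] by simp
 qed
 moreover have "bij_betw ?T (Car (FF X)) (Car Z)"
  unfolding with_coact_simps by (rule k.dbasis_bij[OF vX Zo(3) E b Th TE])
 ultimately show ?thesis using R.cat_isoI[OF FX Z] good by blast
qed

end

section \<open>The fibre functor as a tensor equivalence\<close>

context ultra_hopf
begin

text \<open>The operations of the category are defined through chosen representatives. Each involves
  only finitely many classes, so any representatives give the same result almost everywhere.\<close>

lemma C_ops:
 "Ident C (cl X) = cl (%i. \<lambda>x\<in>Car (X i). x)"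
 "Cmp C (cl X) (cl g) (cl f) = cl (%i. compose (Car (X i)) (g i) (f i))"
 "HAdd C (cl X) (cl Y) (cl f) (cl g) = cl (%i. \<lambda>x\<in>Car (X i). f i x +[Y i] g i x)"
 "HScale C (cl X) (cl Y) (cl c) (cl f) = cl (%i. \<lambda>x\<in>Car (X i). c i *[Y i] f i x)"
 "Tens C (cl X) (cl Y) = cl (TT X Y)"
 "TensHom C (cl X) (cl X') (cl Y) (cl Y') (cl f) (cl g) = cl (%i. S.vmap i (X i) (Y i) (X' i) (Y' i) (f i) (g i))"
 "UnitObj C = cl TI"
 "Assoc C (cl X) (cl Y) (cl Z) = cl (%i. S.vassoc i (X i) (Y i) (Z i))"
 "Braid C (cl X) (cl Y) = cl (%i. vlift (K i) (X i) (Y i) (VT Y X i) (%x y. vpure (K i) (Y i) (X i) y x))"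
 "LUnit C (cl X) = cl (%i. vlift (K i) (VI i) (X i) (X i) (%r x. uncopy_map (K i) (ssp (K i)) r *[X i] x))"
 "RUnit C (cl X) = cl (%i. vlift (K i) (X i) (VI i) (X i) (%x r. uncopy_map (K i) (ssp (K i)) r *[X i] x))"
 unfolding restr_uprod_Comod_def restr_uprod_cat_def tensor_category.simps H.Comod_simps2 umap_cl cl_eq
 using urep_cl[of X] urep_cl[of Y] urep_cl[of Z] urep_cl[of X'] urep_cl[of Y'] urep_cl[of f] urep_cl[of g] urep_cl[of c]
 by (eventually_elim, simp)+

lemma fibre_obj_cl [simp]: "fibre_obj U (cl X) = up X"
 unfolding fibre_obj_def by (rule up_cong[OF urep_cl])

lemma fibre_hom_cl: "fibre_hom U (cl X) (cl Y) (cl f) = restrict (umap1 U f) (Car (up X))"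
proof -
 have "umap2 U (%i g z. g z) (cl f) x = umap1 U f x" for x
  unfolding umap2_def umap1_def cl_eq using urep_cl[of f] by eventually_elim simp
 then show ?thesis by (simp add: fibre_hom_def)
qed

lemma fibre_tensor_cl:
 fixes X Y :: "'i => ('k, 'a, 'v) comodule"
 shows "fibre_tensor U K A (cl X) (cl Y) = cc X Y"
proof -
 have "umap2 U (%i. vpure (K i) (urep (cl X) i) (urep (cl Y) i)) = umap2 U (%i. vpure (K i) (X i) (Y i))"
  by (rule umap2_cong) (use urep_cl[of X] urep_cl[of Y] in "eventually_elim, simp")
 then show ?thesis by (simp add: fibre_tensor_def cc_def C_ops(5))
qed

lemma fibre_unit_uu: "fibre_unit U K = uu"
 by (simp add: fibre_unit_def uu_def Let_def)

lemma C_hom: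
 assumes X: "good X n" and Y: "good Y m"
 shows "g:Hom C (cl X) (cl Y) \<longleftrightarrow> (EX f. (ALL i. f i:chom (K i) (A i) (X i) (Y i)) & g = cl f)"
proof -
 have "Hom C (cl X) (cl Y) = uprod_set U (%i. chom (K i) (A i) (urep (cl X) i) (urep (cl Y) i))"
  by (simp add: restr_uprod_Comod_def restr_uprod_cat_def H.Comod_simps)
 also have "... = uprod_set U (%i. chom (K i) (A i) (X i) (Y i))"
  by (rule uprod_set_cong) (use urep_cl[of X] urep_cl[of Y] in "eventually_elim, simp")
 finally have *: "Hom C (cl X) (cl Y) = uprod_set U (%i. chom (K i) (A i) (X i) (Y i))" .
 show ?thesis
 proof
  assume "g:Hom C (cl X) (cl Y)"
  then show "EX f. (ALL i. f i:chom (K i) (A i) (X i) (Y i)) & g = cl f"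
   unfolding * by (rule uprod_set_cases) (use H.comod_hom_zero[OF goodD(2)[OF X] goodD(2)[OF Y]] in auto)
 qed (auto simp: * uprod_set_cl)
qed

lemma compose_cong: "(!!x. x:S ==> g (f x) = g' (f' x)) ==> compose S g f = compose S g' f'"
 by (auto simp: compose_def)

lemma cc_TT [simp]: "cc (TT X Y) Z = cc (VT X Y) Z" "cc Z (TT X Y) = cc Z (VT X Y)" "cc TI Z = cc VI Z" "cc Z TI = cc Z VI"
 unfolding cc_def up_TT up_TI by (simp_all add: H.ct_alt H.cu_alt)

lemma up_VT_TT [simp]: "up (VT (TT X Y) Z) = up (VT (VT X Y) Z)" "up (VT Z (TT X Y)) = up (VT Z (VT X Y))"
 "up (VT TI Z) = up (VT VI Z)" "up (VT Z TI) = up (VT Z VI)"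
 by (simp_all add: H.ct_alt H.cu_alt)

lemmas cc_closed = k.hom_cl[OF cc_hom]

lemma D_carrier [simp]:
 "Car (comod_tensor kk RA (FF X) (FF Y)) = Car (vten kk (up X) (up Y))"
 "Car (comod_tensor kk RA (comod_tensor kk RA (FF X) (FF Y)) (FF Z)) = Car (vten kk (vten kk (up X) (up Y)) (up Z))"
 "Car (comod_tensor kk RA (comod_unit kk RA) (FF X)) = Car (vten kk VIk (up X))"
 "Car (comod_tensor kk RA (FF X) (comod_unit kk RA)) = Car (vten kk (up X) VIk)"
 by (simp_all add: R.ct_alt R.cu_alt)

lemma fibre_assoc:
 assumes X: "good X n" and Y: "good Y m" and Z: "good Z l"
 shows "compose (Car (vten kk (vten kk (up X) (up Y)) (up Z)))
   (restrict (umap1 U (%i. S.vassoc i (X i) (Y i) (Z i))) (Car (up (VT (VT X Y) Z))))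
   (compose (Car (vten kk (vten kk (up X) (up Y)) (up Z))) (cc (VT X Y) Z)
    (k.vmap (vten kk (up X) (up Y)) (up Z) (up (VT X Y)) (up Z) (cc X Y) (\<lambda>z\<in>Car (up Z). z)))
  = compose (Car (vten kk (vten kk (up X) (up Y)) (up Z))) (cc X (VT Y Z))
   (compose (Car (vten kk (vten kk (up X) (up Y)) (up Z)))
    (k.vmap (up X) (vten kk (up Y) (up Z)) (up X) (up (VT Y Z)) (\<lambda>x\<in>Car (up X). x) (cc Y Z))
    (k.vassoc (up X) (up Y) (up Z)))" (is "compose ?S _ (compose ?S _ ?v) = _")
proof (rule compose_cong)
 fix t assume t: "t:?S"
 note X' = goodD(3)[OF X] and Y' = goodD(3)[OF Y] and Z' = goodD(3)[OF Z]
 have "?v:Lin kk (vten kk (vten kk (up X) (up Y)) (up Z)) (vten kk (up (VT X Y)) (up Z))"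
  by (rule k.vmap_hom[OF kdims k.vtensor_fd[OF kdims gfd_up[OF X'] gfd_up[OF Y']] gfd_up[OF Z'] gfd_up[OF gfd_VT[OF X' Y']] gfd_up[OF Z']
     cc_hom[OF X' Y'] k.hom_restrict[OF gfdD(4)[OF Z'] k.hom_id]])
 from cc_closed[OF gfd_VT[OF X' Y'] Z' k.hom_cl[OF this t]] cc_assoc[OF X' Y' Z' t]
 show "restrict (umap1 U (%i. S.vassoc i (X i) (Y i) (Z i))) (Car (up (VT (VT X Y) Z))) (compose ?S (cc (VT X Y) Z) ?v t)
  = cc X (VT Y Z) (compose ?S (k.vmap (up X) (vten kk (up Y) (up Z)) (up X) (up (VT Y Z)) (\<lambda>x\<in>Car (up X). x) (cc Y Z))
    (k.vassoc (up X) (up Y) (up Z)) t)"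
  using t by (simp add: compose_def)
qed

lemma fibre_lunit:
 assumes X: "good X n"
 shows "compose (Car (vten kk VIk (up X)))
   (restrict (umap1 U (%i. vlift (K i) (VI i) (X i) (X i) (%r x. uncopy_map (K i) (ssp (K i)) r *[X i] x))) (Car (up (VT VI X))))
   (compose (Car (vten kk VIk (up X))) (cc VI X) (k.vmap VIk (up X) (up VI) (up X) uu (\<lambda>x\<in>Car (up X). x)))
  = vlift kk VIk (up X) (up X) (%r x. uncopy_map kk (ssp kk) r *[up X] x)" (is "compose ?S _ (compose ?S _ ?v) = ?R")
proof (rule extensionalityI[of _ ?S])
 fix t assume t: "t:?S"
 note X' = goodD(3)[OF X] and ck = k.fd_copy[OF kdims k.fd_scalar]
 have "?v:Lin kk (vten kk VIk (up X)) (vten kk (up VI) (up X))"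
  by (rule k.vmap_hom[OF kdims ck(8) gfd_up[OF X'] gfd_up[OF gfd_VI] gfd_up[OF X'] k.lm_hom[OF uu_lin] k.hom_restrict[OF gfdD(4)[OF X'] k.hom_id]])
 from cc_closed[OF gfd_VI X' k.hom_cl[OF this t]] cc_unit(1)[OF X' t]
 show "compose ?S (restrict (umap1 U (%i. vlift (K i) (VI i) (X i) (X i) (%r x. uncopy_map (K i) (ssp (K i)) r *[X i] x)))
   (Car (up (VT VI X)))) (compose ?S (cc VI X) ?v) t = ?R t"
  using t by (simp add: compose_def)
qed (simp_all add: vlift_def compose_def)

lemma fibre_runit:
 assumes X: "good X n"
 shows "compose (Car (vten kk (up X) VIk))
   (restrict (umap1 U (%i. vlift (K i) (X i) (VI i) (X i) (%x r. uncopy_map (K i) (ssp (K i)) r *[X i] x))) (Car (up (VT X VI))))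
   (compose (Car (vten kk (up X) VIk)) (cc X VI) (k.vmap (up X) VIk (up X) (up VI) (\<lambda>x\<in>Car (up X). x) uu))
  = vlift kk (up X) VIk (up X) (%x r. uncopy_map kk (ssp kk) r *[up X] x)" (is "compose ?S _ (compose ?S _ ?v) = ?R")
proof (rule extensionalityI[of _ ?S])
 fix t assume t: "t:?S"
 note X' = goodD(3)[OF X] and ck = k.fd_copy[OF kdims k.fd_scalar]
 have "?v:Lin kk (vten kk (up X) VIk) (vten kk (up X) (up VI))"
  by (rule k.vmap_hom[OF kdims gfd_up[OF X'] ck(8) gfd_up[OF X'] gfd_up[OF gfd_VI] k.hom_restrict[OF gfdD(4)[OF X'] k.hom_id] k.lm_hom[OF uu_lin]])
 from cc_closed[OF X' gfd_VI k.hom_cl[OF this t]] cc_unit(2)[OF X' t]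
 show "compose ?S (restrict (umap1 U (%i. vlift (K i) (X i) (VI i) (X i) (%x r. uncopy_map (K i) (ssp (K i)) r *[X i] x)))
   (Car (up (VT X VI)))) (compose ?S (cc X VI) ?v) t = ?R t"
  using t by (simp add: compose_def)
qed (simp_all add: vlift_def compose_def)

lemma FF_cc_iso: "good X n ==> good Y m ==> cat_iso D (comod_tensor kk RA (FF X) (FF Y)) (FF (TT X Y)) (cc X Y)"
 by (rule R.cat_isoI[OF R.ct_object(1)[OF kdims FF_object FF_object] FF_object[OF good_TT] cc_comod])
  (simp_all add: cc_bij[OF goodD(3) goodD(3)])

lemma FF_uu_iso: "cat_iso D (comod_unit kk RA) (FF TI) uu"
 by (rule R.cat_isoI[OF R.cu_object(1)[OF kdims] FF_object[OF good_TI] uu_comod])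
  (simp add: uu_bij R.cu_alt)

lemma C_objE:
 assumes "x:Obj C"
 obtains X n where "good X n" "x = cl X"
 using assms C_obj by blast

lemma C_homE:
 assumes "g:Hom C (cl X) (cl Y)" "good X n" "good Y m"
 obtains f where "!!i. f i:chom (K i) (A i) (X i) (Y i)" "g = cl f"
 using C_hom[OF assms(2,3)] assms(1) by blast

lemmas to_fibre = fibre_hom_cl fibre_tensor_cl fibre_unit_uu fibre_obj_cl C_ops R.Comod_simps2 Let_def R.Comod_simps(2)

theorem fibre_equivalence:
 "tensor_equivalence kk C D (%X. wco (fibre_obj U X) (rho X)) (fibre_hom U) (fibre_tensor U K A) (fibre_unit U K)"
proof (unfold_locales, goal_cases)
 \<comment> \<open>Cases 1 to 6 are functoriality and linearity, 7 to 9 the structure isomorphisms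
   and their naturality, 10 to 13 coherence with associator, braiding and units; 14 is full
   faithfulness and 15 essential surjectivity.\<close>
 case (1 x)
 then show ?case by (elim C_objE) (simp only: to_fibre FF_object)
next
 case (2 x y g)
 obtain X n where X: "good X n" "x = cl X" using 2(1) by (rule C_objE) (rule that)
 obtain Y m where Y: "good Y m" "y = cl Y" using 2(2) by (rule C_objE) (rule that)
 obtain f where f: "!!i. f i:chom (K i) (A i) (X i) (Y i)" "g = cl f" using 2(3) unfolding X(2) Y(2) by (rule C_homE[OF _ X(1) Y(1)]) (rule that)
 show ?case unfolding X(2) Y(2) f(2) to_fibre by (rule fibre_comod_hom[OF X(1) Y(1) f(1)])
next
 case (3 x)
 obtain X n where X: "good X n" "x = cl X" using 3 by (rule C_objE) (rule that)
 show ?case unfolding X(2) to_fibre with_coact_simps by (rule restrict_ext) (auto elim!: up_cases[OF goodD(4)[OF X(1)]])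
next
 case (4 x y z g h)
 obtain X n where X: "good X n" "x = cl X" using 4(1) by (rule C_objE) (rule that)
 obtain Y m where Y: "good Y m" "y = cl Y" using 4(2) by (rule C_objE) (rule that)
 obtain Z l where Z: "good Z l" "z = cl Z" using 4(3) by (rule C_objE) (rule that)
 obtain f where f: "!!i. f i:chom (K i) (A i) (X i) (Y i)" "g = cl f" using 4(4) unfolding X(2) Y(2) by (rule C_homE[OF _ X(1) Y(1)]) (rule that)
 obtain f' where f': "!!i. f' i:chom (K i) (A i) (Y i) (Z i)" "h = cl f'" using 4(5) unfolding Y(2) Z(2) by (rule C_homE[OF _ Y(1) Z(1)]) (rule that)
 show ?case unfolding X(2) Y(2) Z(2) f(2) f'(2) to_fibre with_coact_simps compose_def
  by (rule restrict_ext) (auto elim!: up_cases[OF goodD(4)[OF X(1)]] simp: up_cl[OF H.chD(4)[OF f(1)]])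
next
 case (5 x y g h)
 obtain X n where X: "good X n" "x = cl X" using 5(1) by (rule C_objE) (rule that)
 obtain Y m where Y: "good Y m" "y = cl Y" using 5(2) by (rule C_objE) (rule that)
 obtain f where f: "!!i. f i:chom (K i) (A i) (X i) (Y i)" "g = cl f" using 5(3) unfolding X(2) Y(2) by (rule C_homE[OF _ X(1) Y(1)]) (rule that)
 obtain f' where f': "!!i. f' i:chom (K i) (A i) (X i) (Y i)" "h = cl f'" using 5(4) unfolding X(2) Y(2) by (rule C_homE[OF _ X(1) Y(1)]) (rule that)
 show ?case unfolding X(2) Y(2) f(2) f'(2) to_fibre with_coact_simps
  by (rule restrict_ext) (erule up_cases[OF goodD(4)[OF X(1)]], simp add: up_simps(3) up_cl)
next
 case (6 x y r g)
 obtain X n where X: "good X n" "x = cl X" using 6(1) by (rule C_objE) (rule that)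
 obtain Y m where Y: "good Y m" "y = cl Y" using 6(2) by (rule C_objE) (rule that)
 obtain c where c: "!!i. c i .: K i" "r = cl c" using 6(3) by (rule kk_cases) (rule that)
 obtain f where f: "!!i. f i:chom (K i) (A i) (X i) (Y i)" "g = cl f" using 6(4) unfolding X(2) Y(2) by (rule C_homE[OF _ X(1) Y(1)]) (rule that)
 show ?case unfolding X(2) Y(2) f(2) c(2) to_fibre with_coact_simps
  by (rule restrict_ext) (erule up_cases[OF goodD(4)[OF X(1)]], simp add: up_simps(5) up_cl)
next
 case (7 x y)
 obtain X n where X: "good X n" "x = cl X" using 7(1) by (rule C_objE) (rule that)
 obtain Y m where Y: "good Y m" "y = cl Y" using 7(2) by (rule C_objE) (rule that)
 show ?case unfolding X(2) Y(2) to_fibre by (rule FF_cc_iso[OF X(1) Y(1)])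
next
 case (8 x x' y y' g h)
 obtain X n where X: "good X n" "x = cl X" using 8(1) by (rule C_objE) (rule that)
 obtain X' n' where X': "good X' n'" "x' = cl X'" using 8(2) by (rule C_objE) (rule that)
 obtain Y m where Y: "good Y m" "y = cl Y" using 8(3) by (rule C_objE) (rule that)
 obtain Y' m' where Y': "good Y' m'" "y' = cl Y'" using 8(4) by (rule C_objE) (rule that)
 obtain f where f: "!!i. f i:chom (K i) (A i) (X i) (X' i)" "g = cl f" using 8(5) unfolding X(2) X'(2) by (rule C_homE[OF _ X(1) X'(1)]) (rule that)
 obtain f' where f': "!!i. f' i:chom (K i) (A i) (Y i) (Y' i)" "h = cl f'" using 8(6) unfolding Y(2) Y'(2) by (rule C_homE[OF _ Y(1) Y'(1)]) (rule that)
 show ?case unfolding X(2) Y(2) X'(2) Y'(2) f(2) f'(2) to_fibre D_carrier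
  by (rule compose_cong)
   (simp add: cc_closed[OF goodD(3)[OF X(1)] goodD(3)[OF Y(1)]]
    cc_natural[OF goodD(3)[OF X(1)] goodD(3)[OF Y(1)] goodD(3)[OF X'(1)] goodD(3)[OF Y'(1)] H.chD(2)[OF f(1)] H.chD(2)[OF f'(1)]])
next
 case 9
 show ?case unfolding to_fibre by (rule FF_uu_iso)
next
 case (10 x y z)
 obtain X n where X: "good X n" "x = cl X" using 10(1) by (rule C_objE) (rule that)
 obtain Y m where Y: "good Y m" "y = cl Y" using 10(2) by (rule C_objE) (rule that)
 obtain Z l where Z: "good Z l" "z = cl Z" using 10(3) by (rule C_objE) (rule that)
 show ?case unfolding X(2) Y(2) Z(2) to_fibre D_carrier
  using fibre_assoc[OF X(1) Y(1) Z(1)] by (simp add: R.ct_alt)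
next
 case (11 x y)
 obtain X n where X: "good X n" "x = cl X" using 11(1) by (rule C_objE) (rule that)
 obtain Y m where Y: "good Y m" "y = cl Y" using 11(2) by (rule C_objE) (rule that)
 show ?case unfolding X(2) Y(2) to_fibre D_carrier
  by (rule compose_cong)
   (simp add: cc_closed[OF goodD(3)[OF X(1)] goodD(3)[OF Y(1)]] cc_braid[OF goodD(3)[OF X(1)] goodD(3)[OF Y(1)]])
next
 case (12 x)
 obtain X n where X: "good X n" "x = cl X" using 12 by (rule C_objE) (rule that)
 show ?case unfolding X(2) to_fibre D_carrier using fibre_lunit[OF X(1)] by (simp add: R.cu_alt)
next
 case (13 x)
 obtain X n where X: "good X n" "x = cl X" using 13 by (rule C_objE) (rule that)
 show ?case unfolding X(2) to_fibre D_carrier using fibre_runit[OF X(1)] by (simp add: R.cu_alt)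
next
 case (14 x y)
 obtain X n where X: "good X n" "x = cl X" using 14(1) by (rule C_objE) (rule that)
 obtain Y m where Y: "good Y m" "y = cl Y" using 14(2) by (rule C_objE) (rule that)
 show ?case unfolding X(2) Y(2) bij_betw_def
 proof (rule conjI[OF inj_onI equalityI[OF subsetI subsetI]])
  fix g h assume g: "g:Hom C (cl X) (cl Y)" and h: "h:Hom C (cl X) (cl Y)" and eq: "fibre_hom U (cl X) (cl Y) g = fibre_hom U (cl X) (cl Y) h"
  obtain f where f: "!!i. f i:chom (K i) (A i) (X i) (Y i)" "g = cl f" by (rule C_homE[OF g X(1) Y(1)]) (rule that)
  obtain f' where f': "!!i. f' i:chom (K i) (A i) (X i) (Y i)" "h = cl f'" by (rule C_homE[OF h X(1) Y(1)]) (rule that)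
  show "g = h" unfolding f(2) f'(2) by (rule fibre_faithful[OF X(1) f(1) f'(1) eq[unfolded f(2) f'(2) fibre_hom_cl]])
 next
  fix g assume "g:fibre_hom U (cl X) (cl Y) ` Hom C (cl X) (cl Y)"
  then obtain h where h: "h:Hom C (cl X) (cl Y)" "g = fibre_hom U (cl X) (cl Y) h" by blast
  obtain f where f: "!!i. f i:chom (K i) (A i) (X i) (Y i)" "h = cl f" by (rule C_homE[OF h(1) X(1) Y(1)]) (rule that)
  show "g:Hom D (wco (fibre_obj U (cl X)) (rho (cl X))) (wco (fibre_obj U (cl Y)) (rho (cl Y)))"
   unfolding h(2) f(2) to_fibre by (rule fibre_comod_hom[OF X(1) Y(1) f(1)])
 next
  fix g assume "g:Hom D (wco (fibre_obj U (cl X)) (rho (cl X))) (wco (fibre_obj U (cl Y)) (rho (cl Y)))"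
  then have "g:chom kk RA (FF X) (FF Y)" unfolding to_fibre .
  then obtain f where f: "ALL i. f i:chom (K i) (A i) (X i) (Y i)" "g = restrict (umap1 U f) (Car (up X))"
   using fibre_full[OF X(1) Y(1)] by blast
  then have "cl f:Hom C (cl X) (cl Y)" using C_hom[OF X(1) Y(1)] by blast
  then show "g:fibre_hom U (cl X) (cl Y) ` Hom C (cl X) (cl Y)" unfolding f(2) fibre_hom_cl[where X = X and Y = Y and f = f, symmetric] by (rule imageI)
 qed
next
 case (15 z)
 obtain X n T where X: "good X n" "cat_iso D (FF X) z T" using fibre_ess_surj[OF 15] by blast
 then have "cl X:Obj C" using C_obj by blast
 then show ?case using X(2) fibre_obj_cl[of X] by (intro bexI[of _ "cl X"] exI[of _ T]) simp_all
qed

end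

section \<open>Uniqueness of the representing Hopf algebra\<close>

text \<open>A Hopf algebra representing a fixed fibre functor. The closure conditions on objects
  ensure that coefficients can be formed at tensor products and at the unit, where the product and
  the unit of the Hopf algebra are visible.\<close>

locale fibre_rep = hopf_setup K A + E: tensor_equivalence K C "Comod K A" "%X. wco (om X) (rh X)" omm c u
 for K :: "('k, 'r) ring_scheme" and A :: "('k, 'a, 'm) hopf_scheme" and C :: "('o, 'h, 'k) tensor_category"
  and om :: "'o => ('k, 'w) module" and rh :: "'o => 'w => ('w \<times> 'a => 'k) set"
  and omm :: "'o => 'o => 'h => 'w => 'w" and c :: "'o => 'o => 'w => 'w" and u :: "'w => 'w" +
 assumes ad: "all_dims TYPE('w)" and Tens_closed: "[|X:Obj C; Y:Obj C|] ==> Tens C X Y:Obj C"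
  and UnitObj_closed: "UnitObj C:Obj C"
begin

abbreviation "F X == wco (om X) (rh X)"

lemma F_comod: "X:Obj C ==> rcom K A (F X)" and F_fd: "X:Obj C ==> fd (om X)" and F_vs: "X:Obj C ==> vsp K (om X)"
 using ObjD[OF E.F_obj] by simp_all

lemma F_homs: "X:Obj C ==> Y:Obj C ==> chom K A (F X) (F Y) = omm X Y ` Hom C X Y"
 using E.fully_faithful unfolding bij_betw_def Comod_simps by simp

lemma ess_surj_iso:
 fixes Z :: "('k, 'a, 'w) comodule"
 assumes "Z:OB K A"
 shows "EX X s t. X:Obj C & s:chom K A (F X) Z & t:chom K A Z (F X) & (ALL x:Car (om X). t (s x) = x) & (ALL z:Car Z. s (t z) = z)"
 using E.ess_surj[OF assms] cat_isoD by fastforce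

lemma coef_ex:
 assumes "a .: A"
 shows "EX X f v. X:Obj C & f:Lin K (om X) (ssp K) & v .: om X & a = coef K A (F X) f v"
proof -
 obtain Z :: "('k, 'a, 'w) comodule" and f v where Z: "Z:OB K A" and f: "f:Lin K Z (ssp K)"
  and v: "v .: Z" and a: "a = coef K A Z f v"
  using coeff_size_ex[OF ad assms] unfolding coeff_size_def by blast
 obtain X s t where X: "X:Obj C" and s: "s:chom K A (F X) Z" and t: "t:chom K A Z (F X)"
  and st: "ALL z:Car Z. s (t z) = z" using ess_surj_iso[OF Z] by (elim exE conjE) (rule that)
 have "coef K A (F X) (%x. f (s x)) (t v) = coef K A Z f (s (t v))"
  by (rule coef_comod_hom[OF F_comod[OF X] ObjD(1)[OF Z] s f chD(4)[OF t v], symmetric])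
 then have "a = coef K A (F X) (%x. f (s x)) (t v)" using st v a by simp
 moreover have "(%x. f (s x)):Lin K (om X) (ssp K)" using hom_comp[OF chD(2)[OF s] f] by simp
 ultimately show ?thesis using X chD(4)[OF t v] by auto
qed

lemma coef_iso:
 assumes Y: "Y:OB K A" and X: "X:Obj C" and s: "cat_iso (Comod K A) Y (F X) s"
  and d: "d:Lin K (om X) (ssp K)" and v: "v .: Y" and h: "!!y. y .: Y ==> d (s y) = h y"
 shows "coef K A (F X) d (s v) = coef K A Y h v"
proof -
 have "coef K A (F X) d (s v) = coef K A Y (%y. d (s y)) v"
  by (rule coef_comod_hom[OF ObjD(1)[OF Y] F_comod[OF X] cat_isoD(1)[OF s] _ v]) (use d in simp)
 then show ?thesis using coef_cong[of Y "%y. d (s y)" h v] h by simp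
qed

end

text \<open>Two Hopf algebras representing the same fibre functor: spaces, morphisms and tensor
  structure are shared, and only the coactions differ.\<close>

locale rep_pair = fibre_rep K A C om rh omm c u + B: fibre_rep K B C om si omm c u
 for K :: "('k, 'r) ring_scheme" and A :: "('k, 'a, 'm) hopf_scheme" and B :: "('k, 'b, 'n) hopf_scheme"
  and C :: "('o, 'h, 'k) tensor_category" and om :: "'o => ('k, 'w) module"
  and rh :: "'o => 'w => ('w \<times> 'a => 'k) set" and si :: "'o => 'w => ('w \<times> 'b => 'k) set"
  and omm :: "'o => 'o => 'h => 'w => 'w" and c :: "'o => 'o => 'w => 'w" and u :: "'w => 'w"
begin

abbreviation "coA X == coef K A (wco (om X) (rh X))"
abbreviation "coB X == coef K B (wco (om X) (si X))"

text \<open>Both sets of comodule maps are the image of the same hom set of the category, by full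
  faithfulness. A linear map therefore respects one coaction exactly if it respects the
  other.\<close>

lemma homs_eq: "X:Obj C ==> Y:Obj C ==> chom K A (F X) (F Y) = chom K B (B.F X) (B.F Y)"
 by (simp only: F_homs B.F_homs)

lemma coB_hom:
 assumes X: "X:Obj C" and Y: "Y:Obj C" and T: "T:chom K A (F X) (F Y)" and g: "g:Lin K (om Y) (ssp K)"
  and x: "x .: om X"
 shows "coB Y g (T x) = coB X (%x. g (T x)) x"
 by (rule B.coef_comod_hom[OF B.F_comod[OF X] B.F_comod[OF Y] T[unfolded homs_eq[OF X Y]]]) (use g x in simp_all)

text \<open>\<open>coef_natural\<close> over \<open>A\<close> is applied to the quantity
  "coefficient over \<open>B\<close>". That quantity must make sense for all comodules over
  \<open>A\<close>, so each of them is replaced by an isomorphic object in the image of the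
  functor.\<close>

lemma coef_transfer:
 assumes X: "X:Obj C" and Y: "Y:Obj C" and f: "f:Lin K (om X) (ssp K)" and g: "g:Lin K (om Y) (ssp K)"
  and v: "v .: om X" and w: "w .: om Y" and eq: "coA X f v = coA Y g w"
 shows "coB X f v = coB Y g w"
proof -
 let ?P = "%Z X s t. X:Obj C & s:chom K A (F X) Z & t:chom K A Z (F X) & (ALL x:Car (om X). t (s x) = x) & (ALL z:Car Z. s (t z) = z)"
 have "ALL Z :: ('k, 'a, 'w) comodule. EX X s t. Z:OB K A --> ?P Z X s t"
 proof
  fix Z :: "('k, 'a, 'w) comodule" show "EX X s t. Z:OB K A --> ?P Z X s t"
  proof (cases "Z:OB K A")
   case True
   from ess_surj_iso[OF this] show ?thesis by (simp only: True simp_thms)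
  qed simp
 qed
 then obtain G S T where *: "ALL Z :: ('k, 'a, 'w) comodule. Z:OB K A --> ?P Z (G Z) (S Z) (T Z)" unfolding choice_iff by (elim exE) (rule that)
 have G: "G Z:Obj C" and S: "S Z:chom K A (F (G Z)) Z" and T: "T Z:chom K A Z (F (G Z))"
  and TS: "x .: (om (G Z)) ==> T Z (S Z x) = x" and ST: "z .: Z ==> S Z (T Z z) = z"
  if "Z:OB K A" for Z :: "('k, 'a, 'w) comodule" and x z using * that by blast+
 \<comment> \<open>Naturality of \<open>h\<close> holds because a map of \<open>A\<close>-comodules,
   conjugated by the chosen isomorphisms, becomes a map between objects in the image of the functor,
   and these are maps over \<open>B\<close> too.\<close>
 define h where "h Z f v = coB (G Z) (%x. f (S Z x)) (T Z v)" for Z :: "('k, 'a, 'w) comodule" and f v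
 have F: "F X:OB K A" if "X:Obj C" for X using E.F_obj[OF that] .
 have hF: "h (F X) f v = coB X f v" if X: "X:Obj C" and f: "f:Lin K (om X) (ssp K)" and v: "v .: om X" for X f v
 proof -
  have "T (F X) v .: (om (G (F X)))" using chD(4)[OF T[OF F[OF X]], of v] v by simp
  from coB_hom[OF G[OF F[OF X]] X S[OF F[OF X]] f this] show ?thesis using ST[OF F[OF X], of v] v by (simp add: h_def)
 qed
 have "h (F X) f v = h (F Y) g w"
 proof (rule coef_natural[OF ad F[OF X] F[OF Y] _ _ _ _ eq])
  fix Z :: "('k, 'a, 'w) comodule" and g g' :: "'w => 'k" and x
  assume Z: "Z:OB K A" and "x .: Z" and gg: "!!z. z .: Z ==> g z = g' z"
  show "h Z g x = h Z g' x" unfolding h_def by (rule B.coef_cong) (use gg chD(4)[OF S[OF Z]] in simp)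
 next
  fix Z Z' :: "('k, 'a, 'w) comodule" and q g x
  assume Z: "Z:OB K A" and Z': "Z':OB K A" and q: "q:chom K A Z Z'"
   and g: "g:Lin K Z' (ssp K)" and x: "x .: Z"
  note o = F_comod[OF G[OF Z]] ObjD(1)[OF Z] ObjD(1)[OF Z'] F_comod[OF G[OF Z']]
  let ?q = "compose (Car (F (G Z))) (T Z') (compose (Car (F (G Z))) q (S Z))"
  have q': "?q:chom K A (F (G Z)) (F (G Z'))"
   by (rule comod_hom_comp[OF o(1) o(3) o(4) comod_hom_comp[OF o(1) o(2) o(3) S[OF Z] q] T[OF Z']])
  have Tx: "T Z x .: (om (G Z))" using chD(4)[OF T[OF Z] x] by simp
  have gs: "(%y. g (S Z' y)):Lin K (om (G Z')) (ssp K)" using hom_comp[OF chD(2)[OF S[OF Z']] g] by simp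
  have "h Z' g (q x) = coB (G Z') (%y. g (S Z' y)) (?q (T Z x))"
   using Tx ST[OF Z x] by (simp add: h_def compose_def)
  also have "... = coB (G Z) (%y. g (S Z' (?q y))) (T Z x)" by (rule coB_hom[OF G[OF Z] G[OF Z'] q' gs Tx])
  also have "... = h Z (%x. g (q x)) x" unfolding h_def
   by (rule B.coef_cong) (use ST[OF Z'] chD(4)[OF q] chD(4)[OF S[OF Z]] in "simp add: compose_def")
  finally show "h Z' g (q x) = h Z (%x. g (q x)) x" .
 qed (use f g v w in simp_all)
 then show ?thesis using hF[OF X f v] hF[OF Y g w] by simp
qed

definition phi :: "'a => 'b" where
 "phi a = (SOME b. EX X:Obj C. EX f:Lin K (om X) (ssp K). EX v:Car (om X). a = coA X f v & b = coB X f v)"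

lemma phi_eq:
 assumes X: "X:Obj C" and f: "f:Lin K (om X) (ssp K)" and v: "v .: om X"
 shows "phi (coA X f v) = coB X f v"
 unfolding phi_def
proof (rule some_equality)
 show "EX Y:Obj C. EX g:Lin K (om Y) (ssp K). EX w:Car (om Y). coA X f v = coA Y g w & coB X f v = coB Y g w"
  by (intro bexI[OF _ X] bexI[OF _ f] bexI[OF _ v] conjI refl)
 fix b assume "EX Y:Obj C. EX g:Lin K (om Y) (ssp K). EX w:Car (om Y). coA X f v = coA Y g w & b = coB Y g w"
 then obtain Y g w where *: "Y:Obj C" "g:Lin K (om Y) (ssp K)" "w .: om Y" "coA X f v = coA Y g w" "b = coB Y g w"
  by (elim bexE conjE) (rule that)
 show "b = coB X f v" unfolding *(5) by (rule coef_transfer[OF X *(1) f *(2) v *(3,4), symmetric])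
qed

lemma coA_cases:
 assumes "a .: A"
 obtains X f v where "X:Obj C" "f:Lin K (om X) (ssp K)" "v .: om X" "a = coA X f v"
 using coef_ex[OF assms] by blast

lemma phi_closed:
 assumes "a .: A"
 shows "phi a .: B"
proof -
 obtain X f v where X: "X:Obj C" "f:Lin K (om X) (ssp K)" "v .: om X" "a = coA X f v"
  using assms by (rule coA_cases) (rule that)
 show ?thesis unfolding X(4) phi_eq[OF X(1-3)] by (rule B.coef_closed[OF B.F_comod[OF X(1)]]) (use X in simp_all)
qed

text \<open>The direct sum is formed over \<open>A\<close> and then replaced by an isomorphic object
  in the image of the functor. Its injections and projections are then maps over \<open>B\<close> as
  well, so the same vector and functional yield the sum on both sides.\<close>

lemma phi_add:
 assumes a: "a .: A" and b: "b .: A"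
 shows "phi (a +[A] b) = phi a +[B] phi b"
proof -
 obtain X f v where X: "X:Obj C" "f:Lin K (om X) (ssp K)" "v .: om X" "a = coA X f v"
  using a by (rule coA_cases) (rule that)
 obtain Y g w where Y: "Y:Obj C" "g:Lin K (om Y) (ssp K)" "w .: om Y" "b = coA Y g w"
  using b by (rule coA_cases) (rule that)
 note FX = E.F_obj[OF X(1)] and FY = E.F_obj[OF Y(1)]
 obtain Z :: "('k, 'a, 'w) comodule" and i j p q where Z: "Z:OB K A"
  and h: "i:chom K A (F X) Z" "j:chom K A (F Y) Z" "p:chom K A Z (F X)" "q:chom K A Z (F Y)"
  and px: "ALL x:Car (F X). p (i x) = x & q (i x) = 0[F Y]" and qy: "ALL y:Car (F Y). q (j y) = y & p (j y) = 0[F X]"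
  using direct_sum[OF ad FX FY] by (elim exE conjE) (rule that)
 obtain W s t where W: "W:Obj C" and s: "s:chom K A (F W) Z" and t: "t:chom K A Z (F W)"
  and ts: "ALL x:Car (om W). t (s x) = x" and st: "ALL z:Car Z. s (t z) = z" using ess_surj_iso[OF Z] by (elim exE conjE) (rule that)
 note o = F_comod[OF X(1)] F_comod[OF Y(1)] F_comod[OF W] ObjD(1)[OF Z]
 let ?i = "compose (Car (F X)) t i" and ?j = "compose (Car (F Y)) t j"
  and ?p = "compose (Car (F W)) p s" and ?q = "compose (Car (F W)) q s"
 note i = comod_hom_comp[OF o(1) o(4) o(3) h(1) t] and j = comod_hom_comp[OF o(2) o(4) o(3) h(2) t]
  and p = comod_hom_comp[OF o(3) o(4) o(1) s h(3)] and q = comod_hom_comp[OF o(3) o(4) o(2) s h(4)]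
 let ?F = "%z. f (?p z) +[K] g (?q z)"
 have F: "?F:Lin K (om W) (ssp K)"
  using hom_add_map[OF vs_ssp hom_comp[OF chD(2)[OF p], of f "ssp K"] hom_comp[OF chD(2)[OF q], of g "ssp K"]] X(2) Y(2) by simp
 have iv: "?i v .: om W" using chD(4)[OF i, of v] X(3) by simp
 have jw: "?j w .: om W" using chD(4)[OF j, of w] Y(3) by simp
 have f0: "f 0[om X] = 0[K]" "g 0[om Y] = 0[K]"
  using hom_zero[OF F_vs[OF X(1)] vs_ssp X(2)] hom_zero[OF F_vs[OF Y(1)] vs_ssp Y(2)] by simp_all
 have Fi: "?F (?i x) = f x" if "x .: om X" for x
  using that px st f0 chD(4)[OF h(1), of x] chD(4)[OF t, of "i x"] hom_cl[OF X(2) that] by (simp add: compose_def)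
 have Fj: "?F (?j x) = g x" if "x .: om Y" for x
  using that qy st f0 chD(4)[OF h(2), of x] chD(4)[OF t, of "j x"] hom_cl[OF Y(2) that] by (simp add: compose_def)
 have A: "coA W ?F (?i v +[om W] ?j w) = coA X f v +[A] coA Y g w"
  using hom_add[OF coef_hom[OF o(3), of ?F] , of "?i v" "?j w"] F iv jw
   coef_comod_hom[OF o(1) o(3) i, of ?F v] coef_comod_hom[OF o(2) o(3) j, of ?F w] X(3) Y(3)
   coef_cong[of "F X" "%x. ?F (?i x)" f v] coef_cong[of "F Y" "%x. ?F (?j x)" g w] Fi Fj by simp
 have "coB W ?F (?i v +[om W] ?j w) = coB W ?F (?i v) +[B] coB W ?F (?j w)"
  using hom_add[OF B.coef_hom[OF B.F_comod[OF W], of ?F] , of "?i v" "?j w"] F iv jw by simp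
 also have "coB W ?F (?i v) = coB X f v"
  unfolding coB_hom[OF X(1) W i F X(3)] by (rule B.coef_cong) (use Fi in simp)
 also have "coB W ?F (?j w) = coB Y g w"
  unfolding coB_hom[OF Y(1) W j F Y(3)] by (rule B.coef_cong) (use Fj in simp)
 finally show ?thesis using phi_eq[OF W F vs_add_closed[OF F_vs[OF W] iv jw]] A phi_eq[OF X(1-3)] phi_eq[OF Y(1-3)] X(4) Y(4) by simp
qed

lemma phi_hom: "phi:Lin K A B"
proof (rule homI)
 fix r a assume r: "r .: K" and a: "a .: A"
 obtain X f v where X: "X:Obj C" "f:Lin K (om X) (ssp K)" "v .: om X" "a = coA X f v"
  using a by (rule coA_cases) (rule that)
 have "coA X f (r *[om X] v) = r *[A] coA X f v" "coB X f (r *[om X] v) = r *[B] coB X f v"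
  using hom_smult[OF coef_hom[OF F_comod[OF X(1)], of f] r, of v]
   hom_smult[OF B.coef_hom[OF B.F_comod[OF X(1)], of f] r, of v] X by simp_all
 then show "phi (r *[A] a) = r *[B] phi a"
  using phi_eq[OF X(1,2) vs_sm_closed[OF F_vs[OF X(1)] r X(3)]] phi_eq[OF X(1-3)] X(4) by simp
qed (rule phi_closed phi_add; assumption)+

text \<open>Products are coefficients of tensor product comodules. Over \<open>A\<close> and over
  \<open>B\<close> these have the same underlying space, and the same structure map \<open>c\<close>
  identifies them with the image of the tensor product in the category.\<close>

lemma phi_mult:
 assumes a: "a .: A" and b: "b .: A"
 shows "phi (a **[A] b) = phi a **[B] phi b"
proof -
 obtain X f v where X: "X:Obj C" "f:Lin K (om X) (ssp K)" "v .: om X" "a = coA X f v"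
  using a by (rule coA_cases) (rule that)
 obtain Y g w where Y: "Y:Obj C" "g:Lin K (om Y) (ssp K)" "w .: om Y" "b = coA Y g w"
  using b by (rule coA_cases) (rule that)
 let ?h = "vlift K (om X) (om Y) (ssp K) (%x y. f x **[K] g y)" and ?v = "vpure K (om X) (om Y) v w"
 let ?T = "comod_tensor K A (F X) (F Y)" and ?T' = "comod_tensor K B (B.F X) (B.F Y)"
 note FX = E.F_obj[OF X(1)] and FY = E.F_obj[OF Y(1)] and GX = B.E.F_obj[OF X(1)] and GY = B.E.F_obj[OF Y(1)]
 have V: "?v .: (vten K (om X) (om Y))" by (rule vpure_closed[OF ad F_fd[OF X(1)] F_fd[OF Y(1)] X(3) Y(3)])
 have T: "Car ?T = Car (vten K (om X) (om Y))" "Car ?T' = Car (vten K (om X) (om Y))"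
  by (simp_all add: ct_alt B.ct_alt)
 have cA: "coef K A ?T ?h ?v = coA X f v **[A] coA Y g w"
  using coef_tensor(2)[OF ad FX FY, of f g v w] X Y by simp
 have cB: "coef K B ?T' ?h ?v = coB X f v **[B] coB Y g w"
  using B.coef_tensor(2)[OF ad GX GY, of f g v w] X Y by simp
 have h: "?h:Lin K (vten K (om X) (om Y)) (ssp K)"
  using coef_tensor(1)[OF ad FX FY, of f g v w] X Y by (simp add: ct_alt)
 note W = Tens_closed[OF X(1) Y(1)]
 have ciA: "cat_iso (Comod K A) ?T (F (Tens C X Y)) (c X Y)" using E.c_iso[OF X(1) Y(1)] by (simp add: Comod_simps2)
 have ciB: "cat_iso (Comod K B) ?T' (B.F (Tens C X Y)) (c X Y)" using B.E.c_iso[OF X(1) Y(1)] by (simp add: B.Comod_simps2)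
 obtain d where d: "d:chom K A (F (Tens C X Y)) ?T" "ALL x:Car ?T. d (c X Y x) = x"
  using cat_isoD(2)[OF ciA] by blast
 let ?d = "%z. ?h (d z)"
 have dh: "?d:Lin K (om (Tens C X Y)) (ssp K)"
  using hom_comp[OF chD(2)[OF d(1)], of ?h "ssp K"] h by (simp add: ct_alt)
 have dc: "?d (c X Y y) = ?h y" if "y .: (vten K (om X) (om Y))" for y using d(2) that T by simp
 have cv: "c X Y ?v .: (om (Tens C X Y))" using chD(4)[OF cat_isoD(1)[OF ciA], of ?v] V T by simp
 have "coA (Tens C X Y) ?d (c X Y ?v) = a **[A] b"
  unfolding X(4) Y(4) cA[symmetric]
  by (rule coef_iso[OF ct_object(1)[OF ad FX FY] W ciA dh]) (use V T dc in simp_all)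
 moreover have "coB (Tens C X Y) ?d (c X Y ?v) = coB X f v **[B] coB Y g w"
  unfolding cB[symmetric]
  by (rule B.coef_iso[OF B.ct_object(1)[OF ad GX GY] W ciB dh]) (use V T dc in simp_all)
 ultimately show ?thesis using phi_eq[OF W dh cv] phi_eq[OF X(1-3)] phi_eq[OF Y(1-3)] X(4) Y(4) by simp
qed

lemma phi_one: "phi 1[A] = 1[B]"
proof -
 let ?J = "comod_unit K A :: ('k, 'a, 'w) comodule" and ?J' = "comod_unit K B :: ('k, 'b, 'w) comodule"
 let ?I = "copy_space K (ssp K) :: ('k, 'w) module" and ?h = "uncopy_map K (ssp K) :: 'w => 'k"
  and ?v = "copy_map K (ssp K) 1[K] :: 'w"
 note ck = fd_copy[OF ad fd_scalar]
 have h: "?h:Lin K ?I (ssp K)" by (rule ck(2))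
 have V: "?v .: ?I" and h1: "?h ?v = 1[K]" using ck(3,5)[of "1[K]"] by simp_all
 have T: "Car ?J = Car ?I" "Car ?J' = Car ?I" by (simp_all add: cu_alt B.cu_alt)
 have cA: "coef K A ?J ?h ?v = 1[A]" using coef_unit[OF ad K.one_closed h] h1 by simp
 have cB: "coef K B ?J' ?h ?v = 1[B]" using B.coef_unit[OF ad K.one_closed h] h1 by simp
 note W = UnitObj_closed
 have ciA: "cat_iso (Comod K A) ?J (F (UnitObj C)) u" using E.u_iso by (simp add: Comod_simps2)
 have ciB: "cat_iso (Comod K B) ?J' (B.F (UnitObj C)) u" using B.E.u_iso by (simp add: B.Comod_simps2)
 obtain d where d: "d:chom K A (F (UnitObj C)) ?J" "ALL x:Car ?J. d (u x) = x"
  using cat_isoD(2)[OF ciA] by blast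
 let ?d = "%z. ?h (d z)"
 have dh: "?d:Lin K (om (UnitObj C)) (ssp K)"
  using hom_comp[OF chD(2)[OF d(1)], of ?h "ssp K"] h by (simp add: cu_alt)
 have dc: "?d (u y) = ?h y" if "y .: ?I" for y using d(2) that T by simp
 have cv: "u ?v .: (om (UnitObj C))" using chD(4)[OF cat_isoD(1)[OF ciA], of ?v] V T by simp
 have "coA (UnitObj C) ?d (u ?v) = 1[A]" unfolding cA[symmetric]
  by (rule coef_iso[OF cu_object(1)[OF ad] W ciA dh]) (use V T dc in simp_all)
 moreover have "coB (UnitObj C) ?d (u ?v) = 1[B]" unfolding cB[symmetric]
  by (rule B.coef_iso[OF B.cu_object(1)[OF ad] W ciB dh]) (use V T dc in simp_all)
 ultimately show ?thesis using phi_eq[OF W dh cv] by simp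
qed

theorem hopf_iso: "hopf_isomorphic K A B"
 unfolding hopf_isomorphic_def
proof (intro exI[of _ phi] conjI ballI)
 show "phi:ring_hom A B" by (rule ring_hom_memI) (use phi_closed phi_add phi_mult phi_one in auto)
 show "phi:Lin K A B" by (rule phi_hom)
 \<comment> \<open>The situation is symmetric in the two Hopf algebras. Injectivity of
   \<open>phi\<close> is the well-definedness of the map in the opposite direction.\<close>
 interpret sw: rep_pair K B A C om si rh omm c u by unfold_locales
 show "bij_betw phi (Car A) (Car B)"
  unfolding bij_betw_def
 proof (rule conjI[OF inj_onI equalityI[OF subsetI subsetI]])
  fix a b assume a: "a .: A" and b: "b .: A" and eq: "phi a = phi b"
  obtain X f v where X: "X:Obj C" "f:Lin K (om X) (ssp K)" "v .: om X" "a = coA X f v"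
   using a by (rule coA_cases) (rule that)
  obtain Y g w where Y: "Y:Obj C" "g:Lin K (om Y) (ssp K)" "w .: om Y" "b = coA Y g w"
   using b by (rule coA_cases) (rule that)
  show "a = b" unfolding X(4) Y(4)
   by (rule sw.coef_transfer[OF X(1) Y(1) X(2) Y(2) X(3) Y(3)]) (use eq phi_eq[OF X(1-3)] phi_eq[OF Y(1-3)] X(4) Y(4) in simp)
 next
  fix b assume "b .: B"
  then obtain X f v where X: "X:Obj C" "f:Lin K (om X) (ssp K)" "v .: om X" "b = coB X f v"
   using B.coef_ex by blast
  have "coA X f v .: A" by (rule coef_closed[OF F_comod[OF X(1)]]) (use X in simp_all)
  then show "b:phi ` Car A" unfolding X(4) phi_eq[OF X(1-3), symmetric] by (rule imageI)
 qed (use phi_closed in auto)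
next
 fix a assume "a .: A"
 then obtain X f v where X: "X:Obj C" "f:Lin K (om X) (ssp K)" "v .: om X" "a = coA X f v"
  by (rule coA_cases) (rule that)
 \<comment> \<open>Both coactions live on the same space, so a single basis expands both
   comultiplications, term by term with corresponding coefficients.\<close>
 obtain e ps where b: "dbasis (om X) {..<vdim K (om X)} e ps" using fd_dbasis[OF F_fd[OF X(1)]] by blast
 note e = dbD(3)[OF b] and ps = dbD(4)[OF b]
 let ?I = "{..<vdim K (om X)}"
 have cl: "coA X f (e p) .: A" "coA X (ps p) v .: A" if "p:?I" for p
  using coef_closed[OF F_comod[OF X(1)]] X e[OF that] ps[OF that] by simp_all
 have cl': "coB X f (e p) .: B" "coB X (ps p) v .: B" if "p:?I" for p
  using B.coef_closed[OF B.F_comod[OF X(1)]] X e[OF that] ps[OF that] by simp_all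
 have A: "comult A a = tsum A A ?I (%p. coA X f (e p)) (%p. coA X (ps p) v)"
  unfolding X(4) by (rule comult_coefficient_tsum[OF F_comod[OF X(1)]]) (use X b in simp_all)
 have "comult B (phi a) = tsum B B ?I (%p. coB X f (e p)) (%p. coB X (ps p) v)"
  unfolding X(4) phi_eq[OF X(1-3)] by (rule B.comult_coefficient_tsum[OF B.F_comod[OF X(1)]]) (use X b in simp_all)
 also have "... = tsum B B ?I (%p. phi (coA X f (e p))) (%p. phi (coA X (ps p) v))"
  by (rule tsum_cong[OF B.A_vs B.A_vs refl phi_closed[OF cl(1)] phi_closed[OF cl(2)]])
   (use phi_eq[OF X(1) X(2) e] phi_eq[OF X(1) ps X(3)] in simp_all)
 also have "... = tmap K A A B B phi phi (comult A a)"
  unfolding A by (rule tmap_tsum[OF A_vs A_vs B.A_vs B.A_vs phi_hom phi_hom cl, symmetric])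
 finally show "comult B (phi a) = tmap K A A B B phi phi (comult A a)" .
 show "counit B (phi a) = counit A a"
  unfolding X(4) phi_eq[OF X(1-3)]
  using B.counit_coefficient[OF B.F_comod[OF X(1)], of f v] counit_coefficient[OF F_comod[OF X(1)], of f v] X by simp
qed

end

theorem theorem1p2p2:
  fixes U :: "'i filter"
    and K :: "'i \<Rightarrow> 'k ring"
    and A :: "'i \<Rightarrow> ('k, 'a) hopf"
  assumes "nonprincipal_ultrafilter U"
    and "\<And>i. field (K i)"
    and "\<And>i. hopf_algebra (K i) (A i)"
    and "\<And>i n. \<exists>V :: ('k, 'v) module.
           vectorspace (K i) V \<and> vectorspace.fin_dim (K i) V \<and> vectorspace.dim (K i) V = n"
  shows "represents_restr_uprod TYPE('v) U K A (restr_uprod_hopf TYPE('v) U K A)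
    \<and> (\<forall>B :: (('i \<Rightarrow> 'k) set, 'b) hopf.
         represents_restr_uprod TYPE('v) U K A B
         \<longrightarrow> hopf_isomorphic (uprod_ring U K) B (restr_uprod_hopf TYPE('v) U K A))"
proof -
 interpret ultra_fields U K
  using assms(1,2) by (simp add: ultra_fields_def nonprincipal_ultrafilter_def)
 interpret ultra_hopf U K A "TYPE('v)"
  by (rule ultra_hopf.intro[OF ultra_fields_axioms ultra_hopf_axioms.intro[OF assms(3)]]) (use assms(4) in "simp_all add: S.all_dims_def")
 note E = fibre_equivalence
 have T: "Tens C x y:Obj C" if x: "x:Obj C" and y: "y:Obj C" for x y
 proof -
  obtain X n where X: "good X n" "x = cl X" using x by (rule C_objE) (rule that)
  obtain Y m where Y: "good Y m" "y = cl Y" using y by (rule C_objE) (rule that)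
  show ?thesis unfolding X(2) Y(2) C_ops C_obj using good_TT[OF X(1) Y(1)] by blast
 qed
 have I: "UnitObj C:Obj C" unfolding C_ops C_obj using good_TI by blast
 have "hopf_isomorphic kk B RA" if B: "represents_restr_uprod TYPE('v) U K A B" for B :: "(('i => 'k) set, 'b) hopf"
 proof -
  obtain si where hB: "hopf_algebra kk B" and eB: "tensor_equivalence kk C (Comod kk B) (%X. wco (fibre_obj U X) (si X)) (fibre_hom U) (fibre_tensor U K A) (fibre_unit U K)"
   using B unfolding represents_restr_uprod_def represents_def by blast
  \<comment> \<open>\<open>B\<close> takes the first place since the isomorphism goes from
    \<open>B\<close> to \<open>RA\<close>; the coactions \<open>rho\<close> serve for
    \<open>RA\<close>.\<close>
  have "rep_pair kk B RA C (fibre_obj U) si rho (fibre_hom U) (fibre_tensor U K A) (fibre_unit U K)"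
   unfolding rep_pair_def fibre_rep_def fibre_rep_axioms_def hopf_setup_def
   using hB eB E RA_hopf kdims k.scalars_axioms T I by blast
  then show ?thesis by (rule rep_pair.hopf_iso)
 qed
 then show ?thesis using E RA_hopf unfolding represents_restr_uprod_def represents_def by blast
qed

end
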